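(* For every integer $\ell\geq 4$, every $c\in\{2,\dots,\ell-2\}$ and every constant $d\geq 1$, the problem \textsc{$c$-Colored $P_\ell$ Deletion} is NP-hard, even when restricted to input graphs $G$ whose maximum degree is three and whose girth is greater than $2\cdot d\cdot \ell$.
   Context: A $c$-colored (edge-colored) graph is a simple graph $G=(V,E)$ whose edge set is partitioned into $c$ pairwise disjoint non-empty sets $E=E_1\sqcup\dots\sqcup E_c$; an edge in $E_i$ has color $i$. A path (or cycle) is $c$-colored if its edge set contains edges of exactly $c$ distinct colors. $P_\ell$ denotes a path on $\ell$ vertices. A subgraph $H$ of $G$ is induced if it equals $G[V(H)]$. \textsc{$c$-Colored $P_\ell$ Deletion}: given a $c$-colored graph $G$ and an integer $k$, decide whether there is a set $S$ of at most $k$ edges such that $G-S$ contains no $c$-colored $P_\ell$ as an induced subgraph. The girth of $G$ is the length of a shortest cycle (infinite if $G$ is acyclic). *)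

theory Defs
  imports
    "HOL-Library.Extended_Real"
    "HOL-Library.Disjoint_Sets"
    "HOL-Computational_Algebra.Polynomial"
begin

section \<open>Polynomial time, NP and NP-hardness\<close>

text \<open>
  Deterministic multi-tape Turing machines. States are \<open>0, \<dots>, states M - 1\<close>, with start state \<open>0\<close>
  and halting state \<open>1\<close>; tape symbols are \<open>0, \<dots>, symbs M - 1\<close>, where \<open>0\<close> is the blank and \<open>1\<close>, \<open>2\<close>
  stand for the bits \<open>False\<close>, \<open>True\<close>. Tapes are infinite in both directions. Given the current state
  and the symbols under the heads, the transition function returns the new state and, for every tape,
  the symbol to write and the head movement.
\<close>

record tm =
  tapes :: nat
  symbs :: nat
  states :: nat
  delta :: "nat \<Rightarrow> nat list \<Rightarrow> nat \<times> (nat \<times> int) list"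

definition wf_tm :: "tm \<Rightarrow> bool" where
  "wf_tm M \<longleftrightarrow> tapes M \<ge> 1 \<and> symbs M \<ge> 3 \<and> states M \<ge> 2 \<and>
     (\<forall>q < states M. \<forall>rs. length rs = tapes M \<and> set rs \<subseteq> {..<symbs M} \<longrightarrow>
        (case delta M q rs of (q', as) \<Rightarrow>
           q' < states M \<and> length as = tapes M \<and> set as \<subseteq> {..<symbs M} \<times> {-1, 0, 1}))"

text \<open>State, head positions and tape contents, the latter two indexed by the number of the tape.\<close>

type_synonym config = "nat \<times> (nat \<Rightarrow> int) \<times> (nat \<Rightarrow> int \<Rightarrow> nat)"

fun tm_step :: "tm \<Rightarrow> config \<Rightarrow> config" where
  "tm_step M (q, h, tp) =
     (if q = 1 then (q, h, tp)
      else case delta M q (map (\<lambda>j. tp j (h j)) [0..<tapes M]) of (q', as) \<Rightarrow>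
        (q',
         \<lambda>j. if j < tapes M then h j + snd (as ! j) else h j,
         \<lambda>j. if j < tapes M then (tp j)(h j := fst (as ! j)) else tp j))"

definition tape_of :: "bool list \<Rightarrow> int \<Rightarrow> nat" where
  "tape_of x i = (if 0 \<le> i \<and> i < int (length x) then (if x ! nat i then 2 else 1) else 0)"

definition tm_init :: "bool list \<Rightarrow> config" where
  "tm_init x = (0, \<lambda>_. 0, \<lambda>j. if j = 0 then tape_of x else (\<lambda>_. 0))"

text \<open>The input is on tape \<open>0\<close>; the output is the content of the last tape when the machine halts.\<close>

definition tm_outputs_within :: "tm \<Rightarrow> bool list \<Rightarrow> bool list \<Rightarrow> nat \<Rightarrow> bool" where
  "tm_outputs_within M x y T \<longleftrightarrow>
     (\<exists>t \<le> T. case (tm_step M ^^ t) (tm_init x) of (q, h, tp) \<Rightarrow>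
        q = 1 \<and> tp (tapes M - 1) = tape_of y)"

definition polytime :: "(bool list \<Rightarrow> bool list) \<Rightarrow> bool" where
  "polytime f \<longleftrightarrow>
     (\<exists>M (p :: nat poly). wf_tm M \<and> (\<forall>x. tm_outputs_within M x (f x) (poly p (length x))))"

definition class_P :: "bool list set set" where
  "class_P = {L. polytime (\<lambda>x. [x \<in> L])}"

text \<open>Injective pairing: the digits of \<open>x\<close>, each preceded by \<open>True\<close>, then \<open>False\<close>, then \<open>y\<close>.\<close>

definition pair_code :: "bool list \<Rightarrow> bool list \<Rightarrow> bool list" where
  "pair_code x y = concat (map (\<lambda>b. [True, b]) x) @ False # y"

definition class_NP :: "bool list set set" where
  "class_NP = {L. \<exists>R \<in> class_P. \<exists>p :: nat poly.
     \<forall>x. x \<in> L \<longleftrightarrow> (\<exists>y. length y \<le> poly p (length x) \<and> pair_code x y \<in> R)}"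

text \<open>
  The problem with yes-instances \<open>Y\<close> is NP-hard even when its inputs are restricted to \<open>I\<close>: the
  many-one reductions only produce inputs in \<open>I\<close>, also for no-instances.
\<close>

definition NP_hard_restricted :: "bool list set \<Rightarrow> bool list set \<Rightarrow> bool" where
  "NP_hard_restricted Y I \<longleftrightarrow>
     (\<forall>L \<in> class_NP. \<exists>f. polytime f \<and> (\<forall>x. f x \<in> I \<and> (x \<in> L \<longleftrightarrow> f x \<in> Y)))"


section \<open>Edge-colored graphs\<close>

definition simple_graph :: "'a set \<Rightarrow> 'a set set \<Rightarrow> bool" where
  "simple_graph V E \<longleftrightarrow> finite V \<and> (\<forall>e \<in> E. e \<subseteq> V \<and> card e = 2)"

text \<open>The family \<open>C\<close> of color classes is empty outside \<open>{1..c}\<close> by convention.\<close>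

definition colored_graph :: "nat \<Rightarrow> 'a set \<Rightarrow> 'a set set \<Rightarrow> (nat \<Rightarrow> 'a set set) \<Rightarrow> bool" where
  "colored_graph c V E C \<longleftrightarrow> simple_graph V E \<and>
     E = (\<Union>i \<in> {1..c}. C i) \<and> (\<forall>i \<in> {1..c}. C i \<noteq> {}) \<and> disjoint_family_on C {1..c} \<and>
     (\<forall>i. i \<notin> {1..c} \<longrightarrow> C i = {})"

definition vertex_degree :: "'a set set \<Rightarrow> 'a \<Rightarrow> nat" where
  "vertex_degree E v = card {e \<in> E. v \<in> e}"

definition max_degree :: "'a set \<Rightarrow> 'a set set \<Rightarrow> nat" where
  "max_degree V E = Max (vertex_degree E ` V)"

definition path_edges :: "'a list \<Rightarrow> 'a set set" where
  "path_edges vs = {{vs ! i, vs ! Suc i} | i. Suc i < length vs}"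

definition is_path :: "nat \<Rightarrow> 'a set \<Rightarrow> 'a set set \<Rightarrow> bool" where
  "is_path l W F \<longleftrightarrow> (\<exists>vs. distinct vs \<and> length vs = l \<and> W = set vs \<and> F = path_edges vs)"

definition is_cycle :: "'a set set \<Rightarrow> 'a list \<Rightarrow> bool" where
  "is_cycle E vs \<longleftrightarrow> length vs \<ge> 3 \<and> distinct vs \<and> insert {last vs, hd vs} (path_edges vs) \<subseteq> E"

definition girth :: "'a set set \<Rightarrow> enat" where
  "girth E = Inf {enat (length vs) | vs. is_cycle E vs}"

definition induced_edges :: "'a set set \<Rightarrow> 'a set \<Rightarrow> 'a set set" where
  "induced_edges E W = {e \<in> E. e \<subseteq> W}"

definition colors :: "(nat \<Rightarrow> 'a set set) \<Rightarrow> 'a set set \<Rightarrow> nat set" where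
  "colors C F = {i. C i \<inter> F \<noteq> {}}"

definition has_induced_colored_path ::
    "nat \<Rightarrow> nat \<Rightarrow> 'a set \<Rightarrow> 'a set set \<Rightarrow> (nat \<Rightarrow> 'a set set) \<Rightarrow> bool" where
  "has_induced_colored_path c l V E C \<longleftrightarrow>
     (\<exists>W F. W \<subseteq> V \<and> is_path l W F \<and> F = induced_edges E W \<and> card (colors C F) = c)"


section \<open>The deletion problem\<close>

definition deletion_solvable ::
    "nat \<Rightarrow> nat \<Rightarrow> 'a set \<Rightarrow> 'a set set \<Rightarrow> (nat \<Rightarrow> 'a set set) \<Rightarrow> nat \<Rightarrow> bool" where
  "deletion_solvable c l V E C k \<longleftrightarrow>
     (\<exists>S \<subseteq> E. card S \<le> k \<and> \<not> has_induced_colored_path c l V (E - S) C)"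

fun binary :: "nat \<Rightarrow> bool list" where
  "binary n = (if n = 0 then [] else odd n # binary (n div 2))"

declare binary.simps [simp del]

definition nat_code :: "nat \<Rightarrow> bool list" where
  "nat_code n = pair_code (binary n) []"

definition list_code :: "('b \<Rightarrow> bool list) \<Rightarrow> 'b list \<Rightarrow> bool list" where
  "list_code f xs = concat (map (\<lambda>x. True # f x) xs) @ [False]"

text \<open>
  An input lists the vertices (natural numbers), the edges \<open>{u, v}\<close> of color \<open>i\<close> as triples
  \<open>(u, v, i)\<close>, and the budget; all numbers are in binary.
\<close>

definition input_code :: "nat list \<Rightarrow> (nat \<times> nat \<times> nat) list \<Rightarrow> nat \<Rightarrow> bool list" where
  "input_code vs es k =
     list_code nat_code vs @
     list_code (\<lambda>(u, v, i). nat_code u @ nat_code v @ nat_code i) es @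
     nat_code k"

definition encodes ::
    "bool list \<Rightarrow> nat set \<Rightarrow> nat set set \<Rightarrow> (nat \<Rightarrow> nat set set) \<Rightarrow> nat \<Rightarrow> bool" where
  "encodes w V E C k \<longleftrightarrow> (\<exists>vs es. w = input_code vs es k \<and> V = set vs \<and>
     E = {{u, v} | u v i. (u, v, i) \<in> set es} \<and>
     C = (\<lambda>i. {{u, v} | u v. (u, v, i) \<in> set es}))"

definition colored_path_deletion :: "nat \<Rightarrow> nat \<Rightarrow> bool list set" where
  "colored_path_deletion c l = {w. \<exists>V E C k.
     encodes w V E C k \<and> colored_graph c V E C \<and> deletion_solvable c l V E C k}"

definition max_degree_three_girth_inputs :: "nat \<Rightarrow> real \<Rightarrow> bool list set" where
  "max_degree_three_girth_inputs c g = {w. \<exists>V E C k.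
     encodes w V E C k \<and> colored_graph c V E C \<and>
     max_degree V E = 3 \<and> ereal_of_enat (girth E) > ereal g}"


subsection \<open>The encoding is unambiguous\<close>

lemma pair_code_inject: "pair_code x y = pair_code x' y' \<longleftrightarrow> x = x' \<and> y = y'"
proof (induction x arbitrary: x')
  case Nil
  show ?case by (cases x') (auto simp: pair_code_def)
next
  case (Cons a x)
  then show ?case by (cases x') (auto simp: pair_code_def)
qed

lemma binary_inject: "binary m = binary n \<Longrightarrow> m = n"
proof (induction m arbitrary: n rule: less_induct)
  case (less m)
  show ?case
  proof (cases "m = 0 \<or> n = 0")
    case True
    then show ?thesis using less.prems by (auto simp: binary.simps[of m] binary.simps[of n] split: if_splits)
  next
    case False
    then have "odd m = odd n" "binary (m div 2) = binary (n div 2)"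
      using less.prems by (auto simp: binary.simps[of m] binary.simps[of n])
    moreover from this False have "m div 2 = n div 2" by (intro less.IH) auto
    ultimately show ?thesis by (metis odd_two_times_div_two_succ dvd_mult_div_cancel)
  qed
qed

lemma nat_code_append_inject: "nat_code m @ r = nat_code n @ s \<longleftrightarrow> m = n \<and> r = s"
proof -
  have "nat_code j @ t = pair_code (binary j) t" for j t
    by (simp add: nat_code_def pair_code_def)
  then show ?thesis by (auto simp: pair_code_inject dest: binary_inject)
qed

lemma list_code_append_inject:
  assumes "\<And>x y r s. f x @ r = f y @ s \<longleftrightarrow> x = y \<and> r = s"
  shows "list_code f xs @ r = list_code f ys @ s \<longleftrightarrow> xs = ys \<and> r = s"
proof (induction xs arbitrary: ys)
  case Nil
  show ?case by (cases ys) (auto simp: list_code_def)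
next
  case (Cons a xs)
  show ?case
  proof (cases ys)
    case Nil
    then show ?thesis by (auto simp: list_code_def)
  next
    case (Cons b zs)
    then show ?thesis using Cons.IH[of zs] by (auto simp: list_code_def assms)
  qed
qed

lemma input_code_inject:
  "input_code vs es k = input_code vs' es' k' \<longleftrightarrow> vs = vs' \<and> es = es' \<and> k = k'"
proof -
  let ?f = "\<lambda>(u, v, i). nat_code u @ nat_code v @ nat_code i"
  have f: "?f x @ r = ?f y @ s \<longleftrightarrow> x = y \<and> r = s" for x y r s
    by (cases x; cases y) (auto simp: nat_code_append_inject)
  show ?thesis
    using nat_code_append_inject[of k "[]" k' "[]"]
    by (auto simp: input_code_def list_code_append_inject[OF nat_code_append_inject]
        list_code_append_inject[of ?f, OF f])
qed

lemma encodes_unique: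
  assumes "encodes w V E C k" and "encodes w V' E' C' k'"
  shows "V = V' \<and> E = E' \<and> C = C' \<and> k = k'"
  using assms by (auto simp: encodes_def input_code_inject)

end

theory Submission
  imports Defs "HOL-Library.Nat_Bijection"
begin

text \<open>
  In a graph of girth above \<open>l\<close> every path on \<open>l\<close> vertices is induced, so with \<open>L = l - 1\<close> the task is to hit all
  \<open>L\<close>-edge paths that see all \<open>c\<close> colors. On a long cycle (a ring) in which every window of \<open>L\<close> consecutive
  edges sees all colors, a cheapest hitting set deletes exactly one residue class of positions modulo \<open>L\<close>,
  so a ring stores a phase in \<open>{0, \<dots>, L - 1}\<close>. The ring is made of sections of length \<open>-1\<close> modulo \<open>L\<close>, hence
  each phase is the residue of the attachment vertex of some section. The \<open>L - 1\<close> ring edges before an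
  attachment vertex already see all colors; if the ring has the phase of that vertex, then none of them is
  deleted, so the first edge of the arm must be. An arm joining two rings can be cleaned with three
  deletions unless this happens at both ends, so arms forbid pairs of phases. Taking the sections long
  makes the girth large, and all degrees are at most three.

  With one ring per cell of a grid and possible value \<open>m\<close>, whose phase says whether the cell has the value \<open>m\<close>, a
  larger or a smaller one, arms express that the cell has exactly one value, and they forbid pairs of values
  of neighboring cells. Such a system
  describes the accepting tableaux of a verifier on an input \<open>x\<close> with a free witness. For a fixed
  verifier only finitely many kinds of gadgets occur at a cell, so the graph is
  written down by nested loops over the rows and columns; these loops are programmed in a small while-language
  that compiles to Turing machines with polynomial overhead.
\<close>

text \<open>The budget leaves no slack. It is the sum of lower bounds for pairwise disjoint edge
  sets: \<open>N\<close> for each ring, and one for each of three parts of every arm, namely its two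
  ends with their pendant paths and a stretch of \<open>L\<close> edges in the middle. A deletion
  set within the budget meets each bound exactly and contains nothing else; only this exactness
  turns it into phases. A firing end spends the one deletion of its part on the outermost edge, and
  the colors are arranged so that the middle deletion must then fall on its own side. Two firing
  ends would claim it twice. The obstacle in the other direction is an end that does not fire. Its
  outermost edge survives as a stub on a block of \<open>L\<close> ring vertices, which gives the
  \<open>L + 1\<close> vertices that a path needs. A path through all of them is impossible if the
  attachment vertex lies inside the block, since it then has three branches. If it starts the block,
  the path exists but misses color 2; if it ends the block, the end fires. The side on which a ring
  shows all colors before an attachment vertex is thus essential.\<close>

section \<open>While-programs on tapes\<close>

datatype prog =
    Act nat "nat \<Rightarrow> nat \<times> int"
  | Seq prog prog  (infixr ";;" 60)
  | Whl nat "nat \<Rightarrow> bool" prog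
  | Ite nat "nat \<Rightarrow> bool" prog prog

type_synonym mem = "(nat \<Rightarrow> int) \<times> (nat \<Rightarrow> int \<Rightarrow> nat)"

definition scan :: "mem \<Rightarrow> nat \<Rightarrow> nat" where
  "scan s j = snd s j (fst s j)"

definition act :: "nat \<Rightarrow> (nat \<Rightarrow> nat \<times> int) \<Rightarrow> mem \<Rightarrow> mem" where
  "act j f s = ((fst s)(j := fst s j + snd (f (scan s j))),
     (snd s)(j := (snd s j)(fst s j := fst (f (scan s j)))))"

inductive run :: "prog \<Rightarrow> mem \<Rightarrow> nat \<Rightarrow> mem \<Rightarrow> bool" where
  Act: "run (Act j f) s 1 (act j f s)"
| Seq: "run p s t s' \<Longrightarrow> run q s' u s'' \<Longrightarrow> run (p ;; q) s (t + u) s''"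
| WhlF: "\<not> b (scan s j) \<Longrightarrow> run (Whl j b p) s 1 s"
| WhlT: "b (scan s j) \<Longrightarrow> run p s t s' \<Longrightarrow> run (Whl j b p) s' u s'' \<Longrightarrow> run (Whl j b p) s (1 + t + u) s''"
| IteT: "b (scan s j) \<Longrightarrow> run p s t s' \<Longrightarrow> run (Ite j b p q) s (1 + t) s'"
| IteF: "\<not> b (scan s j) \<Longrightarrow> run q s t s' \<Longrightarrow> run (Ite j b p q) s (1 + t) s'"

fun wfp :: "nat \<Rightarrow> prog \<Rightarrow> bool" where
  "wfp K (Act j f) \<longleftrightarrow> j < K \<and> f ` {..<3} \<subseteq> {..<3} \<times> {-1, 0, 1}"
| "wfp K (p ;; q) \<longleftrightarrow> wfp K p \<and> wfp K q"
| "wfp K (Whl j b p) \<longleftrightarrow> j < K \<and> wfp K p"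
| "wfp K (Ite j b p q) \<longleftrightarrow> j < K \<and> wfp K p \<and> wfp K q"

fun psize :: "prog \<Rightarrow> nat" where
  "psize (Act j f) = 1"
| "psize (p ;; q) = psize p + psize q"
| "psize (Whl j b p) = Suc (psize p)"
| "psize (Ite j b p q) = Suc (psize p + psize q)"

section \<open>Translation of programs into transition tables\<close>

type_synonym instr = "nat list \<Rightarrow> nat \<times> (nat \<times> int) list"

definition nop :: "nat list \<Rightarrow> (nat \<times> int) list" where
  "nop rs = map (\<lambda>a. (a, 0)) rs"

text \<open>The block occupies the states from \<open>a\<close> to \<open>a + psize p - 1\<close>
  and leaves through \<open>e\<close>. Every part is told the address of its successor, and a loop
  body that of its own test, so no separate jumps are inserted and the machine takes exactly the
  steps counted by \<open>run\<close>.\<close>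

fun compile :: "prog \<Rightarrow> nat \<Rightarrow> nat \<Rightarrow> instr list" where
  "compile (Act j f) a e = [\<lambda>rs. (e, (nop rs)[j := f (rs ! j)])]"
| "compile (p ;; q) a e = compile p a (a + psize p) @ compile q (a + psize p) e"
| "compile (Whl j b p) a e = (\<lambda>rs. (if b (rs ! j) then a + 1 else e, nop rs)) # compile p (a + 1) a"
| "compile (Ite j b p q) a e = (\<lambda>rs. (if b (rs ! j) then a + 1 else a + 1 + psize p, nop rs)) #
     compile p (a + 1) e @ compile q (a + 1 + psize p) e"

lemma length_compile [simp]: "length (compile p a e) = psize p"
  by (induction p arbitrary: a e) auto

text \<open>An empty block would make its entry address point behind the code;
  \<open>compile_wf\<close> uses this for the address at which one block hands over to the
  next.\<close>

lemma psize_pos: "psize p > 0"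
  by (induction p) auto

text \<open>States 0 and 1 are reserved for starting and halting, so the code begins at 2. State 0
  only jumps there, which is the one extra step in \<open>machine_outputs\<close>, and the exit
  address 1 makes leaving the program the same as halting.\<close>

definition machine :: "nat \<Rightarrow> prog \<Rightarrow> tm" where
  "machine K p = \<lparr>tapes = K, symbs = 3, states = psize p + 2,
     delta = (\<lambda>q rs. if q = 0 then (2, nop rs) else if q = 1 then (1, nop rs)
       else (compile p 2 1 ! (q - 2)) rs)\<rparr>"

lemma nop_nth: "i < length rs \<Longrightarrow> nop rs ! i = (rs ! i, 0)"
  by (simp add: nop_def)

lemma step_nop:
  assumes "q \<noteq> 1" and "\<And>rs. length rs = tapes M \<Longrightarrow> delta M q rs = (f rs, nop rs)"
  shows "tm_step M (q, s) = (f (map (scan s) [0..<tapes M]), s)"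
proof -
  obtain h tp where s: "s = (h, tp)" by (cases s)
  have e: "map (\<lambda>j. tp j (h j)) [0..<tapes M] = map (scan s) [0..<tapes M]"
    by (simp add: scan_def s)
  show ?thesis using assms(1) unfolding s
    by (auto simp: e assms(2) nop_nth fun_eq_iff s scan_def)
qed

lemma step_act:
  assumes "q \<noteq> 1" and "\<And>rs. length rs = tapes M \<Longrightarrow> delta M q rs = (e, (nop rs)[j := f (rs ! j)])"
    and "j < tapes M"
  shows "tm_step M (q, s) = (e, act j f s)"
proof -
  obtain h tp where s: "s = (h, tp)" by (cases s)
  have e: "map (\<lambda>j. tp j (h j)) [0..<tapes M] = map (scan s) [0..<tapes M]"
    by (simp add: scan_def s)
  show ?thesis using assms(1,3) unfolding s
    by (auto simp: e assms(2) nop_nth fun_eq_iff s scan_def act_def nop_def nth_list_update)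
qed

lemma funpow_add_apply: "(f ^^ (t + u)) x = (f ^^ u) ((f ^^ t) x)"
  by (metis add.commute comp_apply funpow_add)

text \<open>Induction on the run, because a loop re-enters its own block. The bound on
  \<open>a\<close> keeps all addresses of the block away from the halting state 1, where
  \<open>tm_step\<close> is the identity.\<close>

lemma compile_correct:
  assumes "run p s t s'" and "wfp (tapes M) p" and "a \<ge> 2"
    and "\<And>i. i < psize p \<Longrightarrow> delta M (a + i) = compile p a e ! i"
  shows "(tm_step M ^^ t) (a, s) = (e, s')"
  using assms
proof (induction arbitrary: a e rule: run.induct)
  case (Act j f s)
  have "tm_step M (a, s) = (e, act j f s)"
    using Act.prems Act.prems(3)[of 0] by (intro step_act) auto
  then show ?case by simp
next
  case (Seq p s t s' q u s'')
  have 1: "(tm_step M ^^ t) (a, s) = (a + psize p, s')"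
    using Seq.prems by (intro Seq.IH(1)) (auto simp: nth_append)
  have 2: "(tm_step M ^^ u) (a + psize p, s') = (e, s'')"
  proof (rule Seq.IH(2))
    fix i assume "i < psize q"
    then show "delta M (a + psize p + i) = compile q (a + psize p) e ! i"
      using Seq.prems(3)[of "psize p + i"] by (simp add: nth_append add.assoc)
  qed (use Seq.prems in auto)
  show ?case by (simp add: funpow_add_apply 1 2)
next
  case (WhlF b s j p)
  have "tm_step M (a, s) = ((\<lambda>rs. if b (rs ! j) then a + 1 else e) (map (scan s) [0..<tapes M]), s)"
    using WhlF.prems WhlF.prems(3)[of 0] by (intro step_nop) auto
  then show ?case using WhlF by auto
next
  case (WhlT b s j p t s' u s'')
  have "tm_step M (a, s) = ((\<lambda>rs. if b (rs ! j) then a + 1 else e) (map (scan s) [0..<tapes M]), s)"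
    using WhlT.prems WhlT.prems(3)[of 0] by (intro step_nop) auto
  then have 0: "(tm_step M ^^ 1) (a, s) = (a + 1, s)" using WhlT by auto
  have 1: "(tm_step M ^^ t) (a + 1, s) = (a, s')"
  proof (rule WhlT.IH(1))
    fix i assume "i < psize p"
    then show "delta M (a + 1 + i) = compile p (a + 1) a ! i"
      using WhlT.prems(3)[of "Suc i"] by simp
  qed (use WhlT.prems in auto)
  have 2: "(tm_step M ^^ u) (a, s') = (e, s'')"
    using WhlT.prems by (intro WhlT.IH(2)) auto
  show ?case by (simp only: funpow_add_apply 0 1 2)
next
  case (IteT b s j p t s' q)
  have "tm_step M (a, s) =
      ((\<lambda>rs. if b (rs ! j) then a + 1 else a + 1 + psize p) (map (scan s) [0..<tapes M]), s)"
    using IteT.prems IteT.prems(3)[of 0] by (intro step_nop) auto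
  then have 0: "(tm_step M ^^ 1) (a, s) = (a + 1, s)" using IteT by auto
  have 1: "(tm_step M ^^ t) (a + 1, s) = (e, s')"
  proof (rule IteT.IH)
    fix i assume "i < psize p"
    then show "delta M (a + 1 + i) = compile p (a + 1) e ! i"
      using IteT.prems(3)[of "Suc i"] by (simp add: nth_append)
  qed (use IteT.prems in auto)
  show ?case by (simp only: funpow_add_apply 0 1)
next
  case (IteF b s j q t s' p)
  have "tm_step M (a, s) =
      ((\<lambda>rs. if b (rs ! j) then a + 1 else a + 1 + psize p) (map (scan s) [0..<tapes M]), s)"
    using IteF.prems IteF.prems(3)[of 0] by (intro step_nop) auto
  then have 0: "(tm_step M ^^ 1) (a, s) = (a + 1 + psize p, s)" using IteF by auto
  have 1: "(tm_step M ^^ t) (a + 1 + psize p, s) = (e, s')"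
  proof (rule IteF.IH)
    fix i assume "i < psize q"
    then show "delta M (a + 1 + psize p + i) = compile q (a + 1 + psize p) e ! i"
      using IteF.prems(3)[of "Suc (psize p + i)"] by (simp add: nth_append add.assoc)
  qed (use IteF.prems in auto)
  show ?case by (simp only: funpow_add_apply 0 1)
qed

lemma compile_wf:
  assumes "wfp K p" and "a + psize p \<le> n" and "e < n" and "i < psize p"
    and "length rs = K" and "set rs \<subseteq> {..<3}" and "compile p a e ! i = g"
  shows "fst (g rs) < n \<and> length (snd (g rs)) = K \<and> set (snd (g rs)) \<subseteq> {..<3} \<times> {-1, 0, 1}"
  using assms
proof (induction p arbitrary: a e i g)
  case (Act j f)
  then have "rs ! j \<in> {..<3}" by (meson nth_mem subsetD wfp.simps(1))
  then have "f (rs ! j) \<in> {..<3} \<times> {-1, 0, 1}" using Act by auto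
  moreover have "set (nop rs) \<subseteq> {..<3} \<times> {-1, 0, 1}" using Act by (auto simp: nop_def)
  ultimately have "set ((nop rs)[j := f (rs ! j)]) \<subseteq> {..<3} \<times> {-1, 0, 1}"
    using set_update_subset_insert by fastforce
  then show ?case using Act by (auto simp: nop_def)
next
  case (Seq p q)
  show ?case
  proof (cases "i < psize p")
    case True
    then show ?thesis using Seq.prems psize_pos[of q]
      by (intro Seq.IH(1)[of a "a + psize p" i]) (auto simp: nth_append)
  next
    case False
    then show ?thesis using Seq.prems
      by (intro Seq.IH(2)[of "a + psize p" e "i - psize p"]) (auto simp: nth_append)
  qed
next
  case (Whl j b p)
  show ?case
  proof (cases i)
    case 0
    then show ?thesis using Whl.prems psize_pos[of p] by (auto simp: nop_def)
  next
    case (Suc i')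
    then show ?thesis using Whl.prems by (intro Whl.IH[of "a + 1" a i']) auto
  qed
next
  case (Ite j b p q)
  show ?case
  proof (cases i)
    case 0
    then show ?thesis using Ite.prems psize_pos[of p] psize_pos[of q] by (auto simp: nop_def)
  next
    case (Suc i')
    show ?thesis
    proof (cases "i' < psize p")
      case True
      then show ?thesis using Ite.prems Suc
        by (intro Ite.IH(1)[of "a + 1" e i']) (auto simp: nth_append)
    next
      case False
      then show ?thesis using Ite.prems Suc
        by (intro Ite.IH(2)[of "a + 1 + psize p" e "i' - psize p"]) (auto simp: nth_append)
    qed
  qed
qed

lemma wf_machine:
  assumes "wfp K p" and "K \<ge> 1"
  shows "wf_tm (machine K p)"
proof -
  have "case delta (machine K p) q rs of (q', as) \<Rightarrow>
      q' < psize p + 2 \<and> length as = K \<and> set as \<subseteq> {..<3} \<times> {-1, 0, 1}"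
    if "q < psize p + 2" "length rs = K" "set rs \<subseteq> {..<3}" for q rs
  proof (cases "q \<le> 1")
    case True
    then show ?thesis using that psize_pos[of p] by (auto simp: machine_def nop_def)
  next
    case False
    then have "q - 2 < psize p" using that by linarith
    then show ?thesis
      using compile_wf[OF assms(1) _ _ _ that(2,3) refl, of 2 "psize p + 2" 1 "q - 2"] that False
      by (simp add: machine_def case_prod_beta)
  qed
  then show ?thesis using assms(2) by (auto simp: wf_tm_def machine_def)
qed

lemma machine_outputs:
  assumes "wfp K p" and "run p (snd (tm_init x)) t (h, tp)" and "tp (K - 1) = tape_of y" and "t + 1 \<le> T"
  shows "tm_outputs_within (machine K p) x y T"
proof -
  let ?M = "machine K p"
  let ?s = "snd (tm_init x)"
  have "tm_step ?M (0, ?s) = ((\<lambda>_. 2) (map (scan ?s) [0..<tapes ?M]), ?s)"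
    by (intro step_nop) (auto simp: machine_def)
  then have 0: "(tm_step ?M ^^ 1) (0, ?s) = (2, ?s)" by simp
  have 1: "(tm_step ?M ^^ t) (2, ?s) = (1, h, tp)"
    using assms(1,2) by (intro compile_correct) (auto simp: machine_def)
  have "(tm_step ?M ^^ (1 + t)) (tm_init x) = (1, h, tp)"
    using 0 1 by (simp only: funpow_add_apply) (simp add: tm_init_def)
  then show ?thesis using assms(3,4) unfolding tm_outputs_within_def
    by (intro exI[of _ "1 + t"]) (auto simp: machine_def)
qed

section \<open>Registers, output and loops on tapes\<close>

type_synonym st = "(nat \<Rightarrow> nat) \<times> nat \<times> bool list"

definition unary :: "nat \<Rightarrow> int \<Rightarrow> nat" where
  "unary v i = (if 0 \<le> i \<and> i < int v then 1 else 0)"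

definition tapes_of :: "nat \<Rightarrow> bool list \<Rightarrow> st \<Rightarrow> nat \<Rightarrow> int \<Rightarrow> nat" where
  "tapes_of K x s j = (if j = 0 then tape_of x else if j = 1 then tape_of (binary (fst (snd s)))
     else if j = K - 1 then tape_of (snd (snd s)) else unary (fst s j))"

text \<open>Rest positions that spare every search: a register tape rests on the first blank behind
  its ones and the output tape behind its last symbol, so incrementing and emitting are single
  writes. The two binary tapes rest on their first digit.\<close>

definition heads_of :: "nat \<Rightarrow> st \<Rightarrow> nat \<Rightarrow> int" where
  "heads_of K s j = (if j \<le> 1 then 0 else if j = K - 1 then int (length (snd (snd s)))
     else int (fst s j))"

definition memo :: "nat \<Rightarrow> bool list \<Rightarrow> nat set \<Rightarrow> (nat \<Rightarrow> int) \<Rightarrow> st \<Rightarrow> mem" where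
  "memo K x B g s = (\<lambda>j. if j \<in> B then g j else heads_of K s j, tapes_of K x s)"

text \<open>The heads of tapes outside \<open>F\<close> may be anywhere and stay there: such tapes are being scanned
  by an enclosing loop.\<close>

definition exec :: "nat \<Rightarrow> bool list \<Rightarrow> prog \<Rightarrow> nat set \<Rightarrow> st \<Rightarrow> st \<Rightarrow> nat \<Rightarrow> bool" where
  "exec K x p F s s' c \<longleftrightarrow> (\<forall>B g. B \<inter> F = {} \<longrightarrow>
     (\<exists>t \<le> c. run p (memo K x B g s) t (memo K x B g s')))"

lemma exec_mono: "exec K x p F s s' c \<Longrightarrow> F \<subseteq> F' \<Longrightarrow> c \<le> c' \<Longrightarrow> exec K x p F' s s' c'"
  unfolding exec_def by (meson disjoint_iff order_trans subsetD)

lemma exec_seq: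
  assumes "exec K x p F s s' c" and "exec K x q F s' s'' d"
  shows "exec K x (p ;; q) F s s'' (c + d)"
  unfolding exec_def
proof (intro allI impI)
  fix B g assume B: "B \<inter> F = {}"
  obtain t where t: "t \<le> c" "run p (memo K x B g s) t (memo K x B g s')"
    using assms(1) B unfolding exec_def by blast
  obtain u where u: "u \<le> d" "run q (memo K x B g s') u (memo K x B g s'')"
    using assms(2) B unfolding exec_def by blast
  show "\<exists>t\<le>c + d. run (p ;; q) (memo K x B g s) t (memo K x B g s'')"
    using run.Seq[OF t(2) u(2)] t(1) u(1) by (intro exI[of _ "t + u"]) auto
qed

text \<open>A head at rest may as well be listed among the explicitly placed ones. In this way an
  operation takes over its own tape and hands it back at the end.\<close>

lemma memo_insert: "j \<notin> B \<Longrightarrow> v = heads_of K s j \<Longrightarrow> memo K x (insert j B) (g(j := v)) s = memo K x B g s"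
  by (auto simp: memo_def fun_eq_iff)

lemma scan_memo: "j \<in> B \<Longrightarrow> scan (memo K x B g s) j = tapes_of K x s j (g j)"
  by (simp add: scan_def memo_def)

lemma act_memo:
  assumes "j \<in> B" and "f (tapes_of K x s j (g j)) = (a, d)"
    and "\<And>i. i \<noteq> j \<Longrightarrow> i \<notin> B \<Longrightarrow> heads_of K s' i = heads_of K s i"
    and "\<And>i. i \<noteq> j \<Longrightarrow> tapes_of K x s' i = tapes_of K x s i"
    and "tapes_of K x s' j = (tapes_of K x s j)(g j := a)"
  shows "act j f (memo K x B g s) = memo K x B (g(j := g j + d)) s'"
  using assms by (auto simp: act_def memo_def scan_def fun_eq_iff)

lemma act_move: "act j (\<lambda>a. (a, d)) s = ((fst s)(j := fst s j + d), snd s)"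
  by (auto simp: act_def scan_def)

lemma move_memo: "j \<in> B \<Longrightarrow> act j (\<lambda>a. (a, d)) (memo K x B g s) = memo K x B (g(j := g j + d)) s"
  by (auto simp: act_move memo_def fun_eq_iff)

lemma sweep:
  assumes "\<And>k. k < n \<Longrightarrow> P (snd s j (fst s j + int k * d))" and "\<not> P (snd s j (fst s j + int n * d))"
  shows "run (Whl j P (Act j (\<lambda>a. (a, d)))) s (2 * n + 1) ((fst s)(j := fst s j + int n * d), snd s)"
  using assms
proof (induction n arbitrary: s)
  case 0
  have "\<not> P (scan s j)" using 0 by (simp add: scan_def)
  moreover have "((fst s)(j := fst s j + int 0 * d), snd s) = s" by simp
  ultimately show ?case using run.WhlF[of P s j "Act j (\<lambda>a. (a, d))"] by (metis add_0 mult_0_right)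
next
  case (Suc n)
  let ?s = "((fst s)(j := fst s j + d), snd s)"
  have r: "run (Whl j P (Act j (\<lambda>a. (a, d)))) ?s (2 * n + 1)
      ((fst ?s)(j := fst ?s j + int n * d), snd ?s)"
  proof (rule Suc.IH)
    fix k assume "k < n"
    then show "P (snd ?s j (fst ?s j + int k * d))"
      using Suc.prems(1)[of "Suc k"] by (simp add: algebra_simps)
  qed (use Suc.prems(2) in \<open>simp add: algebra_simps\<close>)
  have "P (scan s j)" using Suc.prems(1)[of 0] by (simp add: scan_def)
  moreover have "((fst ?s)(j := fst ?s j + int n * d), snd ?s) = ((fst s)(j := fst s j + int (Suc n) * d), snd s)"
    by (simp add: algebra_simps)
  moreover have "1 + 1 + (2 * n + 1) = 2 * Suc n + 1" by simp
  ultimately show ?case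
    using run.WhlT[of P s j "Act j (\<lambda>a. (a, d))", OF _ run.Act[of j "\<lambda>a. (a, d)" s, unfolded act_move] r] by metis
qed

lemma sweep_memo:
  assumes "j \<in> B" and "\<And>k. k < n \<Longrightarrow> P (tapes_of K x s j (g j + int k * d))"
    and "\<not> P (tapes_of K x s j (g j + int n * d))" and "v = g j + int n * d"
  shows "run (Whl j P (Act j (\<lambda>a. (a, d)))) (memo K x B g s) (2 * n + 1) (memo K x B (g(j := v)) s)"
proof -
  have "((fst (memo K x B g s))(j := fst (memo K x B g s) j + int n * d), snd (memo K x B g s))
      = memo K x B (g(j := v)) s"
    using assms(1,4) by (auto simp: memo_def fun_eq_iff)
  then show ?thesis using sweep[of n P "memo K x B g s" j d] assms by (simp add: memo_def)
qed

lemma tape_of_snoc: "tape_of (w @ [v]) = (tape_of w)(int (length w) := (if v then 2 else 1))"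
  by (auto simp: tape_of_def fun_eq_iff nth_append)

lemma tape_of_nat: "k < length w \<Longrightarrow> tape_of w (int k) = (if w ! k then 2 else 1)"
  by (simp add: tape_of_def)

definition emit :: "nat \<Rightarrow> bool \<Rightarrow> prog" where
  "emit K v = Act (K - 1) (\<lambda>_. (if v then 2 else 1, 1))"

lemma exec_emit:
  assumes "K \<ge> 3"
  shows "exec K x (emit K v) {K - 1} (r, b, w) (r, b, w @ [v]) 1"
  unfolding exec_def
proof (intro allI impI)
  fix B and g :: "nat \<Rightarrow> int" assume "B \<inter> {K - 1} = {}"
  then have k: "K - 1 \<notin> B" by auto
  let ?n = "int (length w)"
  have "act (K - 1) (\<lambda>_. (if v then 2 else 1, 1)) (memo K x (insert (K - 1) B) (g(K - 1 := ?n)) (r, b, w))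
     = memo K x (insert (K - 1) B) ((g(K - 1 := ?n))(K - 1 := (g(K - 1 := ?n)) (K - 1) + 1)) (r, b, w @ [v])"
    using assms by (intro act_memo) (auto simp: heads_of_def tapes_of_def tape_of_snoc fun_eq_iff)
  moreover have "memo K x (insert (K - 1) B) (g(K - 1 := ?n)) (r, b, w) = memo K x B g (r, b, w)"
    using k assms by (intro memo_insert) (auto simp: heads_of_def)
  moreover have "memo K x (insert (K - 1) B) ((g(K - 1 := ?n))(K - 1 := (g(K - 1 := ?n)) (K - 1) + 1)) (r, b, w @ [v])
     = memo K x B g (r, b, w @ [v])"
  proof -
    have "?n + 1 = heads_of K (r, b, w @ [v]) (K - 1)" using assms by (simp add: heads_of_def)
    from memo_insert[OF k this, of x g] show ?thesis by simp
  qed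
  ultimately show "\<exists>t\<le>1. run (emit K v) (memo K x B g (r, b, w)) t (memo K x B g (r, b, w @ [v]))"
    unfolding emit_def by (metis order_refl run.Act)
qed

definition inc :: "nat \<Rightarrow> prog" where
  "inc j = Act j (\<lambda>_. (1, 1))"

lemma unary_Suc: "unary (Suc v) = (unary v)(int v := 1)"
  by (auto simp: unary_def fun_eq_iff)

lemma exec_inc:
  assumes "2 \<le> j" and "j < K - 1"
  shows "exec K x (inc j) {j} (r, b, w) (r(j := Suc (r j)), b, w) 1"
  unfolding exec_def
proof (intro allI impI)
  fix B and g :: "nat \<Rightarrow> int" assume "B \<inter> {j} = {}"
  then have k: "j \<notin> B" by auto
  let ?n = "int (r j)"
  have "act j (\<lambda>_. (1, 1)) (memo K x (insert j B) (g(j := ?n)) (r, b, w))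
     = memo K x (insert j B) ((g(j := ?n))(j := (g(j := ?n)) j + 1)) (r(j := Suc (r j)), b, w)"
    using assms by (intro act_memo) (auto simp: heads_of_def tapes_of_def unary_Suc fun_eq_iff)
  moreover have "memo K x (insert j B) (g(j := ?n)) (r, b, w) = memo K x B g (r, b, w)"
    using k assms by (intro memo_insert) (auto simp: heads_of_def)
  moreover have "memo K x (insert j B) ((g(j := ?n))(j := (g(j := ?n)) j + 1)) (r(j := Suc (r j)), b, w)
     = memo K x B g (r(j := Suc (r j)), b, w)"
    using memo_insert[of j B "?n + 1" K "(r(j := Suc (r j)), b, w)" x g] k assms by (auto simp: heads_of_def add.commute)
  ultimately show "\<exists>t\<le>1. run (inc j) (memo K x B g (r, b, w)) t (memo K x B g (r(j := Suc (r j)), b, w))"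
    unfolding inc_def by (metis order_refl run.Act)
qed

definition clr :: "nat \<Rightarrow> prog" where
  "clr j = Act j (\<lambda>a. (a, -1)) ;; Whl j (\<lambda>a. a = 1) (Act j (\<lambda>_. (0, -1))) ;; Act j (\<lambda>a. (a, 1))"

lemma exec_clr:
  assumes j: "2 \<le> j" "j < K - 1"
  shows "exec K x (clr j) {j} (r, b, w) (r(j := 0), b, w) (2 * r j + 3)"
  unfolding exec_def
proof (intro allI impI)
  fix B and g :: "nat \<Rightarrow> int" assume "B \<inter> {j} = {}"
  then have k: "j \<notin> B" by auto
  let ?B = "insert j B"
  have loop: "run (Whl j (\<lambda>a. a = 1) (Act j (\<lambda>_. (0, -1))))
      (memo K x ?B (g(j := int v - 1)) (r(j := v), b, w)) (2 * v + 1)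
      (memo K x ?B (g(j := -1)) (r(j := 0), b, w))" for v
  proof (induction v)
    case 0
    have "scan (memo K x ?B (g(j := int 0 - 1)) (r(j := 0), b, w)) j \<noteq> 1"
      using j by (simp add: scan_memo tapes_of_def unary_def)
    from run.WhlF[of "\<lambda>a. a = 1", OF this] show ?case
      by (metis add_0 mult_0_right diff_0 of_nat_0)
  next
    case (Suc v)
    let ?s = "memo K x ?B (g(j := int (Suc v) - 1)) (r(j := Suc v), b, w)"
    have 1: "scan ?s j = 1" using j by (simp add: scan_memo tapes_of_def unary_def)
    have "act j (\<lambda>_. (0, -1)) ?s = memo K x ?B ((g(j := int (Suc v) - 1))(j := (g(j := int (Suc v) - 1)) j + -1)) (r(j := v), b, w)"
      using j by (intro act_memo) (auto simp: heads_of_def tapes_of_def unary_def fun_eq_iff)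
    then have 2: "run (Act j (\<lambda>_. (0, -1))) ?s 1 (memo K x ?B (g(j := int v - 1)) (r(j := v), b, w))"
      using run.Act[of j "\<lambda>_. (0, -1)" ?s] by (simp add: algebra_simps)
    have "1 + 1 + (2 * v + 1) = 2 * Suc v + 1" by simp
    then show ?case using run.WhlT[of "\<lambda>a. a = 1", OF 1 2 Suc.IH] by metis
  qed
  let ?s = "memo K x ?B (g(j := int (r j))) (r, b, w)"
  have 1: "run (Act j (\<lambda>a. (a, -1))) ?s 1 (memo K x ?B (g(j := int (r j) - 1)) (r(j := r j), b, w))"
    using run.Act[of j "\<lambda>a. (a, -1)" ?s] by (simp add: move_memo)
  have 2: "run (Act j (\<lambda>a. (a, 1))) (memo K x ?B (g(j := -1)) (r(j := 0), b, w)) 1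
      (memo K x ?B (g(j := 0)) (r(j := 0), b, w))"
    using run.Act[of j "\<lambda>a. (a, 1)" "memo K x ?B (g(j := -1)) (r(j := 0), b, w)"] by (simp add: move_memo)
  have s: "?s = memo K x B g (r, b, w)" "memo K x ?B (g(j := 0)) (r(j := 0), b, w) = memo K x B g (r(j := 0), b, w)"
    using k j by (auto intro!: memo_insert simp: heads_of_def)
  have "run (clr j) (memo K x B g (r, b, w)) (1 + (2 * r j + 1 + 1)) (memo K x B g (r(j := 0), b, w))"
    unfolding clr_def s[symmetric] using 1 loop 2 by (intro run.Seq)
  then show "\<exists>t\<le>2 * r j + 3. run (clr j) (memo K x B g (r, b, w)) t (memo K x B g (r(j := 0), b, w))"
    by (intro exI[of _ "1 + (2 * r j + 1 + 1)"]) auto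
qed

text \<open>The head position on tape \<open>j\<close> is the loop counter: the ones are scanned
  from right to left and never altered. Loop bounds therefore survive, and loops over different
  tapes nest without copies.\<close>

definition rept :: "nat \<Rightarrow> prog \<Rightarrow> prog" where
  "rept j p = Act j (\<lambda>a. (a, -1)) ;; Whl j (\<lambda>a. a = 1) (p ;; Act j (\<lambda>a. (a, -1))) ;;
     Act j (\<lambda>a. (a, 1)) ;; Whl j (\<lambda>a. a = 1) (Act j (\<lambda>a. (a, 1)))"

lemma exec_rept:
  assumes j: "2 \<le> j" "j < K - 1" and body: "\<And>k. k < v \<Longrightarrow> exec K x p F (\<sigma> k) (\<sigma> (Suc k)) c"
    and v: "\<And>k. k \<le> v \<Longrightarrow> fst (\<sigma> k) j = v" and F: "j \<notin> F"
  shows "exec K x (rept j p) (insert j F) (\<sigma> 0) (\<sigma> v) (v * (c + 4) + 4)"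
  unfolding exec_def
proof (intro allI impI)
  fix B and g :: "nat \<Rightarrow> int" assume "B \<inter> insert j F = {}"
  then have k: "j \<notin> B" and BF: "insert j B \<inter> F = {}" using F by auto
  let ?B = "insert j B"
  let ?m = "\<lambda>i s. memo K x ?B (g(j := i)) s"
  let ?W = "Whl j (\<lambda>a. a = 1) (p ;; Act j (\<lambda>a. (a, -1)))"
  have tj: "tapes_of K x (\<sigma> k) j = unary v" if "k \<le> v" for k
    using that v j by (simp add: tapes_of_def)
  \<comment> \<open>Before round \<open>k\<close> the head stands on cell \<open>v - 1 - k\<close>;
    after the last round it is on cell \<open>-1\<close>, the blank to the left.\<close>
  have loop: "\<exists>t \<le> (v - k) * (c + 2) + 1. run ?W (?m (int v - 1 - int k) (\<sigma> k)) t (?m (-1) (\<sigma> v))"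
    if "k \<le> v" for k
    using that
  proof (induction rule: inc_induct)
    case base
    have "scan (?m (int v - 1 - int v) (\<sigma> v)) j \<noteq> 1" by (simp add: scan_memo tj unary_def)
    from run.WhlF[of "\<lambda>a. a = 1", OF this]
    have "run ?W (?m (int v - 1 - int v) (\<sigma> v)) 1 (?m (-1) (\<sigma> v))" by simp
    then show ?case by (intro exI[of _ 1] conjI) linarith
  next
    case (step n)
    then obtain t where t: "t \<le> (v - Suc n) * (c + 2) + 1"
      "run ?W (?m (int v - 1 - int (Suc n)) (\<sigma> (Suc n))) t (?m (-1) (\<sigma> v))" by blast
    obtain u where u: "u \<le> c" "run p (?m (int v - 1 - int n) (\<sigma> n)) u (?m (int v - 1 - int n) (\<sigma> (Suc n)))"
      using body[of n] step BF unfolding exec_def by blast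
    have 1: "run (Act j (\<lambda>a. (a, -1))) (?m (int v - 1 - int n) (\<sigma> (Suc n))) 1 (?m (int v - 1 - int (Suc n)) (\<sigma> (Suc n)))"
      using run.Act[of j "\<lambda>a. (a, -1)" "?m (int v - 1 - int n) (\<sigma> (Suc n))"]
      by (simp add: move_memo algebra_simps)
    have "scan (?m (int v - 1 - int n) (\<sigma> n)) j = 1"
      using step by (simp add: scan_memo tj unary_def)
    from run.WhlT[OF this run.Seq[OF u(2) 1] t(2)]
    have "run ?W (?m (int v - 1 - int n) (\<sigma> n)) (1 + (u + 1) + t) (?m (-1) (\<sigma> v))" by simp
    moreover have "1 + (u + 1) + t \<le> (v - n) * (c + 2) + 1"
    proof -
      have "v - n = Suc (v - Suc n)" using step by simp
      then show ?thesis using t(1) u(1) by simp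
    qed
    ultimately show ?case by blast
  qed
  obtain t where t: "t \<le> v * (c + 2) + 1" "run ?W (?m (int v - 1) (\<sigma> 0)) t (?m (-1) (\<sigma> v))"
    using loop[of 0] by auto
  have 1: "run (Act j (\<lambda>a. (a, -1))) (?m (int v) (\<sigma> 0)) 1 (?m (int v - 1) (\<sigma> 0))"
    using run.Act[of j "\<lambda>a. (a, -1)" "?m (int v) (\<sigma> 0)"] by (simp add: move_memo)
  have 2: "run (Act j (\<lambda>a. (a, 1))) (?m (-1) (\<sigma> v)) 1 (?m 0 (\<sigma> v))"
    using run.Act[of j "\<lambda>a. (a, 1)" "?m (-1) (\<sigma> v)"] by (simp add: move_memo)
  have 3: "run (Whl j (\<lambda>a. a = 1) (Act j (\<lambda>a. (a, 1)))) (?m 0 (\<sigma> v)) (2 * v + 1) (?m (int v) (\<sigma> v))"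
    using sweep_memo[of j ?B v "\<lambda>a. a = 1" K x "\<sigma> v" "g(j := 0)" 1 "int v"] by (simp add: tj unary_def)
  have s: "?m (int v) (\<sigma> 0) = memo K x B g (\<sigma> 0)" "?m (int v) (\<sigma> v) = memo K x B g (\<sigma> v)"
    using k j v by (auto intro!: memo_insert simp: heads_of_def)
  have "run (rept j p) (memo K x B g (\<sigma> 0)) (1 + (t + (1 + (2 * v + 1)))) (memo K x B g (\<sigma> v))"
    unfolding rept_def s[symmetric] using 1 t(2) 2 3 by (intro run.Seq)
  moreover have "1 + (t + (1 + (2 * v + 1))) \<le> v * (c + 4) + 4" using t(1) by (simp add: algebra_simps)
  ultimately show "\<exists>t\<le>v * (c + 4) + 4. run (rept j p) (memo K x B g (\<sigma> 0)) t (memo K x B g (\<sigma> v))" by blast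
qed

definition for_bits :: "nat \<Rightarrow> prog \<Rightarrow> prog \<Rightarrow> prog" where
  "for_bits j p q = Whl j (\<lambda>a. a \<noteq> 0) (Ite j (\<lambda>a. a = 2) q p ;; Act j (\<lambda>a. (a, 1))) ;;
     Act j (\<lambda>a. (a, -1)) ;; Whl j (\<lambda>a. a \<noteq> 0) (Act j (\<lambda>a. (a, -1))) ;; Act j (\<lambda>a. (a, 1))"

lemma exec_for_bits:
  assumes j: "j \<le> 1"
    and body: "\<And>k. k < length bs \<Longrightarrow> exec K x (if bs ! k then q else p) F (\<sigma> k) (\<sigma> (Suc k)) c"
    and tj: "\<And>k. k \<le> length bs \<Longrightarrow> tapes_of K x (\<sigma> k) j = tape_of bs" and F: "j \<notin> F"
  shows "exec K x (for_bits j p q) (insert j F) (\<sigma> 0) (\<sigma> (length bs)) (length bs * (c + 5) + 4)"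
  unfolding exec_def
proof (intro allI impI)
  fix B and g :: "nat \<Rightarrow> int" assume "B \<inter> insert j F = {}"
  then have k: "j \<notin> B" and BF: "insert j B \<inter> F = {}" using F by auto
  let ?B = "insert j B"
  let ?v = "length bs"
  let ?m = "\<lambda>i s. memo K x ?B (g(j := i)) s"
  let ?W = "Whl j (\<lambda>a. a \<noteq> 0) (Ite j (\<lambda>a. a = 2) q p ;; Act j (\<lambda>a. (a, 1)))"
  have loop: "\<exists>t \<le> (?v - k) * (c + 3) + 1. run ?W (?m (int k) (\<sigma> k)) t (?m (int ?v) (\<sigma> ?v))"
    if "k \<le> ?v" for k
    using that
  proof (induction rule: inc_induct)
    case base
    have "\<not> scan (?m (int ?v) (\<sigma> ?v)) j \<noteq> 0" by (simp add: scan_memo tj tape_of_def)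
    from run.WhlF[of "\<lambda>a. a \<noteq> 0", OF this]
    have "run ?W (?m (int ?v) (\<sigma> ?v)) 1 (?m (int ?v) (\<sigma> ?v))" .
    then show ?case by (intro exI[of _ 1] conjI) linarith
  next
    case (step n)
    then obtain t where t: "t \<le> (?v - Suc n) * (c + 3) + 1"
      "run ?W (?m (int (Suc n)) (\<sigma> (Suc n))) t (?m (int ?v) (\<sigma> ?v))" by blast
    obtain u where u: "u \<le> c" "run (if bs ! n then q else p) (?m (int n) (\<sigma> n)) u (?m (int n) (\<sigma> (Suc n)))"
      using body[of n] step BF unfolding exec_def by blast
    have sc: "scan (?m (int n) (\<sigma> n)) j = (if bs ! n then 2 else 1)"
      using step by (simp add: scan_memo tj tape_of_nat)
    have 0: "run (Ite j (\<lambda>a. a = 2) q p) (?m (int n) (\<sigma> n)) (1 + u) (?m (int n) (\<sigma> (Suc n)))"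
      using u(2) sc run.IteT[of "\<lambda>a. a = 2" "?m (int n) (\<sigma> n)" j q u _ p]
        run.IteF[of "\<lambda>a. a = 2" "?m (int n) (\<sigma> n)" j p u _ q] by (cases "bs ! n") auto
    have 1: "run (Act j (\<lambda>a. (a, 1))) (?m (int n) (\<sigma> (Suc n))) 1 (?m (int (Suc n)) (\<sigma> (Suc n)))"
      using run.Act[of j "\<lambda>a. (a, 1)" "?m (int n) (\<sigma> (Suc n))"]
      by (simp add: move_memo algebra_simps)
    have "scan (?m (int n) (\<sigma> n)) j \<noteq> 0" using sc by simp
    from run.WhlT[OF this run.Seq[OF 0 1] t(2)]
    have "run ?W (?m (int n) (\<sigma> n)) (1 + (1 + u + 1) + t) (?m (int ?v) (\<sigma> ?v))" by simp
    moreover have "1 + (1 + u + 1) + t \<le> (?v - n) * (c + 3) + 1"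
    proof -
      have "?v - n = Suc (?v - Suc n)" using step by simp
      then show ?thesis using t(1) u(1) by simp
    qed
    ultimately show ?case by blast
  qed
  obtain t where t: "t \<le> ?v * (c + 3) + 1" "run ?W (?m 0 (\<sigma> 0)) t (?m (int ?v) (\<sigma> ?v))"
    using loop[of 0] by auto
  have 1: "run (Act j (\<lambda>a. (a, -1))) (?m (int ?v) (\<sigma> ?v)) 1 (?m (int ?v - 1) (\<sigma> ?v))"
    using run.Act[of j "\<lambda>a. (a, -1)" "?m (int ?v) (\<sigma> ?v)"] by (simp add: move_memo)
  have 2: "run (Whl j (\<lambda>a. a \<noteq> 0) (Act j (\<lambda>a. (a, -1)))) (?m (int ?v - 1) (\<sigma> ?v)) (2 * ?v + 1) (?m (-1) (\<sigma> ?v))"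
    using sweep_memo[of j ?B ?v "\<lambda>a. a \<noteq> 0" K x "\<sigma> ?v" "g(j := int ?v - 1)" "-1" "-1"]
    by (simp add: tj tape_of_def)
  have 3: "run (Act j (\<lambda>a. (a, 1))) (?m (-1) (\<sigma> ?v)) 1 (?m 0 (\<sigma> ?v))"
    using run.Act[of j "\<lambda>a. (a, 1)" "?m (-1) (\<sigma> ?v)"] by (simp add: move_memo)
  have s: "?m 0 (\<sigma> 0) = memo K x B g (\<sigma> 0)" "?m 0 (\<sigma> ?v) = memo K x B g (\<sigma> ?v)"
    using k j by (auto intro!: memo_insert simp: heads_of_def)
  have "run (for_bits j p q) (memo K x B g (\<sigma> 0)) (t + (1 + ((2 * ?v + 1) + 1))) (memo K x B g (\<sigma> ?v))"
    unfolding for_bits_def s[symmetric] using t(2) 1 2 3 by (intro run.Seq)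
  moreover have "t + (1 + ((2 * ?v + 1) + 1)) \<le> ?v * (c + 5) + 4" using t(1) by (simp add: algebra_simps)
  ultimately show "\<exists>t\<le>?v * (c + 5) + 4. run (for_bits j p q) (memo K x B g (\<sigma> 0)) t (memo K x B g (\<sigma> ?v))"
    by blast
qed

section \<open>A binary counter\<close>

fun bits_suc :: "bool list \<Rightarrow> bool list" where
  "bits_suc [] = [True]"
| "bits_suc (False # bs) = True # bs"
| "bits_suc (True # bs) = False # bits_suc bs"

lemma binary_Suc: "binary (Suc n) = bits_suc (binary n)"
proof (induction n rule: less_induct)
  case (less n)
  show ?case
  proof (cases "n = 0")
    case True
    then show ?thesis by (simp add: binary.simps)
  next
    case False
    show ?thesis
    proof (cases "even n")
      case True
      then show ?thesis using False by (simp add: binary.simps[of n] binary.simps[of "Suc n"])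
    next
      case o: False
      then have "Suc n div 2 = Suc (n div 2)" by presburger
      then show ?thesis using o False less.IH[of "n div 2"]
        by (simp add: binary.simps[of n] binary.simps[of "Suc n"])
    qed
  qed
qed

text \<open>This crude bound suffices, because the only number counted up in binary is the budget,
  which is itself polynomial in the input length.\<close>

lemma length_binary: "length (binary n) \<le> n"
proof (induction n)
  case (Suc n)
  have "length (bits_suc bs) \<le> Suc (length bs)" for bs by (induction bs rule: bits_suc.induct) auto
  from this[of "binary n"] show ?case using Suc by (simp add: binary_Suc)
qed (simp add: binary.simps)

definition bump :: prog where
  "bump = (Whl 1 (\<lambda>a. a = 2) (Act 1 (\<lambda>_. (1, 1))) ;; Act 1 (\<lambda>_. (2, -1))) ;;
     Whl 1 (\<lambda>a. a \<noteq> 0) (Act 1 (\<lambda>a. (a, -1))) ;; Act 1 (\<lambda>a. (a, 1))"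

lemma tape_of_update:
  "(tape_of (pre @ v # bs))(int (length pre) := (if v' then 2 else 1)) = tape_of (pre @ v' # bs)"
  by (auto simp: tape_of_def fun_eq_iff nth_append nth_Cons split: nat.splits)

text \<open>Digits are stored with the least significant one first, so the carry runs to the right.
  \<open>pre\<close> collects the digits already passed, and \<open>n\<close> is the cell where the
  carry stops, which is also the length of the way back.\<close>

lemma run_bits_suc:
  assumes "snd s 1 = tape_of (pre @ bs)" and "fst s 1 = int (length pre)"
  shows "\<exists>n. n \<le> length (bits_suc bs) + length pre \<and>
    run (Whl 1 (\<lambda>a. a = 2) (Act 1 (\<lambda>_. (1, 1))) ;; Act 1 (\<lambda>_. (2, -1))) s (2 * (n - length pre) + 2)
      ((fst s)(1 := int n - 1), (snd s)(1 := tape_of (pre @ bits_suc bs))) \<and> n \<ge> length pre"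
  using assms
proof (induction bs arbitrary: pre s)
  case Nil
  have 1: "run (Whl 1 (\<lambda>a. a = 2) (Act 1 (\<lambda>_. (1, 1)))) s 1 s"
    using Nil by (intro run.WhlF) (simp add: scan_def tape_of_def)
  have "act 1 (\<lambda>_. (2, -1)) s = ((fst s)(1 := int (length pre) - 1), (snd s)(1 := tape_of (pre @ [True])))"
    using Nil tape_of_snoc[of pre True] by (simp add: act_def)
  then have "run (Act 1 (\<lambda>_. (2, -1))) s 1 ((fst s)(1 := int (length pre) - 1), (snd s)(1 := tape_of (pre @ [True])))"
    using run.Act[of 1 "\<lambda>_. (2, -1)" s] by simp
  from run.Seq[OF 1 this] show ?case
    by (intro exI[of _ "length pre"]) (simp del: fun_upd_apply)
next
  case (Cons v bs)
  show ?case
  proof (cases v)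
    case False
    have 1: "run (Whl 1 (\<lambda>a. a = 2) (Act 1 (\<lambda>_. (1, 1)))) s 1 s"
      using Cons.prems False by (intro run.WhlF) (simp add: scan_def tape_of_def)
    have "act 1 (\<lambda>_. (2, -1)) s = ((fst s)(1 := int (length pre) - 1), (snd s)(1 := tape_of (pre @ True # bs)))"
      using Cons.prems tape_of_update[of pre v bs True] by (simp add: act_def)
    then have "run (Act 1 (\<lambda>_. (2, -1))) s 1 ((fst s)(1 := int (length pre) - 1), (snd s)(1 := tape_of (pre @ True # bs)))"
      using run.Act[of 1 "\<lambda>_. (2, -1)" s] by simp
    from run.Seq[OF 1 this] False show ?thesis
      by (intro exI[of _ "length pre"]) (simp del: fun_upd_apply)
  next
    case True
    let ?s = "act 1 (\<lambda>_. (1, 1)) s"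
    have s: "?s = ((fst s)(1 := int (length (pre @ [False]))), (snd s)(1 := tape_of ((pre @ [False]) @ bs)))"
      using Cons.prems tape_of_update[of pre v bs False] by (simp add: act_def add.commute)
    have i: "snd ?s 1 = tape_of ((pre @ [False]) @ bs)" "fst ?s 1 = int (length (pre @ [False]))"
      unfolding s by simp_all
    obtain n where n: "n \<le> length (bits_suc bs) + length (pre @ [False])" "n \<ge> length (pre @ [False])"
      "run (Whl 1 (\<lambda>a. a = 2) (Act 1 (\<lambda>_. (1, 1))) ;; Act 1 (\<lambda>_. (2, -1))) ?s (2 * (n - length (pre @ [False])) + 2)
      ((fst ?s)(1 := int n - 1), (snd ?s)(1 := tape_of ((pre @ [False]) @ bits_suc bs)))"
      using Cons.IH[of ?s "pre @ [False]", OF i(1) i(2)] by blast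
    obtain t1 t2 s1 where t: "2 * (n - length (pre @ [False])) + 2 = t1 + t2"
      "run (Whl 1 (\<lambda>a. a = 2) (Act 1 (\<lambda>_. (1, 1)))) ?s t1 s1"
      "run (Act 1 (\<lambda>_. (2, -1))) s1 t2 ((fst ?s)(1 := int n - 1), (snd ?s)(1 := tape_of ((pre @ [False]) @ bits_suc bs)))"
      using n(3) by (cases rule: run.cases) auto
    have "scan s 1 = 2" using Cons.prems True by (simp add: scan_def tape_of_def)
    from run.Seq[OF run.WhlT[OF this run.Act t(2)] t(3)]
    have "run (Whl 1 (\<lambda>a. a = 2) (Act 1 (\<lambda>_. (1, 1))) ;; Act 1 (\<lambda>_. (2, -1))) s (1 + 1 + t1 + t2)
      ((fst s)(1 := int n - 1), (snd s)(1 := tape_of (pre @ bits_suc (v # bs))))"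
      using s True by simp
    moreover have "1 + 1 + t1 + t2 = 2 * (n - length pre) + 2" using t(1) n(2) by simp
    ultimately have "run (Whl 1 (\<lambda>a. a = 2) (Act 1 (\<lambda>_. (1, 1))) ;; Act 1 (\<lambda>_. (2, -1))) s (2 * (n - length pre) + 2)
      ((fst s)(1 := int n - 1), (snd s)(1 := tape_of (pre @ bits_suc (v # bs))))" by metis
    moreover have "n \<le> length (bits_suc (v # bs)) + length pre" "length pre \<le> n" using n(1,2) True by auto
    ultimately show ?thesis by blast
  qed
qed

lemma exec_bump: "exec K x bump {1} (r, b, w) (r, Suc b, w) (4 * b + 10)"
  unfolding exec_def
proof (intro allI impI)
  fix B :: "nat set" and g :: "nat \<Rightarrow> int" assume "B \<inter> {1} = {}"
  then have k: "1 \<notin> B" by auto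
  let ?s = "memo K x B g (r, b, w)"
  have s1: "snd ?s 1 = tape_of ([] @ binary b)" "fst ?s 1 = int (length [])"
    using k by (auto simp: memo_def tapes_of_def heads_of_def)
  obtain n where n: "n \<le> length (binary (Suc b))"
    "run (Whl 1 (\<lambda>a. a = 2) (Act 1 (\<lambda>_. (1, 1))) ;; Act 1 (\<lambda>_. (2, -1))) ?s (2 * n + 2)
      ((fst ?s)(1 := int n - 1), (snd ?s)(1 := tape_of (binary (Suc b))))"
    using run_bits_suc[OF s1] by (auto simp: binary_Suc)
  let ?s2 = "((fst ?s)(1 := int n - 1), (snd ?s)(1 := tape_of (binary (Suc b))))"
  have 2: "run (Whl 1 (\<lambda>a. a \<noteq> 0) (Act 1 (\<lambda>a. (a, -1)))) ?s2 (2 * n + 1)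
      ((fst ?s2)(1 := fst ?s2 1 + int n * (-1)), snd ?s2)"
    using n(1) by (intro sweep) (auto simp: tape_of_def)
  have e: "((fst ?s)(1 := 0), (snd ?s)(1 := tape_of (binary (Suc b)))) = memo K x B g (r, Suc b, w)"
    using k by (auto simp: memo_def tapes_of_def heads_of_def fun_eq_iff)
  have 3: "run (Act 1 (\<lambda>a. (a, 1))) ((fst ?s2)(1 := fst ?s2 1 + int n * (-1)), snd ?s2) 1 (memo K x B g (r, Suc b, w))"
    using run.Act[of 1 "\<lambda>a. (a, 1)" "((fst ?s2)(1 := fst ?s2 1 + int n * (-1)), snd ?s2)"]
    unfolding e[symmetric] by (simp add: act_move)
  have "run bump ?s ((2 * n + 2) + ((2 * n + 1) + 1)) (memo K x B g (r, Suc b, w))"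
    unfolding bump_def by (rule run.Seq[OF n(2) run.Seq[OF 2 3]])
  moreover have "(2 * n + 2) + ((2 * n + 1) + 1) \<le> 4 * b + 10" using n(1) length_binary[of "Suc b"] by simp
  ultimately show "\<exists>t\<le>4 * b + 10. run bump ?s t (memo K x B g (r, Suc b, w))" by blast
qed

section \<open>Traversing a grid in polynomial time\<close>

definition polyb :: "(bool list \<Rightarrow> nat) \<Rightarrow> bool" where
  "polyb f \<longleftrightarrow> (\<exists>p :: nat poly. \<forall>x. f x \<le> poly p (length x))"

lemma polyb_const [intro, simp]: "polyb (\<lambda>_. k)"
  unfolding polyb_def by (intro exI[of _ "[:k:]"]) simp

lemma polyb_poly [intro, simp]: "polyb (\<lambda>x. poly p (length x))"
  unfolding polyb_def by (intro exI[of _ p]) simp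

lemma polyb_length [intro, simp]: "polyb (\<lambda>x. length x)"
  unfolding polyb_def by (intro exI[of _ "[:0, 1:]"]) simp

lemma polyb_add [intro, simp]:
  assumes "polyb f" and "polyb g" shows "polyb (\<lambda>x. f x + g x)"
proof -
  from assms obtain p q where "\<forall>x. f x \<le> poly p (length x)" "\<forall>x. g x \<le> poly q (length x)"
    unfolding polyb_def by auto
  then show ?thesis unfolding polyb_def by (intro exI[of _ "p + q"]) (simp add: add_mono)
qed

lemma polyb_mult [intro, simp]:
  assumes "polyb f" and "polyb g" shows "polyb (\<lambda>x. f x * g x)"
proof -
  from assms obtain p q where "\<forall>x. f x \<le> poly p (length x)" "\<forall>x. g x \<le> poly q (length x)"
    unfolding polyb_def by auto
  then show ?thesis unfolding polyb_def by (intro exI[of _ "p * q"]) (simp add: mult_mono)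
qed

abbreviation "T2 \<equiv> 13 :: nat"

text \<open>Tape 2 holds the input length, 3 is scratch, 4 to 8 hold the loop bounds, 9 and 10 the current
  row and column, 11 the budget; 12 is the output.\<close>

definition skip :: prog where
  "skip = Act 0 (\<lambda>a. (a, 0))"

lemma exec_skip: "exec K x skip F s s 1"
proof -
  have "run skip m 1 m" for m using run.Act[of 0 "\<lambda>a. (a, 0)" m] by (simp add: skip_def act_move)
  then show ?thesis unfolding exec_def by (metis order_refl)
qed

definition seqs :: "prog list \<Rightarrow> prog" where
  "seqs ps = foldr (\<lambda>p q. p ;; q) ps skip"

lemma wfp_seqs: "(\<And>p. p \<in> set ps \<Longrightarrow> wfp K p) \<Longrightarrow> K \<ge> 1 \<Longrightarrow> wfp K (seqs ps)"
  by (induction ps) (auto simp: seqs_def skip_def)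

lemma exec_seqs:
  assumes "\<And>y s. y \<in> set ys \<Longrightarrow> Q s \<Longrightarrow> exec K x (P y) F s (f y s) (c y) \<and> Q (f y s)" and "Q s"
  shows "exec K x (seqs (map P ys)) F s (fold f ys s) (sum_list (map c ys) + 1)"
  using assms
proof (induction ys arbitrary: s)
  case Nil
  show ?case using exec_skip[of K x F s] by (simp add: seqs_def)
next
  case (Cons y ys)
  have y: "exec K x (P y) F s (f y s) (c y)" "Q (f y s)" using Cons.prems(1)[of y s] Cons.prems(2) by auto
  have "exec K x (seqs (map P ys)) F (f y s) (fold f ys (f y s)) (sum_list (map c ys) + 1)"
    using y(2) Cons.prems(1) by (intro Cons.IH) auto
  from exec_seq[OF y(1) this]
  have "exec K x (P y ;; seqs (map P ys)) F s (fold f ys (f y s)) (c y + (sum_list (map c ys) + 1))" .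
  then show ?case by (simp add: seqs_def)
qed

definition emits :: "bool list \<Rightarrow> prog" where
  "emits bs = seqs (map (emit T2) bs)"

lemma wfp_emits [simp]: "wfp T2 (emits bs)"
  unfolding emits_def by (intro wfp_seqs) (auto simp: emit_def)

lemma exec_emits: "exec T2 x (emits bs) {12} (r, b, w) (r, b, w @ bs) (length bs + 1)"
proof -
  let ?f = "\<lambda>v (r, b, w). (r, b, w @ [v])"
  have "exec T2 x (seqs (map (emit T2) bs)) {12} (r, b, w) (fold ?f bs (r, b, w)) (sum_list (map (\<lambda>_. 1) bs) + 1)"
    using exec_emit[of T2] by (intro exec_seqs[where Q = "\<lambda>_. True"]) (auto split: prod.splits)
  moreover have "fold ?f bs (r, b, w) = (r, b, w @ bs)"
    by (induction bs arbitrary: w) auto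
  moreover have "sum_list (map (\<lambda>_. 1) bs) = length bs" by (induction bs) auto
  ultimately show ?thesis by (simp add: emits_def)
qed

definition incs :: "nat \<Rightarrow> nat \<Rightarrow> prog" where
  "incs j n = seqs (replicate n (inc j))"

lemma wfp_incs [simp]: "j < K \<Longrightarrow> wfp K (incs j n)"
  unfolding incs_def by (intro wfp_seqs) (auto simp: inc_def)

lemma exec_incs:
  assumes "2 \<le> j" and "j < K - 1"
  shows "exec K x (incs j n) {j} (r, b, w) (r(j := r j + n), b, w) (n + 1)"
proof -
  let ?f = "\<lambda>v (r, b, w). (r(j := Suc (r j)), b, w)"
  have "exec K x (seqs (map (\<lambda>_. inc j) [0..<n])) {j} (r, b, w) (fold ?f [0..<n] (r, b, w))
      (sum_list (map (\<lambda>_. 1) [0..<n]) + 1)"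
    using exec_inc[OF assms] by (intro exec_seqs[where Q = "\<lambda>_. True"]) (auto split: prod.splits)
  moreover have "fold ?f [0..<n] (r, b, w) = (r(j := r j + n), b, w)"
    by (induction n) auto
  moreover have "map (\<lambda>_. inc j) [0..<n] = replicate n (inc j)" by (simp add: map_replicate_const)
  moreover have "sum_list (map (\<lambda>_. 1) [0..<n]) = n" by (induction n) auto
  ultimately show ?thesis by (simp add: incs_def)
qed

lemma wfp_loops [simp]:
  "wfp K (rept j p) \<longleftrightarrow> j < K \<and> wfp K p"
  "wfp K (clr j) \<longleftrightarrow> j < K"
  "wfp K (inc j) \<longleftrightarrow> j < K"
  "wfp K (for_bits j p q) \<longleftrightarrow> j < K \<and> wfp K p \<and> wfp K q"
  "wfp K (emit K v) \<longleftrightarrow> K > 0"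
  "wfp K bump \<longleftrightarrow> K > 1"
  by (auto simp: rept_def clr_def inc_def for_bits_def emit_def bump_def)

text \<open>Horner's rule: \<open>pCons a p\<close> is \<open>a\<close> plus the input length times
  \<open>p\<close>. The product is collected in the scratch register 3 and moved back afterwards,
  because a register cannot change while it drives its own loop.\<close>

lemma poly_program:
  fixes p :: "nat poly"
  assumes j: "4 \<le> j" "j \<le> 8"
  shows "\<exists>P c. wfp T2 P \<and> polyb c \<and> (\<forall>x r b w. r 2 = length x \<longrightarrow> r 3 = 0 \<longrightarrow> r j = 0 \<longrightarrow>
    exec T2 x P {2, 3, j} (r, b, w) (r(j := poly p (length x)), b, w) (c x))"
proof (induction p)
  case 0
  have "(r(j := poly 0 (length x)), b, w) = (r, b, w)" if "r j = 0" for r :: "nat \<Rightarrow> nat" and x :: "bool list" and b :: nat and w :: "bool list"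
    using that by auto
  then have "wfp T2 skip \<and> polyb (\<lambda>_. 1) \<and> (\<forall>x r b w. r 2 = length x \<longrightarrow> r 3 = 0 \<longrightarrow> r j = 0 \<longrightarrow>
    exec T2 x skip {2, 3, j} (r, b, w) (r(j := poly 0 (length x)), b, w) 1)"
    using exec_skip by (auto simp: skip_def)
  then show ?case by blast
next
  case (pCons a p)
  then obtain P c where P: "wfp T2 P" "polyb c" and e: "\<And>x r b w. r 2 = length x \<Longrightarrow> r 3 = 0 \<Longrightarrow> r j = 0 \<Longrightarrow>
    exec T2 x P {2, 3, j} (r, b, w) (r(j := poly p (length x)), b, w) (c x)" by blast
  let ?P = "P ;; rept j (rept 2 (inc 3)) ;; clr j ;; rept 3 (inc j) ;; clr 3 ;; incs j a"
  let ?v = "\<lambda>x. poly p (length x) :: nat"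
  let ?c = "\<lambda>x. c x + ((?v x * ((length x * (1 + 4) + 4) + 4) + 4) + ((2 * ?v x + 3) +
    (((?v x * length x) * (1 + 4) + 4) + ((2 * (?v x * length x) + 3) + (a + 1)))))"
  have "exec T2 x ?P {2, 3, j} (r, b, w) (r(j := poly (pCons a p) (length x)), b, w) (?c x)"
    if r: "r 2 = length x" "r 3 = 0" "r j = 0" for x r b w
  proof -
    let ?n = "length x"
    let ?r1 = "r(j := ?v x)"
    let ?r2 = "?r1(3 := ?v x * ?n)"
    let ?r3 = "?r2(j := 0)"
    let ?r4 = "?r3(j := ?v x * ?n)"
    let ?r5 = "?r4(3 := 0)"
    have 1: "exec T2 x P {2, 3, j} (r, b, w) (?r1, b, w) (c x)" using e r by simp
    have in2: "exec T2 x (rept 2 (inc 3)) {2, 3} (?r1(3 := u), b, w) (?r1(3 := u + ?n), b, w) (?n * (1 + 4) + 4)" for u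
    proof -
      have "exec T2 x (rept 2 (inc 3)) (insert 2 {3}) ((\<lambda>k. (?r1(3 := u + k), b, w)) 0)
          ((\<lambda>k. (?r1(3 := u + k), b, w)) ?n) (?n * (1 + 4) + 4)"
      proof (rule exec_rept)
        fix k
        show "exec T2 x (inc 3) {3} (?r1(3 := u + k), b, w) (?r1(3 := u + Suc k), b, w) 1"
          using exec_inc[of 3 T2 x "?r1(3 := u + k)" b w] by simp
      qed (use r j in auto)
      then show ?thesis by (auto intro: exec_mono)
    qed
    have 2: "exec T2 x (rept j (rept 2 (inc 3))) {2, 3, j} (?r1, b, w) (?r2, b, w)
        (?v x * ((?n * (1 + 4) + 4) + 4) + 4)"
    proof -
      have "exec T2 x (rept j (rept 2 (inc 3))) (insert j {2, 3}) ((\<lambda>k. (?r1(3 := k * ?n), b, w)) 0)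
          ((\<lambda>k. (?r1(3 := k * ?n), b, w)) (?v x)) (?v x * ((?n * (1 + 4) + 4) + 4) + 4)"
      proof (rule exec_rept)
        fix k
        show "exec T2 x (rept 2 (inc 3)) {2, 3} (?r1(3 := k * ?n), b, w) (?r1(3 := Suc k * ?n), b, w) (?n * (1 + 4) + 4)"
          using in2[of "k * ?n"] by (simp add: add.commute)
      qed (use r j in auto)
      moreover have "?r1(3 := 0 * ?n) = ?r1" using r j by auto
      ultimately show ?thesis by (auto simp: insert_commute)
    qed
    have 3: "exec T2 x (clr j) {2, 3, j} (?r2, b, w) (?r3, b, w) (2 * ?v x + 3)"
      using exec_clr[of j T2 x ?r2 b w] j by (auto intro: exec_mono)
    have 4: "exec T2 x (rept 3 (inc j)) {2, 3, j} (?r3, b, w) (?r4, b, w) ((?v x * ?n) * (1 + 4) + 4)"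
    proof -
      have "exec T2 x (rept 3 (inc j)) (insert 3 {j}) ((\<lambda>k. (?r3(j := k), b, w)) 0)
          ((\<lambda>k. (?r3(j := k), b, w)) (?v x * ?n)) ((?v x * ?n) * (1 + 4) + 4)"
      proof (rule exec_rept)
        fix k
        show "exec T2 x (inc j) {j} (?r3(j := k), b, w) (?r3(j := Suc k), b, w) 1"
          using exec_inc[of j T2 x "?r3(j := k)" b w] j by simp
      qed (use j in auto)
      then show ?thesis by (auto intro: exec_mono)
    qed
    have 5: "exec T2 x (clr 3) {2, 3, j} (?r4, b, w) (?r5, b, w) (2 * (?v x * ?n) + 3)"
      using exec_clr[of 3 T2 x ?r4 b w] j by (auto intro: exec_mono)
    have 6: "exec T2 x (incs j a) {2, 3, j} (?r5, b, w) (?r5(j := ?r5 j + a), b, w) (a + 1)"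
      using exec_incs[of j T2 x a ?r5 b w] j by (auto intro: exec_mono)
    have "?r5(j := ?r5 j + a) = r(j := poly (pCons a p) ?n)"
      using r j by (auto simp: fun_eq_iff algebra_simps)
    then show ?thesis using exec_seq[OF 1 exec_seq[OF 2 exec_seq[OF 3 exec_seq[OF 4 exec_seq[OF 5 6]]]]] by simp
  qed
  moreover have "wfp T2 ?P" using P(1) j by simp
  moreover have "polyb ?c" using P(2) by (intro polyb_add polyb_mult polyb_const polyb_poly polyb_length)
  ultimately show ?case by blast
qed

definition St :: "(nat \<Rightarrow> nat) \<Rightarrow> nat \<Rightarrow> nat \<Rightarrow> nat \<times> bool list \<Rightarrow> st" where
  "St r t i a = (r(9 := t, 10 := i, 11 := fst a), 0, snd a)"

lemma St_reg [simp]: "j \<le> 8 \<Longrightarrow> fst (St r t i a) j = r j"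
  by (simp add: St_def)

lemma exec_St_inc:
  "exec T2 x (inc 9) {9} (St r t i a) (St r (Suc t) i a) 1"
  "exec T2 x (inc 10) {10} (St r t i a) (St r t (Suc i) a) 1"
  using exec_inc[of 9 T2 x "r(9 := t, 10 := i, 11 := fst a)" 0 "snd a"]
    exec_inc[of 10 T2 x "r(9 := t, 10 := i, 11 := fst a)" 0 "snd a"]
  by (simp_all add: St_def fun_upd_twist)

lemma exec_St_clr:
  "t \<le> m \<Longrightarrow> exec T2 x (clr 9) {9} (St r t i a) (St r 0 i a) (2 * m + 3)"
  "i \<le> m \<Longrightarrow> exec T2 x (clr 10) {10} (St r t i a) (St r t 0 a) (2 * m + 3)"
proof -
  assume "t \<le> m"
  moreover have "exec T2 x (clr 9) {9} (St r t i a) (St r 0 i a) (2 * t + 3)"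
    using exec_clr[of 9 T2 x "r(9 := t, 10 := i, 11 := fst a)" 0 "snd a"] by (simp add: St_def fun_upd_twist)
  ultimately show "exec T2 x (clr 9) {9} (St r t i a) (St r 0 i a) (2 * m + 3)" by (auto intro: exec_mono)
next
  assume "i \<le> m"
  moreover have "exec T2 x (clr 10) {10} (St r t i a) (St r t 0 a) (2 * i + 3)"
    using exec_clr[of 10 T2 x "r(9 := t, 10 := i, 11 := fst a)" 0 "snd a"] by (simp add: St_def fun_upd_twist)
  ultimately show "exec T2 x (clr 10) {10} (St r t i a) (St r t 0 a) (2 * m + 3)" by (auto intro: exec_mono)
qed

section \<open>The list of events and its traversal\<close>

type_synonym event = "nat \<times> nat \<times> nat"

definition row_events :: "nat \<Rightarrow> nat \<Rightarrow> nat \<Rightarrow> nat \<Rightarrow> event list" where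
  "row_events g t i v = map (\<lambda>j. (g, t, i + j)) [0..<v]"

definition grid_events :: "nat \<Rightarrow> nat \<Rightarrow> nat \<Rightarrow> event list" where
  "grid_events g v u = concat (map (\<lambda>t. row_events g t 0 u) [0..<v])"

definition bit_events :: "nat \<Rightarrow> bool list \<Rightarrow> event list" where
  "bit_events i bs = concat (map (\<lambda>j. [(4, 0, i + 2 * j), (if bs ! j then 4 else 5, 0, Suc (i + 2 * j))]) [0..<length bs])"

definition row_prog :: "(nat \<Rightarrow> prog) \<Rightarrow> nat \<Rightarrow> nat \<Rightarrow> prog" where
  "row_prog P g j = rept j (P g ;; inc 10)"

definition grid_prog :: "(nat \<Rightarrow> prog) \<Rightarrow> nat \<Rightarrow> nat \<Rightarrow> nat \<Rightarrow> prog" where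
  "grid_prog P g j k = clr 9 ;; clr 10 ;; rept j (row_prog P g k ;; clr 10 ;; inc 9)"

text \<open>Registers 4 to 8 hold \<open>q\<close>, \<open>A\<close>, \<open>A + 1\<close>,
  \<open>B\<close> and \<open>B + 1\<close>. Each bit of the input contributes two columns, as in
  \<open>pair_code\<close>: the marker True and the bit itself. The traversal is run three times
  with different bodies, since the input code lists all vertices before all edges and the budget
  last.\<close>

definition skeleton :: "(nat \<Rightarrow> prog) \<Rightarrow> prog" where
  "skeleton P = grid_prog P 0 6 8 ;; grid_prog P 1 6 7 ;; grid_prog P 2 5 8 ;;
     clr 9 ;; clr 10 ;; row_prog P 3 5 ;; P 7 ;;
     for_bits 0 (P 4 ;; inc 10 ;; P 5 ;; inc 10) (P 4 ;; inc 10 ;; P 4 ;; inc 10) ;;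
     P 5 ;; inc 10 ;; row_prog P 6 4 ;; row_prog P 3 5 ;;
     clr 9 ;; clr 10 ;; rept 5 (inc 9 ;; inc 10) ;; P 8"

text \<open>
  The tableau has rows \<open>0, \<dots>, A\<close> and columns \<open>0, \<dots>, B\<close>; tape position 0 is column \<open>A\<close>. An event \<open>(g, t, i)\<close>
  imposes condition \<open>g\<close> at row \<open>t\<close>, column \<open>i\<close>: 0 a cell is there, 1 and 2 consistency with the right and the
  next-row neighbor, 3 to 6 the input symbol is blank, True, False, or part of the witness, 7 all heads start
  there, 8 the output symbol there is True.
\<close>

definition events :: "nat \<Rightarrow> nat \<Rightarrow> bool list \<Rightarrow> event list" where
  "events A q x = (let B = 2 * A + 2 * length x + q in
     grid_events 0 (Suc A) (Suc B) @ grid_events 1 (Suc A) B @ grid_events 2 A (Suc B) @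
     row_events 3 0 0 A @ [(7, 0, A)] @ bit_events A x @ [(5, 0, A + 2 * length x)] @
     row_events 6 0 (Suc (A + 2 * length x)) q @ row_events 3 0 (Suc (A + 2 * length x + q)) A @ [(8, A, A)])"

context
  fixes x :: "bool list" and P :: "nat \<Rightarrow> prog" and r :: "nat \<Rightarrow> nat" and m c :: nat
    and f :: "event \<Rightarrow> nat \<times> bool list \<Rightarrow> nat \<times> bool list"
  assumes body: "\<And>g t i a. g < 9 \<Longrightarrow> t \<le> m \<Longrightarrow> i \<le> m \<Longrightarrow>
    exec T2 x (P g) {9, 10, 11, 12} (St r t i a) (St r t i (f (g, t, i) a)) c"
begin

lemma exec_row:
  assumes "g < 9" "t \<le> m" "i + v \<le> Suc m" "2 \<le> j" "j \<le> 8" "r j = v"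
  shows "exec T2 x (row_prog P g j) {j, 9, 10, 11, 12} (St r t i a) (St r t (i + v) (fold f (row_events g t i v) a))
    (v * ((c + 1) + 4) + 4)"
proof -
  let ?\<sigma> = "\<lambda>k. St r t (i + k) (fold f (row_events g t i k) a)"
  have "exec T2 x (rept j (P g ;; inc 10)) (insert j {9, 10, 11, 12}) (?\<sigma> 0) (?\<sigma> v) (v * ((c + 1) + 4) + 4)"
  proof (rule exec_rept)
    fix k assume "k < v"
    then have 1: "exec T2 x (P g) {9, 10, 11, 12} (?\<sigma> k) (St r t (i + k) (f (g, t, i + k) (fold f (row_events g t i k) a))) c"
      using assms by (intro body) auto
    have 2: "exec T2 x (inc 10) {9, 10, 11, 12} (St r t (i + k) (f (g, t, i + k) (fold f (row_events g t i k) a)))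
        (St r t (Suc (i + k)) (f (g, t, i + k) (fold f (row_events g t i k) a))) 1"
      by (rule exec_mono[OF exec_St_inc(2)]) auto
    show "exec T2 x (P g ;; inc 10) {9, 10, 11, 12} (?\<sigma> k) (?\<sigma> (Suc k)) (c + 1)"
      using exec_seq[OF 1 2] by (simp add: row_events_def)
  qed (use assms in auto)
  then show ?thesis by (simp add: row_prog_def row_events_def)
qed

lemma exec_grid:
  assumes "g < 9" "v \<le> Suc m" "u \<le> Suc m" "2 \<le> j" "j \<le> 8" "r j = v" "2 \<le> k" "k \<le> 8" "r k = u" "j \<noteq> k"
    "t \<le> Suc m" "i \<le> Suc m"
  shows "exec T2 x (grid_prog P g j k) {0, 4, 5, 6, 7, 8, j, k, 9, 10, 11, 12} (St r t i a)
    (St r v 0 (fold f (grid_events g v u) a))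
    ((2 * Suc m + 3) + ((2 * Suc m + 3) + (v * (((u * ((c + 1) + 4) + 4) + ((2 * Suc m + 3) + 1)) + 4) + 4)))"
proof -
  let ?F = "{0, 4, 5, 6, 7, 8, j, k, 9, 10, 11, 12}"
  let ?\<sigma> = "\<lambda>l. St r l 0 (fold f (grid_events g l u) a)"
  have 1: "exec T2 x (clr 9) ?F (St r t i a) (St r 0 i a) (2 * Suc m + 3)"
    by (rule exec_mono[OF exec_St_clr(1)]) (use assms in auto)
  have 2: "exec T2 x (clr 10) ?F (St r 0 i a) (St r 0 0 a) (2 * Suc m + 3)"
    by (rule exec_mono[OF exec_St_clr(2)]) (use assms in auto)
  have "exec T2 x (rept j (row_prog P g k ;; clr 10 ;; inc 9)) (insert j {k, 9, 10, 11, 12}) (?\<sigma> 0) (?\<sigma> v)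
      (v * (((u * ((c + 1) + 4) + 4) + ((2 * Suc m + 3) + 1)) + 4) + 4)"
  proof (rule exec_rept)
    fix l assume l: "l < v"
    let ?a = "fold f (row_events g l 0 u) (fold f (grid_events g l u) a)"
    have 1: "exec T2 x (row_prog P g k) {k, 9, 10, 11, 12} (?\<sigma> l) (St r l (0 + u) ?a) (u * ((c + 1) + 4) + 4)"
      by (rule exec_row) (use assms l in auto)
    have 2: "exec T2 x (clr 10) {k, 9, 10, 11, 12} (St r l (0 + u) ?a) (St r l 0 ?a) (2 * Suc m + 3)"
      by (rule exec_mono[OF exec_St_clr(2)]) (use assms in auto)
    have 3: "exec T2 x (inc 9) {k, 9, 10, 11, 12} (St r l 0 ?a) (St r (Suc l) 0 ?a) 1"
      by (rule exec_mono[OF exec_St_inc(1)]) auto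
    have "?a = fold f (grid_events g (Suc l) u) a" by (simp add: grid_events_def)
    then show "exec T2 x (row_prog P g k ;; clr 10 ;; inc 9) {k, 9, 10, 11, 12} (?\<sigma> l) (?\<sigma> (Suc l))
        ((u * ((c + 1) + 4) + 4) + ((2 * Suc m + 3) + 1))"
      using exec_seq[OF 1 exec_seq[OF 2 3]] by simp
  qed (use assms in auto)
  then have "exec T2 x (rept j (row_prog P g k ;; clr 10 ;; inc 9)) ?F (?\<sigma> 0) (?\<sigma> v)
      (v * (((u * ((c + 1) + 4) + 4) + ((2 * Suc m + 3) + 1)) + 4) + 4)"
    by (rule exec_mono) auto
  moreover have "?\<sigma> 0 = St r 0 0 a" by (simp add: grid_events_def)
  ultimately have 3: "exec T2 x (rept j (row_prog P g k ;; clr 10 ;; inc 9)) ?F (St r 0 0 a) (?\<sigma> v)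
      (v * (((u * ((c + 1) + 4) + 4) + ((2 * Suc m + 3) + 1)) + 4) + 4)"
    by metis
  show ?thesis unfolding grid_prog_def by (rule exec_seq[OF 1 exec_seq[OF 2 3]])
qed

lemma exec_bits:
  assumes "i + 2 * length x \<le> Suc m"
  shows "exec T2 x (for_bits 0 (P 4 ;; inc 10 ;; P 5 ;; inc 10) (P 4 ;; inc 10 ;; P 4 ;; inc 10))
    {0, 9, 10, 11, 12} (St r 0 i a) (St r 0 (i + 2 * length x) (fold f (bit_events i x) a))
    (length x * ((c + (1 + (c + 1))) + 5) + 4)"
proof -
  let ?F = "{9, 10, 11, 12}"
  let ?ev = "\<lambda>k. concat (map (\<lambda>j. [(4, 0, i + 2 * j), (if x ! j then 4 else 5, 0, Suc (i + 2 * j))]) [0..<k])"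
  let ?\<sigma> = "\<lambda>k. St r 0 (i + 2 * k) (fold f (?ev k) a)"
  have "exec T2 x (for_bits 0 (P 4 ;; inc 10 ;; P 5 ;; inc 10) (P 4 ;; inc 10 ;; P 4 ;; inc 10))
    (insert 0 ?F) (?\<sigma> 0) (?\<sigma> (length x)) (length x * ((c + (1 + (c + 1))) + 5) + 4)"
  proof (rule exec_for_bits)
    fix k assume k: "k < length x"
    let ?a = "fold f (?ev k) a"
    let ?g = "if x ! k then 4 else 5 :: nat"
    let ?a1 = "f (4, 0, i + 2 * k) ?a"
    let ?a2 = "f (?g, 0, Suc (i + 2 * k)) ?a1"
    have 1: "exec T2 x (P 4) ?F (?\<sigma> k) (St r 0 (i + 2 * k) ?a1) c"
      by (rule body) (use assms k in auto)
    have 2: "exec T2 x (inc 10) ?F (St r 0 (i + 2 * k) ?a1) (St r 0 (Suc (i + 2 * k)) ?a1) 1"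
      by (rule exec_mono[OF exec_St_inc(2)]) auto
    have 3: "exec T2 x (P ?g) ?F (St r 0 (Suc (i + 2 * k)) ?a1) (St r 0 (Suc (i + 2 * k)) ?a2) c"
      by (rule body) (use assms k in auto)
    have 4: "exec T2 x (inc 10) ?F (St r 0 (Suc (i + 2 * k)) ?a2) (St r 0 (Suc (Suc (i + 2 * k))) ?a2) 1"
      by (rule exec_mono[OF exec_St_inc(2)]) auto
    have e1: "(if x ! k then P 4 ;; inc 10 ;; P 4 ;; inc 10 else P 4 ;; inc 10 ;; P 5 ;; inc 10) =
        P 4 ;; inc 10 ;; P ?g ;; inc 10" by simp
    have e2: "?\<sigma> (Suc k) = St r 0 (Suc (Suc (i + 2 * k))) ?a2" by simp
    show "exec T2 x (if x ! k then P 4 ;; inc 10 ;; P 4 ;; inc 10 else P 4 ;; inc 10 ;; P 5 ;; inc 10) ?F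
        (?\<sigma> k) (?\<sigma> (Suc k)) (c + (1 + (c + 1)))"
      unfolding e1 e2 by (rule exec_seq[OF 1 exec_seq[OF 2 exec_seq[OF 3 4]]])
  qed (auto simp: tapes_of_def)
  then show ?thesis by (simp add: bit_events_def)
qed

text \<open>The row and column at the beginning are arbitrary within the bounds, because a later
  pass starts where the previous one has stopped, at \<open>(A, A)\<close>. \<open>C\<close> is a
  common bound for the blocks of the traversal, apart from single bodies and the loop over the input
  bits.\<close>

lemma exec_skeleton:
  assumes r: "r 4 = q" "r 5 = A" "r 6 = Suc A" "r 7 = B" "r 8 = Suc B"
    and B: "B = 2 * A + 2 * length x + q" "B \<le> m" "A \<ge> 1" and ti: "t \<le> Suc m" "i \<le> Suc m"
    and C: "C = (2 * Suc m + 3) + ((2 * Suc m + 3) + (Suc m * (((Suc m * ((c + 1) + 4) + 4) + ((2 * Suc m + 3) + 1)) + 4) + 4))"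
  shows "exec T2 x (skeleton P) {0, 4, 5, 6, 7, 8, 9, 10, 11, 12} (St r t i a)
    (St r A A (fold f (events A q x) a)) (20 * C + m * (c + (1 + (c + 1)) + 5) + 4 * c)"
proof -
  let ?F = "{0, 4, 5, 6, 7, 8, 9, 10, 11, 12}"
  let ?n = "length x"
  have Am: "Suc A \<le> Suc m" "A + 2 * ?n + q + A \<le> m" using B by auto
  have g: "exec T2 x (grid_prog P g j k) ?F (St r t i a) (St r v 0 (fold f (grid_events g v u) a)) C"
    if "g < 9" "r j = v" "r k = u" "j \<in> {5, 6}" "k \<in> {7, 8}" "t \<le> Suc m" "i \<le> Suc m" for g j k v u t i a
  proof (rule exec_mono[OF exec_grid[of g v u j k t i a]])
    have v: "v \<le> Suc m" "u \<le> Suc m" using that r Am B by auto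
    show "(2 * Suc m + 3) + ((2 * Suc m + 3) + (v * (((u * ((c + 1) + 4) + 4) + ((2 * Suc m + 3) + 1)) + 4) + 4)) \<le> C"
      unfolding C using v by (intro add_mono mult_mono order_refl) auto
    show "v \<le> Suc m" "u \<le> Suc m" using v by auto
  qed (use that in auto)
  have w: "exec T2 x (row_prog P g j) ?F (St r 0 i a) (St r 0 i' (fold f (row_events g 0 i v) a)) C"
    if "g < 9" "i + v \<le> Suc m" "r j = v" "i' = i + v" "j \<in> {4, 5}" for g i v j i' a
  proof -
    have "v * ((c + 1) + 4) + 4 \<le> Suc m * ((c + 1) + 4) + 4" using that by (intro add_mono mult_mono) auto
    also have "\<dots> \<le> C" unfolding C by simp
    finally have "v * ((c + 1) + 4) + 4 \<le> C" .
    moreover have "exec T2 x (row_prog P g j) {j, 9, 10, 11, 12} (St r 0 i a) (St r 0 (i + v) (fold f (row_events g 0 i v) a))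
        (v * ((c + 1) + 4) + 4)" by (rule exec_row) (use that in auto)
    ultimately show ?thesis unfolding \<open>i' = i + v\<close> using that(5) by (elim exec_mono) auto
  qed
  have cl9: "exec T2 x (clr 9) ?F (St r t i a) (St r 0 i a) C" if "t \<le> Suc m" for t i a
    by (rule exec_mono[OF exec_St_clr(1)[OF that]]) (auto simp: C)
  have cl10: "exec T2 x (clr 10) ?F (St r t i a) (St r t 0 a) C" if "i \<le> Suc m" for t i a
    by (rule exec_mono[OF exec_St_clr(2)[OF that]]) (auto simp: C)
  have p: "exec T2 x (P g) ?F (St r t i a) (St r t i (f (g, t, i) a)) c" if "g < 9" "t \<le> m" "i \<le> m" for g t i a
    by (rule exec_mono[OF body[OF that]]) auto
  have i10: "exec T2 x (inc 10) ?F (St r t i a) (St r t (Suc i) a) C" for t i a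
    by (rule exec_mono[OF exec_St_inc(2)]) (auto simp: C)
  have bi: "exec T2 x (for_bits 0 (P 4 ;; inc 10 ;; P 5 ;; inc 10) (P 4 ;; inc 10 ;; P 4 ;; inc 10)) ?F
      (St r 0 A a) (St r 0 (A + 2 * ?n) (fold f (bit_events A x) a)) (m * ((c + (1 + (c + 1))) + 5) + C)" for a
  proof (rule exec_mono[OF exec_bits])
    have "length x * ((c + (1 + (c + 1))) + 5) \<le> m * ((c + (1 + (c + 1))) + 5)"
      using B by (intro mult_mono) auto
    then show "length x * ((c + (1 + (c + 1))) + 5) + 4 \<le> m * ((c + (1 + (c + 1))) + 5) + C" using C by linarith
  qed (use Am in auto)
  have dia: "exec T2 x (rept 5 (inc 9 ;; inc 10)) ?F (St r 0 0 a) (St r A A a) C" for a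
  proof -
    have "exec T2 x (rept 5 (inc 9 ;; inc 10)) (insert 5 {9, 10}) ((\<lambda>k. St r k k a) 0) ((\<lambda>k. St r k k a) A) (A * ((1 + 1) + 4) + 4)"
    proof (rule exec_rept)
      fix k
      show "exec T2 x (inc 9 ;; inc 10) {9, 10} (St r k k a) (St r (Suc k) (Suc k) a) (1 + 1)"
        by (rule exec_seq; rule exec_mono, rule exec_St_inc) auto
    qed (use r in auto)
    moreover have "A * ((1 + 1) + 4) + 4 \<le> C"
    proof -
      have "A * ((1 + 1) + 4) \<le> Suc m * (((Suc m * ((c + 1) + 4) + 4) + ((2 * Suc m + 3) + 1)) + 4)"
        using Am by (intro mult_mono) auto
      then show ?thesis unfolding C by linarith
    qed
    ultimately show ?thesis by (elim exec_mono) auto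
  qed
  define a1 where "a1 = fold f (grid_events 0 (Suc A) (Suc B)) a"
  define a2 where "a2 = fold f (grid_events 1 (Suc A) B) a1"
  define a3 where "a3 = fold f (grid_events 2 A (Suc B)) a2"
  define a4 where "a4 = fold f (row_events 3 0 0 A) a3"
  define a5 where "a5 = f (7, 0, A) a4"
  define a6 where "a6 = fold f (bit_events A x) a5"
  define a7 where "a7 = f (5, 0, A + 2 * ?n) a6"
  define a8 where "a8 = fold f (row_events 6 0 (Suc (A + 2 * ?n)) q) a7"
  define a9 where "a9 = fold f (row_events 3 0 (Suc (A + 2 * ?n + q)) A) a8"
  have 1: "exec T2 x (grid_prog P 0 6 8) ?F (St r t i a) (St r (Suc A) 0 a1) C"
    unfolding a1_def by (rule g) (use r ti in auto)
  have 2: "exec T2 x (grid_prog P 1 6 7) ?F (St r (Suc A) 0 a1) (St r (Suc A) 0 a2) C"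
    unfolding a2_def by (rule g) (use r Am in auto)
  have 3: "exec T2 x (grid_prog P 2 5 8) ?F (St r (Suc A) 0 a2) (St r A 0 a3) C"
    unfolding a3_def by (rule g) (use r Am in auto)
  have 4: "exec T2 x (clr 9) ?F (St r A 0 a3) (St r 0 0 a3) C" by (rule cl9) (use Am in auto)
  have 5: "exec T2 x (clr 10) ?F (St r 0 0 a3) (St r 0 0 a3) C" by (rule cl10) auto
  have 6: "exec T2 x (row_prog P 3 5) ?F (St r 0 0 a3) (St r 0 A a4) C"
    unfolding a4_def by (rule w) (use r Am in auto)
  have 7: "exec T2 x (P 7) ?F (St r 0 A a4) (St r 0 A a5) c"
    unfolding a5_def by (rule p) (use Am in auto)
  note 8 = bi[of a5, folded a6_def]
  have 9: "exec T2 x (P 5) ?F (St r 0 (A + 2 * ?n) a6) (St r 0 (A + 2 * ?n) a7) c"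
    unfolding a7_def by (rule p) (use Am in auto)
  note 10 = i10[of 0 "A + 2 * ?n" a7]
  have 11: "exec T2 x (row_prog P 6 4) ?F (St r 0 (Suc (A + 2 * ?n)) a7) (St r 0 (Suc (A + 2 * ?n + q)) a8) C"
    unfolding a8_def by (rule w) (use r Am in auto)
  have 12: "exec T2 x (row_prog P 3 5) ?F (St r 0 (Suc (A + 2 * ?n + q)) a8) (St r 0 (Suc (A + 2 * ?n + q + A)) a9) C"
    unfolding a9_def by (rule w) (use r Am in auto)
  have 13: "exec T2 x (clr 9) ?F (St r 0 (Suc (A + 2 * ?n + q + A)) a9) (St r 0 (Suc (A + 2 * ?n + q + A)) a9) C"
    by (rule cl9) auto
  have 14: "exec T2 x (clr 10) ?F (St r 0 (Suc (A + 2 * ?n + q + A)) a9) (St r 0 0 a9) C"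
    by (rule cl10) (use Am in auto)
  have 15: "exec T2 x (P 8) ?F (St r A A a9) (St r A A (f (8, A, A) a9)) c"
    by (rule p) (use Am in auto)
  note ex = exec_seq[OF 1 exec_seq[OF 2 exec_seq[OF 3 exec_seq[OF 4 exec_seq[OF 5 exec_seq[OF 6
    exec_seq[OF 7 exec_seq[OF 8 exec_seq[OF 9 exec_seq[OF 10 exec_seq[OF 11 exec_seq[OF 12
    exec_seq[OF 13 exec_seq[OF 14 exec_seq[OF dia 15]]]]]]]]]]]]]]]
  have "f (8, A, A) a9 = fold f (events A q x) a"
    unfolding events_def Let_def B(1)[symmetric]
    by (simp add: a1_def a2_def a3_def a4_def a5_def a6_def a7_def a8_def a9_def)
  then have e: "fold f (events A q x) a = f (8, A, A) a9" ..
  have "exec T2 x (skeleton P) ?F (St r t i a) (St r A A (fold f (events A q x) a))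
    (C + (C + (C + (C + (C + (C + (c + (m * (c + (1 + (c + 1)) + 5) + C + (c + (C + (C + (C + (C + (C + (C + c)))))))))))))))"
    unfolding skeleton_def e by (rule ex)
  then show ?thesis by (rule exec_mono) auto
qed

end

section \<open>Names of vertices\<close>

fun unbinary :: "bool list \<Rightarrow> nat" where
  "unbinary [] = 0"
| "unbinary (b # bs) = of_bool b + 2 * unbinary bs"

lemma binary_unbinary: "bs = [] \<or> last bs \<Longrightarrow> binary (unbinary bs) = bs"
proof (induction bs)
  case (Cons b bs)
  show ?case
  proof (cases "bs = []")
    case True
    then show ?thesis using Cons by (simp add: binary.simps)
  next
    case False
    then have IH: "binary (unbinary bs) = bs" using Cons by auto
    then have "unbinary bs \<noteq> 0" using False by (metis binary.simps)
    then show ?thesis using IH by (cases b) (simp_all add: binary.simps[of "Suc (2 * unbinary bs)"] binary.simps[of "2 * unbinary bs"])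
  qed
qed (simp add: binary.simps)

text \<open>A name is a number whose binary digits are three unary blocks. Unary coordinates can be
  printed by looping over a register, and shifted by a constant by printing more zeros, so no
  arithmetic on names is ever carried out. The final True makes the digit string canonical, as
  \<open>binary_unbinary\<close> requires.\<close>

definition name_bits :: "nat \<Rightarrow> nat \<Rightarrow> nat \<Rightarrow> bool list" where
  "name_bits t i z = replicate t False @ True # replicate i False @ True # replicate z False @ [True]"

definition vertex_name :: "nat \<Rightarrow> nat \<Rightarrow> nat \<Rightarrow> nat" where
  "vertex_name t i z = unbinary (name_bits t i z)"

lemma binary_vertex_name: "binary (vertex_name t i z) = name_bits t i z"
  by (simp add: vertex_name_def binary_unbinary name_bits_def)

lemma unary_prefix_inject:
  "replicate t False @ True # u = replicate t' False @ True # u' \<longleftrightarrow> t = t' \<and> u = u'"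
proof (induction t arbitrary: t')
  case 0
  show ?case by (cases t') auto
next
  case (Suc t)
  then show ?case by (cases t') auto
qed

lemma vertex_name_inject:
  "vertex_name t i z = vertex_name t' i' z' \<longleftrightarrow> t = t' \<and> i = i' \<and> z = z'"
proof
  assume "vertex_name t i z = vertex_name t' i' z'"
  then have "name_bits t i z = name_bits t' i' z'" by (metis binary_vertex_name)
  then show "t = t' \<and> i = i' \<and> z = z'" by (simp add: name_bits_def unary_prefix_inject)
qed auto

definition zeros :: "nat \<Rightarrow> bool list" where
  "zeros n = concat (replicate n [True, False])"

lemma length_zeros [simp]: "length (zeros n) = 2 * n"
  by (induction n) (auto simp: zeros_def)

lemma zeros_add: "zeros (m + n) = zeros m @ zeros n"
  by (simp add: zeros_def replicate_add)

lemma zeros_Suc_right: "zeros (Suc n) = zeros n @ [True, False]"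
  using zeros_add[of n 1] by (simp add: zeros_def)

lemma nat_code_vertex_name:
  "nat_code (vertex_name t i z) = zeros t @ [True, True] @ zeros i @ [True, True] @ zeros z @ [True, True, False]"
proof -
  have "concat (map (\<lambda>b. [True, b]) (replicate n False)) = zeros n" for n
    by (simp add: zeros_def)
  then show ?thesis
    by (simp add: nat_code_def pair_code_def binary_vertex_name name_bits_def del: map_replicate)
qed

section \<open>Printing the vertices and edges of one event\<close>

type_synonym tvertex = "nat \<times> nat \<times> nat"

definition print_name :: "tvertex \<Rightarrow> prog" where
  "print_name v = (case v of (p, q, z) \<Rightarrow>
     rept 9 (emits [True, False]) ;; emits (zeros p @ [True, True]) ;;
     rept 10 (emits [True, False]) ;; emits (zeros q @ [True, True] @ zeros z @ [True, True, False]))"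

definition shift :: "nat \<Rightarrow> nat \<Rightarrow> tvertex \<Rightarrow> nat" where
  "shift t i v = (case v of (p, q, z) \<Rightarrow> vertex_name (t + p) (i + q) z)"

definition name_cost :: "tvertex \<Rightarrow> nat" where
  "name_cost v = (case v of (p, q, z) \<Rightarrow> 2 * p + 2 * q + 2 * z + 20)"

lemma wfp_print_name [simp]: "wfp T2 (print_name v)"
  by (simp add: print_name_def split: prod.split)

lemma exec_zeros:
  "exec T2 x (rept 9 (emits [True, False])) {9, 12} (St r t i (k, w)) (St r t i (k, w @ zeros t)) (7 * t + 4)"
  "exec T2 x (rept 10 (emits [True, False])) {10, 12} (St r t i (k, w)) (St r t i (k, w @ zeros i)) (7 * i + 4)"
proof -
  have b: "exec T2 x (emits [True, False]) {12} (St r t i (k, w @ zeros l)) (St r t i (k, w @ zeros (Suc l))) 3" for l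
    using exec_emits[of x "[True, False]" "r(9 := t, 10 := i, 11 := k)" 0 "w @ zeros l"]
    by (simp add: St_def zeros_Suc_right numeral_3_eq_3)
  have "exec T2 x (rept 9 (emits [True, False])) (insert 9 {12}) ((\<lambda>l. St r t i (k, w @ zeros l)) 0)
      ((\<lambda>l. St r t i (k, w @ zeros l)) t) (t * (3 + 4) + 4)"
    by (rule exec_rept) (auto simp: St_def intro: b[unfolded St_def fst_conv snd_conv])
  then show "exec T2 x (rept 9 (emits [True, False])) {9, 12} (St r t i (k, w)) (St r t i (k, w @ zeros t)) (7 * t + 4)"
    by (simp add: zeros_def mult.commute)
  have "exec T2 x (rept 10 (emits [True, False])) (insert 10 {12}) ((\<lambda>l. St r t i (k, w @ zeros l)) 0)
      ((\<lambda>l. St r t i (k, w @ zeros l)) i) (i * (3 + 4) + 4)"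
    by (rule exec_rept) (auto simp: St_def intro: b[unfolded St_def fst_conv snd_conv])
  then show "exec T2 x (rept 10 (emits [True, False])) {10, 12} (St r t i (k, w)) (St r t i (k, w @ zeros i)) (7 * i + 4)"
    by (simp add: zeros_def mult.commute)
qed

lemma exec_St_emits:
  "12 \<in> F \<Longrightarrow> exec T2 x (emits bs) F (St r t i (k, w)) (St r t i (k, w @ bs)) (length bs + 1)"
  unfolding St_def fst_conv snd_conv by (rule exec_mono[OF exec_emits]) auto

lemma exec_St_emit:
  "12 \<in> F \<Longrightarrow> exec T2 x (emit T2 v) F (St r t i (k, w)) (St r t i (k, w @ [v])) 1"
  unfolding St_def fst_conv snd_conv by (rule exec_mono[OF exec_emit]) auto

lemma exec_print_name:
  assumes "t \<le> m" "i \<le> m"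
  shows "exec T2 x (print_name v) {9, 10, 11, 12} (St r t i (k, w)) (St r t i (k, w @ nat_code (shift t i v)))
    (14 * m + name_cost v)"
proof -
  obtain p q z where v: "v = (p, q, z)" by (cases v)
  let ?F = "{9, 10, 11, 12}"
  have 1: "exec T2 x (rept 9 (emits [True, False])) ?F (St r t i (k, w)) (St r t i (k, w @ zeros t)) (7 * t + 4)" for w
    by (rule exec_mono[OF exec_zeros(1)]) auto
  have 2: "exec T2 x (rept 10 (emits [True, False])) ?F (St r t i (k, w)) (St r t i (k, w @ zeros i)) (7 * i + 4)" for w
    by (rule exec_mono[OF exec_zeros(2)]) auto
  have 3: "exec T2 x (emits bs) ?F (St r t i (k, w)) (St r t i (k, w @ bs)) (length bs + 1)" for bs w
    by (rule exec_St_emits) auto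
  have e: "w @ nat_code (shift t i v) =
      (((w @ zeros t) @ zeros p @ [True, True]) @ zeros i) @ zeros q @ [True, True] @ zeros z @ [True, True, False]"
    by (simp add: v shift_def nat_code_vertex_name zeros_add)
  show ?thesis unfolding e
    by (simp only: v print_name_def prod.case, rule exec_mono[OF exec_seq[OF 1 exec_seq[OF 3 exec_seq[OF 2 3]]]])
      (use assms in \<open>auto simp: v name_cost_def\<close>)
qed

lemma exec_outputs:
  assumes "\<And>y w. y \<in> set ys \<Longrightarrow> exec T2 x (P y) F (St r t i (k, w)) (St r t i (k, w @ h y)) (c y)"
  shows "exec T2 x (seqs (map P ys)) F (St r t i (k, w)) (St r t i (k, w @ concat (map h ys)))
    (sum_list (map c ys) + 1)"
  using assms
proof (induction ys arbitrary: w)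
  case Nil
  show ?case using exec_skip[of T2 x F "St r t i (k, w)"] by (simp add: seqs_def)
next
  case (Cons y ys)
  have "exec T2 x (P y) F (St r t i (k, w)) (St r t i (k, w @ h y)) (c y)" using Cons.prems by simp
  moreover have "exec T2 x (seqs (map P ys)) F (St r t i (k, w @ h y)) (St r t i (k, (w @ h y) @ concat (map h ys)))
    (sum_list (map c ys) + 1)" by (rule Cons.IH) (use Cons.prems in auto)
  ultimately have "exec T2 x (P y ;; seqs (map P ys)) F (St r t i (k, w))
    (St r t i (k, (w @ h y) @ concat (map h ys))) (c y + (sum_list (map c ys) + 1))" by (rule exec_seq)
  then show ?case by (simp add: seqs_def add.assoc)
qed

type_synonym tedge = "tvertex \<times> tvertex \<times> nat"

definition vertex_prog :: "(nat \<Rightarrow> nat list) \<Rightarrow> nat \<Rightarrow> prog" where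
  "vertex_prog Vt g = seqs (map (\<lambda>z. emit T2 True ;; print_name (0, 0, z)) (Vt g))"

definition edge_prog :: "(nat \<Rightarrow> tedge list) \<Rightarrow> nat \<Rightarrow> prog" where
  "edge_prog Et g = seqs (map (\<lambda>(u, v, l). emit T2 True ;; print_name u ;; print_name v ;; emits (nat_code l)) (Et g))"

definition vertices_of :: "(nat \<Rightarrow> nat list) \<Rightarrow> event list \<Rightarrow> nat list" where
  "vertices_of Vt ev = concat (map (\<lambda>(g, t, i). map (vertex_name t i) (Vt g)) ev)"

definition edges_of :: "(nat \<Rightarrow> tedge list) \<Rightarrow> event list \<Rightarrow> (nat \<times> nat \<times> nat) list" where
  "edges_of Et ev = concat (map (\<lambda>(g, t, i). map (\<lambda>(u, v, l). (shift t i u, shift t i v, l)) (Et g)) ev)"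

definition budget_of :: "(nat \<Rightarrow> nat) \<Rightarrow> event list \<Rightarrow> nat" where
  "budget_of kc ev = sum_list (map (\<lambda>(g, t, i). kc g) ev)"

abbreviation edge_code :: "nat \<times> nat \<times> nat \<Rightarrow> bool list" where
  "edge_code \<equiv> (\<lambda>(u, v, i). nat_code u @ nat_code v @ nat_code i)"

definition vertex_out :: "(nat \<Rightarrow> nat list) \<Rightarrow> event \<Rightarrow> nat \<times> bool list \<Rightarrow> nat \<times> bool list" where
  "vertex_out Vt e a = (fst a, snd a @ concat (map (\<lambda>x. True # nat_code x) (vertices_of Vt [e])))"

definition edge_out :: "(nat \<Rightarrow> tedge list) \<Rightarrow> event \<Rightarrow> nat \<times> bool list \<Rightarrow> nat \<times> bool list" where
  "edge_out Et e a = (fst a, snd a @ concat (map (\<lambda>x. True # edge_code x) (edges_of Et [e])))"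

definition count_out :: "(nat \<Rightarrow> nat) \<Rightarrow> event \<Rightarrow> nat \<times> bool list \<Rightarrow> nat \<times> bool list" where
  "count_out kc e a = (fst a + kc (fst e), snd a)"

lemma fold_vertex_out:
  "fold (vertex_out Vt) ev (k, w) = (k, w @ concat (map (\<lambda>x. True # nat_code x) (vertices_of Vt ev)))"
  by (induction ev arbitrary: w) (auto simp: vertex_out_def vertices_of_def)

lemma fold_edge_out:
  "fold (edge_out Et) ev (k, w) = (k, w @ concat (map (\<lambda>x. True # edge_code x) (edges_of Et ev)))"
  by (induction ev arbitrary: w) (auto simp: edge_out_def edges_of_def)

lemma fold_count_out: "fold (count_out kc) ev (k, w) = (k + budget_of kc ev, w)"
  by (induction ev arbitrary: k) (auto simp: count_out_def budget_of_def)

lemma sum_list_const_bound: "sum_list (map (\<lambda>y. k + c y) ys) = length ys * k + sum_list (map c ys)" for k :: nat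
  by (induction ys) auto

definition vertex_cost :: "(nat \<Rightarrow> nat list) \<Rightarrow> nat \<Rightarrow> nat \<Rightarrow> nat" where
  "vertex_cost Vt g m = length (Vt g) * (14 * m + 1) + sum_list (map (\<lambda>z. name_cost (0, 0, z)) (Vt g)) + 1"

lemma exec_vertex_prog:
  assumes "t \<le> m" "i \<le> m"
  shows "exec T2 x (vertex_prog Vt g) {9, 10, 11, 12} (St r t i a) (St r t i (vertex_out Vt (g, t, i) a))
    (vertex_cost Vt g m)"
proof -
  let ?F = "{9, 10, 11, 12}"
  obtain k w where a: "a = (k, w)" by (cases a)
  have "exec T2 x (vertex_prog Vt g) ?F (St r t i (k, w))
      (St r t i (k, w @ concat (map (\<lambda>z. True # nat_code (vertex_name t i z)) (Vt g))))
      (sum_list (map (\<lambda>z. (14 * m + 1) + name_cost (0, 0, z)) (Vt g)) + 1)"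
    unfolding vertex_prog_def
  proof (rule exec_outputs)
    fix z w
    have 1: "exec T2 x (emit T2 True) ?F (St r t i (k, w)) (St r t i (k, w @ [True])) 1"
      by (rule exec_St_emit) auto
    from exec_seq[OF 1 exec_print_name[OF assms, of x "(0, 0, z)" r k "w @ [True]"]]
    show "exec T2 x (emit T2 True ;; print_name (0, 0, z)) ?F (St r t i (k, w))
        (St r t i (k, w @ True # nat_code (vertex_name t i z))) ((14 * m + 1) + name_cost (0, 0, z))"
      by (simp add: shift_def)
  qed
  then show ?thesis unfolding sum_list_const_bound
    by (simp add: a vertex_out_def vertices_of_def vertex_cost_def comp_def)
qed

definition edge_cost :: "(nat \<Rightarrow> tedge list) \<Rightarrow> nat \<Rightarrow> nat \<Rightarrow> nat" where
  "edge_cost Et g m = length (Et g) * (28 * m + 2) +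
     sum_list (map (\<lambda>(u, v, l). name_cost u + name_cost v + length (nat_code l)) (Et g)) + 1"

lemma exec_edge_prog:
  assumes "t \<le> m" "i \<le> m"
  shows "exec T2 x (edge_prog Et g) {9, 10, 11, 12} (St r t i a) (St r t i (edge_out Et (g, t, i) a))
    (edge_cost Et g m)"
proof -
  let ?F = "{9, 10, 11, 12}"
  obtain k w where a: "a = (k, w)" by (cases a)
  have "exec T2 x (edge_prog Et g) ?F (St r t i (k, w))
      (St r t i (k, w @ concat (map (\<lambda>(u, v, l). True # nat_code (shift t i u) @ nat_code (shift t i v) @ nat_code l) (Et g))))
      (sum_list (map (\<lambda>e. (28 * m + 2) + (case e of (u, v, l) \<Rightarrow> name_cost u + name_cost v + length (nat_code l))) (Et g)) + 1)"
    unfolding edge_prog_def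
  proof (rule exec_outputs)
    fix e :: tedge and w
    obtain u v l where e: "e = (u, v, l)" by (cases e)
    have 1: "exec T2 x (emit T2 True) ?F (St r t i (k, w)) (St r t i (k, w @ [True])) 1"
      by (rule exec_St_emit) auto
    note 2 = exec_print_name[OF assms, of x u r k "w @ [True]"]
    note 3 = exec_print_name[OF assms, of x v r k "(w @ [True]) @ nat_code (shift t i u)"]
    have 4: "exec T2 x (emits (nat_code l)) ?F (St r t i (k, w')) (St r t i (k, w' @ nat_code l)) (length (nat_code l) + 1)" for w'
      by (rule exec_St_emits) auto
    have "exec T2 x (emit T2 True ;; print_name u ;; print_name v ;; emits (nat_code l)) ?F (St r t i (k, w))
        (St r t i (k, (((w @ [True]) @ nat_code (shift t i u)) @ nat_code (shift t i v)) @ nat_code l))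
        ((28 * m + 2) + (name_cost u + name_cost v + length (nat_code l)))"
      by (rule exec_mono[OF exec_seq[OF 1 exec_seq[OF 2 exec_seq[OF 3 4]]]]) auto
    then show "exec T2 x (case e of (u, v, l) \<Rightarrow> emit T2 True ;; print_name u ;; print_name v ;; emits (nat_code l)) ?F
        (St r t i (k, w)) (St r t i (k, w @ (case e of (u, v, l) \<Rightarrow> True # nat_code (shift t i u) @ nat_code (shift t i v) @ nat_code l)))
        ((28 * m + 2) + (case e of (u, v, l) \<Rightarrow> name_cost u + name_cost v + length (nat_code l)))"
      by (simp add: e)
  qed
  then show ?thesis unfolding sum_list_const_bound
    by (simp add: a edge_out_def edges_of_def edge_cost_def case_prod_beta' comp_def)
qed

lemma exec_count_prog:
  "exec T2 x (incs 11 (kc g)) {9, 10, 11, 12} (St r t i a) (St r t i (count_out kc (g, t, i) a)) (kc g + 1)"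
proof -
  have "exec T2 x (incs 11 (kc g)) {11} (St r t i a) (St r t i (count_out kc (g, t, i) a)) (kc g + 1)"
    using exec_incs[of 11 T2 x "kc g" "r(9 := t, 10 := i, 11 := fst a)" 0 "snd a"]
    by (simp add: St_def count_out_def)
  then show ?thesis by (rule exec_mono) auto
qed

lemma length_row_events [simp]: "length (row_events g t i v) = v"
  by (simp add: row_events_def)

lemma length_grid_events [simp]: "length (grid_events g v u) = v * u"
  by (induction v) (auto simp: grid_events_def)

lemma length_bit_events [simp]: "length (bit_events i x) = 2 * length x"
proof -
  have "length (concat (map (\<lambda>j. [h j, h' j]) [0..<n])) = 2 * n" for h h' :: "nat \<Rightarrow> event" and n
    by (induction n) auto
  then show ?thesis by (simp add: bit_events_def)
qed

lemma length_events:
  "length (events A q x) = (let B = 2 * A + 2 * length x + q in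
     Suc A * Suc B + Suc A * B + A * Suc B + A + 1 + 2 * length x + 1 + q + A + 1)"
  by (simp add: events_def Let_def)

lemma events_group: "(g, t, i) \<in> set (events A q x) \<Longrightarrow> g < 9"
  by (auto simp: events_def Let_def grid_events_def row_events_def bit_events_def split: if_splits)

lemma budget_bound: "budget_of kc (events A q x) \<le> (\<Sum>g<9. kc g) * length (events A q x)"
proof -
  have "budget_of kc ev \<le> (\<Sum>g<9. kc g) * length ev" if "\<And>g t i. (g, t, i) \<in> set ev \<Longrightarrow> g < 9" for ev
    using that
  proof (induction ev)
    case (Cons e ev)
    obtain g t i where e: "e = (g, t, i)" by (cases e)
    have "g < 9" using Cons.prems[of g t i] e by simp
    then have "kc g \<le> (\<Sum>g<9. kc g)" by (intro member_le_sum) auto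
    moreover have "budget_of kc ev \<le> (\<Sum>g<9. kc g) * length ev" using Cons by auto
    ultimately show ?case by (simp add: e budget_of_def)
  qed (simp add: budget_of_def)
  then show ?thesis using events_group by blast
qed

text \<open>The budget has been collected in unary in register 11. Counting the binary tape 1 up
  that many times converts it.\<close>

definition output_prog :: prog where
  "output_prog = rept 11 bump ;; for_bits 1 (emits [True, False]) (emits [True, True]) ;; emit T2 False"

lemma exec_output_prog:
  "exec T2 x output_prog {1, 11, 12} (St r t i (k, w)) ((r(9 := t, 10 := i, 11 := k)), k, w @ nat_code k)
    ((k * ((4 * k + 10) + 4) + 4) + ((k * (3 + 5) + 4) + 1))"
proof -
  let ?r = "r(9 := t, 10 := i, 11 := k)"
  let ?F = "{1, 11, 12}"
  have "exec T2 x (rept 11 bump) (insert 11 {1}) ((\<lambda>l. (?r, l, w)) 0) ((\<lambda>l. (?r, l, w)) k) (k * ((4 * k + 10) + 4) + 4)"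
    by (rule exec_rept) (auto intro!: exec_mono[OF exec_bump])
  then have 1: "exec T2 x (rept 11 bump) ?F (?r, 0, w) (?r, k, w) (k * ((4 * k + 10) + 4) + 4)"
    by (rule exec_mono) auto
  let ?b = "binary k"
  let ?\<sigma> = "\<lambda>l. (?r, k, w @ concat (map (\<lambda>b. [True, b]) (take l ?b)))"
  have "exec T2 x (for_bits 1 (emits [True, False]) (emits [True, True])) (insert 1 {12}) (?\<sigma> 0) (?\<sigma> (length ?b))
      (length ?b * (3 + 5) + 4)"
  proof (rule exec_for_bits)
    fix l assume "l < length ?b"
    then have "take (Suc l) ?b = take l ?b @ [?b ! l]" by (simp add: take_Suc_conv_app_nth)
    then show "exec T2 x (if ?b ! l then emits [True, True] else emits [True, False]) {12} (?\<sigma> l) (?\<sigma> (Suc l)) 3"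
      using exec_emits[of x "[True, ?b ! l]" ?r k "w @ concat (map (\<lambda>b. [True, b]) (take l ?b))"]
      by (auto simp: numeral_3_eq_3)
  qed (auto simp: tapes_of_def)
  then have 2: "exec T2 x (for_bits 1 (emits [True, False]) (emits [True, True])) ?F (?r, k, w)
      (?r, k, w @ concat (map (\<lambda>b. [True, b]) ?b)) (k * (3 + 5) + 4)"
    using exec_mono[of T2 x _ "insert 1 {12}" "?\<sigma> 0" "?\<sigma> (length ?b)" "length ?b * (3 + 5) + 4" ?F "k * (3 + 5) + 4"]
      length_binary[of k] by simp
  have 3: "exec T2 x (emit T2 False) ?F (?r, k, w @ concat (map (\<lambda>b. [True, b]) ?b)) (?r, k, (w @ concat (map (\<lambda>b. [True, b]) ?b)) @ [False]) 1"
    by (rule exec_mono[OF exec_emit]) auto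
  have e: "w @ nat_code k = (w @ concat (map (\<lambda>b. [True, b]) ?b)) @ [False]" by (simp add: nat_code_def pair_code_def)
  show ?thesis unfolding output_prog_def e St_def fst_conv snd_conv by (rule exec_seq[OF 1 exec_seq[OF 2 3]])
qed

lemma wfp_skeleton: "(\<And>g. wfp T2 (P g)) \<Longrightarrow> wfp T2 (skeleton P)"
  by (simp add: skeleton_def grid_prog_def row_prog_def)

lemma wfp_bodies: "wfp T2 (vertex_prog Vt g)" "wfp T2 (edge_prog Et g)"
  unfolding vertex_prog_def edge_prog_def by (auto intro!: wfp_seqs)

definition skeleton_cost :: "nat \<Rightarrow> nat \<Rightarrow> nat" where
  "skeleton_cost m c = 20 * ((2 * Suc m + 3) + ((2 * Suc m + 3) + (Suc m * (((Suc m * ((c + 1) + 4) + 4) +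
     ((2 * Suc m + 3) + 1)) + 4) + 4))) + m * (c + (1 + (c + 1)) + 5) + 4 * c"

lemma polyb_Suc [intro, simp]: "polyb f \<Longrightarrow> polyb (\<lambda>x. Suc (f x))"
  using polyb_add[of f "\<lambda>_. 1"] by simp

lemma polyb_sum: "finite I \<Longrightarrow> (\<And>i. i \<in> I \<Longrightarrow> polyb (f i)) \<Longrightarrow> polyb (\<lambda>x. \<Sum>i\<in>I. f i x)"
  by (induction rule: finite_induct) auto

lemma polyb_mono: "polyb g \<Longrightarrow> (\<And>x. f x \<le> g x) \<Longrightarrow> polyb f"
  unfolding polyb_def by (meson order_trans)

lemma polyb_skeleton_cost: "polyb m \<Longrightarrow> polyb c \<Longrightarrow> polyb (\<lambda>x. skeleton_cost (m x) (c x))"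
  unfolding skeleton_cost_def by (intro polyb_add polyb_mult polyb_const polyb_Suc)

text \<open>The tables \<open>Vt\<close>, \<open>Et\<close> and \<open>kc\<close> have finitely many
  relevant rows and do not depend on \<open>x\<close>, so they are part of the program text. Only
  the list of events depends on \<open>x\<close>.\<close>

theorem polytime_grid_output:
  fixes A q :: "nat poly"
  assumes A: "\<And>n. poly A n \<ge> 1"
  shows "polytime (\<lambda>x. let ev = events (poly A (length x)) (poly q (length x)) x in
    input_code (vertices_of Vt ev) (edges_of Et ev) (budget_of kc ev))"
proof -
  let ?pB = "A + A + [:0, 2:] + q"
  obtain P4 c4 where P4: "wfp T2 P4" "polyb c4" "\<And>x r b w. r 2 = length x \<Longrightarrow> r 3 = 0 \<Longrightarrow> r 4 = 0 \<Longrightarrow>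
      exec T2 x P4 {2, 3, 4} (r, b, w) (r(4 := poly q (length x)), b, w) (c4 x)"
    using poly_program[of 4 q] by auto
  obtain P5 c5 where P5: "wfp T2 P5" "polyb c5" "\<And>x r b w. r 2 = length x \<Longrightarrow> r 3 = 0 \<Longrightarrow> r 5 = 0 \<Longrightarrow>
      exec T2 x P5 {2, 3, 5} (r, b, w) (r(5 := poly A (length x)), b, w) (c5 x)"
    using poly_program[of 5 A] by auto
  obtain P6 c6 where P6: "wfp T2 P6" "polyb c6" "\<And>x r b w. r 2 = length x \<Longrightarrow> r 3 = 0 \<Longrightarrow> r 6 = 0 \<Longrightarrow>
      exec T2 x P6 {2, 3, 6} (r, b, w) (r(6 := poly (A + [:1:]) (length x)), b, w) (c6 x)"
    using poly_program[of 6 "A + [:1:]"] by auto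
  obtain P7 c7 where P7: "wfp T2 P7" "polyb c7" "\<And>x r b w. r 2 = length x \<Longrightarrow> r 3 = 0 \<Longrightarrow> r 7 = 0 \<Longrightarrow>
      exec T2 x P7 {2, 3, 7} (r, b, w) (r(7 := poly ?pB (length x)), b, w) (c7 x)"
    using poly_program[of 7 ?pB] by auto
  obtain P8 c8 where P8: "wfp T2 P8" "polyb c8" "\<And>x r b w. r 2 = length x \<Longrightarrow> r 3 = 0 \<Longrightarrow> r 8 = 0 \<Longrightarrow>
      exec T2 x P8 {2, 3, 8} (r, b, w) (r(8 := poly (?pB + [:1:]) (length x)), b, w) (c8 x)"
    using poly_program[of 8 "?pB + [:1:]"] by auto
  let ?P = "for_bits 0 (inc 2) (inc 2) ;; P4 ;; P5 ;; P6 ;; P7 ;; P8 ;;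
    skeleton (vertex_prog Vt) ;; emit T2 False ;; skeleton (edge_prog Et) ;; emit T2 False ;;
    skeleton (\<lambda>g. incs 11 (kc g)) ;; output_prog"
  let ?B = "\<lambda>x. poly ?pB (length x)"
  let ?ev = "\<lambda>x. events (poly A (length x)) (poly q (length x)) x"
  let ?k = "\<lambda>x. budget_of kc (?ev x)"
  let ?cv = "\<lambda>x. \<Sum>g<9. vertex_cost Vt g (?B x)"
  let ?ce = "\<lambda>x. \<Sum>g<9. edge_cost Et g (?B x)"
  let ?ck = "\<lambda>x :: bool list. \<Sum>g<9. kc g + 1"
  let ?c = "\<lambda>x. (length x * (1 + 5) + 4) + (c4 x + (c5 x + (c6 x + (c7 x + (c8 x +
    (skeleton_cost (?B x) (?cv x) + (1 + (skeleton_cost (?B x) (?ce x) + (1 + (skeleton_cost (?B x) (?ck x) +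
    ((?k x * ((4 * ?k x + 10) + 4) + 4) + ((?k x * (3 + 5) + 4) + 1))))))))))))"
  have ex: "\<exists>t s. t \<le> ?c x \<and> run ?P (snd (tm_init x)) t s \<and>
      snd s 12 = tape_of (input_code (vertices_of Vt (?ev x)) (edges_of Et (?ev x)) (?k x))" for x
  proof -
    let ?n = "length x"
    let ?q = "poly q ?n" and ?A = "poly A ?n"
    let ?r2 = "(\<lambda>_. 0)(2 := ?n)"
    let ?r4 = "?r2(4 := ?q)"
    let ?r5 = "?r4(5 := ?A)"
    let ?r6 = "?r5(6 := poly (A + [:1:]) ?n)"
    let ?r7 = "?r6(7 := ?B x)"
    let ?r8 = "?r7(8 := poly (?pB + [:1:]) ?n)"
    let ?F = "UNIV :: nat set"
    let ?s0 = "(\<lambda>_. 0, 0, []) :: st"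
    \<comment> \<open>Both branches increment register 2, so this pass over the input computes its
      length.\<close>
    have "exec T2 x (for_bits 0 (inc 2) (inc 2)) (insert 0 {2}) ((\<lambda>k. ((\<lambda>_. 0)(2 := k), 0, [])) 0)
        ((\<lambda>k. ((\<lambda>_. 0)(2 := k), 0, [])) ?n) (?n * (1 + 5) + 4)"
    proof (rule exec_for_bits)
      fix k
      show "exec T2 x (if x ! k then inc 2 else inc 2) {2} ((\<lambda>_. 0)(2 := k), 0, []) ((\<lambda>_. 0)(2 := Suc k), 0, []) 1"
        using exec_inc[of 2 T2 x "(\<lambda>_. 0)(2 := k)" 0 "[]"] by simp
    qed (auto simp: tapes_of_def)
    moreover have "(\<lambda>_. 0)(2 := 0) = (\<lambda>_ :: nat. 0 :: nat)" by auto
    ultimately have "exec T2 x (for_bits 0 (inc 2) (inc 2)) (insert 0 {2}) ?s0 (?r2, 0, []) (?n * (1 + 5) + 4)"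
      by simp
    then have 1: "exec T2 x (for_bits 0 (inc 2) (inc 2)) ?F ?s0 (?r2, 0, []) (?n * (1 + 5) + 4)"
      by (rule exec_mono) auto
    have 2: "exec T2 x P4 ?F (?r2, 0, []) (?r4, 0, []) (c4 x)" by (rule exec_mono[OF P4(3)]) auto
    have 3: "exec T2 x P5 ?F (?r4, 0, []) (?r5, 0, []) (c5 x)" by (rule exec_mono[OF P5(3)]) auto
    have 4: "exec T2 x P6 ?F (?r5, 0, []) (?r6, 0, []) (c6 x)" by (rule exec_mono[OF P6(3)]) auto
    have 5: "exec T2 x P7 ?F (?r6, 0, []) (?r7, 0, []) (c7 x)" by (rule exec_mono[OF P7(3)]) auto
    have 6: "exec T2 x P8 ?F (?r7, 0, []) (St ?r8 0 0 (0, [])) (c8 x)"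
    proof -
      have "St ?r8 0 0 (0, []) = (?r8, 0, [])" by (auto simp: St_def fun_eq_iff)
      then show ?thesis using exec_mono[OF P8(3), of ?r7 x ?F "c8 x" 0 "[]"] by simp
    qed
    have sk: "exec T2 x (skeleton P) ?F (St ?r8 t i a) (St ?r8 ?A ?A (fold f (?ev x) a)) (skeleton_cost (?B x) (\<Sum>g<9. c g))"
      if P: "\<And>g t i a. g < 9 \<Longrightarrow> t \<le> ?B x \<Longrightarrow> i \<le> ?B x \<Longrightarrow>
        exec T2 x (P g) {9, 10, 11, 12} (St ?r8 t i a) (St ?r8 t i (f (g, t, i) a)) (c g)"
        and "t \<le> ?B x" "i \<le> ?B x" for P f c t i a
    proof -
      have "exec T2 x (P g) {9, 10, 11, 12} (St ?r8 t i a) (St ?r8 t i (f (g, t, i) a)) (\<Sum>g<9. c g)"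
        if "g < 9" "t \<le> ?B x" "i \<le> ?B x" for g t i a
      proof -
        have "c g \<le> (\<Sum>g<9. c g)" using that by (intro member_le_sum) auto
        then show ?thesis using exec_mono[OF P[OF that], of _ "\<Sum>g<9. c g"] by blast
      qed
      then have "exec T2 x (skeleton P) {0, 4, 5, 6, 7, 8, 9, 10, 11, 12} (St ?r8 t i a)
          (St ?r8 ?A ?A (fold f (?ev x) a)) (skeleton_cost (?B x) (\<Sum>g<9. c g))"
        unfolding skeleton_cost_def
        by (rule exec_skeleton[of "?B x" x P ?r8 f "\<Sum>g<9. c g" ?q ?A "?B x", OF _ _ _ _ _ _ _ _ _ _ _ refl])
          (use that(2,3) A[of ?n] in auto)
      then show ?thesis by (rule exec_mono) auto
    qed
    let ?w1 = "concat (map (\<lambda>x. True # nat_code x) (vertices_of Vt (?ev x)))"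
    let ?w2 = "concat (map (\<lambda>x. True # edge_code x) (edges_of Et (?ev x)))"
    have 7: "exec T2 x (skeleton (vertex_prog Vt)) ?F (St ?r8 0 0 (0, [])) (St ?r8 ?A ?A (0, ?w1)) (skeleton_cost (?B x) (?cv x))"
      using sk[of "vertex_prog Vt" "vertex_out Vt" "\<lambda>g. vertex_cost Vt g (?B x)" 0 0 "(0, [])"] exec_vertex_prog
      by (simp add: fold_vertex_out)
    have 8: "exec T2 x (emit T2 False) ?F (St ?r8 ?A ?A (0, ?w1)) (St ?r8 ?A ?A (0, ?w1 @ [False])) 1"
      by (rule exec_St_emit) auto
    have 9: "exec T2 x (skeleton (edge_prog Et)) ?F (St ?r8 ?A ?A (0, ?w1 @ [False]))
        (St ?r8 ?A ?A (0, (?w1 @ [False]) @ ?w2)) (skeleton_cost (?B x) (?ce x))"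
      using sk[of "edge_prog Et" "edge_out Et" "\<lambda>g. edge_cost Et g (?B x)" ?A ?A "(0, ?w1 @ [False])"] exec_edge_prog
      by (simp add: fold_edge_out)
    have 10: "exec T2 x (emit T2 False) ?F (St ?r8 ?A ?A (0, (?w1 @ [False]) @ ?w2))
        (St ?r8 ?A ?A (0, ((?w1 @ [False]) @ ?w2) @ [False])) 1"
      by (rule exec_St_emit) auto
    have 11: "exec T2 x (skeleton (\<lambda>g. incs 11 (kc g))) ?F (St ?r8 ?A ?A (0, ((?w1 @ [False]) @ ?w2) @ [False]))
        (St ?r8 ?A ?A (?k x, ((?w1 @ [False]) @ ?w2) @ [False])) (skeleton_cost (?B x) (?ck x))"
      using sk[of "\<lambda>g. incs 11 (kc g)" "count_out kc" "\<lambda>g. kc g + 1" ?A ?A "(0, ((?w1 @ [False]) @ ?w2) @ [False])"]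
        exec_count_prog by (simp add: fold_count_out)
    note 12 = exec_mono[OF exec_output_prog[of x ?r8 ?A ?A "?k x" "((?w1 @ [False]) @ ?w2) @ [False]"] subset_UNIV order_refl]
    note ex = exec_seq[OF 1 exec_seq[OF 2 exec_seq[OF 3 exec_seq[OF 4 exec_seq[OF 5 exec_seq[OF 6 exec_seq[OF 7
      exec_seq[OF 8 exec_seq[OF 9 exec_seq[OF 10 exec_seq[OF 11 12]]]]]]]]]]]
    define s :: st where "s = (?r8(9 := ?A, 10 := ?A, 11 := ?k x), ?k x, (((?w1 @ [False]) @ ?w2) @ [False]) @ nat_code (?k x))"
    obtain t where t: "t \<le> ?c x" "run ?P (memo T2 x {} (\<lambda>_. 0) ?s0) t (memo T2 x {} (\<lambda>_. 0) s)"
      using ex[folded s_def] unfolding exec_def by blast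
    have "memo T2 x {} (\<lambda>_. 0) ?s0 = snd (tm_init x)"
      by (auto simp: memo_def tm_init_def heads_of_def tapes_of_def fun_eq_iff tape_of_def unary_def binary.simps)
    moreover have "snd (memo T2 x {} (\<lambda>_. 0) s) 12 = tape_of (input_code (vertices_of Vt (?ev x)) (edges_of Et (?ev x)) (?k x))"
      by (simp add: memo_def tapes_of_def s_def input_code_def list_code_def)
    ultimately show ?thesis using t by (intro exI[of _ t] exI[of _ "memo T2 x {} (\<lambda>_. 0) s"]) simp
  qed
  have wf: "wfp T2 ?P" using P4(1) P5(1) P6(1) P7(1) P8(1)
    by (auto simp: output_prog_def wfp_bodies intro!: wfp_skeleton)
  have k: "polyb ?k"
  proof (rule polyb_mono)
    show "?k x \<le> (\<Sum>g<9. kc g) * length (?ev x)" for x by (rule budget_bound)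
    show "polyb (\<lambda>x. (\<Sum>g<9. kc g) * length (?ev x))"
      unfolding length_events Let_def by (intro polyb_add polyb_mult polyb_const polyb_Suc polyb_poly polyb_length)
  qed
  have cv: "polyb ?cv" "polyb ?ce"
    unfolding vertex_cost_def edge_cost_def
    by (intro polyb_sum polyb_add polyb_mult polyb_const polyb_Suc polyb_poly; simp)+
  have "polyb ?c"
    using P4(2) P5(2) P6(2) P7(2) P8(2) k cv
    by (intro polyb_add polyb_mult polyb_const polyb_Suc polyb_poly polyb_length polyb_skeleton_cost)
  then have "polyb (\<lambda>x. ?c x + 1)" by (rule polyb_add) (rule polyb_const)
  then obtain p :: "nat poly" where p: "\<And>x. ?c x + 1 \<le> poly p (length x)" unfolding polyb_def by blast
  have "tm_outputs_within (machine T2 ?P) x (input_code (vertices_of Vt (?ev x)) (edges_of Et (?ev x)) (?k x)) (poly p (length x))" for x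
  proof -
    obtain t s where ts: "t \<le> ?c x" "run ?P (snd (tm_init x)) t s"
      "snd s 12 = tape_of (input_code (vertices_of Vt (?ev x)) (edges_of Et (?ev x)) (?k x))" using ex by blast
    have "run ?P (snd (tm_init x)) t (fst s, snd s)" using ts(2) by simp
    moreover have "snd s (T2 - 1) = tape_of (input_code (vertices_of Vt (?ev x)) (edges_of Et (?ev x)) (?k x))"
      using ts(3) by simp
    moreover have "t + 1 \<le> poly p (length x)" using ts(1) p[of x] by linarith
    ultimately show ?thesis by (rule machine_outputs[OF wf])
  qed
  moreover have "wf_tm (machine T2 ?P)" using wf by (rule wf_machine) simp
  ultimately show ?thesis unfolding polytime_def Let_def by blast
qed

section \<open>Paths, cycles and cyclic windows\<close>

lemma girth_le: "is_cycle E vs \<Longrightarrow> girth E \<le> enat (length vs)"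
  unfolding girth_def by (rule Inf_lower) auto

lemma girth_ge: "(\<And>vs. is_cycle E vs \<Longrightarrow> n \<le> length vs) \<Longrightarrow> enat n \<le> girth E"
  unfolding girth_def by (rule Inf_greatest) auto

lemma path_edges_finite: "finite (path_edges vs)"
proof -
  have "path_edges vs = (\<lambda>i. {vs ! i, vs ! Suc i}) ` {i. Suc i < length vs}"
    unfolding path_edges_def by auto
  moreover have "finite {i. Suc i < length vs}" by (rule finite_subset[of _ "{..<length vs}"]) auto
  ultimately show ?thesis by simp
qed

text \<open>A chord would close a cycle on at most \<open>length vs\<close> vertices. The girth is
  that of the whole graph \<open>E\<close>, so the argument applies to whatever a deletion leaves
  over.\<close>

lemma induced_path_of_girth:
  assumes "simple_graph V E" and "enat (length vs) < girth E" and "distinct vs"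
    and "path_edges vs \<subseteq> E'" and "E' \<subseteq> E"
  shows "induced_edges E' (set vs) = path_edges vs"
proof
  show "path_edges vs \<subseteq> induced_edges E' (set vs)"
    using assms(4) by (auto simp: induced_edges_def path_edges_def)
  show "induced_edges E' (set vs) \<subseteq> path_edges vs"
  proof
    fix e assume "e \<in> induced_edges E' (set vs)"
    then have e: "e \<in> E" "e \<subseteq> set vs" "card e = 2"
      using assms(1,5) by (auto simp: induced_edges_def simple_graph_def)
    then obtain a b where ab: "e = {a, b}" "a \<noteq> b" by (meson card_2_iff)
    obtain i j where ij: "e = {vs ! i, vs ! j}" "i < j" "j < length vs"
    proof -
      obtain i' j' where "a = vs ! i'" "b = vs ! j'" "i' < length vs" "j' < length vs"
        using e(2) ab by (auto simp: in_set_conv_nth)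
      moreover from this ab have "i' \<noteq> j'" by auto
      ultimately show ?thesis using that[of i' j'] that[of j' i'] ab by (cases "i' < j'") (auto simp: insert_commute)
    qed
    show "e \<in> path_edges vs"
    proof (cases "j = Suc i")
      case True
      then show ?thesis using ij by (auto simp: path_edges_def)
    next
      case False
      let ?us = "take (Suc j - i) (drop i vs)"
      have len: "length ?us = Suc j - i" using ij by simp
      have nth: "?us ! k = vs ! (i + k)" if "k < Suc j - i" for k using that ij by simp
      have ne: "?us \<noteq> []" using len ij by auto
      have "hd ?us = vs ! i" using ne nth[of 0] ij by (simp add: hd_conv_nth)
      moreover have "last ?us = vs ! j" using ne nth[of "j - i"] len ij by (simp add: last_conv_nth)
      moreover have "path_edges ?us \<subseteq> path_edges vs"
      proof
        fix f assume "f \<in> path_edges ?us"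
        then obtain k where k: "f = {?us ! k, ?us ! Suc k}" "Suc k < length ?us" by (auto simp: path_edges_def)
        then have "f = {vs ! (i + k), vs ! Suc (i + k)}" "Suc (i + k) < length vs"
          using nth[of k] nth[of "Suc k"] len ij by auto
        then show "f \<in> path_edges vs" by (auto simp: path_edges_def)
      qed
      ultimately have "is_cycle E ?us"
        using assms(3-5) ij e(1) len False by (auto simp: is_cycle_def insert_commute)
      then have "girth E \<le> enat (length ?us)" by (rule girth_le)
      also have "\<dots> \<le> enat (length vs)" using len ij by auto
      finally show ?thesis using assms(2) by simp
    qed
  qed
qed

lemma cycle_edge:
  assumes "i < length vs"
  shows "{vs ! i, vs ! (Suc i mod length vs)} \<in> insert {last vs, hd vs} (path_edges vs)"
proof (cases "Suc i < length vs")
  case True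
  then show ?thesis by (auto simp: path_edges_def)
next
  case False
  then have "Suc i = length vs" "vs \<noteq> []" using assms by auto
  then have "last vs = vs ! i" "hd vs = vs ! (Suc i mod length vs)"
    by (auto simp: last_conv_nth hd_conv_nth simp flip: \<open>Suc i = length vs\<close>)
  then show ?thesis by auto
qed

text \<open>If removing \<open>F\<close> leaves a rooted forest with parent map \<open>up\<close>, a lowest vertex of a cycle avoiding
  \<open>F\<close> would have two parents.\<close>

lemma cycle_meets:
  fixes ht :: "'a \<Rightarrow> int"
  assumes cyc: "is_cycle E vs"
    and forest: "\<And>e. e \<in> E - F \<Longrightarrow> \<exists>a b. e = {a, b} \<and> b = up a \<and> ht a < ht b"
  shows "insert {last vs, hd vs} (path_edges vs) \<inter> F \<noteq> {}"
proof
  assume disj: "insert {last vs, hd vs} (path_edges vs) \<inter> F = {}"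
  let ?n = "length vs"
  have n: "?n \<ge> 3" and d: "distinct vs" and sub: "insert {last vs, hd vs} (path_edges vs) \<subseteq> E"
    using cyc by (auto simp: is_cycle_def)
  obtain m where m: "m < ?n" "\<And>k. k < ?n \<Longrightarrow> ht (vs ! m) \<le> ht (vs ! k)"
  proof -
    let ?A = "(\<lambda>k. ht (vs ! k)) ` {..<?n}"
    have "finite ?A" "?A \<noteq> {}" using n by (auto simp: lessThan_empty_iff)
    then have "Min ?A \<in> ?A" by (rule Min_in)
    then obtain k where "k < ?n" "Min ?A = ht (vs ! k)" by auto
    moreover have "Min ?A \<le> ht (vs ! k')" if "k' < ?n" for k' using that by (intro Min_le) auto
    ultimately show ?thesis using that by metis
  qed
  have nb: "vs ! k = up (vs ! m)" if "k < ?n" "{vs ! m, vs ! k} \<in> insert {last vs, hd vs} (path_edges vs)" for k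
  proof -
    have "{vs ! m, vs ! k} \<in> E - F" using that disj sub by blast
    then obtain a b where ab: "{vs ! m, vs ! k} = {a, b}" "b = up a" "ht a < ht b" using forest by blast
    have "a = vs ! m \<and> b = vs ! k"
      using ab m(2)[OF that(1)] by (auto simp: doubleton_eq_iff)
    then show ?thesis using ab by auto
  qed
  let ?p = "(m + ?n - 1) mod ?n" and ?s = "Suc m mod ?n"
  have "?n > 0" using n by linarith
  then have p: "?p < ?n" "?s < ?n" by simp_all
  have sp: "Suc ?p mod ?n = m"
  proof -
    have "Suc ?p mod ?n = (Suc (m + ?n - 1)) mod ?n" by (rule mod_Suc_eq)
    also have "Suc (m + ?n - 1) = m + ?n" using n by simp
    finally show ?thesis using m(1) by simp
  qed
  have "vs ! ?s = up (vs ! m)" using nb[of ?s] cycle_edge[OF m(1)] p by simp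
  moreover have "vs ! ?p = up (vs ! m)" using nb[of ?p] cycle_edge[OF p(1)] p sp by (simp add: insert_commute)
  ultimately have "?p = ?s" using d p by (metis nth_eq_iff_index_eq)
  moreover have "?p = (if m = 0 then ?n - 1 else m - 1)"
  proof (cases "m = 0")
    case False
    then have "m + ?n - 1 = (m - 1) + ?n" by simp
    then have "?p = (m - 1) mod ?n" by simp
    then show ?thesis using False m(1) by simp
  qed (use n in simp)
  moreover have "?s = (if Suc m = ?n then 0 else Suc m)" using m(1) by simp
  ultimately show False using n by (auto split: if_splits)
qed

lemma constant_run:
  assumes "\<And>i. a \<le> i \<Longrightarrow> Suc i < b \<Longrightarrow> f i = f (Suc i)" and "a \<le> i" and "i < b"
  shows "f i = f (a :: nat)"
  using assms(2,3)
proof (induction rule: dec_induct)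
  case (step n)
  then show ?case using assms(1)[of n] by simp
qed simp

text \<open>A path passes \<open>w\<close> at most once, hence falls into at most two pieces there,
  and \<open>f\<close> is constant on each. If \<open>f\<close> names the branches at
  \<open>w\<close>, a path meets no more than two of them.\<close>

lemma two_branches:
  assumes "distinct vs"
    and "\<And>i. Suc i < length vs \<Longrightarrow> vs ! i \<noteq> w \<Longrightarrow> vs ! Suc i \<noteq> w \<Longrightarrow> f (vs ! i) = f (vs ! Suc i)"
  obtains b b' where "\<And>v. v \<in> set vs \<Longrightarrow> v \<noteq> w \<Longrightarrow> f v = b \<or> f v = b'"
proof -
  \<comment> \<open>If \<open>w\<close> is not on the path, \<open>length vs\<close> serves as its
    position, so that all vertices come before it.\<close>
  obtain p where p: "\<And>i. i < length vs \<Longrightarrow> vs ! i = w \<longleftrightarrow> i = p"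
  proof (cases "w \<in> set vs")
    case True
    then obtain p where "p < length vs" "vs ! p = w" by (auto simp: in_set_conv_nth)
    then show ?thesis using assms(1) by (intro that[of p]) (auto simp: nth_eq_iff_index_eq)
  next
    case False
    then show ?thesis by (intro that[of "length vs"]) auto
  qed
  have "f v = f (vs ! 0) \<or> f v = f (vs ! Suc p)" if v: "v \<in> set vs" "v \<noteq> w" for v
  proof -
    obtain i where i: "i < length vs" "v = vs ! i" using v(1) by (metis in_set_conv_nth)
    then have "i \<noteq> p" using p v(2) by auto
    then consider "i < p" | "i > p" by linarith
    then show ?thesis
    proof cases
      case 1
      have "f (vs ! i) = f (vs ! 0)"
        using 1 i p by (intro constant_run[of 0 "Suc i" "\<lambda>i. f (vs ! i)"] assms(2)) auto
      then show ?thesis using i by simp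
    next
      case 2
      have "f (vs ! i) = f (vs ! Suc p)"
        using 2 i p by (intro constant_run[of "Suc p" "Suc i" "\<lambda>i. f (vs ! i)"] assms(2)) auto
      then show ?thesis using i by simp
    qed
  qed
  then show ?thesis using that by blast
qed

section \<open>Cutting a cycle at a residue class\<close>

lemma shift_residue:
  fixes s r D :: nat
  assumes "r < D"
  shows "(s + (D - 1 - r)) mod D = D - 1 \<longleftrightarrow> s mod D = r"
proof -
  let ?u = "s mod D"
  have u: "?u < D" using assms by simp
  have e: "(s + (D - 1 - r)) mod D = (?u + (D - 1 - r)) mod D" by (simp add: mod_add_left_eq)
  show ?thesis
  proof (cases "?u \<le> r")
    case True
    then have "?u + (D - 1 - r) < D" using u assms by linarith
    then have "(?u + (D - 1 - r)) mod D = ?u + (D - 1 - r)" by (rule mod_less)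
    then show ?thesis unfolding e using True u assms by linarith
  next
    case False
    then have "?u + (D - 1 - r) = (?u - r - 1) + D" using u assms by linarith
    then have "(?u + (D - 1 - r)) mod D = (?u - r - 1) mod D" by (simp only: mod_add_self2)
    also have "\<dots> = ?u - r - 1" by (rule mod_less) (use u in linarith)
    finally show ?thesis unfolding e using False u assms by linarith
  qed
qed

text \<open>After the shift of \<open>shift_residue\<close> the positions of the chosen residue are
  the last ones of the blocks of length \<open>D\<close>. Any other step stays inside its block and
  does not wrap around, since \<open>M\<close> is a multiple of \<open>D\<close>. Removing the
  residue class thus leaves exactly these blocks.\<close>

lemma shift_step:
  fixes s a D M :: nat
  assumes "D dvd M" and "M > 0" and "((s + a) mod M) mod D \<noteq> D - 1"
  defines "u \<equiv> (s + a) mod M"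
  shows "((Suc s mod M) + a) mod M = Suc u" and "Suc u div D = u div D" and "Suc u mod D = Suc (u mod D)"
proof -
  have D: "D > 0" using assms(1,2) by (metis dvd_0_left_iff not_gr0)
  show 3: "Suc u mod D = Suc (u mod D)" using assms(3) D by (simp add: u_def mod_Suc)
  then show "Suc u div D = u div D" by (simp add: div_Suc)
  have "Suc u \<noteq> M"
  proof
    assume "Suc u = M"
    then have "Suc u mod D = 0" using assms(1) by simp
    then show False using 3 by simp
  qed
  moreover have "u < M" using assms(2) by (simp add: u_def)
  ultimately have "Suc u < M" by simp
  have "((Suc s mod M) + a) mod M = (Suc s + a) mod M" by (simp add: mod_add_left_eq)
  also have "\<dots> = Suc u mod M" by (simp add: u_def mod_Suc_eq)
  finally show "((Suc s mod M) + a) mod M = Suc u" using \<open>Suc u < M\<close> by simp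
qed

lemma mod_shift_inj:
  fixes s s' a M :: nat
  assumes "s < M" and "s' < M" and "(s + a) mod M = (s' + a) mod M"
  shows "s = s'"
proof -
  have "int ((s + a) mod M) = int ((s' + a) mod M)" using assms(3) by simp
  then have "(int s + int a) mod int M = (int s' + int a) mod int M" by (simp add: of_nat_mod)
  then have "int s mod int M = int s' mod int M" by (simp add: mod_eq_dvd_iff)
  then have "int (s mod M) = int (s' mod M)" by (simp add: of_nat_mod)
  then show ?thesis using assms(1,2) by simp
qed

text \<open>If every window of \<open>L\<close> cyclically consecutive positions is hit, then \<open>M / L\<close> hits are needed,
  and with exactly that many every window is hit once, so the hits form a residue class.\<close>

lemma sum_cyclic_shift:
  fixes f :: "nat \<Rightarrow> nat"
  assumes "\<And>s. f (s + M) = f s"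
  shows "(\<Sum>s<M. f (s + i)) = (\<Sum>s<M. f s)"
proof (induction i)
  case (Suc i)
  have "(\<Sum>s<M. f (s + Suc i)) + f i = (\<Sum>s<Suc M. f (s + i))"
    by (subst sum.lessThan_Suc_shift) simp
  also have "\<dots> = (\<Sum>s<M. f (s + i)) + f i" using assms[of i] by (simp add: add.commute)
  finally show ?case using Suc by simp
qed simp

lemma cyclic_windows:
  fixes A :: "nat set"
  assumes A: "A \<subseteq> {..<M}" and L: "L > 0" "M = N * L" "N > 0"
    and hit: "\<And>s. \<exists>i<L. (s + i) mod M \<in> A"
  shows "N \<le> card A"
    and "card A = N \<Longrightarrow> \<exists>r<L. \<forall>s<M. s \<in> A \<longleftrightarrow> s mod L = r"
proof -
  define f :: "nat \<Rightarrow> nat" where "f s = of_bool (s mod M \<in> A)" for s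
  define w where "w s = (\<Sum>i<L. f (s + i))" for s
  have M: "M > 0" using L by simp
  have per: "f (s + M) = f s" for s by (simp add: f_def)
  have fA: "(\<Sum>s<M. f s) = card A"
  proof -
    have "(\<Sum>s<M. f s) = (\<Sum>s<M. of_bool (s \<in> A))" by (intro sum.cong) (auto simp: f_def)
    also have "\<dots> = card ({..<M} \<inter> A)" by (simp add: of_bool_def sum.If_cases)
    also have "{..<M} \<inter> A = A" using A by auto
    finally show ?thesis .
  qed
  \<comment> \<open>Double counting: each hit lies in exactly \<open>L\<close> of the
    \<open>M\<close> windows.\<close>
  have "(\<Sum>s<M. w s) = (\<Sum>i<L. \<Sum>s<M. f (s + i))" unfolding w_def by (rule sum.swap)
  also have "\<dots> = L * card A" by (simp add: sum_cyclic_shift[of f M, OF per] fA)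
  finally have total: "(\<Sum>s<M. w s) = L * card A" .
  have w1: "w s \<ge> 1" for s
  proof -
    obtain i where "i < L" "(s + i) mod M \<in> A" using hit by blast
    then have "1 \<le> f (s + i)" by (simp add: f_def)
    also have "\<dots> \<le> w s" unfolding w_def using \<open>i < L\<close> by (intro member_le_sum) auto
    finally show ?thesis .
  qed
  have "L * N = (\<Sum>s<M. 1)" using L by (simp add: mult.commute)
  also have "\<dots> \<le> (\<Sum>s<M. w s)" by (intro sum_mono w1)
  finally have "L * N \<le> L * card A" by (simp add: total)
  then show "N \<le> card A" using L by simp
  assume "card A = N"
  then have "(\<Sum>s<M. w s) = M" using total L(2) by (simp only: mult.commute)
  then have eq: "(\<Sum>s<M. 1) = (\<Sum>s<M. w s)" by simp
  have wM: "w s = 1" if "s < M" for s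
  proof -
    have "1 = w s" by (rule sum_mono_inv[OF eq]) (use that w1 in auto)
    then show ?thesis by simp
  qed
  have w: "w s = 1" for s
  proof -
    have "f (s + i) = f (s mod M + i)" for i by (simp add: f_def mod_add_left_eq)
    then have "w s = w (s mod M)" by (simp add: w_def)
    then show ?thesis using wM M by simp
  qed
  \<comment> \<open>The windows at \<open>s\<close> and \<open>s + 1\<close> contain one hit each
    and differ only in their outermost positions.\<close>
  have fL: "f (s + L) = f s" for s
  proof -
    have "w s + f (s + L) = (\<Sum>i<Suc L. f (s + i))" by (simp add: w_def)
    also have "\<dots> = f s + w (Suc s)" unfolding w_def by (subst sum.lessThan_Suc_shift) simp
    finally show ?thesis using w by simp
  qed
  have fLk: "f (s + k * L) = f s" for s k
  proof (induction k)
    case (Suc k)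
    have "s + Suc k * L = (s + k * L) + L" by simp
    then show ?case using Suc fL[of "s + k * L"] by (simp only:)
  qed simp
  have fm: "f s = f (s mod L)" for s
    using fLk[of "s mod L" "s div L"] by simp
  obtain r where "r < L" "(0 + r) mod M \<in> A" using hit by blast
  then have r: "r < L" "f r = 1" by (simp_all add: f_def)
  have f0: "f i = 0" if "i < L" "i \<noteq> r" for i
  proof -
    have "(\<Sum>i<L. f i) = 1" using w[of 0] by (simp add: w_def)
    then have "f r + (\<Sum>i\<in>{..<L} - {r}. f i) = 1" using r(1) by (subst (asm) sum.remove[of _ r]) auto
    then have "(\<Sum>i\<in>{..<L} - {r}. f i) = 0" using r(2) by linarith
    then show ?thesis using that by simp
  qed
  have fr: "f s = 1 \<longleftrightarrow> s mod L = r" for s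
  proof (cases "s mod L = r")
    case True
    have "f s = f r" by (rule trans[OF fm]) (simp only: True)
    then show ?thesis using r(2) True by simp
  next
    case False
    have "f s = 0" by (rule trans[OF fm f0]) (use False L(1) in auto)
    then show ?thesis using False by simp
  qed
  show "\<exists>r<L. \<forall>s<M. s \<in> A \<longleftrightarrow> s mod L = r"
  proof (intro exI[of _ r] conjI allI impI)
    fix s assume "s < M"
    then have "s \<in> A \<longleftrightarrow> f s = 1" by (simp add: f_def)
    then show "s \<in> A \<longleftrightarrow> s mod L = r" by (simp only: fr)
  qed (rule r(1))
qed

text \<open>The lower bounds already use up all of \<open>upper\<close>. The second conclusion will
  exclude deletions at edges that belong to no part.\<close>

lemma tight_cover:
  assumes fin: "finite J" "finite S" and disj: "disjoint_family_on A J"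
    and lower: "\<And>j. j \<in> J \<Longrightarrow> n j \<le> card (S \<inter> A j)" and upper: "card S \<le> (\<Sum>j\<in>J. n j)"
  shows "\<And>j. j \<in> J \<Longrightarrow> card (S \<inter> A j) = n j" and "S \<subseteq> (\<Union>j\<in>J. A j)"
proof -
  have U: "card (\<Union>j\<in>J. S \<inter> A j) = (\<Sum>j\<in>J. card (S \<inter> A j))"
    using fin disj by (intro card_UN_disjoint) (auto simp: disjoint_family_on_def)
  have le: "card (\<Union>j\<in>J. S \<inter> A j) \<le> card S" using fin by (intro card_mono) auto
  have s: "(\<Sum>j\<in>J. n j) \<le> (\<Sum>j\<in>J. card (S \<inter> A j))" by (intro sum_mono lower)
  then have eq: "(\<Sum>j\<in>J. n j) = (\<Sum>j\<in>J. card (S \<inter> A j))" using U le upper by linarith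
  then show "card (S \<inter> A j) = n j" if "j \<in> J" for j
    using sum_mono_inv[OF eq lower that fin(1)] by simp
  have "card (\<Union>j\<in>J. S \<inter> A j) = card S" using U le upper eq by linarith
  then have "(\<Union>j\<in>J. S \<inter> A j) = S" using fin(2) by (intro card_subset_eq) auto
  then show "S \<subseteq> (\<Union>j\<in>J. A j)" by blast
qed

section \<open>The gadget graph\<close>

datatype ('r, 'k) vertex = Ring 'r nat | Arm 'k nat | PenL 'k nat | PenR 'k nat

text \<open>Colors, parts and deletions depend on the role of an edge, so edges are handled through
  indices that show this role; \<open>inj_edge\<close> justifies it.\<close>

datatype ('r, 'k) eidx = RE 'r nat | AE 'k nat | DL 'k nat | DR 'k nat

text \<open>
  Every ring carries \<open>H\<close> sections of \<open>\<Lambda>\<close> edges; \<open>pos h\<close> is the vertex of section \<open>h\<close> where an arm may be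
  attached. The arm of a conflict \<open>k\<close> leads from section \<open>lh k\<close> of ring \<open>lr k\<close> to section \<open>rh k\<close> of ring
  \<open>rr k\<close>; two pendant paths hang off it.
\<close>

locale gadget =
  fixes L c \<Lambda> H H0 :: nat and Rg :: "'r set" and Kf :: "'k set"
    and lr rr :: "'k \<Rightarrow> 'r" and lh rh :: "'k \<Rightarrow> nat"
  assumes L: "3 \<le> L" and c: "2 \<le> c" "c < L"
    and \<Lambda>: "2 * L < \<Lambda>" "\<Lambda> mod L = L - 1" and H: "0 < H" "L dvd H"
    and fin: "finite Rg" "finite Kf" and ne: "Kf \<noteq> {}"
    and rings: "\<And>k. k \<in> Kf \<Longrightarrow> lr k \<in> Rg" "\<And>k. k \<in> Kf \<Longrightarrow> rr k \<in> Rg"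
    and sections: "\<And>k. k \<in> Kf \<Longrightarrow> lh k < H0" "\<And>k. k \<in> Kf \<Longrightarrow> H0 \<le> rh k"
      "\<And>k. k \<in> Kf \<Longrightarrow> lh k < H" "\<And>k. k \<in> Kf \<Longrightarrow> rh k < H"
    and inj: "inj_on (\<lambda>k. (lr k, lh k)) Kf" "inj_on (\<lambda>k. (rr k, rh k)) Kf"
begin

definition M :: nat where "M = H * \<Lambda>"

definition pos :: "nat \<Rightarrow> nat" where "pos h = h * \<Lambda> + L - 1"

definition node :: "'k \<Rightarrow> nat \<Rightarrow> ('r, 'k) vertex" where
  "node k j = (if j = 0 then Ring (lr k) (pos (lh k))
     else if j = 2 * L + 2 then Ring (rr k) (pos (rh k)) else Arm k j)"

definition pl :: "'k \<Rightarrow> nat \<Rightarrow> ('r, 'k) vertex" where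
  "pl k j = (if j = 0 then Arm k 2 else PenL k j)"

definition pr :: "'k \<Rightarrow> nat \<Rightarrow> ('r, 'k) vertex" where
  "pr k j = (if j = 0 then Arm k (2 * L) else PenR k j)"

fun ends :: "('r, 'k) eidx \<Rightarrow> ('r, 'k) vertex \<times> ('r, 'k) vertex" where
  "ends (RE X s) = (Ring X s, Ring X (Suc s mod M))"
| "ends (AE k j) = (node k j, node k (Suc j))"
| "ends (DL k j) = (pl k j, pl k (Suc j))"
| "ends (DR k j) = (pr k j, pr k (Suc j))"

fun valid :: "('r, 'k) eidx \<Rightarrow> bool" where
  "valid (RE X s) \<longleftrightarrow> X \<in> Rg \<and> s < M"
| "valid (AE k j) \<longleftrightarrow> k \<in> Kf \<and> j < 2 * L + 2"
| "valid (DL k j) \<longleftrightarrow> k \<in> Kf \<and> j < L - 2"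
| "valid (DR k j) \<longleftrightarrow> k \<in> Kf \<and> j < L - 2"

fun vvalid :: "('r, 'k) vertex \<Rightarrow> bool" where
  "vvalid (Ring X s) \<longleftrightarrow> X \<in> Rg \<and> s < M"
| "vvalid (Arm k j) \<longleftrightarrow> k \<in> Kf \<and> 1 \<le> j \<and> j \<le> 2 * L + 1"
| "vvalid (PenL k j) \<longleftrightarrow> k \<in> Kf \<and> 1 \<le> j \<and> j \<le> L - 2"
| "vvalid (PenR k j) \<longleftrightarrow> k \<in> Kf \<and> 1 \<le> j \<and> j \<le> L - 2"

text \<open>The color sequence \<open>a, 3, 4, ..., c, a, a, ...\<close>. For \<open>a\<close> equal
  to 1 or 2 its first \<open>c - 1\<close> entries show every color except
  \<open>3 - a\<close>.\<close>

definition stretch :: "nat \<Rightarrow> nat \<Rightarrow> nat" where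
  "stretch a j = (if 1 \<le> j \<and> j \<le> c - 2 then j + 2 else a)"

text \<open>Within a section the index \<open>j\<close> runs through
  \<open>1, ..., L - 1, 0, 1, ...\<close> and ends with \<open>L - 1\<close>, because
  \<open>\<Lambda>\<close> is \<open>L - 1\<close> modulo \<open>L\<close>. The next section starts
  with 1 again, so index 0 is skipped at the boundary. This does no harm: index 0 has color 1, which
  occurs at index \<open>L - 2\<close> as well.\<close>

definition rcol :: "nat \<Rightarrow> nat" where
  "rcol s = (let j = (s mod \<Lambda> + 1) mod L in if j = L - 1 then 2 else stretch 1 j)"

text \<open>Color 2 is missing on the edges 2 to \<open>L\<close>, and color 1 on the edges
  \<open>L + 1\<close> to \<open>2 * L - 1\<close>. The missing color is supplied by edge 1 or
  \<open>L + 1\<close> in the first case and by edge \<open>2 * L\<close> in the second, so the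
  windows of \<open>L\<close> edges starting at 1, 2 and \<open>L + 1\<close> show all colors. Each
  side piece left by the deletions has at most one edge of its rare color, at its tip.\<close>

definition acol :: "nat \<Rightarrow> nat" where
  "acol j = (if j = 1 then 2 else if 2 \<le> j \<and> j \<le> L then stretch 1 (j - 2)
     else if L < j \<and> j < 2 * L then stretch 2 (j - Suc L) else 1)"

text \<open>The \<open>L - 2\<close> edges of a pendant path complete the two outermost arm edges to
  a path of \<open>L\<close> edges in all colors, which forces a deletion at that end. The left
  pendant path avoids color 2 and the right one color 1, like the arm edges next to them.\<close>

fun col :: "('r, 'k) eidx \<Rightarrow> nat" where
  "col (RE X s) = rcol s"
| "col (AE k j) = acol j"
| "col (DL k j) = stretch 1 (Suc j)"
| "col (DR k j) = (if j = c - 2 then 2 else stretch 2 (Suc j))"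

definition edge :: "('r, 'k) eidx \<Rightarrow> ('r, 'k) vertex set" where
  "edge e = {fst (ends e), snd (ends e)}"

definition V :: "('r, 'k) vertex set" where "V = {v. vvalid v}"

definition EI :: "('r, 'k) eidx set" where "EI = {e. valid e}"

definition E :: "('r, 'k) vertex set set" where "E = edge ` EI"

definition C :: "nat \<Rightarrow> ('r, 'k) vertex set set" where "C i = edge ` {e \<in> EI. col e = i}"

lemma M_pos: "0 < M" "2 * L < M"
proof -
  have "1 * \<Lambda> \<le> H * \<Lambda>" using H(1) by (intro mult_right_mono) auto
  then show "2 * L < M" using \<Lambda>(1) unfolding M_def by linarith
  then show "0 < M" by simp
qed

lemma dvd_M: "L dvd M" "\<Lambda> dvd M"
  using H(2) by (auto simp: M_def)

lemma pos_less: "h < H \<Longrightarrow> pos h + L < M"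
proof -
  assume "h < H"
  then have "Suc h * \<Lambda> \<le> H * \<Lambda>" by (intro mult_right_mono) auto
  then show ?thesis using \<Lambda>(1) L by (simp add: M_def pos_def)
qed

lemma pos_mod: "pos h mod \<Lambda> = L - 1"
proof -
  have "pos h = (L - 1) + h * \<Lambda>" using L by (simp add: pos_def)
  then have "pos h mod \<Lambda> = (L - 1) mod \<Lambda>" by simp
  then show ?thesis using \<Lambda>(1) by simp
qed

lemma pos_inj: "pos h = pos h' \<longleftrightarrow> h = h'"
proof
  assume "pos h = pos h'"
  then have "h * \<Lambda> = h' * \<Lambda>" using L unfolding pos_def by linarith
  then show "h = h'" using \<Lambda>(1) by simp
qed simp

lemma Suc_mod_M: "s < M \<Longrightarrow> Suc s mod M = (if Suc s = M then 0 else Suc s)"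
  by simp

lemma pos_valid: "k \<in> Kf \<Longrightarrow> pos (lh k) < M" "k \<in> Kf \<Longrightarrow> pos (rh k) < M"
  using pos_less[of "lh k"] pos_less[of "rh k"] sections by auto

lemma node_vvalid: "k \<in> Kf \<Longrightarrow> j \<le> 2 * L + 2 \<Longrightarrow> vvalid (node k j)"
  using rings pos_valid by (auto simp: node_def)

lemma ends_vvalid:
  assumes "valid e" shows "vvalid (fst (ends e))" "vvalid (snd (ends e))"
proof -
  have "vvalid (fst (ends e)) \<and> vvalid (snd (ends e))"
  proof (cases e)
    case (RE X s)
    then show ?thesis using assms M_pos by simp
  next
    case (AE k j)
    then show ?thesis using assms by (simp add: node_vvalid)
  next
    case (DL k j)
    then show ?thesis using assms L by (auto simp: pl_def)
  next
    case (DR k j)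
    then show ?thesis using assms L by (auto simp: pr_def)
  qed
  then show "vvalid (fst (ends e))" "vvalid (snd (ends e))" by auto
qed

lemma ends_ne:
  assumes "valid e" shows "fst (ends e) \<noteq> snd (ends e)"
proof (cases e)
  case (RE X s)
  then show ?thesis using assms M_pos L by (auto simp: Suc_mod_M)
next
  case (AE k j)
  then show ?thesis using assms L by (auto simp: node_def)
qed (auto simp: pl_def pr_def)

text \<open>On a ring this needs \<open>M > 2\<close>, otherwise two indices would name the same
  vertex pair. Deleted edges can now be counted as indices.\<close>

lemma inj_edge: "inj_on edge EI"
proof (rule inj_onI)
  fix e e' assume e: "e \<in> EI" "e' \<in> EI" "edge e = edge e'"
  then have d: "(fst (ends e) = fst (ends e') \<and> snd (ends e) = snd (ends e')) \<or>
      (fst (ends e) = snd (ends e') \<and> snd (ends e) = fst (ends e'))"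
    by (auto simp: edge_def doubleton_eq_iff)
  have v: "valid e" "valid e'" using e by (auto simp: EI_def)
  show "e = e'"
  proof (cases e)
    case (RE X s)
    then show ?thesis
    proof (cases e')
      case (RE X' s')
      then show ?thesis using d v \<open>e = RE X s\<close> M_pos L by (auto simp: Suc_mod_M split: if_splits)
    qed (use d v in \<open>auto simp: node_def pl_def pr_def split: if_splits\<close>)
  next
    case (AE k j)
    then show ?thesis
      by (cases e') (use d v L in \<open>auto simp: node_def pl_def pr_def split: if_splits\<close>)
  next
    case (DL k j)
    then show ?thesis
      by (cases e') (use d v L in \<open>auto simp: node_def pl_def pr_def split: if_splits\<close>)
  next
    case (DR k j)
    then show ?thesis
      by (cases e') (use d v L in \<open>auto simp: node_def pl_def pr_def split: if_splits\<close>)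
  qed
qed

lemma finite_V: "finite V"
proof -
  have "V \<subseteq> (\<lambda>(X, s). Ring X s) ` (Rg \<times> {..<M}) \<union> (\<lambda>(k, j). Arm k j) ` (Kf \<times> {..2 * L + 1}) \<union>
      (\<lambda>(k, j). PenL k j) ` (Kf \<times> {..L}) \<union> (\<lambda>(k, j). PenR k j) ` (Kf \<times> {..L})"
  proof
    fix v assume "v \<in> V"
    then have "vvalid v" by (simp add: V_def)
    then show "v \<in> (\<lambda>(X, s). Ring X s) ` (Rg \<times> {..<M}) \<union> (\<lambda>(k, j). Arm k j) ` (Kf \<times> {..2 * L + 1}) \<union>
      (\<lambda>(k, j). PenL k j) ` (Kf \<times> {..L}) \<union> (\<lambda>(k, j). PenR k j) ` (Kf \<times> {..L})"
      by (cases v) (auto simp: image_iff)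
  qed
  then show ?thesis using fin by (meson finite_UnI finite_SigmaI finite_imageI finite_lessThan finite_atMost finite_subset)
qed

lemma finite_EI: "finite EI"
proof -
  have "EI \<subseteq> (\<lambda>(X, s). RE X s) ` (Rg \<times> {..<M}) \<union> (\<lambda>(k, j). AE k j) ` (Kf \<times> {..2 * L + 1}) \<union>
      (\<lambda>(k, j). DL k j) ` (Kf \<times> {..L}) \<union> (\<lambda>(k, j). DR k j) ` (Kf \<times> {..L})"
  proof
    fix e assume "e \<in> EI"
    then have "valid e" by (simp add: EI_def)
    then show "e \<in> (\<lambda>(X, s). RE X s) ` (Rg \<times> {..<M}) \<union> (\<lambda>(k, j). AE k j) ` (Kf \<times> {..2 * L + 1}) \<union>
      (\<lambda>(k, j). DL k j) ` (Kf \<times> {..L}) \<union> (\<lambda>(k, j). DR k j) ` (Kf \<times> {..L})"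
      by (cases e) (auto simp: image_iff)
  qed
  then show ?thesis using fin by (meson finite_UnI finite_SigmaI finite_imageI finite_lessThan finite_atMost finite_subset)
qed

lemma simple: "simple_graph V E"
proof -
  have "edge e \<subseteq> V \<and> card (edge e) = 2" if "e \<in> EI" for e
    using that ends_vvalid[of e] ends_ne[of e] by (auto simp: edge_def EI_def V_def)
  then show ?thesis using finite_V by (auto simp: simple_graph_def E_def)
qed

lemma stretch_range: "1 \<le> a \<Longrightarrow> a \<le> 2 \<Longrightarrow> 1 \<le> stretch a j \<and> stretch a j \<le> c"
  using c by (auto simp: stretch_def)

lemma stretch_ne: "1 \<le> a \<Longrightarrow> a \<le> 2 \<Longrightarrow> b \<le> 2 \<Longrightarrow> a \<noteq> b \<Longrightarrow> stretch a j \<noteq> b"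
  by (auto simp: stretch_def)

lemma col_range: "1 \<le> col e \<and> col e \<le> c"
  using c stretch_range[of 1] stretch_range[of 2]
  by (cases e) (auto simp: rcol_def acol_def Let_def)

lemma stretch_onto:
  assumes "i \<in> {1..c}" "i \<noteq> b" "a = 1 \<and> b = 2 \<or> a = 2 \<and> b = 1" "n \<ge> c - 1"
  shows "\<exists>j < n. stretch a j = i"
proof (cases "i \<le> 2")
  case True
  then have "stretch a 0 = i" using assms by (auto simp: stretch_def)
  then show ?thesis using c assms by (intro exI[of _ 0]) auto
next
  case False
  then show ?thesis using assms c by (intro exI[of _ "i - 2"]) (auto simp: stretch_def)
qed

lemma colored: "colored_graph c V E C"
proof -
  have ne': "C i \<noteq> {}" if i: "i \<in> {1..c}" for i
  proof -
    obtain k where k: "k \<in> Kf" using ne by blast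
    show ?thesis
    proof (cases "i = 2")
      case True
      then have "AE k 1 \<in> {e \<in> EI. col e = i}" using k by (auto simp: EI_def acol_def)
      then show ?thesis by (auto simp: C_def)
    next
      case False
      moreover have "c - 1 \<le> L - 1" using c by simp
      ultimately obtain j where j: "j < L - 1" "stretch 1 j = i" using stretch_onto[of i 2 1 "L - 1"] i by blast
      then have "AE k (j + 2) \<in> {e \<in> EI. col e = i}" using k by (auto simp: EI_def acol_def)
      then show ?thesis by (auto simp: C_def)
    qed
  qed
  have "disjoint_family_on C {1..c}"
    unfolding disjoint_family_on_def C_def using inj_edge by (auto simp: inj_on_def)
  moreover have "E = (\<Union>i\<in>{1..c}. C i)"
  proof
    show "E \<subseteq> (\<Union>i\<in>{1..c}. C i)"
    proof
      fix x assume "x \<in> E"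
      then obtain e where "e \<in> EI" "x = edge e" by (auto simp: E_def)
      then have "x \<in> C (col e)" "col e \<in> {1..c}" using col_range[of e] by (auto simp: C_def)
      then show "x \<in> (\<Union>i\<in>{1..c}. C i)" by blast
    qed
  qed (auto simp: E_def C_def)
  moreover have "C i = {}" if "i \<notin> {1..c}" for i using that col_range by (auto simp: C_def)
  ultimately show ?thesis using simple ne' by (auto simp: colored_graph_def)
qed

section \<open>Degrees and girth of the gadget graph\<close>

definition incident :: "('r, 'k) vertex \<Rightarrow> ('r, 'k) eidx set" where
  "incident v = {e \<in> EI. fst (ends e) = v \<or> snd (ends e) = v}"

text \<open>Injectivity allows one arm per attachment vertex from each side, and \<open>H0\<close>
  separates the sides. So a ring vertex carries at most one arm end, which bounds the degrees, and a
  ring segment with a single attachment vertex is an end of at most one arm, which makes the pieces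
  in \<open>long_cycles\<close> acyclic.\<close>

lemma slot_unique:
  assumes "k \<in> Kf" "k' \<in> Kf"
  shows "lr k = lr k' \<Longrightarrow> pos (lh k) = pos (lh k') \<Longrightarrow> k = k'"
    and "rr k = rr k' \<Longrightarrow> pos (rh k) = pos (rh k') \<Longrightarrow> k = k'"
    and "pos (lh k) \<noteq> pos (rh k')"
  using assms inj sections(1,2)[of k] sections(1,2)[of k'] by (auto simp: pos_inj inj_on_def)

lemma card_incident: "card (incident v) \<le> 3"
proof -
  have le3: "card S \<le> 3" if "S \<subseteq> {a, b, d}" for S :: "('r, 'k) eidx set" and a b d
  proof -
    have "card S \<le> card {a, b, d}" using that by (intro card_mono) auto
    also have "\<dots> \<le> 3" by (simp add: card_insert_if)
    finally show ?thesis .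
  qed
  show ?thesis
  proof (cases v)
    case (Ring X s)
    define T :: "('r, 'k) eidx set" where "T = {AE k 0 |k. k \<in> Kf \<and> lr k = X \<and> pos (lh k) = s} \<union>
      {AE k (2 * L + 1) |k. k \<in> Kf \<and> rr k = X \<and> pos (rh k) = s}"
    have "a = b" if "a \<in> T" "b \<in> T" for a b
      using that slot_unique unfolding T_def by force
    then obtain t where t: "T \<subseteq> {t}" by (metis empty_subsetI insertI1 singletonD subset_singletonD subsetI)
    have "incident v \<subseteq> {RE X s, RE X ((s + M - 1) mod M), t}"
    proof
      fix e assume "e \<in> incident v"
      then have e: "valid e" "fst (ends e) = v \<or> snd (ends e) = v" by (auto simp: incident_def EI_def)
      have "e \<in> {RE X s, RE X ((s + M - 1) mod M)} \<union> T"
      proof (cases e)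
        case (RE X' s')
        then show ?thesis using e Ring M_pos by (auto simp: Suc_mod_M split: if_splits)
      next
        case (AE k j)
        then show ?thesis using e Ring L by (auto simp: node_def T_def split: if_splits)
      qed (use e Ring in \<open>auto simp: pl_def pr_def split: if_splits\<close>)
      then show "e \<in> {RE X s, RE X ((s + M - 1) mod M), t}" using t by auto
    qed
    then show ?thesis by (rule le3)
  next
    case (Arm k j)
    have "incident v \<subseteq> {AE k (j - 1), AE k j, if j = 2 then DL k 0 else DR k 0}"
    proof
      fix e assume "e \<in> incident v"
      then have e: "valid e" "fst (ends e) = v \<or> snd (ends e) = v" by (auto simp: incident_def EI_def)
      show "e \<in> {AE k (j - 1), AE k j, if j = 2 then DL k 0 else DR k 0}"
        by (cases e) (use e Arm L in \<open>auto simp: node_def pl_def pr_def split: if_splits\<close>)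
    qed
    then show ?thesis by (rule le3)
  next
    case (PenL k j)
    have "incident v \<subseteq> {DL k (j - 1), DL k j, DL k j}"
    proof
      fix e assume "e \<in> incident v"
      then have e: "valid e" "fst (ends e) = v \<or> snd (ends e) = v" by (auto simp: incident_def EI_def)
      show "e \<in> {DL k (j - 1), DL k j, DL k j}"
        by (cases e) (use e PenL in \<open>auto simp: node_def pl_def pr_def split: if_splits\<close>)
    qed
    then show ?thesis by (rule le3)
  next
    case (PenR k j)
    have "incident v \<subseteq> {DR k (j - 1), DR k j, DR k j}"
    proof
      fix e assume "e \<in> incident v"
      then have e: "valid e" "fst (ends e) = v \<or> snd (ends e) = v" by (auto simp: incident_def EI_def)
      show "e \<in> {DR k (j - 1), DR k j, DR k j}"
        by (cases e) (use e PenR in \<open>auto simp: node_def pl_def pr_def split: if_splits\<close>)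
    qed
    then show ?thesis by (rule le3)
  qed
qed

lemma degree: "vertex_degree E v = card (incident v)"
proof -
  have "{e \<in> E. v \<in> e} = edge ` incident v"
    by (auto simp: E_def incident_def edge_def)
  moreover have "inj_on edge (incident v)" using inj_edge by (rule inj_on_subset) (auto simp: incident_def)
  ultimately show ?thesis by (simp add: vertex_degree_def card_image)
qed

text \<open>The bound is attained at vertex 2 of an arm, where its pendant path begins;
  \<open>ne\<close> provides an arm.\<close>

lemma max_degree: "max_degree V E = 3"
proof -
  obtain k where k: "k \<in> Kf" using ne by blast
  let ?D = "{AE k 1, AE k 2, DL k 0} :: ('r, 'k) eidx set"
  have "?D \<subseteq> incident (Arm k 2)"
    using k L by (auto simp: incident_def EI_def node_def pl_def)
  moreover have "finite (incident (Arm k 2))" using finite_EI by (simp add: incident_def)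
  ultimately have "card ?D \<le> card (incident (Arm k 2))" by (rule card_mono[rotated])
  then have "vertex_degree E (Arm k 2) = 3" using card_incident[of "Arm k 2"] by (simp add: degree)
  moreover have "Arm k 2 \<in> V" using k L by (simp add: V_def)
  ultimately show ?thesis unfolding max_degree_def using finite_V card_incident
    by (intro Max_eqI) (auto simp: degree image_iff intro: bexI[of _ "Arm k 2"])
qed

text \<open>Every cycle contains a ring edge from each of the \<open>\<Lambda>\<close> residue
  classes \<open>F r\<close>, and these are disjoint. The reason: removing \<open>F r\<close> cuts
  the rings into segments of \<open>\<Lambda>\<close> vertices with one attachment vertex each, so
  what remains are segments, at most two of them joined by an arm, and pendant paths. This is a
  forest.\<close>

lemma long_cycles:
  assumes cyc: "is_cycle E vs"
  shows "\<Lambda> \<le> length vs"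
proof -
  let ?cyc = "insert {last vs, hd vs} (path_edges vs)"
  define F where "F r = edge ` {RE X s |X s. valid (RE X s) \<and> s mod \<Lambda> = r}" for r
  have hits: "?cyc \<inter> F r \<noteq> {}" if r: "r < \<Lambda>" for r
  proof -
    \<comment> \<open>The forest is rooted as follows. \<open>u\<close> shifts positions so that the
      cuts end the blocks of length \<open>\<Lambda>\<close>, and \<open>ys\<close> is the place of
      the attachment vertex in its block. Ring edges point towards it, arm edges from left to right,
      pendant edges towards the arm. A left end has height 0 and a right end, the root, height
      \<open>2 * L + 2\<close>.\<close>
    define a where "a = \<Lambda> - 1 - r"
    define u where "u s = (s + a) mod M" for s
    define ys where "ys = (L - 1 + a) mod \<Lambda>"
    define base :: "'r \<Rightarrow> nat \<Rightarrow> int" where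
      "base X n = (if \<exists>k\<in>Kf. rr k = X \<and> u (pos (rh k)) div \<Lambda> = n then 2 * int L + 2 else 0)" for X n
    define ht :: "('r, 'k) vertex \<Rightarrow> int" where
      "ht v = (case v of Ring X s \<Rightarrow> base X (u s div \<Lambda>) - \<bar>int (u s mod \<Lambda>) - int ys\<bar>
        | Arm k j \<Rightarrow> int j | PenL k j \<Rightarrow> 2 - int j | PenR k j \<Rightarrow> 2 * int L - int j)" for v
    define up :: "('r, 'k) vertex \<Rightarrow> ('r, 'k) vertex" where
      "up v = (case v of Ring X s \<Rightarrow> if u s mod \<Lambda> < ys then Ring X (Suc s mod M)
          else if ys < u s mod \<Lambda> then Ring X ((s + M - 1) mod M)
          else Arm (SOME k. k \<in> Kf \<and> lr k = X \<and> pos (lh k) = s) 1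
        | Arm k j \<Rightarrow> node k (Suc j) | PenL k j \<Rightarrow> pl k (j - 1) | PenR k j \<Rightarrow> pr k (j - 1))" for v
    have ymod: "u s mod \<Lambda> = (s + a) mod \<Lambda>" for s
      using dvd_M(2) by (simp add: u_def mod_mod_cancel)
    have upos: "u (pos h) mod \<Lambda> = ys" for h
    proof -
      have "(pos h + a) mod \<Lambda> = (pos h mod \<Lambda> + a) mod \<Lambda>" by (simp add: mod_add_left_eq)
      then show ?thesis by (simp add: ymod pos_mod ys_def)
    qed
    have useg: "h = h'" if "u (pos h) div \<Lambda> = u (pos h') div \<Lambda>" "h < H" "h' < H" for h h'
    proof -
      have "u (pos h) = u (pos h) div \<Lambda> * \<Lambda> + u (pos h) mod \<Lambda>" by (rule div_mult_mod_eq[symmetric])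
      also have "\<dots> = u (pos h') div \<Lambda> * \<Lambda> + u (pos h') mod \<Lambda>" by (simp only: that(1) upos)
      also have "\<dots> = u (pos h')" by (rule div_mult_mod_eq)
      finally have "u (pos h) = u (pos h')" .
      then have eq: "(pos h + a) mod M = (pos h' + a) mod M" unfolding u_def .
      have "pos h < M" "pos h' < M" using pos_less[OF that(2)] pos_less[OF that(3)] by linarith+
      then have "pos h = pos h'" by (rule mod_shift_inj[OF _ _ eq])
      then show ?thesis by (simp add: pos_inj)
    qed
    have ht_l: "ht (node k 0) = 0" if "k \<in> Kf" for k
    proof -
      have "\<not> (\<exists>k'\<in>Kf. rr k' = lr k \<and> u (pos (rh k')) div \<Lambda> = u (pos (lh k)) div \<Lambda>)"
      proof
        assume "\<exists>k'\<in>Kf. rr k' = lr k \<and> u (pos (rh k')) div \<Lambda> = u (pos (lh k)) div \<Lambda>"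
        then obtain k' where k': "k' \<in> Kf" "u (pos (rh k')) div \<Lambda> = u (pos (lh k)) div \<Lambda>" by blast
        have "rh k' = lh k" by (rule useg[OF k'(2) sections(4)[OF k'(1)] sections(3)[OF that]])
        then show False using slot_unique(3)[of k k'] that k' by simp
      qed
      then show ?thesis by (simp add: ht_def node_def base_def upos)
    qed
    have ht_r: "ht (node k (2 * L + 2)) = 2 * int L + 2" if "k \<in> Kf" for k
      using that by (auto simp: ht_def node_def base_def upos)
    have up_l: "up (node k 0) = node k 1" if k: "k \<in> Kf" for k
    proof -
      have "(SOME k'. k' \<in> Kf \<and> lr k' = lr k \<and> pos (lh k') = pos (lh k)) = k"
      proof (rule some_equality)
        fix k' assume k': "k' \<in> Kf \<and> lr k' = lr k \<and> pos (lh k') = pos (lh k)"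
        show "k' = k" by (rule slot_unique(1)) (use k k' in simp_all)
      qed (use k in simp)
      then show ?thesis using L by (simp add: up_def node_def upos)
    qed
    show ?thesis
    proof (rule cycle_meets[OF cyc, of _ up ht])
      fix e assume "e \<in> E - F r"
      then obtain x where x: "e = edge x" "valid x" "edge x \<notin> F r" by (auto simp: E_def EI_def)
      have "(snd (ends x) = up (fst (ends x)) \<and> ht (fst (ends x)) < ht (snd (ends x))) \<or>
        (fst (ends x) = up (snd (ends x)) \<and> ht (snd (ends x)) < ht (fst (ends x)))"
      proof (cases x)
        case (RE X s)
        have "s mod \<Lambda> \<noteq> r" using x RE by (auto simp: F_def)
        then have "(s + a) mod \<Lambda> \<noteq> \<Lambda> - 1" using shift_residue[OF r, of s] by (simp add: a_def)
        then have nm: "((s + a) mod M) mod \<Lambda> \<noteq> \<Lambda> - 1" using ymod[of s] by (simp add: u_def)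
        note st = shift_step[OF dvd_M(2) M_pos(1) nm]
        have u1: "u (Suc s mod M) = Suc (u s)" "Suc (u s) div \<Lambda> = u s div \<Lambda>" "Suc (u s) mod \<Lambda> = Suc (u s mod \<Lambda>)"
          using st by (simp_all add: u_def)
        have s: "s < M" using x RE by simp
        have bk: "(Suc s mod M + M - 1) mod M = s"
          using s by (auto simp: Suc_mod_M)
        show ?thesis
        proof (cases "u s mod \<Lambda> < ys")
          case True
          then show ?thesis using RE u1 by (simp add: up_def ht_def)
        next
          case False
          then show ?thesis using RE u1 bk by (simp add: up_def ht_def)
        qed
      next
        case (AE k j)
        then have k: "k \<in> Kf" "j < 2 * L + 2" using x by auto
        have "up (node k j) = node k (Suc j)"
        proof (cases "j = 0")
          case False
          then have "node k j = Arm k j" using k by (simp add: node_def)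
          then show ?thesis by (simp add: up_def)
        qed (use up_l k in simp)
        moreover have "ht (node k j') = int j'" if "j' \<le> 2 * L + 2" for j'
        proof -
          consider "j' = 0" | "j' = 2 * L + 2" | "j' \<noteq> 0 \<and> j' \<noteq> 2 * L + 2" by linarith
          then show ?thesis
          proof cases
            case 3
            then have "node k j' = Arm k j'" by (simp add: node_def)
            then show ?thesis by (simp add: ht_def)
          qed (use ht_l ht_r k in auto)
        qed
        ultimately show ?thesis using AE k by simp
      next
        case (DL k j)
        then show ?thesis by (auto simp: up_def ht_def pl_def)
      next
        case (DR k j)
        then show ?thesis by (auto simp: up_def ht_def pr_def)
      qed
      moreover have "e = {fst (ends x), snd (ends x)}" "e = {snd (ends x), fst (ends x)}"
        unfolding x(1) edge_def by auto
      ultimately show "\<exists>a b. e = {a, b} \<and> b = up a \<and> ht a < ht b" by blast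
    qed
  qed
  have disjF: "r = r'" if F: "e \<in> F r" "e \<in> F r'" for e r r'
  proof -
    obtain X s X' s' where e: "e = edge (RE X s)" "e = edge (RE X' s')" "valid (RE X s)" "valid (RE X' s')"
      and m: "s mod \<Lambda> = r" "s' mod \<Lambda> = r'" using F unfolding F_def by blast
    have "RE X s = (RE X' s' :: ('r, 'k) eidx)"
      by (rule inj_onD[OF inj_edge trans[OF e(1)[symmetric] e(2)]]) (use e(3,4) in \<open>simp_all add: EI_def\<close>)
    then show ?thesis using m by simp
  qed
  define g where "g r = (SOME e. e \<in> ?cyc \<inter> F r)" for r
  have g: "g r \<in> ?cyc \<inter> F r" if "r < \<Lambda>" for r
  proof -
    have "\<exists>e. e \<in> ?cyc \<inter> F r" using hits[OF that] by blast
    then show ?thesis unfolding g_def by (rule someI_ex[of "\<lambda>e. e \<in> ?cyc \<inter> F r"])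
  qed
  have "inj_on g {..<\<Lambda>}"
  proof (rule inj_onI)
    fix r r' assume "r \<in> {..<\<Lambda>}" "r' \<in> {..<\<Lambda>}" "g r = g r'"
    then have "g r \<in> F r" "g r \<in> F r'" using g by (blast, metis IntD2 lessThan_iff)
    then show "r = r'" by (rule disjF)
  qed
  moreover have "g ` {..<\<Lambda>} \<subseteq> ?cyc" using g by blast
  moreover have "finite ?cyc" using path_edges_finite[of vs] by simp
  ultimately have "card {..<\<Lambda>} \<le> card ?cyc" by (rule card_inj_on_le)
  also have "card ?cyc \<le> length vs"
  proof -
    have "?cyc \<subseteq> (\<lambda>i. {vs ! i, vs ! (Suc i mod length vs)}) ` {..<length vs}"
    proof
      fix e assume "e \<in> ?cyc"
      moreover have "vs \<noteq> []" using cyc by (auto simp: is_cycle_def)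
      ultimately consider "e = {vs ! (length vs - 1), vs ! 0}" | i where "Suc i < length vs" "e = {vs ! i, vs ! Suc i}"
        by (auto simp: path_edges_def last_conv_nth hd_conv_nth)
      then show "e \<in> (\<lambda>i. {vs ! i, vs ! (Suc i mod length vs)}) ` {..<length vs}"
      proof cases
        case 1
        then show ?thesis using \<open>vs \<noteq> []\<close> by (intro image_eqI[of _ _ "length vs - 1"]) auto
      next
        case 2
        then show ?thesis by (intro image_eqI[of _ _ i]) auto
      qed
    qed
    then have "card ?cyc \<le> card ((\<lambda>i. {vs ! i, vs ! (Suc i mod length vs)}) ` {..<length vs})"
      by (rule card_mono[rotated]) simp
    also have "\<dots> \<le> card {..<length vs}" by (rule card_image_le) simp
    finally show ?thesis by simp
  qed
  finally show ?thesis by simp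
qed

lemma girth_bound: "enat \<Lambda> \<le> girth E"
  using long_cycles by (rule girth_ge)

end

section \<open>From deletion sets to phases\<close>

context gadget
begin

definition N :: nat where "N = M div L"

lemma N: "M = N * L" "N > 0"
proof -
  show 1: "M = N * L" unfolding N_def using dvd_M(1) by simp
  show "N > 0" using 1 M_pos(1) by (cases N) auto
qed

definition fires :: "('r \<Rightarrow> nat) \<Rightarrow> 'r \<Rightarrow> nat \<Rightarrow> bool" where
  "fires ph X h \<longleftrightarrow> ph X = pos h mod L"

definition consistent :: "('r \<Rightarrow> nat) \<Rightarrow> bool" where
  "consistent ph \<longleftrightarrow> (\<forall>X\<in>Rg. ph X < L) \<and>
     (\<forall>k\<in>Kf. \<not> (fires ph (lr k) (lh k) \<and> fires ph (rr k) (rh k)))"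

definition budget :: nat where "budget = card Rg * N + 3 * card Kf"

text \<open>All lower bounds come from here: a path of \<open>L\<close> edges in all colors has
  fewer vertices than \<open>\<Lambda>\<close>, hence is induced in whatever remains, and so must
  lose an edge.\<close>

lemma window_hit:
  assumes S: "S \<subseteq> E" "\<not> has_induced_colored_path c (Suc L) V (E - S) C"
    and v: "inj_on v {..L}" and e: "\<And>i. i < L \<Longrightarrow> e i \<in> EI \<and> edge (e i) = {v i, v (Suc i)}"
    and cols: "\<And>x. x \<in> {1..c} \<Longrightarrow> \<exists>i<L. col (e i) = x"
  shows "\<exists>i<L. edge (e i) \<in> S"
proof (rule ccontr)
  assume no: "\<not> (\<exists>i<L. edge (e i) \<in> S)"
  let ?vs = "map v [0..<Suc L]"
  have pe: "path_edges ?vs = (\<lambda>i. edge (e i)) ` {..<L}"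
  proof -
    have nv: "?vs ! i = v i" if "i \<le> L" for i using that by (simp del: upt_Suc)
    have "path_edges us = (\<lambda>i. {us ! i, us ! Suc i}) ` {i. Suc i < length us}" for us :: "('r, 'k) vertex list"
      by (auto simp: path_edges_def)
    from this[of ?vs] have "path_edges ?vs = (\<lambda>i. {?vs ! i, ?vs ! Suc i}) ` {i. Suc i < length ?vs}" .
    also have "{i. Suc i < length ?vs} = {..<L}" by auto
    also have "(\<lambda>i. {?vs ! i, ?vs ! Suc i}) ` {..<L} = (\<lambda>i. {v i, v (Suc i)}) ` {..<L}" by (intro image_cong) (auto simp: nv simp del: upt_Suc)
    also have "\<dots> = (\<lambda>i. edge (e i)) ` {..<L}" using e by (intro image_cong) auto
    finally show ?thesis .
  qed
  have "inj_on v (set [0..<Suc L])" using v by (rule inj_on_subset) (auto simp del: upt_Suc)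
  then have d: "distinct ?vs" by (simp add: distinct_map del: upt_Suc)
  have sub: "path_edges ?vs \<subseteq> E - S" unfolding pe using e no by (auto simp: E_def)
  have "enat (length ?vs) < girth E"
  proof -
    have "enat (length ?vs) < enat \<Lambda>" using \<Lambda>(1) L by simp
    then show ?thesis using girth_bound by (rule less_le_trans)
  qed
  then have ind: "path_edges ?vs = induced_edges (E - S) (set ?vs)"
    using induced_path_of_girth[OF simple _ d sub] by auto
  have inV: "set ?vs \<subseteq> V"
  proof
    fix x assume "x \<in> set ?vs"
    then obtain i where i: "i \<le> L" "x = v i" by (auto simp: less_Suc_eq_le simp del: upt_Suc)
    have "\<exists>j<L. v i \<in> edge (e j)"
    proof (cases "i < L")
      case True
      then show ?thesis using e[OF True] by auto
    next
      case False
      then have "i = Suc (L - 1)" "L - 1 < L" using i L by auto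
      then show ?thesis using e[of "L - 1"] by auto
    qed
    then show "x \<in> V" using e simple i by (auto simp: E_def simple_graph_def)
  qed
  have "colors C (path_edges ?vs) = {1..c}"
  proof
    show "colors C (path_edges ?vs) \<subseteq> {1..c}"
      using colored by (auto simp: colors_def colored_graph_def)
    show "{1..c} \<subseteq> colors C (path_edges ?vs)"
    proof
      fix x assume "x \<in> {1..c}"
      then obtain i where i: "i < L" "col (e i) = x" using cols by blast
      then have "edge (e i) \<in> C x \<inter> path_edges ?vs" using e[OF i(1)] unfolding pe by (auto simp: C_def)
      then show "x \<in> colors C (path_edges ?vs)" by (auto simp: colors_def)
    qed
  qed
  then have "card (colors C (path_edges ?vs)) = c" by simp
  moreover have "is_path (Suc L) (set ?vs) (path_edges ?vs)"
    unfolding is_path_def using d by (intro exI[of _ ?vs]) simp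
  ultimately have "has_induced_colored_path c (Suc L) V (E - S) C"
    unfolding has_induced_colored_path_def using inV ind by blast
  then show False using S(2) by simp
qed

text \<open>A window contains every index from 1 to \<open>L - 1\<close>. It meets at most one
  section boundary, and only index 0 is left out there.\<close>

lemma ring_window_colors: "x \<in> {1..c} \<Longrightarrow> \<exists>i<L. rcol ((s + i) mod M) = x"
proof -
  assume x: "x \<in> {1..c}"
  obtain j where j: "1 \<le> j" "j < L" "(if j = L - 1 then 2 else stretch 1 j) = x"
  proof (cases "x \<le> 2")
    case True
    have "stretch 1 (L - 2) = 1" "L - 2 \<noteq> L - 1" "1 \<le> L - 2" using c L by (auto simp: stretch_def)
    then show ?thesis using that[of "L - 1"] that[of "L - 2"] x c True by (cases "x = 2") auto
  next
    case False
    then have "stretch 1 (x - 2) = x" "x - 2 \<noteq> L - 1" "1 \<le> x - 2" "x - 2 < L" using x c by (auto simp: stretch_def)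
    then show ?thesis using that[of "x - 2"] by auto
  qed
  let ?b = "s mod \<Lambda>"
  have b: "?b < \<Lambda>" using \<Lambda>(1) by simp
  have smod: "((s + i) mod M) mod \<Lambda> = (?b + i) mod \<Lambda>" for i
    using dvd_M(2) by (simp add: mod_mod_cancel mod_add_left_eq)
  have "\<exists>i<L. ((?b + i) mod \<Lambda> + 1) mod L = j"
  proof -
    \<comment> \<open>\<open>t\<close> is the offset of index \<open>j\<close> if no boundary
      intervenes. Behind a boundary the index runs one ahead, so \<open>t - 1\<close> is taken; the
      boundary itself would mean index 0, but \<open>j\<close> is positive.\<close>
    define t where "t = (j + (L - (?b + 1) mod L)) mod L"
    have t: "t < L" "(?b + 1 + t) mod L = j"
    proof -
      show "t < L" using L by (simp add: t_def)
      have "(?b + 1 + t) mod L = ((?b + 1) mod L + (j + (L - (?b + 1) mod L))) mod L"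
        unfolding t_def by (simp only: mod_add_left_eq mod_add_right_eq)
      also have "(?b + 1) mod L + (j + (L - (?b + 1) mod L)) = j + L"
        using mod_less_divisor[of L "?b + 1"] L by linarith
      finally show "(?b + 1 + t) mod L = j" using j(2) by simp
    qed
    show ?thesis
    proof (cases "?b + t < \<Lambda>")
      case True
      then have "((?b + t) mod \<Lambda> + 1) mod L = j" using t(2) by (simp add: add.commute add.left_commute)
      then show ?thesis using t(1) by blast
    next
      case False
      then have "t \<ge> 1" using b by (cases t) auto
      show ?thesis
      proof (cases "?b + (t - 1) < \<Lambda>")
        case True
        then have "?b + t = \<Lambda>" using False by linarith
        then have "j = (\<Lambda> + 1) mod L" using t(2) by (simp add: add.commute add.left_commute)
        also have "\<dots> = (\<Lambda> mod L + 1) mod L" by (rule mod_add_left_eq[symmetric])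
        also have "\<dots> = 0" using \<Lambda>(2) L by simp
        finally show ?thesis using j(1) by simp
      next
        case F2: False
        let ?i = "t - 1"
        have "(?b + ?i) mod \<Lambda> = (?b + ?i - \<Lambda>) mod \<Lambda>" using F2 by (intro le_mod_geq) simp
        also have "\<dots> = ?b + ?i - \<Lambda>" by (rule mod_less) (use b t(1) \<Lambda>(1) in linarith)
        finally have m: "(?b + ?i) mod \<Lambda> = ?b + ?i - \<Lambda>" .
        let ?r = "?b + ?i - \<Lambda> + 1"
        have "j = (?r + (\<Lambda> + 1)) mod L" using t(2) F2 \<open>t \<ge> 1\<close> by (simp add: add.commute add.left_commute)
        also have "\<dots> = (?r + (\<Lambda> + 1) mod L) mod L" by (rule mod_add_right_eq[symmetric])
        also have "(\<Lambda> + 1) mod L = 0"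
        proof -
          have "(\<Lambda> + 1) mod L = (\<Lambda> mod L + 1) mod L" by (rule mod_add_left_eq[symmetric])
          then show ?thesis using \<Lambda>(2) L by simp
        qed
        finally have "((?b + ?i) mod \<Lambda> + 1) mod L = j" unfolding m by simp
        then show ?thesis using t(1) by (intro exI[of _ ?i]) simp
      qed
    qed
  qed
  then obtain i where i: "i < L" "((?b + i) mod \<Lambda> + 1) mod L = j" by blast
  then have "rcol ((s + i) mod M) = x" using j by (simp add: rcol_def smod Let_def)
  then show ?thesis using i by blast
qed

lemma arm_window:
  assumes S: "S \<subseteq> E" "\<not> has_induced_colored_path c (Suc L) V (E - S) C" and k: "k \<in> Kf"
    and j: "1 \<le> j" "j \<le> Suc L" and cols: "\<And>x. x \<in> {1..c} \<Longrightarrow> \<exists>i<L. acol (j + i) = x"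
  shows "\<exists>i<L. edge (AE k (j + i)) \<in> S"
proof (rule window_hit[OF S, where v = "\<lambda>i. node k (j + i)"])
  show "inj_on (\<lambda>i. node k (j + i)) {..L}" using j by (auto simp: inj_on_def node_def)
qed (use k j cols in \<open>auto simp: EI_def edge_def\<close>)

text \<open>Read backwards from an attachment vertex, the indices are
  \<open>L - 1, L - 2, ..., 1\<close>, so the \<open>L - 1\<close> ring edges before it show all
  colors.\<close>

lemma pos_back: "i < L \<Longrightarrow> rcol (pos h - 1 - i) = (let j = L - 1 - i in if j = L - 1 then 2 else if j = 0 then 2 else stretch 1 j) \<or> i = L - 1"
proof (cases "i = L - 1")
  case False
  assume i: "i < L"
  have "pos h - 1 - i = (L - 2 - i) + h * \<Lambda>" using i False L by (simp add: pos_def)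
  then have "(pos h - 1 - i) mod \<Lambda> = (L - 2 - i) mod \<Lambda>" by simp
  then have "(pos h - 1 - i) mod \<Lambda> = L - 2 - i" using \<Lambda>(1) by simp
  then have "((pos h - 1 - i) mod \<Lambda> + 1) mod L = L - 1 - i" using i False by simp
  then show ?thesis using i False by (simp add: rcol_def Let_def)
qed simp

lemma consistent_of_deletion:
  assumes S: "S \<subseteq> E" "card S \<le> budget" "\<not> has_induced_colored_path c (Suc L) V (E - S) C"
  shows "\<exists>ph. consistent ph"
proof -
  note hit = window_hit[OF S(1,3)]
  define T where "T = {e \<in> EI. edge e \<in> S}"
  have finT: "finite T" using finite_EI by (simp add: T_def)
  have "T \<subseteq> EI" by (auto simp: T_def)
  then have "card T = card (edge ` T)" using inj_edge inj_on_subset by (metis card_image)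
  also have "edge ` T = S" using S(1) by (auto simp: T_def E_def)
  finally have cardT: "card T \<le> budget" using S(2) by simp
  define J :: "('r + 'k \<times> nat) set" where "J = Inl ` Rg \<union> Inr ` (Kf \<times> {0, 1, 2})"
  \<comment> \<open>The edges \<open>L + 2\<close> to \<open>2 * L - 1\<close> of an arm are
    deliberately in no part: a deletion set within the budget then cannot contain them.\<close>
  define part :: "'r + 'k \<times> nat \<Rightarrow> ('r, 'k) eidx set" where
    "part p = (case p of Inl X \<Rightarrow> range (RE X)
      | Inr (k, i) \<Rightarrow> if i = 0 then {AE k 0, AE k 1} \<union> range (DL k)
          else if i = 1 then {AE k (2 * L + 1), AE k (2 * L)} \<union> range (DR k)
          else AE k ` {2..Suc L})" for p
  define need :: "'r + 'k \<times> nat \<Rightarrow> nat" where "need p = (case p of Inl X \<Rightarrow> N | Inr _ \<Rightarrow> 1)" for p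
  have sumneed: "(\<Sum>p\<in>J. need p) = budget"
  proof -
    have "(\<Sum>p\<in>J. need p) = (\<Sum>p\<in>Inl ` Rg. need p) + (\<Sum>p\<in>Inr ` (Kf \<times> {0, 1, 2}). need p)"
      unfolding J_def using fin by (intro sum.union_disjoint) auto
    also have "(\<Sum>p\<in>Inl ` Rg. need p) = card Rg * N" by (simp add: sum.reindex need_def)
    also have "(\<Sum>p\<in>Inr ` (Kf \<times> {0, 1, 2 :: nat}). need p) = card (Kf \<times> {0, 1, 2 :: nat})"
      by (simp add: sum.reindex need_def)
    finally show ?thesis by (simp add: budget_def card_cartesian_product)
  qed
  have disj: "disjoint_family_on part J"
    unfolding disjoint_family_on_def J_def part_def using L by (auto split: if_splits)
  define A where "A X = {s. RE X s \<in> T}" for X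
  have AM: "A X \<subseteq> {..<M}" for X by (auto simp: A_def T_def EI_def)
  have cardA: "card (T \<inter> part (Inl X)) = card (A X)" for X
  proof -
    have "T \<inter> part (Inl X) = RE X ` A X" by (auto simp: A_def part_def)
    then show ?thesis by (simp add: card_image inj_on_def)
  qed
  have ring: "\<exists>i<L. (s + i) mod M \<in> A X" if X: "X \<in> Rg" for X s
  proof -
    have "\<exists>i<L. edge (RE X ((s + i) mod M)) \<in> S"
    proof (rule hit[where v = "\<lambda>i. Ring X ((s + i) mod M)"])
      show "inj_on (\<lambda>i. Ring X ((s + i) mod M)) {..L}"
      proof (rule inj_onI)
        fix i j assume ij: "i \<in> {..L}" "j \<in> {..L}" "Ring X ((s + i) mod M) = Ring X ((s + j) mod M)"
        then have "(i + s) mod M = (j + s) mod M" by (simp add: add.commute)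
        then show "i = j" by (rule mod_shift_inj[rotated 2]) (use ij M_pos(2) in auto)
      qed
      fix i
      have "Suc ((s + i) mod M) mod M = (s + Suc i) mod M" by (simp add: mod_Suc_eq)
      then show "RE X ((s + i) mod M) \<in> EI \<and>
          edge (RE X ((s + i) mod M)) = {Ring X ((s + i) mod M), Ring X ((s + Suc i) mod M)}"
        using X M_pos by (simp add: EI_def edge_def)
    qed (use ring_window_colors in auto)
    then show ?thesis using X M_pos by (auto simp: A_def T_def EI_def)
  qed
  have penL: "\<exists>i<L. edge (if i < 2 then AE k i else DL k (i - 2)) \<in> S" if k: "k \<in> Kf" for k
  proof (rule hit[where v = "\<lambda>i. if i \<le> 2 then node k i else PenL k (i - 2)"])
    show "inj_on (\<lambda>i. if i \<le> 2 then node k i else PenL k (i - 2)) {..L}"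
      using L by (auto simp: inj_on_def node_def)
    fix x assume x: "x \<in> {1..c}"
    show "\<exists>i<L. col (if i < 2 then AE k i else DL k (i - 2)) = x"
    proof (cases "x \<le> 2")
      case True
      then have "col (if x - 1 < 2 then AE k (x - 1) else DL k (x - 1 - 2)) = x"
        using x by (cases "x = 1") (auto simp: acol_def)
      then show ?thesis using L True by (intro exI[of _ "x - 1"]) auto
    next
      case False
      then show ?thesis using x c by (intro exI[of _ "x - 1"]) (auto simp: stretch_def)
    qed
  next
    fix i assume "i < L"
    then show "(if i < 2 then AE k i else DL k (i - 2)) \<in> EI \<and> edge (if i < 2 then AE k i else DL k (i - 2)) =
        {if i \<le> 2 then node k i else PenL k (i - 2), if Suc i \<le> 2 then node k (Suc i) else PenL k (Suc i - 2)}"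
      using k L by (auto simp: EI_def edge_def pl_def node_def Suc_diff_le less_Suc_eq_le numeral_2_eq_2)
  qed
  have penR: "\<exists>i<L. edge (if i < 2 then AE k (2 * L + 1 - i) else DR k (i - 2)) \<in> S" if k: "k \<in> Kf" for k
  proof (rule hit[where v = "\<lambda>i. if i \<le> 2 then node k (2 * L + 2 - i) else PenR k (i - 2)"])
    show "inj_on (\<lambda>i. if i \<le> 2 then node k (2 * L + 2 - i) else PenR k (i - 2)) {..L}"
      using L by (auto simp: inj_on_def node_def)
    fix x assume x: "x \<in> {1..c}"
    show "\<exists>i<L. col (if i < 2 then AE k (2 * L + 1 - i) else DR k (i - 2)) = x"
    proof (cases "x \<le> 2")
      case True
      show ?thesis
      proof (cases "x = 1")
        case True
        then show ?thesis using L by (intro exI[of _ 0]) (auto simp: acol_def)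
      next
        case False
        then show ?thesis using L c x True by (intro exI[of _ c]) auto
      qed
    next
      case False
      then show ?thesis using x c by (intro exI[of _ "x - 1"]) (auto simp: stretch_def)
    qed
  next
    fix i assume i: "i < L"
    consider "i = 0" | "i = 1" | "i \<ge> 2" by linarith
    then show "(if i < 2 then AE k (2 * L + 1 - i) else DR k (i - 2)) \<in> EI \<and> edge (if i < 2 then AE k (2 * L + 1 - i) else DR k (i - 2)) =
        {if i \<le> 2 then node k (2 * L + 2 - i) else PenR k (i - 2), if Suc i \<le> 2 then node k (2 * L + 2 - Suc i) else PenR k (Suc i - 2)}"
    proof cases
      case 3
      then show ?thesis using k L i by (auto simp: EI_def edge_def pr_def node_def Suc_diff_le)
    qed (use k L in \<open>auto simp: EI_def edge_def node_def insert_commute\<close>)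
  qed
  have cross: "\<exists>i<L. edge (AE k (2 + i)) \<in> S" if k: "k \<in> Kf" for k
  proof (rule arm_window[OF S(1,3) k])
    fix x assume x: "x \<in> {1..c}"
    show "\<exists>i<L. acol (2 + i) = x"
    proof (cases "x = 2")
      case True
      then show ?thesis using L by (intro exI[of _ "L - 1"]) (auto simp: acol_def stretch_def)
    next
      case False
      then obtain i where "i < L - 1" "stretch 1 i = x" using stretch_onto[of x 2 1 "L - 1"] x c by fastforce
      then show ?thesis by (intro exI[of _ i]) (auto simp: acol_def)
    qed
  qed (use L in auto)
  \<comment> \<open>This window and the next one contribute no lower bound of their own. They
    restrict where the single deletions of the parts may lie.\<close>
  have armL: "\<exists>i<L. edge (AE k (1 + i)) \<in> S" if k: "k \<in> Kf" for k
  proof (rule arm_window[OF S(1,3) k])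
    fix x assume x: "x \<in> {1..c}"
    show "\<exists>i<L. acol (1 + i) = x"
    proof (cases "x = 2")
      case True
      then show ?thesis using L by (intro exI[of _ 0]) (auto simp: acol_def)
    next
      case False
      then obtain i where "i < L - 1" "stretch 1 i = x" using stretch_onto[of x 2 1 "L - 1"] x c by fastforce
      then show ?thesis by (intro exI[of _ "Suc i"]) (auto simp: acol_def)
    qed
  qed (use L in auto)
  have armR: "\<exists>i<L. edge (AE k (Suc L + i)) \<in> S" if k: "k \<in> Kf" for k
  proof (rule arm_window[OF S(1,3) k])
    fix x assume x: "x \<in> {1..c}"
    show "\<exists>i<L. acol (Suc L + i) = x"
    proof (cases "x = 1")
      case True
      then show ?thesis using L by (intro exI[of _ "L - 1"]) (auto simp: acol_def)
    next
      case False
      then obtain i where "i < L - 1" "stretch 2 i = x" using stretch_onto[of x 1 2 "L - 1"] x c by fastforce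
      then show ?thesis by (intro exI[of _ i]) (auto simp: acol_def)
    qed
  qed (use L in auto)
  \<comment> \<open>\<open>e0\<close> stands for the outermost edge at either end of an arm, with
    outer vertex \<open>u\<close>. The path continues with the \<open>L - 1\<close> ring edges
    before the attachment vertex.\<close>
  have slot: "\<exists>i<L. edge (if i = 0 then e0 else RE X (pos h - i)) \<in> S"
    if X: "X \<in> Rg" "h < H" and e0: "e0 \<in> EI" "edge e0 = {u, Ring X (pos h)}" "col e0 = 1" "\<And>s. u \<noteq> Ring X s" for X h e0 u
  proof (rule hit[where v = "\<lambda>i. if i = 0 then u else Ring X (pos h - (i - 1))"])
    have P: "pos h \<ge> L - 1" "pos h < M" using pos_less[OF X(2)] by (auto simp: pos_def)
    show "inj_on (\<lambda>i. if i = 0 then u else Ring X (pos h - (i - 1))) {..L}"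
    proof (rule inj_onI)
      fix i j assume "i \<in> {..L}" "j \<in> {..L}" "(if i = 0 then u else Ring X (pos h - (i - 1))) = (if j = 0 then u else Ring X (pos h - (j - 1)))"
      then show "i = j" by (cases "i = 0"; cases "j = 0") (use P e0(4) e0(4)[symmetric] in auto)
    qed
    fix x assume x: "x \<in> {1..c}"
    show "\<exists>i<L. col (if i = 0 then e0 else RE X (pos h - i)) = x"
    proof (cases "x = 1")
      case True
      then show ?thesis using L e0 by (intro exI[of _ 0]) auto
    next
      case False
      have r: "rcol (pos h - Suc i) = (if i = 0 then 2 else stretch 1 (L - 1 - i))" if "i < L - 1" for i
        using pos_back[of i h] that L by (auto simp: Let_def)
      show ?thesis
      proof (cases "x = 2")
        case True
        then show ?thesis using L r[of 0] by (intro exI[of _ 1]) auto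
      next
        case x2: False
        \<comment> \<open>Color \<open>x > 2\<close> has index \<open>x - 2\<close>, which lies
          \<open>L + 1 - x\<close> edges behind index \<open>L - 1\<close>.\<close>
        have "L - 1 - (L + 1 - x) = x - 2" using x x2 False c by auto
        then have "rcol (pos h - Suc (L + 1 - x)) = x"
          using r[of "L + 1 - x"] x x2 False c by (auto simp: stretch_def)
        then show ?thesis using x x2 False c by (intro exI[of _ "Suc (L + 1 - x)"]) auto
      qed
    qed
  next
    have P: "pos h \<ge> L - 1" "pos h < M" using pos_less[OF X(2)] by (auto simp: pos_def)
    fix i assume i: "i < L"
    show "(if i = 0 then e0 else RE X (pos h - i)) \<in> EI \<and> edge (if i = 0 then e0 else RE X (pos h - i)) =
        {if i = 0 then u else Ring X (pos h - (i - 1)), if Suc i = 0 then u else Ring X (pos h - (Suc i - 1))}"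
    proof (cases "i = 0")
      case False
      then have "Suc (pos h - i) mod M = pos h - (i - 1)" using P i by simp
      then show ?thesis using False X P i by (auto simp: EI_def edge_def)
    qed (use e0 in auto)
  qed
  have lower: "need p \<le> card (T \<inter> part p)" if pJ: "p \<in> J" for p
  proof (cases p)
    case (Inl X)
    then have "X \<in> Rg" using pJ by (auto simp: J_def)
    then have "N \<le> card (A X)" using cyclic_windows(1)[OF AM, of L N] N L ring by auto
    then show ?thesis using Inl by (simp add: need_def cardA)
  next
    case (Inr ki)
    then obtain k i where ki: "p = Inr (k, i)" "k \<in> Kf" "i \<in> {0, 1, 2}" using pJ by (auto simp: J_def)
    have mem: "e \<in> T" if "edge e \<in> S" "valid e" for e using that by (auto simp: T_def EI_def)
    have "T \<inter> part p \<noteq> {}"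
    proof -
      consider "i = 0" | "i = 1" | "i = 2" using ki by auto
      then show ?thesis
      proof cases
        case 1
        obtain a where a: "a < L" "edge (if a < 2 then AE k a else DL k (a - 2)) \<in> S" using penL ki by blast
        then have "(if a < 2 then AE k a else DL k (a - 2)) \<in> T" using ki L by (intro mem) auto
        moreover have "(if a < 2 then AE k a else DL k (a - 2)) \<in> part p"
          using 1 ki by (cases "a = 0"; cases "a = 1") (auto simp: part_def)
        ultimately show ?thesis by blast
      next
        case 2
        obtain a where a: "a < L" "edge (if a < 2 then AE k (2 * L + 1 - a) else DR k (a - 2)) \<in> S" using penR ki by blast
        then have "(if a < 2 then AE k (2 * L + 1 - a) else DR k (a - 2)) \<in> T" using ki L by (intro mem) auto
        moreover have "(if a < 2 then AE k (2 * L + 1 - a) else DR k (a - 2)) \<in> part p"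
          using 2 ki by (cases "a = 0"; cases "a = 1") (auto simp: part_def)
        ultimately show ?thesis by blast
      next
        case 3
        obtain a where a: "a < L" "edge (AE k (2 + a)) \<in> S" using cross ki by blast
        then have "AE k (2 + a) \<in> T" using ki L by (intro mem) auto
        moreover have "AE k (2 + a) \<in> part p" using 3 ki a by (auto simp: part_def)
        ultimately show ?thesis by blast
      qed
    qed
    then have "card (T \<inter> part p) > 0" using finT by (simp add: card_gt_0_iff)
    then show ?thesis using ki by (simp add: need_def)
  qed
  have finJ: "finite J" using fin by (simp add: J_def)
  note tight = tight_cover[OF finJ finT disj lower cardT[folded sumneed]]
  have rX: "\<exists>r<L. \<forall>s<M. s \<in> A X \<longleftrightarrow> s mod L = r" if X: "X \<in> Rg" for X
  proof (rule cyclic_windows(2)[OF AM, of L N])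
    show "card (A X) = N" using tight(1)[of "Inl X"] X by (simp add: J_def need_def cardA)
  qed (use N L ring[OF X] in auto)
  have "\<exists>ph. \<forall>X\<in>Rg. ph X < L \<and> (\<forall>s<M. s \<in> A X \<longleftrightarrow> s mod L = ph X)"
    by (rule bchoice) (use rX in blast)
  then obtain ph where ph: "\<And>X. X \<in> Rg \<Longrightarrow> ph X < L"
    "\<And>X s. X \<in> Rg \<Longrightarrow> s < M \<Longrightarrow> s \<in> A X \<longleftrightarrow> s mod L = ph X" by blast
  have one: "e = e'" if "e \<in> T" "e' \<in> T" "e \<in> part (Inr (k, i))" "e' \<in> part (Inr (k, i))" "k \<in> Kf" "i \<in> {0, 1, 2}" for e e' k i
  proof -
    have "card (T \<inter> part (Inr (k, i))) = 1" using tight(1)[of "Inr (k, i)"] that by (auto simp: J_def need_def)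
    then obtain z where z: "T \<inter> part (Inr (k, i)) = {z}" by (auto simp: card_1_singleton_iff)
    have "e \<in> {z}" "e' \<in> {z}" unfolding z[symmetric] using that by auto
    then show ?thesis by simp
  qed
  \<comment> \<open>If the ring has the phase of the attachment vertex, the \<open>L - 1\<close>
    edges before it have other residues and survive, so the hit in \<open>slot\<close> is
    \<open>e0\<close>.\<close>
  have first: "e0 \<in> T" if fs: "X \<in> Rg" "h < H" "e0 \<in> EI" "edge e0 = {u, Ring X (pos h)}" "col e0 = 1" "\<And>s. u \<noteq> Ring X s" "fires ph X h" for X h e0 u
  proof -
    obtain i where i: "i < L" "edge (if i = 0 then e0 else RE X (pos h - i)) \<in> S" using slot[OF fs(1-6)] by blast
    have P: "pos h \<ge> L - 1" "pos h < M" using pos_less[OF fs(2)] by (auto simp: pos_def)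
    show ?thesis
    proof (cases "i = 0")
      case True
      then show ?thesis using i fs by (simp add: T_def)
    next
      case False
      then have "RE X (pos h - i) \<in> T" using i fs P by (simp add: T_def EI_def)
      then have "pos h - i \<in> A X" by (simp add: A_def)
      then have "(pos h - i) mod L = pos h mod L" using ph(2)[OF fs(1), of "pos h - i"] P fs(7) by (simp add: fires_def)
      then have "L dvd i" using P i(1) mod_eq_dvd_iff_nat[of "pos h - i" "pos h" L] by auto
      then show ?thesis using False i(1) by (auto dest: dvd_imp_le)
    qed
  qed
  \<comment> \<open>Both outermost edges are deleted, hence edges 1 and \<open>2 * L\<close> are
    not. The window at 1 then needs a deletion among the edges 2 to \<open>L\<close> and the window
    at \<open>L + 1\<close> needs edge \<open>L + 1\<close>; but these lie in the same part, which
    has only one deletion.\<close>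
  have "\<not> (fires ph (lr k) (lh k) \<and> fires ph (rr k) (rh k))" if k: "k \<in> Kf" for k
  proof
    assume f: "fires ph (lr k) (lh k) \<and> fires ph (rr k) (rh k)"
    have a0: "AE k 0 \<in> T"
      by (rule first[of "lr k" "lh k" _ "Arm k 1"])
        (use k f L rings sections in \<open>auto simp: EI_def edge_def node_def acol_def insert_commute\<close>)
    have b0: "AE k (2 * L + 1) \<in> T"
      by (rule first[of "rr k" "rh k" _ "Arm k (2 * L + 1)"])
        (use k f L rings sections in \<open>auto simp: EI_def edge_def node_def acol_def\<close>)
    have "AE k 1 \<notin> T" using one[OF a0, of "AE k 1" k 0] k by (auto simp: part_def)
    moreover obtain i where i: "i < L" "edge (AE k (1 + i)) \<in> S" using armL k by blast
    moreover have iT: "AE k (1 + i) \<in> T" using i k by (auto simp: T_def EI_def)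
    ultimately have i0: "i \<noteq> 0" by (cases i) auto
    have "AE k (2 * L) \<notin> T" using one[OF b0, of "AE k (2 * L)" k 1] k by (auto simp: part_def)
    moreover obtain i' where i': "i' < L" "edge (AE k (Suc L + i')) \<in> S" using armR k by blast
    moreover have iT': "AE k (Suc L + i') \<in> T" using i' k by (auto simp: T_def EI_def)
    ultimately have i'0: "i' \<noteq> L - 1" using L by (cases "i' = L - 1") (auto simp: mult_2)
    obtain p where p: "p \<in> J" "AE k (Suc L + i') \<in> part p" using tight(2) iT' by blast
    \<comment> \<open>Edge \<open>2 * L\<close> is already excluded, and the edges strictly between
      \<open>L + 1\<close> and \<open>2 * L\<close> lie in no part.\<close>
    have "i' = 0"
    proof (rule ccontr)
      assume "i' \<noteq> 0"
      then show False using p i' i'0 L by (auto simp: J_def part_def split: if_splits)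
    qed
    then have "AE k (Suc L) \<in> T" using iT' by simp
    then have "AE k (1 + i) = (AE k (Suc L) :: ('r, 'k) eidx)" using one[OF iT, of "AE k (Suc L)" k 2] k i i0 L by (auto simp: part_def)
    then show False using i by simp
  qed
  then have "consistent ph" using ph(1) by (auto simp: consistent_def)
  then show ?thesis by blast
qed

end

section \<open>From phases to deletion sets\<close>

text \<open>Labels that stay constant along undeleted edges: block \<open>n\<close> of ring
  \<open>X\<close> together with a stub on it, and the left and right remainders of an arm.\<close>

datatype ('r, 'k) comp = RC 'r nat | LA 'k | RA 'k

context gadget
begin

context
  fixes ph :: "'r \<Rightarrow> nat"
  assumes cons: "consistent ph"
begin

abbreviation "fireL k \<equiv> fires ph (lr k) (lh k)"
abbreviation "fireR k \<equiv> fires ph (rr k) (rh k)"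

text \<open>Either the outermost arm edge or the next one is deleted, depending on whether the end
  fires. In the middle, edge \<open>L\<close> shortens the left piece, as is necessary when the left
  end fires; otherwise edge \<open>L + 1\<close> shortens the right piece.\<close>

fun cut :: "('r, 'k) eidx \<Rightarrow> bool" where
  "cut (RE X s) \<longleftrightarrow> s mod L = ph X"
| "cut (AE k j) \<longleftrightarrow> j = (if fireL k then 0 else 1) \<or> j = (if fireR k then 2 * L + 1 else 2 * L) \<or>
     j = (if fireL k then L else L + 1)"
| "cut (DL k j) \<longleftrightarrow> False"
| "cut (DR k j) \<longleftrightarrow> False"

definition u :: "'r \<Rightarrow> nat \<Rightarrow> nat" where "u X s = (s + (L - 1 - ph X)) mod M"

definition comp :: "('r, 'k) vertex \<Rightarrow> ('r, 'k) comp" where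
  "comp v = (case v of Ring X s \<Rightarrow> RC X (u X s div L)
     | Arm k j \<Rightarrow> if j = 1 then (if fireL k then LA k else RC (lr k) (u (lr k) (pos (lh k)) div L))
         else if j = 2 * L + 1 then (if fireR k then RA k else RC (rr k) (u (rr k) (pos (rh k)) div L))
         else if j \<le> (if fireL k then L else L + 1) then LA k else RA k
     | PenL k j \<Rightarrow> LA k | PenR k j \<Rightarrow> RA k)"

lemma phL: "X \<in> Rg \<Longrightarrow> ph X < L"
  using cons by (simp add: consistent_def)

lemma not_both: "k \<in> Kf \<Longrightarrow> \<not> (fireL k \<and> fireR k)"
  using cons by (simp add: consistent_def)

lemma u_mod: "u X s mod L = (s + (L - 1 - ph X)) mod L"
  using dvd_M(1) by (simp add: u_def mod_mod_cancel)

lemma cut_iff: "X \<in> Rg \<Longrightarrow> u X s mod L = L - 1 \<longleftrightarrow> s mod L = ph X"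
  unfolding u_mod by (rule shift_residue) (rule phL)

lemma uncut_step:
  assumes "X \<in> Rg" and "s mod L \<noteq> ph X"
  shows "u X (Suc s mod M) = Suc (u X s)" "Suc (u X s) div L = u X s div L"
    "Suc (u X s) mod L = Suc (u X s mod L)"
proof -
  have "((s + (L - 1 - ph X)) mod M) mod L \<noteq> L - 1"
    using cut_iff[OF assms(1), of s] assms(2) by (simp add: u_def)
  note st = shift_step[OF dvd_M(1) M_pos(1) this]
  show "u X (Suc s mod M) = Suc (u X s)" "Suc (u X s) div L = u X s div L"
    "Suc (u X s) mod L = Suc (u X s mod L)"
    using st by (simp_all add: u_def)
qed

lemma u_inj: "s < M \<Longrightarrow> s' < M \<Longrightarrow> u X s = u X s' \<Longrightarrow> s = s'"
  unfolding u_def by (rule mod_shift_inj)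

lemma u_inj': "s < M \<Longrightarrow> s' < M \<Longrightarrow> u X s div L = u X s' div L \<Longrightarrow> u X s mod L = u X s' mod L \<Longrightarrow> s = s'"
proof (rule u_inj)
  assume a: "u X s div L = u X s' div L" "u X s mod L = u X s' mod L"
  have "u X s = u X s div L * L + u X s mod L" by (rule div_mult_mod_eq[symmetric])
  also have "\<dots> = u X s' div L * L + u X s' mod L" by (simp only: a)
  also have "\<dots> = u X s'" by (rule div_mult_mod_eq)
  finally show "u X s = u X s'" .
qed

text \<open>Attachment vertices are congruent modulo \<open>\<Lambda>\<close>, and
  \<open>\<Lambda>\<close> exceeds the block length \<open>L\<close>. So a block holds at most one
  of them and has at most one stub.\<close>

lemma slot_segment:
  assumes "h < H" "h' < H" and "u X (pos h) div L = u X (pos h') div L"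
  shows "h = h'"
proof -
  let ?a = "L - 1 - ph X"
  have m: "u X (pos g) mod \<Lambda> = (L - 1 + ?a) mod \<Lambda>" for g
  proof -
    have "u X (pos g) mod \<Lambda> = (pos g + ?a) mod \<Lambda>" using dvd_M(2) by (simp add: u_def mod_mod_cancel)
    also have "\<dots> = (pos g mod \<Lambda> + ?a) mod \<Lambda>" by (rule mod_add_left_eq[symmetric])
    finally show ?thesis by (simp add: pos_mod)
  qed
  have eqm: "u X (pos h) mod \<Lambda> = u X (pos h') mod \<Lambda>" by (simp only: m)
  have less: "b = a" if "a \<le> b" "a div L = b div L" "a mod \<Lambda> = b mod \<Lambda>" for a b
  proof -
    have "b - a < L"
    proof -
      have 1: "b = b div L * L + b mod L" by (rule div_mult_mod_eq[symmetric])
      have 2: "a = b div L * L + a mod L" unfolding that(2)[symmetric] by (rule div_mult_mod_eq[symmetric])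
      have "b mod L < L" using L by simp
      then show ?thesis using 1 2 L by linarith
    qed
    moreover have "\<Lambda> dvd b - a" using that(1,3) mod_eq_dvd_iff_nat[of a b \<Lambda>] by auto
    ultimately have "b - a = 0" using \<Lambda>(1) dvd_imp_le[of \<Lambda> "b - a"] by (cases "b - a = 0") auto
    then show ?thesis using that(1) by simp
  qed
  have "u X (pos h) = u X (pos h')"
    using less[of "u X (pos h)" "u X (pos h')"] less[of "u X (pos h')" "u X (pos h)"] assms(3) eqm by (metis nat_le_linear)
  then have "pos h = pos h'" by (rule u_inj[rotated 2]) (use pos_less[OF assms(1)] pos_less[OF assms(2)] in auto)
  then show ?thesis by (simp add: pos_inj)
qed

lemma comp_edge:
  assumes "valid e" "\<not> cut e"
  shows "comp (fst (ends e)) = comp (snd (ends e))"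
proof (cases e)
  case (RE X s)
  then show ?thesis using assms uncut_step[of X s] by (simp add: comp_def)
next
  case (AE k j)
  then have k: "k \<in> Kf" "j < 2 * L + 2" "\<not> cut (AE k j)" using assms by auto
  consider "j = 0" | "j = 1" | "2 \<le> j \<and> j \<le> 2 * L - 1" | "j = 2 * L" | "j = 2 * L + 1" using k by linarith
  then show ?thesis
  proof cases
    case 1
    then show ?thesis using AE k L by (auto simp: comp_def node_def split: if_splits)
  next
    case 2
    then show ?thesis using AE k L by (auto simp: comp_def node_def split: if_splits)
  next
    case 3
    then show ?thesis using AE k L by (auto simp: comp_def node_def split: if_splits)
  next
    case 4
    then show ?thesis using AE k L by (auto simp: comp_def node_def split: if_splits)
  next
    case 5
    then show ?thesis using AE k L by (auto simp: comp_def node_def split: if_splits)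
  qed
next
  case (DL k j)
  then show ?thesis using L by (auto simp: comp_def pl_def)
next
  case (DR k j)
  then show ?thesis using L by (auto simp: comp_def pr_def)
qed

definition deleted :: "('r, 'k) vertex set set" where
  "deleted = edge ` {e \<in> EI. cut e}"

lemma card_deleted: "card deleted \<le> budget"
proof -
  define R where "R = {e \<in> EI. cut e \<and> (\<exists>X s. e = RE X s)}"
  define T where "T = {e \<in> EI. cut e \<and> (\<exists>k j. e = AE k j)}"
  have "R \<subseteq> (\<lambda>(X, n). RE X (n * L + ph X)) ` (Rg \<times> {..<N})"
  proof
    fix e assume "e \<in> R"
    then obtain X s where e: "e = RE X s" "X \<in> Rg" "s < M" "s mod L = ph X" by (auto simp: R_def EI_def)
    have "s = s div L * L + ph X" using e(4) by (metis div_mult_mod_eq)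
    moreover have "s div L < N" using e(3) N(1) by (simp add: less_mult_imp_div_less)
    ultimately show "e \<in> (\<lambda>(X, n). RE X (n * L + ph X)) ` (Rg \<times> {..<N})"
      using e by (intro image_eqI[of _ _ "(X, s div L)"]) auto
  qed
  then have "card R \<le> card ((\<lambda>(X, n). RE X (n * L + ph X)) ` (Rg \<times> {..<N}) :: ('r, 'k) eidx set)"
    by (rule card_mono[rotated]) (use fin in auto)
  also have "\<dots> \<le> card (Rg \<times> {..<N})" by (rule card_image_le) (use fin in auto)
  finally have R: "card R \<le> card Rg * N" by (simp add: card_cartesian_product)
  let ?f = "\<lambda>(k, i :: nat). AE k (if i = 0 then (if fireL k then 0 else 1) else if i = 1 then (if fireR k then 2 * L + 1 else 2 * L)
      else (if fireL k then L else L + 1)) :: ('r, 'k) eidx"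
  have "T \<subseteq> ?f ` (Kf \<times> {0, 1, 2})"
  proof
    fix e assume "e \<in> T"
    then obtain k j where e: "e = AE k j" "k \<in> Kf" "cut (AE k j)" by (auto simp: T_def EI_def)
    then consider "e = ?f (k, 0)" | "e = ?f (k, 1)" | "e = ?f (k, 2)" by (auto simp del: One_nat_def)
    then show "e \<in> ?f ` (Kf \<times> {0, 1, 2})" using e(2) by cases blast+
  qed
  then have "card T \<le> card (?f ` (Kf \<times> {0, 1, 2}))"
    by (rule card_mono[rotated]) (use fin in auto)
  also have "\<dots> \<le> card (Kf \<times> {0, 1, 2 :: nat})" by (rule card_image_le) (use fin in auto)
  finally have T: "card T \<le> 3 * card Kf" by (simp add: card_cartesian_product)
  have "{e \<in> EI. cut e} \<subseteq> R \<union> T"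
  proof
    fix e assume "e \<in> {e \<in> EI. cut e}"
    then show "e \<in> R \<union> T" by (cases e) (auto simp: R_def T_def)
  qed
  then have "card {e \<in> EI. cut e} \<le> card (R \<union> T)"
    by (rule card_mono[rotated]) (use finite_EI in \<open>auto simp: R_def T_def\<close>)
  also have "\<dots> \<le> card R + card T" by (rule card_Un_le)
  finally have "card {e \<in> EI. cut e} \<le> budget" using R T by (simp add: budget_def)
  moreover have "card deleted \<le> card {e \<in> EI. cut e}" unfolding deleted_def
    by (rule card_image_le) (use finite_EI in auto)
  ultimately show ?thesis by simp
qed

text \<open>The edges from an attachment vertex onwards have indices \<open>0, ..., L - 2\<close>,
  whereas color 2 needs index \<open>L - 1\<close>. This is the converse of \<open>pos_back\<close>:
  all colors on one side, one color missing on the other.\<close>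

lemma rcol_after_slot:
  assumes "i \<le> L - 2" shows "rcol (pos h + i) \<noteq> 2"
proof -
  have "pos h + i = (L - 1 + i) + h * \<Lambda>" using L by (simp add: pos_def)
  then have "(pos h + i) mod \<Lambda> = ((L - 1 + i) + h * \<Lambda>) mod \<Lambda>" by (simp only:)
  also have "\<dots> = (L - 1 + i) mod \<Lambda>" by (rule mod_mult_self1)
  also have "\<dots> = L - 1 + i" by (rule mod_less) (use assms \<Lambda>(1) L in linarith)
  finally have "((pos h + i) mod \<Lambda> + 1) mod L = (L + i) mod L" using L by simp
  also have "\<dots> = i" using assms L by simp
  finally have "((pos h + i) mod \<Lambda> + 1) mod L = i" .
  moreover have "i \<noteq> L - 1" using assms L by linarith
  ultimately show ?thesis using stretch_ne[of 1 2 i] by (simp add: rcol_def Let_def)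
qed

text \<open>A path in all colors has \<open>L + 1\<close> vertices with a common label. In a
  remainder of an arm it must use the only edge of the rare color, at the tip, and from there each
  of the two continuations gives only \<open>L\<close> vertices. In a ring block it must consist of
  all \<open>L\<close> ring vertices and the stub.\<close>

lemma no_colored_path: "\<not> has_induced_colored_path c (Suc L) V (E - deleted) C"
proof
  assume "has_induced_colored_path c (Suc L) V (E - deleted) C"
  then obtain W F vs where W: "W \<subseteq> V" "distinct vs" "length vs = Suc L" "W = set vs" "F = path_edges vs"
    "F = induced_edges (E - deleted) W" "card (colors C F) = c"
    unfolding has_induced_colored_path_def is_path_def by blast
  have vs: "distinct vs" "length vs = Suc L" "set vs \<subseteq> V"
    "path_edges vs \<subseteq> E - deleted" "card (colors C (path_edges vs)) = c"
    using W unfolding induced_edges_def by auto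
  have "colors C (path_edges vs) \<subseteq> {1..c}" using colored by (auto simp: colors_def colored_graph_def)
  then have cols: "colors C (path_edges vs) = {1..c}" using vs(5) by (intro card_subset_eq) auto
  have unc: "\<exists>e. valid e \<and> \<not> cut e \<and> edge e = x" if "x \<in> path_edges vs" for x
  proof -
    have "x \<in> E" "x \<notin> deleted" using vs(4) that by auto
    then obtain e where "e \<in> EI" "x = edge e" "\<not> cut e" by (auto simp: E_def deleted_def)
    then show ?thesis by (auto simp: EI_def)
  qed
  have colored_edge: "\<exists>e. valid e \<and> \<not> cut e \<and> col e = i \<and> edge e \<subseteq> set vs" if i: "i \<in> {1..c}" for i
  proof -
    have "i \<in> colors C (path_edges vs)" using i by (simp only: cols)
    then obtain x where x: "x \<in> C i" "x \<in> path_edges vs" unfolding colors_def by blast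
    obtain e where e: "valid e" "\<not> cut e" "edge e = x" using unc[OF x(2)] by blast
    obtain e' where e': "e' \<in> EI" "col e' = i" "x = edge e'" using x(1) by (auto simp: C_def)
    have "e = e'" by (rule inj_onD[OF inj_edge]) (use e e' in \<open>auto simp: EI_def\<close>)
    moreover have "x \<subseteq> set vs" using x(2) by (auto simp: path_edges_def)
    ultimately show ?thesis using e e' by blast
  qed
  have adj: "\<exists>e. valid e \<and> \<not> cut e \<and> edge e = {vs ! i, vs ! Suc i}" if "Suc i < length vs" for i
    using unc[of "{vs ! i, vs ! Suc i}"] that by (auto simp: path_edges_def)
  have adj_comp: "comp (vs ! i) = comp (vs ! Suc i)" if i: "Suc i < length vs" for i
  proof -
    obtain e where e: "valid e" "\<not> cut e" "edge e = {vs ! i, vs ! Suc i}" using adj[OF i] by blast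
    then have "comp (fst (ends e)) = comp (snd (ends e))" by (intro comp_edge)
    moreover have "(fst (ends e) = vs ! i \<and> snd (ends e) = vs ! Suc i) \<or> (fst (ends e) = vs ! Suc i \<and> snd (ends e) = vs ! i)"
      using e(3) by (auto simp: edge_def doubleton_eq_iff)
    ultimately show ?thesis by auto
  qed
  define q where "q = comp (vs ! 0)"
  have cq: "comp v = q" if "v \<in> set vs" for v
  proof -
    obtain i where i: "i < length vs" "v = vs ! i" using \<open>v \<in> set vs\<close> by (metis in_set_conv_nth)
    have "comp (vs ! i) = comp (vs ! 0)"
      by (rule constant_run[of 0 "length vs" "\<lambda>i. comp (vs ! i)"]) (use adj_comp i in auto)
    then show ?thesis using i by (simp add: q_def)
  qed
  have vv: "vvalid v" if "v \<in> set vs" for v using vs(3) that by (auto simp: V_def)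
  have card: "card (set vs) = Suc L" using vs(1,2) by (simp add: distinct_card)
  have branch: "\<exists>b b'. \<forall>v. v \<in> set vs \<longrightarrow> v \<noteq> w \<longrightarrow> f v = b \<or> f v = b'"
    if f: "\<And>e. valid e \<Longrightarrow> \<not> cut e \<Longrightarrow> edge e \<subseteq> set vs \<Longrightarrow> w \<notin> edge e \<Longrightarrow> f (fst (ends e)) = f (snd (ends e))"
    for w and f :: "('r, 'k) vertex \<Rightarrow> nat"
  proof -
    obtain b b' where "\<And>v. v \<in> set vs \<Longrightarrow> v \<noteq> w \<Longrightarrow> f v = b \<or> f v = b'"
    proof (rule two_branches[OF vs(1), of w f])
      fix i assume i: "Suc i < length vs" "vs ! i \<noteq> w" "vs ! Suc i \<noteq> w"
      obtain e where e: "valid e" "\<not> cut e" "edge e = {vs ! i, vs ! Suc i}" using adj[OF i(1)] by blast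
      then have "f (fst (ends e)) = f (snd (ends e))" using i by (intro f) auto
      moreover have "(fst (ends e) = vs ! i \<and> snd (ends e) = vs ! Suc i) \<or> (fst (ends e) = vs ! Suc i \<and> snd (ends e) = vs ! i)"
        using e(3) by (auto simp: edge_def doubleton_eq_iff)
      ultimately show "f (vs ! i) = f (vs ! Suc i)" by auto
    qed blast
    then show ?thesis by blast
  qed
  have in_vs: "fst (ends e) \<in> set vs \<and> snd (ends e) \<in> set vs" if "edge e \<subseteq> set vs" for e
    using that by (auto simp: edge_def)
  have small: False if "set vs \<subseteq> A" "finite A" "card A \<le> L" for A
    using card_mono[OF that(2,1)] that(3) card by simp
  show False
  proof (cases q)
    case (LA k)
    obtain e where e: "valid e" "\<not> cut e" "col e = 2" "edge e \<subseteq> set vs" using colored_edge[of 2] c by auto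
    have ce: "comp (fst (ends e)) = LA k" "comp (snd (ends e)) = LA k" using cq in_vs[OF e(4)] LA by auto
    \<comment> \<open>Edge 1 is the only candidate of color 2 in a left remainder, and it survives
      only if the left end fires.\<close>
    have "e = AE k 1 \<and> fireL k"
    proof (cases e)
      case (RE X s)
      then show ?thesis using ce by (simp add: comp_def)
    next
      case (AE k' j)
      have j: "j < 2 * L + 2" using e AE by simp
      have "\<not> (2 \<le> j \<and> j \<le> L)" using e(3) AE stretch_ne[of 1 2 "j - 2"] by (auto simp: acol_def)
      moreover have "j \<noteq> 0" "j \<noteq> 2 * L" "j \<noteq> 2 * L + 1" using e(3) AE L by (auto simp: acol_def split: if_splits)
      moreover have "\<not> (L < j \<and> j < 2 * L)"
      proof
        assume "L < j \<and> j < 2 * L"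
        then show False using ce(2) AE L by (auto simp: comp_def node_def split: if_splits)
      qed
      ultimately have "j = 1" using j by linarith
      then show ?thesis using AE ce e(2) L by (auto simp: comp_def node_def split: if_splits)
    next
      case (DL k' j)
      then show ?thesis using e(3) stretch_ne[of 1 2 "Suc j"] by auto
    next
      case (DR k' j)
      then show ?thesis using ce L by (auto simp: comp_def pr_def split: if_splits)
    qed
    then have fL: "fireL k" and a1: "Arm k 1 \<in> set vs" using in_vs[OF e(4)] L by (auto simp: node_def)
    have shape: "v \<in> Arm k ` {1..L} \<union> PenL k ` {1..L - 2}" if "v \<in> set vs" for v
      using cq[OF that] vv[OF that] LA fL L by (cases v) (auto simp: comp_def split: if_splits)
    \<comment> \<open>Branches at arm vertex 2: 0 is the tip, 1 the rest of the arm, 2 the pendant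
      path. The tip is used, so there is room for only one of the others.\<close>
    let ?w = "Arm k 2"
    let ?f = "\<lambda>v :: ('r, 'k) vertex. case v of Arm k' j \<Rightarrow> if j \<le> 1 then 0 else (1 :: nat) | _ \<Rightarrow> 2"
    obtain b b' where bb: "\<And>v. v \<in> set vs \<Longrightarrow> v \<noteq> ?w \<Longrightarrow> ?f v = b \<or> ?f v = b'"
    proof -
      have "\<exists>b b'. \<forall>v. v \<in> set vs \<longrightarrow> v \<noteq> ?w \<longrightarrow> ?f v = b \<or> ?f v = b'"
      proof (rule branch)
        fix e assume e: "valid e" "\<not> cut e" "edge e \<subseteq> set vs" "?w \<notin> edge e"
        note sh = shape[of "fst (ends e)"] shape[of "snd (ends e)"]
        show "?f (fst (ends e)) = ?f (snd (ends e))"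
          by (cases e) (use e sh in_vs[OF e(3)] L in \<open>auto simp: node_def pl_def pr_def edge_def split: if_splits\<close>)
      qed
      then show ?thesis using that by blast
    qed
    have "?f (Arm k 1) = b \<or> ?f (Arm k 1) = b'" by (rule bb[OF a1]) simp
    then have "set vs \<subseteq> Arm k ` {1..L} \<or> set vs \<subseteq> {Arm k 1, Arm k 2} \<union> PenL k ` {1..L - 2}"
    proof (cases "\<exists>j. PenL k j \<in> set vs")
      case True
      then obtain j where "PenL k j \<in> set vs" by blast
      then have b2: "b = 2 \<and> b' = 0 \<or> b = 0 \<and> b' = 2" using bb[of "PenL k j"] bb[OF a1] by auto
      have "v \<in> {Arm k 1, Arm k 2} \<union> PenL k ` {1..L - 2}" if "v \<in> set vs" for v
        using shape[OF that] bb[OF that] b2 by (auto split: if_splits)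
      then show ?thesis by blast
    next
      case False
      then have "v \<in> Arm k ` {1..L}" if "v \<in> set vs" for v using shape[OF that] that by auto
      then show ?thesis by blast
    qed
    moreover have "card (Arm k ` {1..L}) \<le> L" using card_image_le[of "{1..L}" "Arm k"] by simp
    moreover have "card ({Arm k 1, Arm k 2} \<union> PenL k ` {1..L - 2} :: ('r, 'k) vertex set) \<le> L"
    proof -
      have "card ({Arm k 1, Arm k 2} \<union> PenL k ` {1..L - 2} :: ('r, 'k) vertex set)
          \<le> card {Arm k 1, Arm k 2 :: ('r, 'k) vertex} + card (PenL k ` {1..L - 2} :: ('r, 'k) vertex set)" by (rule card_Un_le)
      also have "card (PenL k ` {1..L - 2} :: ('r, 'k) vertex set) \<le> L - 2" using card_image_le[of "{1..L - 2}" "PenL k"] by simp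
      finally show ?thesis using L by simp
    qed
    moreover have "finite (Arm k ` {1..L})" "finite ({Arm k 1, Arm k 2} \<union> PenL k ` {1..L - 2})" by auto
    ultimately show False using small by blast
  next
    case (RA k)
    obtain e where e: "valid e" "\<not> cut e" "col e = 1" "edge e \<subseteq> set vs" using colored_edge[of 1] c by auto
    have ce: "comp (fst (ends e)) = RA k" "comp (snd (ends e)) = RA k" using cq in_vs[OF e(4)] RA by auto
    \<comment> \<open>The mirror image with color 1: edge \<open>2 * L + 1\<close> also has this
      color, but it joins the arm to a ring vertex and so cannot lie in a right remainder.\<close>
    have "e = AE k (2 * L) \<and> fireR k"
    proof (cases e)
      case (RE X s)
      then show ?thesis using ce by (simp add: comp_def)
    next
      case (AE k' j)
      have j: "j < 2 * L + 2" using e AE by simp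
      have "\<not> (L < j \<and> j < 2 * L)" using e(3) AE stretch_ne[of 2 1 "j - Suc L"] by (auto simp: acol_def)
      moreover have "j \<noteq> 2 * L + 1" "j \<noteq> 0" using ce AE by (auto simp: comp_def node_def split: if_splits)
      moreover have "\<not> (1 \<le> j \<and> j \<le> L)"
      proof
        assume "1 \<le> j \<and> j \<le> L"
        then show False using ce(1) AE L by (auto simp: comp_def node_def split: if_splits)
      qed
      ultimately have "j = 2 * L" using j by linarith
      then show ?thesis using AE ce e(2) L by (auto simp: comp_def node_def split: if_splits)
    next
      case (DL k' j)
      then show ?thesis using ce L by (auto simp: comp_def pl_def split: if_splits)
    next
      case (DR k' j)
      then show ?thesis using e(3) stretch_ne[of 2 1 "Suc j"] by (auto split: if_splits)
    qed
    then have fR: "fireR k" and a1: "Arm k (2 * L + 1) \<in> set vs" and k: "k \<in> Kf"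
      using in_vs[OF e(4)] L e(1) by (auto simp: node_def)
    \<comment> \<open>Here the exclusion of two firing ends is used: the middle deletion is at
      \<open>L + 1\<close>, so the right remainder has only the \<open>L\<close> arm vertices from
      \<open>L + 2\<close> to \<open>2 * L + 1\<close>. With a deletion at \<open>L\<close> there
      would be one more.\<close>
    have fL: "\<not> fireL k" using not_both[OF k] fR by blast
    have shape: "v \<in> Arm k ` {L + 2..2 * L + 1} \<union> PenR k ` {1..L - 2}" if "v \<in> set vs" for v
      using cq[OF that] vv[OF that] RA fL L by (cases v) (auto simp: comp_def split: if_splits)
    let ?w = "Arm k (2 * L)"
    let ?f = "\<lambda>v :: ('r, 'k) vertex. case v of Arm k' j \<Rightarrow> if 2 * L < j then 0 else (1 :: nat) | _ \<Rightarrow> 2"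
    obtain b b' where bb: "\<And>v. v \<in> set vs \<Longrightarrow> v \<noteq> ?w \<Longrightarrow> ?f v = b \<or> ?f v = b'"
    proof -
      have "\<exists>b b'. \<forall>v. v \<in> set vs \<longrightarrow> v \<noteq> ?w \<longrightarrow> ?f v = b \<or> ?f v = b'"
      proof (rule branch)
        fix e assume e: "valid e" "\<not> cut e" "edge e \<subseteq> set vs" "?w \<notin> edge e"
        note sh = shape[of "fst (ends e)"] shape[of "snd (ends e)"]
        show "?f (fst (ends e)) = ?f (snd (ends e))"
          by (cases e) (use e sh in_vs[OF e(3)] L in \<open>auto simp: node_def pl_def pr_def edge_def split: if_splits\<close>)
      qed
      then show ?thesis using that by blast
    qed
    have "set vs \<subseteq> Arm k ` {L + 2..2 * L + 1} \<or> set vs \<subseteq> {Arm k (2 * L + 1), Arm k (2 * L)} \<union> PenR k ` {1..L - 2}"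
    proof (cases "\<exists>j. PenR k j \<in> set vs")
      case True
      then obtain j where "PenR k j \<in> set vs" by blast
      then have b2: "b = 2 \<and> b' = 0 \<or> b = 0 \<and> b' = 2" using bb[of "PenR k j"] bb[OF a1] by auto
      have "v \<in> {Arm k (2 * L + 1), Arm k (2 * L)} \<union> PenR k ` {1..L - 2}" if "v \<in> set vs" for v
        using shape[OF that] bb[OF that] b2 by (auto split: if_splits)
      then show ?thesis by blast
    next
      case False
      then have "v \<in> Arm k ` {L + 2..2 * L + 1}" if "v \<in> set vs" for v using shape[OF that] that by auto
      then show ?thesis by blast
    qed
    moreover have "card (Arm k ` {L + 2..2 * L + 1}) \<le> L" using card_image_le[of "{L + 2..2 * L + 1}" "Arm k"] by simp
    moreover have "card ({Arm k (2 * L + 1), Arm k (2 * L)} \<union> PenR k ` {1..L - 2} :: ('r, 'k) vertex set) \<le> L"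
    proof -
      have "card ({Arm k (2 * L + 1), Arm k (2 * L)} \<union> PenR k ` {1..L - 2} :: ('r, 'k) vertex set)
          \<le> card {Arm k (2 * L + 1), Arm k (2 * L) :: ('r, 'k) vertex} + card (PenR k ` {1..L - 2} :: ('r, 'k) vertex set)" by (rule card_Un_le)
      also have "card (PenR k ` {1..L - 2} :: ('r, 'k) vertex set) \<le> L - 2" using card_image_le[of "{1..L - 2}" "PenR k"] by simp
      finally show ?thesis using L by simp
    qed
    moreover have "finite (Arm k ` {L + 2..2 * L + 1})" "finite ({Arm k (2 * L + 1), Arm k (2 * L)} \<union> PenR k ` {1..L - 2})" by auto
    ultimately show False using small by blast
  next
    case (RC X n)
    define R :: "('r, 'k) vertex set" where "R = {Ring X s |s. s < M \<and> u X s div L = n}"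
    define y where "y v = (case v of Ring _ s \<Rightarrow> u X s mod L | _ \<Rightarrow> 0)" for v :: "('r, 'k) vertex"
    have yinj: "inj_on y R"
    proof (rule inj_onI)
      fix v v' assume "v \<in> R" "v' \<in> R" "y v = y v'"
      then obtain s s' where "v = Ring X s" "v' = Ring X s'" "s < M" "s' < M" "u X s div L = u X s' div L" "u X s mod L = u X s' mod L"
        by (auto simp: R_def y_def)
      then show "v = v'" using u_inj' by blast
    qed
    have ysub: "y ` R \<subseteq> {..<L}" using L by (auto simp: R_def y_def)
    have finR: "finite R" using yinj ysub by (metis finite_imageD finite_lessThan finite_subset)
    have cR: "card R \<le> L" using card_inj_on_le[OF yinj ysub] by simp
    define attach where "attach a P \<longleftrightarrow>
      (\<exists>k\<in>Kf. a = Arm k 1 \<and> \<not> fireL k \<and> lr k = X \<and> P = lh k \<and> u X (pos P) div L = n) \<or>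
      (\<exists>k\<in>Kf. a = Arm k (2 * L + 1) \<and> \<not> fireR k \<and> rr k = X \<and> P = rh k \<and> u X (pos P) div L = n)" for a :: "('r, 'k) vertex" and P
    have shape: "v \<in> R \<or> (\<exists>P. attach v P)" if "v \<in> set vs" for v
    proof (cases v)
      case (Ring Y s)
      then show ?thesis using cq[OF that] vv[OF that] RC by (auto simp: comp_def R_def)
    next
      case (Arm k j)
      then show ?thesis using cq[OF that] vv[OF that] RC by (auto simp: comp_def attach_def split: if_splits)
    qed (use cq[OF that] RC in \<open>auto simp: comp_def\<close>)
    have attach_unique: "a = a' \<and> P = P'" if "attach a P" "attach a' P'" for a a' P P'
    proof -
      have PH: "P < H" "P' < H" "u X (pos P) div L = u X (pos P') div L"
        using that sections by (auto simp: attach_def)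
      then have PP: "P = P'" using slot_segment by blast
      have "a = a'" using that unfolding attach_def PP[symmetric]
      proof (elim disjE bexE conjE)
        fix k k' assume "k \<in> Kf" "k' \<in> Kf" "lr k = X" "lr k' = X" "P = lh k" "P = lh k'" "a = Arm k 1" "a' = Arm k' 1"
        then show ?thesis using slot_unique(1)[of k k'] by simp
      next
        fix k k' assume "k \<in> Kf" "k' \<in> Kf" "lr k = X" "rr k' = X" "P = lh k" "P = rh k'"
        then show ?thesis using slot_unique(3)[of k k'] by simp
      next
        fix k k' assume "k \<in> Kf" "k' \<in> Kf" "rr k = X" "lr k' = X" "P = rh k" "P = lh k'"
        then show ?thesis using slot_unique(3)[of k' k] by simp
      next
        fix k k' assume "k \<in> Kf" "k' \<in> Kf" "rr k = X" "rr k' = X" "P = rh k" "P = rh k'" "a = Arm k (2 * L + 1)" "a' = Arm k' (2 * L + 1)"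
        then show ?thesis using slot_unique(2)[of k k'] by simp
      qed
      then show ?thesis using PP by blast
    qed
    \<comment> \<open>The block alone has too few vertices, so the path contains a stub vertex, and
      by counting it then contains the whole block.\<close>
    obtain a where a: "a \<in> set vs" "a \<notin> R" using small[OF _ finR cR] by blast
    then obtain P where P: "attach a P" using shape by blast
    have X: "X \<in> Rg" and PH: "P < H" and aR: "\<And>s. a \<noteq> Ring X s" and Pn: "u X (pos P) div L = n" and nf: "\<not> fires ph X P"
      using P rings sections by (auto simp: attach_def)
    have sub: "set vs \<subseteq> insert a R" using shape attach_unique P by blast
    have "card (insert a R) \<le> Suc L" using cR finR by (simp add: card_insert_if)
    then have eq: "set vs = insert a R" using sub card finR by (intro card_seteq) auto
    then have "card R = L" using card finR a(2) by simp
    then have yim: "y ` R = {..<L}" using ysub card_image[OF yinj] by (intro card_subset_eq) auto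
    have posM: "pos P < M" using pos_less[OF PH] by simp
    let ?w = "Ring X (pos P)"
    let ?y = "u X (pos P) mod L"
    \<comment> \<open>An attachment vertex at the last place of its block means that the end fires,
      and a firing end leaves no stub.\<close>
    have yP: "?y \<noteq> L - 1" using cut_iff[OF X] nf by (auto simp: fires_def)
    have arm_edge: "?w \<in> edge e \<and> col e = 1" if e: "valid e" "\<not> cut e" "edge e \<subseteq> set vs" "\<And>s. e \<noteq> RE X s" for e
    proof -
      have mem: "fst (ends e) \<in> insert a R" "snd (ends e) \<in> insert a R" using in_vs[OF e(3)] eq by auto
      show ?thesis
      proof (cases e)
        case (RE Y s)
        then show ?thesis using mem e(4) aR P by (auto simp: R_def attach_def)
      next
        case (AE k j)
        have kj: "k \<in> Kf" "j < 2 * L + 2" using e(1) AE by auto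
        have nA: "v = a" if "v \<in> insert a R" "\<And>Y s. v \<noteq> Ring Y s" for v using that by (auto simp: R_def)
        have "node k j = a \<or> node k (Suc j) = a"
          using mem AE kj nA[of "node k j"] nA[of "node k (Suc j)"] L by (cases "j = 0") (auto simp: node_def)
        then show ?thesis using P
          unfolding attach_def
        proof (elim disjE bexE conjE)
          fix k' assume h: "node k j = a" "k' \<in> Kf" "a = Arm k' 1" "\<not> fireL k'" "lr k' = X" "P = lh k'"
          then have "k' = k \<and> j = 1" by (auto simp: node_def split: if_splits)
          then show ?thesis using h AE e(2) by auto
        next
          fix k' assume h: "node k j = a" "k' \<in> Kf" "a = Arm k' (2 * L + 1)" "\<not> fireR k'" "rr k' = X" "P = rh k'"
          then have "k' = k \<and> j = 2 * L + 1" by (auto simp: node_def split: if_splits)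
          then show ?thesis using h AE L by (auto simp: node_def edge_def acol_def)
        next
          fix k' assume h: "node k (Suc j) = a" "k' \<in> Kf" "a = Arm k' 1" "\<not> fireL k'" "lr k' = X" "P = lh k'"
          then have "k' = k \<and> j = 0" by (auto simp: node_def split: if_splits)
          then show ?thesis using h AE L by (auto simp: node_def edge_def acol_def)
        next
          fix k' assume h: "node k (Suc j) = a" "k' \<in> Kf" "a = Arm k' (2 * L + 1)" "\<not> fireR k'" "rr k' = X" "P = rh k'"
          then have "k' = k \<and> j = 2 * L" by (auto simp: node_def split: if_splits)
          then show ?thesis using h AE e(2) by auto
        qed
      next
        case (DL k j)
        then show ?thesis using mem P L by (auto simp: R_def attach_def pl_def split: if_splits)
      next
        case (DR k j)
        then show ?thesis using mem P L by (auto simp: R_def attach_def pr_def split: if_splits)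
      qed
    qed
    have ring_edge: "u X s div L = n \<and> Suc (u X s mod L) < L \<and> u X (Suc s mod M) mod L = Suc (u X s mod L) \<and> u X (Suc s mod M) div L = n"
      if e: "valid (RE X s)" "\<not> cut (RE X s)" "edge (RE X s) \<subseteq> set vs" for s
    proof -
      have "Ring X s \<in> insert a R" using e(3) eq by (auto simp: edge_def)
      then have 1: "u X s div L = n" using aR by (auto simp: R_def)
      have "s mod L \<noteq> ph X" using e(2) by simp
      then have "u X s mod L \<noteq> L - 1" using cut_iff[OF X] by blast
      moreover have "u X s mod L < L" using L by simp
      ultimately show ?thesis using 1 uncut_step[OF X \<open>s mod L \<noteq> ph X\<close>] by auto
    qed
    show False
    proof (cases "?y = 0")
      case True
      \<comment> \<open>The attachment vertex starts the block, so every ring edge in the block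
        comes after it and avoids color 2, and the stub edge has color 1.\<close>
      obtain e where e: "valid e" "\<not> cut e" "col e = 2" "edge e \<subseteq> set vs" using colored_edge[of 2] c by auto
      have "\<exists>s. e = RE X s" using arm_edge[OF e(1,2,4)] e(3) by auto
      then obtain s where s: "e = RE X s" by blast
      have sM: "s < M" using e(1) s by simp
      let ?i = "u X s mod L"
      have re: "u X s div L = n" "Suc ?i < L" using ring_edge[of s] e s by auto
      have "u X s = u X s div L * L + ?i" "u X (pos P) = u X (pos P) div L * L + ?y" by (simp_all only: div_mult_mod_eq)
      then have us: "u X s = u X (pos P) + ?i" using re Pn True by simp
      have "u X (pos P + i) = (u X (pos P) + i) mod M" for i
      proof -
        have "pos P + i + (L - 1 - ph X) = pos P + (L - 1 - ph X) + i" by simp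
        then show ?thesis unfolding u_def by (simp only: mod_add_left_eq)
      qed
      from this[of ?i] have "u X (pos P + ?i) = (u X (pos P) + ?i) mod M" .
      also have "\<dots> = u X s" using us by (simp add: u_def)
      finally have "pos P + ?i = s" by (rule u_inj[rotated 2]) (use pos_less[OF PH] re(2) sM in auto)
      then show False using rcol_after_slot[of ?i P] re(2) e(3) s by simp
    next
      case False
      have yl: "?y < L" using L by simp
      \<comment> \<open>Three nonempty branches at the attachment vertex: the stub, the part of the
        block before it, and the part after it.\<close>
      let ?f = "\<lambda>v. if v = a then 0 else if y v < ?y then 1 else (2 :: nat)"
      obtain b b' where bb: "\<And>v. v \<in> set vs \<Longrightarrow> v \<noteq> ?w \<Longrightarrow> ?f v = b \<or> ?f v = b'"
      proof -
        have "\<exists>b b'. \<forall>v. v \<in> set vs \<longrightarrow> v \<noteq> ?w \<longrightarrow> ?f v = b \<or> ?f v = b'"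
        proof (rule branch)
          fix e assume e: "valid e" "\<not> cut e" "edge e \<subseteq> set vs" "?w \<notin> edge e"
          have "\<exists>s. e = RE X s" using arm_edge[OF e(1-3)] e(4) by auto
          then obtain s where s: "e = RE X s" by blast
          have sM: "s < M" using e(1) s by simp
          note re = ring_edge[of s, OF e(1-3)[unfolded s]]
          have 1: "u X s mod L \<noteq> ?y"
          proof
            assume "u X s mod L = ?y"
            then have "s = pos P" by (rule u_inj'[rotated 3]) (use re Pn sM posM in auto)
            then show False using e(4) s by (simp add: edge_def)
          qed
          have 2: "u X (Suc s mod M) mod L \<noteq> ?y"
          proof
            assume "u X (Suc s mod M) mod L = ?y"
            then have "Suc s mod M = pos P" by (rule u_inj'[rotated 3]) (use re Pn M_pos posM in auto)
            then show False using e(4) s by (simp add: edge_def)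
          qed
          show "?f (fst (ends e)) = ?f (snd (ends e))"
            using 1 2 re aR[symmetric] by (auto simp: s y_def)
        qed
        then show ?thesis using that by blast
      qed
      have "?y - 1 \<in> y ` R" "?y + 1 \<in> y ` R" using yim yl yP by auto
      then obtain v1 v2 where v: "v1 \<in> R" "y v1 = ?y - 1" "v2 \<in> R" "y v2 = ?y + 1" by (metis imageE)
      have yw: "y ?w = ?y" by (simp add: y_def)
      have "v1 \<noteq> ?w" "v2 \<noteq> ?w" "a \<noteq> ?w" "v1 \<noteq> a" "v2 \<noteq> a" using v yw False a aR by auto
      then have "?f v1 = 1" "?f v2 = 2" "?f a = 0" using v False by auto
      moreover have "?f v1 = b \<or> ?f v1 = b'" "?f v2 = b \<or> ?f v2 = b'" "?f a = b \<or> ?f a = b'"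
        using bb[of v1] bb[of v2] bb[of a] v eq a \<open>v1 \<noteq> ?w\<close> \<open>v2 \<noteq> ?w\<close> \<open>a \<noteq> ?w\<close> by blast+
      ultimately show False by linarith
    qed
  qed
qed

lemma deletion_of_consistent: "deletion_solvable c (Suc L) V E C budget"
proof -
  have "deleted \<subseteq> E" by (auto simp: deleted_def E_def)
  then show ?thesis unfolding deletion_solvable_def using card_deleted no_colored_path by blast
qed

end

theorem deletion_iff: "deletion_solvable c (Suc L) V E C budget \<longleftrightarrow> (\<exists>ph. consistent ph)"
  using deletion_of_consistent consistent_of_deletion unfolding deletion_solvable_def by blast

end

section \<open>Encoding grid constraints as gadget graphs\<close>

lemma inj_image_op: "inj f \<Longrightarrow> inj ((`) f)"
  by (rule injI) (simp add: inj_image_eq_iff)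

lemma path_edges_image: "path_edges us = (\<lambda>i. {us ! i, us ! Suc i}) ` {i. Suc i < length us}"
  by (auto simp: path_edges_def)

lemma path_edges_map: "path_edges (map f vs) = (`) f ` path_edges vs"
proof -
  have "path_edges (map f vs) = (\<lambda>i. f ` {vs ! i, vs ! Suc i}) ` {i. Suc i < length vs}"
    unfolding path_edges_image length_map by (intro image_cong) auto
  then show ?thesis unfolding path_edges_image image_image .
qed

lemma list_in_range: "set vs \<subseteq> f ` V \<Longrightarrow> \<exists>us. vs = map f us \<and> set us \<subseteq> V"
proof (induction vs)
  case (Cons v vs)
  then obtain us x where "vs = map f us" "set us \<subseteq> V" "v = f x" "x \<in> V" by auto
  then show ?case by (intro exI[of _ "x # us"]) simp
qed simp

lemma induced_edges_image: "inj f \<Longrightarrow> induced_edges ((`) f ` E) (f ` W) = (`) f ` induced_edges E W"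
  by (auto simp: induced_edges_def inj_image_subset_iff)

lemma colors_image: "inj f \<Longrightarrow> colors (\<lambda>i. (`) f ` C i) ((`) f ` F) = colors C F"
  unfolding colors_def by (simp only: image_Int[OF inj_image_op, symmetric] image_is_empty)

lemma has_path_image:
  fixes f :: "'a \<Rightarrow> 'b"
  assumes f: "inj f"
  shows "has_induced_colored_path c l (f ` V) ((`) f ` E) (\<lambda>i. (`) f ` C i) \<longleftrightarrow> has_induced_colored_path c l V E C"
proof
  assume "has_induced_colored_path c l V E C"
  then obtain W F vs where W': "W \<subseteq> V" "distinct vs" "length vs = l" "W = set vs" "F = path_edges vs"
    "F = induced_edges E W" "card (colors C F) = c"
    unfolding has_induced_colored_path_def is_path_def by blast
  note W = W'(1-4) W'(6,7)[unfolded W'(5)]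
  have "is_path l (f ` W) (path_edges (map f vs))"
    unfolding is_path_def using W inj_on_subset[OF f subset_UNIV]
    by (intro exI[of _ "map f vs"]) (simp add: distinct_map)
  moreover have "path_edges (map f vs) = induced_edges ((`) f ` E) (f ` W)"
    unfolding path_edges_map induced_edges_image[OF f] W(5) ..
  moreover have "card (colors (\<lambda>i. (`) f ` C i) (path_edges (map f vs))) = c"
    unfolding path_edges_map colors_image[OF f] by (rule W(6))
  moreover have "f ` W \<subseteq> f ` V" using W(1) by blast
  ultimately show "has_induced_colored_path c l (f ` V) ((`) f ` E) (\<lambda>i. (`) f ` C i)"
    unfolding has_induced_colored_path_def by blast
next
  assume "has_induced_colored_path c l (f ` V) ((`) f ` E) (\<lambda>i. (`) f ` C i)"
  then obtain W' F' vs' where W0: "W' \<subseteq> f ` V" "distinct vs'" "length vs' = l" "W' = set vs'" "F' = path_edges vs'"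
    "F' = induced_edges ((`) f ` E) W'" "card (colors (\<lambda>i. (`) f ` C i) F') = c"
    unfolding has_induced_colored_path_def is_path_def by blast
  note W = W0(1-4) W0(6,7)[unfolded W0(5)]
  obtain vs where vs: "vs' = map f vs" "set vs \<subseteq> V" using list_in_range[of vs' f V] W by auto
  have "(`) f ` path_edges vs = (`) f ` induced_edges E (set vs)"
    using W(5) unfolding W(4) vs(1) set_map path_edges_map induced_edges_image[OF f] .
  then have "path_edges vs = induced_edges E (set vs)"
    by (rule iffD1[OF inj_image_eq_iff[OF inj_image_op[OF f]]])
  moreover have "card (colors C (path_edges vs)) = c"
    using W(6) unfolding vs(1) path_edges_map colors_image[OF f] .
  moreover have "is_path l (set vs) (path_edges vs)"
    unfolding is_path_def using W(2,3) vs by (intro exI[of _ vs]) (auto simp: distinct_map)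
  ultimately show "has_induced_colored_path c l V E C"
    unfolding has_induced_colored_path_def using vs(2) by blast
qed

text \<open>The gadget graph lives on a datatype, while inputs name vertices by numbers. Deletion
  sets of the renamed graph are images of deletion sets of the original one, of the same
  size.\<close>

lemma deletion_image:
  fixes f :: "'a \<Rightarrow> 'b"
  assumes f: "inj f"
  shows "deletion_solvable c l (f ` V) ((`) f ` E) (\<lambda>i. (`) f ` C i) k \<longleftrightarrow> deletion_solvable c l V E C k"
proof -
  have diff: "(`) f ` E - (`) f ` S = (`) f ` (E - S)" for S
    by (rule image_set_diff[OF inj_image_op[OF f], symmetric])
  have card: "card ((`) f ` S) = card S" for S
    by (rule card_image[OF inj_on_subset[OF inj_image_op[OF f] subset_UNIV]])
  show ?thesis
  proof
    assume "deletion_solvable c l V E C k"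
    then obtain S where S: "S \<subseteq> E" "card S \<le> k" "\<not> has_induced_colored_path c l V (E - S) C"
      unfolding deletion_solvable_def by blast
    then have "\<not> has_induced_colored_path c l (f ` V) ((`) f ` E - (`) f ` S) (\<lambda>i. (`) f ` C i)"
      unfolding diff has_path_image[OF f] by simp
    moreover have "(`) f ` S \<subseteq> (`) f ` E" using S(1) by blast
    moreover have "card ((`) f ` S) \<le> k" using S(2) by (simp only: card)
    ultimately show "deletion_solvable c l (f ` V) ((`) f ` E) (\<lambda>i. (`) f ` C i) k"
      unfolding deletion_solvable_def by blast
  next
    assume "deletion_solvable c l (f ` V) ((`) f ` E) (\<lambda>i. (`) f ` C i) k"
    then obtain S' where S: "S' \<subseteq> (`) f ` E" "card S' \<le> k"
      "\<not> has_induced_colored_path c l (f ` V) ((`) f ` E - S') (\<lambda>i. (`) f ` C i)"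
      unfolding deletion_solvable_def by blast
    obtain S where S': "S \<subseteq> E" "S' = (`) f ` S" using S(1) by (meson subset_imageE)
    have "card S \<le> k" using S(2) unfolding S'(2) card .
    moreover have "\<not> has_induced_colored_path c l V (E - S) C"
      using S(3) unfolding S'(2) diff has_path_image[OF f] .
    ultimately show "deletion_solvable c l V E C k"
      unfolding deletion_solvable_def using S'(1) by blast
  qed
qed

lemma colored_graph_image:
  assumes f: "inj f" and g: "colored_graph c V E C"
  shows "colored_graph c (f ` V) ((`) f ` E) (\<lambda>i. (`) f ` C i)"
proof -
  have "simple_graph (f ` V) ((`) f ` E)"
    using g card_image[OF inj_on_subset[OF f subset_UNIV]] by (auto simp: colored_graph_def simple_graph_def)
  moreover have "(`) f ` E = (\<Union>i\<in>{1..c}. (`) f ` C i)" using g by (auto simp: colored_graph_def)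
  moreover have "disjoint_family_on (\<lambda>i. (`) f ` C i) {1..c}"
    using g unfolding colored_graph_def disjoint_family_on_def
    by (simp only: image_Int[OF inj_image_op[OF f], symmetric] image_is_empty) blast
  ultimately show ?thesis using g by (auto simp: colored_graph_def)
qed

lemma max_degree_image:
  assumes f: "inj f"
  shows "max_degree (f ` V) ((`) f ` E) = max_degree V E"
proof -
  have "vertex_degree ((`) f ` E) (f v) = vertex_degree E v" for v
  proof -
    have "{e \<in> (`) f ` E. f v \<in> e} = (`) f ` {e \<in> E. v \<in> e}" by (auto dest!: injD[OF f])
    then show ?thesis unfolding vertex_degree_def
      using card_image[OF inj_on_subset[OF inj_image_op[OF f] subset_UNIV]] by simp
  qed
  then show ?thesis by (simp add: max_degree_def image_image)
qed

lemma girth_image: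
  assumes f: "inj f" and E: "\<And>e. e \<in> E \<Longrightarrow> e \<subseteq> V" and n: "\<And>vs. is_cycle E vs \<Longrightarrow> n \<le> length vs"
  shows "enat n \<le> girth ((`) f ` E)"
proof (rule girth_ge)
  fix vs' assume cyc: "is_cycle ((`) f ` E) vs'"
  have "set vs' \<subseteq> f ` V"
  proof
    fix v assume "v \<in> set vs'"
    then obtain i where "i < length vs'" "v = vs' ! i" by (metis in_set_conv_nth)
    then have "{v, vs' ! (Suc i mod length vs')} \<in> (`) f ` E"
      using cycle_edge[of i vs'] cyc unfolding is_cycle_def by blast
    then show "v \<in> f ` V" using E by blast
  qed
  then obtain vs where vs: "vs' = map f vs" using list_in_range by blast
  have ne: "vs \<noteq> []" using cyc vs by (auto simp: is_cycle_def)
  have "insert {last vs', hd vs'} (path_edges vs') = (`) f ` insert {last vs, hd vs} (path_edges vs)"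
    using ne by (simp add: vs path_edges_map last_map hd_map)
  then have "(`) f ` insert {last vs, hd vs} (path_edges vs) \<subseteq> (`) f ` E" using cyc by (simp add: is_cycle_def)
  then have "insert {last vs, hd vs} (path_edges vs) \<subseteq> E" using inj_image_op[OF f] by (simp only: inj_image_subset_iff)
  then have "is_cycle E vs" using cyc vs by (auto simp: is_cycle_def distinct_map)
  then show "n \<le> length vs'" using n vs by simp
qed

section \<open>The events as a set\<close>

lemma set_row_events: "set (row_events g t i v) = {(g, t, j) |j. i \<le> j \<and> j < i + v}"
proof
  show "{(g, t, j) |j. i \<le> j \<and> j < i + v} \<subseteq> set (row_events g t i v)"
  proof
    fix e assume "e \<in> {(g, t, j) |j. i \<le> j \<and> j < i + v}"
    then obtain j where "e = (g, t, j)" "i \<le> j" "j < i + v" by blast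
    then show "e \<in> set (row_events g t i v)"
      unfolding row_events_def set_map by (intro image_eqI[of _ _ "j - i"]) auto
  qed
qed (auto simp: row_events_def)

lemma set_grid_events: "set (grid_events g v u) = {(g, t, j) |t j. t < v \<and> j < u}"
  by (auto simp: grid_events_def set_row_events)

lemma set_bit_events:
  "set (bit_events i x) = {e. \<exists>j<length x. e = (4, 0, i + 2 * j) \<or> e = (if x ! j then 4 else 5, 0, Suc (i + 2 * j))}"
  by (auto simp: bit_events_def)

lemma distinct_row_events: "distinct (row_events g t i v)"
  by (simp add: row_events_def distinct_map inj_on_def)

lemma distinct_grid_events: "distinct (grid_events g v u)"
proof (induction v)
  case (Suc v)
  have "grid_events g (Suc v) u = grid_events g v u @ row_events g v 0 u" by (simp add: grid_events_def)
  then show ?case using Suc by (auto simp: distinct_row_events set_grid_events set_row_events)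
qed (simp add: grid_events_def)

lemma distinct_bit_events: "distinct (bit_events i x)"
proof -
  let ?ev = "\<lambda>n. concat (map (\<lambda>j. [(4 :: nat, 0 :: nat, i + 2 * j), (if x ! j then 4 else 5, 0, Suc (i + 2 * j))]) [0..<n])"
  have "distinct (?ev n) \<and> (\<forall>(g, t, j) \<in> set (?ev n). j < i + 2 * n)" for n
  proof (induction n)
    case (Suc n)
    have "(g, t, j) \<notin> set (?ev n)" if "j \<ge> i + 2 * n" for g t j using Suc that by fastforce
    then show ?case using Suc by fastforce
  qed simp
  then show ?thesis by (simp add: bit_events_def)
qed

text \<open>This is for the budget, which is summed along the list; the encoded vertex and edge sets
  would not notice a repetition.\<close>

lemma distinct_events: "distinct (events A q x)"
  unfolding events_def Let_def
  by (auto simp: distinct_row_events distinct_grid_events distinct_bit_events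
      set_row_events set_grid_events set_bit_events split: if_splits)

lemma events_iff:
  "(g, t, i) \<in> set (events A q x) \<longleftrightarrow> (let n = length x; B = 2 * A + 2 * n + q in
     g = 0 \<and> t \<le> A \<and> i \<le> B \<or> g = 1 \<and> t \<le> A \<and> i < B \<or> g = 2 \<and> t < A \<and> i \<le> B \<or>
     g = 3 \<and> t = 0 \<and> (i < A \<or> A + 2 * n + q < i \<and> i \<le> B) \<or> g = 7 \<and> t = 0 \<and> i = A \<or>
     t = 0 \<and> (\<exists>j<n. g = 4 \<and> i = A + 2 * j \<or> g = (if x ! j then 4 else 5) \<and> i = Suc (A + 2 * j)) \<or>
     g = 5 \<and> t = 0 \<and> i = A + 2 * n \<or> g = 6 \<and> t = 0 \<and> A + 2 * n < i \<and> i \<le> A + 2 * n + q \<or>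
     g = 8 \<and> t = A \<and> i = A)"
proof -
  have 1: "(g, t, i) \<in> set (grid_events g' v u) \<longleftrightarrow> g = g' \<and> t < v \<and> i < u" for g' v u
    by (auto simp: set_grid_events)
  have 2: "(g, t, i) \<in> set (row_events g' t' j v) \<longleftrightarrow> g = g' \<and> t = t' \<and> j \<le> i \<and> i < j + v" for g' t' j v
    by (auto simp: set_row_events)
  define Q where "Q \<longleftrightarrow> (\<exists>j<length x. g = 4 \<and> i = A + 2 * j \<or> g = (if x ! j then 4 else 5) \<and> i = Suc (A + 2 * j))"
  have 3: "(g, t, i) \<in> set (bit_events A x) \<longleftrightarrow> t = 0 \<and> Q"
    unfolding set_bit_events mem_Collect_eq prod.inject Q_def by blast
  have 4: "Suc (A + 2 * length x + q) \<le> i \<and> i < Suc (A + 2 * length x + q) + A \<longleftrightarrow>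
      A + 2 * length x + q < i \<and> i \<le> 2 * A + 2 * length x + q" by linarith
  have 5: "Suc (A + 2 * length x) \<le> i \<and> i < Suc (A + 2 * length x) + q \<longleftrightarrow>
      A + 2 * length x < i \<and> i \<le> A + 2 * length x + q" by linarith
  show ?thesis
    unfolding events_def Let_def set_append Un_iff 1 2 3 4 5 list.set empty_iff insert_iff prod.inject
      less_Suc_eq_le Q_def[symmetric]
    by (simp only: le0 add_0 simp_thms) satx
qed

text \<open>Kind 6 has two offsets: the cell itself, for its start symbol, and its right neighbor,
  so that the witness has no gaps.\<close>

definition offsets :: "nat \<Rightarrow> (nat \<times> nat) set" where
  "offsets g = (if g = 1 then {(0, 1)} else if g = 2 then {(1, 0)} else if g = 6 then {(0, 0), (0, 1)} else {(0, 0)})"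

text \<open>\<open>1 \<le> A\<close> matters for the last witness column, whose right neighbor must
  still be in the grid.\<close>

lemma events_offset:
  assumes "1 \<le> A"
  shows "(g, t, i) \<in> set (events A q x) \<Longrightarrow> (p, r) \<in> offsets g \<Longrightarrow> (0, t + p, i + r) \<in> set (events A q x)"
  using assms unfolding events_iff offsets_def Let_def by (auto split: if_splits)

definition zcode :: "nat \<Rightarrow> nat \<Rightarrow> nat \<Rightarrow> nat" where
  "zcode k m s = prod_encode (k, prod_encode (m, s))"

lemma zcode_inject [simp]: "zcode k m s = zcode k' m' s' \<longleftrightarrow> k = k' \<and> m = m' \<and> s = s'"
  by (simp add: zcode_def)

type_synonym cell_item = "nat \<times> nat \<times> nat"

definition vname :: "(cell_item, cell_item) vertex \<Rightarrow> nat" where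
  "vname v = (case v of Ring (t, i, m) s \<Rightarrow> vertex_name t i (zcode 0 m s)
     | Arm (t, i, k) j \<Rightarrow> vertex_name t i (zcode 1 k j)
     | PenL (t, i, k) j \<Rightarrow> vertex_name t i (zcode 2 k j)
     | PenR (t, i, k) j \<Rightarrow> vertex_name t i (zcode 3 k j))"

lemma inj_vname: "inj vname"
proof (rule injI)
  fix v w assume "vname v = vname w"
  then show "v = w" by (cases v; cases w) (auto simp: vname_def vertex_name_inject)
qed

definition lz :: "(nat, nat) vertex \<Rightarrow> nat" where
  "lz v = (case v of Ring m s \<Rightarrow> zcode 0 m s | Arm k j \<Rightarrow> zcode 1 k j
     | PenL k j \<Rightarrow> zcode 2 k j | PenR k j \<Rightarrow> zcode 3 k j)"

abbreviation locv :: "nat \<Rightarrow> nat \<Rightarrow> (nat, nat) vertex \<Rightarrow> (cell_item, cell_item) vertex" where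
  "locv t i \<equiv> map_vertex (\<lambda>m. (t, i, m)) (\<lambda>k. (t, i, k))"

abbreviation loce :: "nat \<Rightarrow> nat \<Rightarrow> (nat, nat) eidx \<Rightarrow> (cell_item, cell_item) eidx" where
  "loce t i \<equiv> map_eidx (\<lambda>m. (t, i, m)) (\<lambda>k. (t, i, k))"

lemma vname_locv: "vname (locv t i v) = vertex_name t i (lz v)"
  by (cases v) (auto simp: vname_def lz_def)

lemma set_concat_events:
  "set (concat (map (\<lambda>(g, t, i). f g t i) ev)) = {y. \<exists>g t i. (g, t, i) \<in> set ev \<and> y \<in> set (f g t i)}"
  by force

lemma image_setcompr: "f ` {h t i v |g t i v. P g t i v} = {f (h t i v) |g t i v. P g t i v}"
  by blast

lemma setcompr_image:
  "{y. \<exists>g t i. P g t i \<and> y \<in> f t i ` {v. Q g v}} = {f t i v |g t i v. P g t i \<and> Q g v}"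
  by blast

text \<open>
  A cell \<open>(t, i)\<close> of the grid takes a value below \<open>\<delta>\<close>. An entry \<open>(m, p, q, m')\<close> of \<open>forb g\<close> forbids, for every
  event \<open>(g, t, i)\<close>, the value \<open>m\<close> at \<open>(t, i)\<close> together with \<open>m'\<close> at \<open>(t + p, i + q)\<close>.
\<close>

locale grid_csp =
  fixes L c \<Lambda> \<delta> :: nat and forb :: "nat \<Rightarrow> (nat \<times> nat \<times> nat \<times> nat) list"
  assumes L: "3 \<le> L" and c: "2 \<le> c" "c < L" and \<Lambda>: "2 * L < \<Lambda>" "\<Lambda> mod L = L - 1" and \<delta>: "1 \<le> \<delta>"
    and forb: "\<And>g m p q m'. (m, p, q, m') \<in> set (forb g) \<Longrightarrow> m < \<delta> \<and> m' < \<delta> \<and> (p, q) \<in> offsets g"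
begin

text \<open>
  The ring \<open>(t, i, m)\<close> in phase 0 says that the value of the cell is \<open>m\<close>, in phase 1 that it is larger,
  in any other phase that it is smaller. A conflict type \<open>(g, m, a, p, q, m', b)\<close> excludes phase \<open>a\<close> of
  ring \<open>m\<close> of a cell together with phase \<open>b\<close> of ring \<open>m'\<close> of the cell at offset \<open>(p, q)\<close>.
\<close>

definition types :: "(nat \<times> nat \<times> nat \<times> nat \<times> nat \<times> nat \<times> nat) list" where
  "types = map (\<lambda>a. (0, 0, a, 0, 0, 0, a)) [2..<L] @
     concat (map (\<lambda>m. map (\<lambda>b. (0, m, 1, 0, 0, Suc m, b)) [2..<L]) [0..<\<delta> - 1]) @
     [(0, \<delta> - 1, 1, 0, 0, \<delta> - 1, 1)] @
     concat (map (\<lambda>g. map (\<lambda>(m, p, q, m'). (g, m, 0, p, q, m', 0)) (forb g)) [0..<9])"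

definition NT :: nat where "NT = length types"

definition gr :: "nat \<Rightarrow> nat" where "gr k = fst (types ! k)"

definition lrf :: "cell_item \<Rightarrow> cell_item" where
  "lrf = (\<lambda>(t, i, k). case types ! k of (g, m, a, p, q, m', b) \<Rightarrow> (t, i, m))"

definition rrf :: "cell_item \<Rightarrow> cell_item" where
  "rrf = (\<lambda>(t, i, k). case types ! k of (g, m, a, p, q, m', b) \<Rightarrow> (t + p, i + q, m'))"

text \<open>Every type owns \<open>L\<close> consecutive sections on each side, the right ones
  behind all \<open>NT * L\<close> left ones. Among these \<open>L\<close> sections each residue of
  the attachment vertex occurs once; the one at distance \<open>L - 1 - a\<close> from the first has
  residue \<open>a\<close>, by \<open>section_phase\<close>.\<close>

definition lsec :: "nat \<Rightarrow> nat" where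
  "lsec k = (case types ! k of (g, m, a, p, q, m', b) \<Rightarrow> k * L + (L - 1 - a))"

definition rsec :: "nat \<Rightarrow> nat" where
  "rsec k = (case types ! k of (g, m, a, p, q, m', b) \<Rightarrow> (NT + k) * L + (L - 1 - b))"

definition lhf :: "cell_item \<Rightarrow> nat" where "lhf = (\<lambda>(t, i, k). lsec k)"

definition rhf :: "cell_item \<Rightarrow> nat" where "rhf = (\<lambda>(t, i, k). rsec k)"

definition H :: nat where "H = 2 * NT * L"

definition M0 :: nat where "M0 = H * \<Lambda>"

fun lvv :: "nat \<Rightarrow> (nat, nat) vertex \<Rightarrow> bool" where
  "lvv g (Ring m s) \<longleftrightarrow> g = 0 \<and> m < \<delta> \<and> s < M0"
| "lvv g (Arm k j) \<longleftrightarrow> k < NT \<and> gr k = g \<and> 1 \<le> j \<and> j \<le> 2 * L + 1"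
| "lvv g (PenL k j) \<longleftrightarrow> k < NT \<and> gr k = g \<and> 1 \<le> j \<and> j \<le> L - 2"
| "lvv g (PenR k j) \<longleftrightarrow> k < NT \<and> gr k = g \<and> 1 \<le> j \<and> j \<le> L - 2"

fun lev :: "nat \<Rightarrow> (nat, nat) eidx \<Rightarrow> bool" where
  "lev g (RE m s) \<longleftrightarrow> g = 0 \<and> m < \<delta> \<and> s < M0"
| "lev g (AE k j) \<longleftrightarrow> k < NT \<and> gr k = g \<and> j < 2 * L + 2"
| "lev g (DL k j) \<longleftrightarrow> k < NT \<and> gr k = g \<and> j < L - 2"
| "lev g (DR k j) \<longleftrightarrow> k < NT \<and> gr k = g \<and> j < L - 2"

text \<open>Any listing of the finite set will do, since only its elements enter the graph. The list
  is a constant of the machine and never computed by it.\<close>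

definition Vl :: "nat \<Rightarrow> (nat, nat) vertex list" where "Vl g = (SOME xs. set xs = {v. lvv g v})"

definition El :: "nat \<Rightarrow> (nat, nat) eidx list" where "El g = (SOME xs. set xs = {e. lev g e})"

text \<open>Coordinates relative to the cell of the event. Only the right end of an arm can lie at a
  neighboring cell, whence the offset \<open>(p, q)\<close>.\<close>

definition tn :: "nat \<Rightarrow> nat \<Rightarrow> tvertex" where
  "tn k j = (case types ! k of (g, m, a, p, q, m', b) \<Rightarrow>
     if j = 0 then (0, 0, zcode 0 m (lsec k * \<Lambda> + L - 1))
     else if j = 2 * L + 2 then (p, q, zcode 0 m' (rsec k * \<Lambda> + L - 1)) else (0, 0, zcode 1 k j))"

fun tends :: "(nat, nat) eidx \<Rightarrow> tvertex \<times> tvertex" where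
  "tends (RE m s) = ((0, 0, zcode 0 m s), (0, 0, zcode 0 m (Suc s mod M0)))"
| "tends (AE k j) = (tn k j, tn k (Suc j))"
| "tends (DL k j) = ((0, 0, if j = 0 then zcode 1 k 2 else zcode 2 k j), (0, 0, zcode 2 k (Suc j)))"
| "tends (DR k j) = ((0, 0, if j = 0 then zcode 1 k (2 * L) else zcode 3 k j), (0, 0, zcode 3 k (Suc j)))"

definition Vt :: "nat \<Rightarrow> nat list" where "Vt g = map lz (Vl g)"

definition Et :: "nat \<Rightarrow> tedge list" where
  "Et g = map (\<lambda>e. (fst (tends e), snd (tends e), gadget.col L c \<Lambda> (loce 0 0 e))) (El g)"

definition kc :: "nat \<Rightarrow> nat" where
  "kc g = (if g = 0 then \<delta> * (M0 div L) else 0) + 3 * card {k. k < NT \<and> gr k = g}"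

lemma types_valid:
  "(g, m, a, p, q, m', b) \<in> set types \<Longrightarrow> m < \<delta> \<and> m' < \<delta> \<and> a < L \<and> b < L \<and> g < 9 \<and> (p, q) \<in> offsets g"
proof -
  assume "(g, m, a, p, q, m', b) \<in> set types"
  moreover have "(0, 0) \<in> offsets 0" by (simp add: offsets_def)
  ultimately show ?thesis using L \<delta> by (auto simp: types_def dest: forb)
qed

lemma type_at:
  assumes "k < NT"
  obtains m a p q m' b where "types ! k = (gr k, m, a, p, q, m', b)" "(gr k, m, a, p, q, m', b) \<in> set types"
    "m < \<delta>" "m' < \<delta>" "a < L" "b < L" "(p, q) \<in> offsets (gr k)"
proof -
  obtain g m a p q m' b where t: "types ! k = (g, m, a, p, q, m', b)" by (metis prod_cases7)
  then have "(g, m, a, p, q, m', b) \<in> set types" using assms by (metis NT_def nth_mem)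
  then show ?thesis using that[of m a p q m' b] t types_valid by (simp add: gr_def)
qed

lemma finite_lvv: "finite {v. lvv g v}"
proof -
  let ?A = "(\<lambda>(m, s). Ring m s) ` ({..<\<delta>} \<times> {..<M0}) \<union> (\<lambda>(k, j). Arm k j) ` ({..<NT} \<times> {..2 * L + 1}) \<union>
      (\<lambda>(k, j). PenL k j) ` ({..<NT} \<times> {..L}) \<union> (\<lambda>(k, j). PenR k j) ` ({..<NT} \<times> {..L})"
  have "v \<in> ?A" if "lvv g v" for v using that by (cases v) (auto simp: image_iff)
  then have "{v. lvv g v} \<subseteq> ?A" by blast
  moreover have "finite ?A" by simp
  ultimately show ?thesis by (rule finite_subset)
qed

lemma finite_lev: "finite {e. lev g e}"
proof -
  let ?A = "(\<lambda>(m, s). RE m s) ` ({..<\<delta>} \<times> {..<M0}) \<union> (\<lambda>(k, j). AE k j) ` ({..<NT} \<times> {..2 * L + 1}) \<union>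
      (\<lambda>(k, j). DL k j) ` ({..<NT} \<times> {..L}) \<union> (\<lambda>(k, j). DR k j) ` ({..<NT} \<times> {..L})"
  have "v \<in> ?A" if "lev g v" for v using that by (cases v) (auto simp: image_iff)
  then have "{v. lev g v} \<subseteq> ?A" by blast
  moreover have "finite ?A" by simp
  ultimately show ?thesis by (rule finite_subset)
qed

lemma set_Vl: "set (Vl g) = {v. lvv g v}"
  unfolding Vl_def by (rule someI_ex[of "\<lambda>xs. set xs = {v. lvv g v}"]) (rule finite_list[OF finite_lvv])

lemma set_El: "set (El g) = {e. lev g e}"
  unfolding El_def by (rule someI_ex[of "\<lambda>xs. set xs = {e. lev g e}"]) (rule finite_list[OF finite_lev])

lemma section_less: "a < L \<Longrightarrow> k * L + (L - 1 - a) < Suc k * L"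
  using L by simp

lemma section_div: "(k * L + (L - 1 - a)) div L = k"
  using L by simp

text \<open>\<open>L\<close> divides \<open>\<Lambda> + 1\<close>, so the attachment vertex of
  section \<open>h\<close> is \<open>- h - 1\<close> modulo \<open>L\<close>; for
  \<open>h = k * L + (L - 1 - a)\<close> this is \<open>a\<close>.\<close>

lemma section_phase:
  assumes "a < L"
  shows "((k * L + (L - 1 - a)) * \<Lambda> + L - 1) mod L = a"
proof -
  let ?h = "k * L + (L - 1 - a)"
  let ?p = "?h * \<Lambda> + L - 1"
  have "L dvd Suc \<Lambda>"
  proof -
    have "Suc \<Lambda> mod L = Suc (\<Lambda> mod L) mod L" by (rule mod_Suc_eq[symmetric])
    then show ?thesis using \<Lambda>(2) L by (simp add: dvd_eq_mod_eq_0)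
  qed
  then have "L dvd ?h * Suc \<Lambda> + L" by (intro dvd_add dvd_mult dvd_refl)
  moreover have "?p + (L - a) + k * L = ?h * Suc \<Lambda> + L" using assms L by simp
  ultimately have "L dvd ?p + (L - a) + k * L" by (simp only:)
  then have "L dvd ?p + (L - a)" by (simp add: dvd_add_left_iff)
  then have "(?p + (L - a)) mod L = 0" by (simp add: dvd_eq_mod_eq_0)
  moreover have "(?p mod L + (L - a)) mod L = (?p + (L - a)) mod L" by (rule mod_add_left_eq)
  moreover have "(a + (L - a)) mod L = 0" using assms by simp
  ultimately have "(?p mod L + (L - a)) mod L = (a + (L - a)) mod L" by (simp only:)
  then show ?thesis by (rule mod_shift_inj[rotated 2]) (use assms in auto)
qed

context
  fixes A q :: nat and x :: "bool list"
  assumes A: "1 \<le> A"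
begin

definition ev :: "event list" where "ev = events A q x"

definition Rg :: "cell_item set" where "Rg = {(t, i, m). (0, t, i) \<in> set ev \<and> m < \<delta>}"

definition Kf :: "cell_item set" where "Kf = {(t, i, k). k < NT \<and> (gr k, t, i) \<in> set ev}"

lemma NT_pos: "0 < NT"
  by (simp add: NT_def types_def)

lemma ev_cell: "(g, t, i) \<in> set ev \<Longrightarrow> (p, r) \<in> offsets g \<Longrightarrow> (0, t + p, i + r) \<in> set ev"
  unfolding ev_def by (rule events_offset[OF A])

lemma ev_cell0: "(g, t, i) \<in> set ev \<Longrightarrow> (0, t, i) \<in> set ev"
  using A unfolding ev_def events_iff Let_def by auto

lemma gadget: "gadget L c \<Lambda> H (NT * L) Rg Kf lrf rrf lhf rhf"
proof
  show "0 < H" using NT_pos L by (simp add: H_def)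
  have "Rg \<subseteq> (\<lambda>((g, t, i), m). (t, i, m)) ` (set ev \<times> {..<\<delta>})"
  proof
    fix X assume "X \<in> Rg"
    then obtain t i m where "X = (t, i, m)" "(0, t, i) \<in> set ev" "m < \<delta>" by (auto simp: Rg_def)
    then show "X \<in> (\<lambda>((g, t, i), m). (t, i, m)) ` (set ev \<times> {..<\<delta>})"
      by (intro image_eqI[of _ _ "((0, t, i), m)"]) auto
  qed
  then show "finite Rg" by (rule finite_subset) simp
  have "Kf \<subseteq> (\<lambda>((g, t, i), m). (t, i, m)) ` (set ev \<times> {..<NT})"
  proof
    fix X assume "X \<in> Kf"
    then obtain t i m where "X = (t, i, m)" "(gr m, t, i) \<in> set ev" "m < NT" by (auto simp: Kf_def)
    then show "X \<in> (\<lambda>((g, t, i), m). (t, i, m)) ` (set ev \<times> {..<NT})"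
      by (intro image_eqI[of _ _ "((gr m, t, i), m)"]) auto
  qed
  then show "finite Kf" by (rule finite_subset) simp
  \<comment> \<open>This type occurs at every cell, whatever \<open>forb\<close> contains, so the
    graph has an arm and its maximum degree is exactly three.\<close>
  have "(0, \<delta> - 1, 1, 0, 0, \<delta> - 1, 1) \<in> set types" by (simp add: types_def)
  then obtain k where "k < NT" "types ! k = (0, \<delta> - 1, 1, 0, 0, \<delta> - 1, 1)" by (metis NT_def in_set_conv_nth)
  then have "(0, 0, k) \<in> Kf" by (simp add: Kf_def gr_def ev_def events_iff)
  then show "Kf \<noteq> {}" by blast
  fix k assume k: "k \<in> Kf"
  obtain t i j where kt: "k = (t, i, j)" "j < NT" "(gr j, t, i) \<in> set ev" using k by (auto simp: Kf_def)
  obtain m a p r m' b where ty: "types ! j = (gr j, m, a, p, r, m', b)" "m < \<delta>" "m' < \<delta>" "a < L" "b < L" "(p, r) \<in> offsets (gr j)"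
    using type_at[OF kt(2)] by metis
  show "lrf k \<in> Rg" using kt ty ev_cell0 by (auto simp: Rg_def lrf_def)
  show "rrf k \<in> Rg" using kt ty ev_cell[OF kt(3) ty(6)] by (auto simp: Rg_def rrf_def)
  have "Suc j * L \<le> NT * L" using kt(2) by (intro mult_right_mono) auto
  then show l: "lhf k < NT * L" using section_less[OF ty(4), of j] kt ty by (simp add: lhf_def lsec_def)
  show "NT * L \<le> rhf k" using kt ty by (simp add: rhf_def rsec_def add_mult_distrib)
  show "lhf k < H" using l by (simp add: H_def)
  have "Suc (NT + j) * L \<le> 2 * NT * L" using kt(2) by (intro mult_right_mono) auto
  then show "rhf k < H" using section_less[OF ty(5), of "NT + j"] kt ty by (simp add: rhf_def rsec_def H_def)
next
  have ls: "lsec k div L = k" and rs: "rsec k div L = NT + k" for k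
  proof -
    obtain g m a p q m' b where t: "types ! k = (g, m, a, p, q, m', b)" by (metis prod_cases7)
    show "lsec k div L = k" "rsec k div L = NT + k"
      unfolding lsec_def rsec_def t prod.case by (rule section_div)+
  qed
  show "inj_on (\<lambda>k. (lrf k, lhf k)) Kf"
  proof (rule inj_onI)
    fix k k' assume "(lrf k, lhf k) = (lrf k', lhf k')"
    moreover obtain t i j t' i' j' where kk: "k = (t, i, j)" "k' = (t', i', j')" by (metis prod_cases3)
    ultimately have "lsec j = lsec j'" "lrf k = lrf k'" by (auto simp: lhf_def)
    then have "j = j'" by (metis ls)
    then show "k = k'" using \<open>lrf k = lrf k'\<close> kk by (auto simp: lrf_def split: prod.splits)
  qed
  show "inj_on (\<lambda>k. (rrf k, rhf k)) Kf"
  proof (rule inj_onI)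
    fix k k' assume "(rrf k, rhf k) = (rrf k', rhf k')"
    moreover obtain t i j t' i' j' where kk: "k = (t, i, j)" "k' = (t', i', j')" by (metis prod_cases3)
    ultimately have "rsec j = rsec j'" "rrf k = rrf k'" by (auto simp: rhf_def)
    then have "j = j'" by (metis rs add_left_cancel)
    then show "k = k'" using \<open>rrf k = rrf k'\<close> kk by (auto simp: rrf_def split: prod.splits)
  qed
qed (use L c \<Lambda> in \<open>auto simp: H_def\<close>)

interpretation G: gadget L c \<Lambda> H "NT * L" Rg Kf lrf rrf lhf rhf
  by (rule gadget)

lemma GM: "G.M = M0"
  by (simp add: G.M_def M0_def)

lemma Rg_iff: "(t, i, m) \<in> Rg \<longleftrightarrow> (0, t, i) \<in> set ev \<and> m < \<delta>"
  by (simp add: Rg_def)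

lemma Kf_iff: "(t, i, k) \<in> Kf \<longleftrightarrow> k < NT \<and> (gr k, t, i) \<in> set ev"
  by (simp add: Kf_def)

lemma arm_at:
  assumes "types ! k = (g, m, a, p, r, m', b)"
  shows "lrf (t, i, k) = (t, i, m)" "rrf (t, i, k) = (t + p, i + r, m')" "lhf (t, i, k) = lsec k" "rhf (t, i, k) = rsec k"
  using assms by (simp_all add: lrf_def rrf_def lhf_def rhf_def)

lemma V_eq: "G.V = {locv t i v |g t i v. (g, t, i) \<in> set ev \<and> lvv g v}"
proof
  show "G.V \<subseteq> {locv t i v |g t i v. (g, t, i) \<in> set ev \<and> lvv g v}"
  proof
    fix v assume "v \<in> G.V"
    then have v: "G.vvalid v" by (simp add: G.V_def)
    have "\<exists>g t i w. v = locv t i w \<and> (g, t, i) \<in> set ev \<and> lvv g w"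
    proof (cases v)
      case (Ring X s)
      then obtain t i m where "v = Ring (t, i, m) s" "(0, t, i) \<in> set ev" "m < \<delta>" "s < M0" using v by (cases X) (auto simp: Rg_iff GM)
      then show ?thesis by (intro exI[of _ 0] exI[of _ t] exI[of _ i] exI[of _ "Ring m s"]) auto
    next
      case (Arm X s)
      then obtain t i k where "v = Arm (t, i, k) s" "(gr k, t, i) \<in> set ev" "k < NT" "1 \<le> s" "s \<le> 2 * L + 1" using v by (cases X) (auto simp: Kf_iff)
      then show ?thesis by (intro exI[of _ "gr k"] exI[of _ t] exI[of _ i] exI[of _ "Arm k s"]) auto
    next
      case (PenL X s)
      then obtain t i k where "v = PenL (t, i, k) s" "(gr k, t, i) \<in> set ev" "k < NT" "1 \<le> s" "s \<le> L - 2" using v by (cases X) (auto simp: Kf_iff)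
      then show ?thesis by (intro exI[of _ "gr k"] exI[of _ t] exI[of _ i] exI[of _ "PenL k s"]) auto
    next
      case (PenR X s)
      then obtain t i k where "v = PenR (t, i, k) s" "(gr k, t, i) \<in> set ev" "k < NT" "1 \<le> s" "s \<le> L - 2" using v by (cases X) (auto simp: Kf_iff)
      then show ?thesis by (intro exI[of _ "gr k"] exI[of _ t] exI[of _ i] exI[of _ "PenR k s"]) auto
    qed
    then show "v \<in> {locv t i v |g t i v. (g, t, i) \<in> set ev \<and> lvv g v}" by blast
  qed
  have "G.vvalid (locv t i v)" if "(g, t, i) \<in> set ev" "lvv g v" for g t i v
    using that by (cases v) (auto simp: Rg_iff Kf_iff GM)
  then show "{locv t i v |g t i v. (g, t, i) \<in> set ev \<and> lvv g v} \<subseteq> G.V" by (auto simp: G.V_def)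
qed

lemma EI_eq: "G.EI = {loce t i e |g t i e. (g, t, i) \<in> set ev \<and> lev g e}"
proof
  show "G.EI \<subseteq> {loce t i e |g t i e. (g, t, i) \<in> set ev \<and> lev g e}"
  proof
    fix v assume "v \<in> G.EI"
    then have v: "G.valid v" by (simp add: G.EI_def)
    have "\<exists>g t i w. v = loce t i w \<and> (g, t, i) \<in> set ev \<and> lev g w"
    proof (cases v)
      case (RE X s)
      then obtain t i m where "v = RE (t, i, m) s" "(0, t, i) \<in> set ev" "m < \<delta>" "s < M0" using v by (cases X) (auto simp: Rg_iff GM)
      then show ?thesis by (intro exI[of _ 0] exI[of _ t] exI[of _ i] exI[of _ "RE m s"]) auto
    next
      case (AE X s)
      then obtain t i k where "v = AE (t, i, k) s" "(gr k, t, i) \<in> set ev" "k < NT" "s < 2 * L + 2" using v by (cases X) (auto simp: Kf_iff)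
      then show ?thesis by (intro exI[of _ "gr k"] exI[of _ t] exI[of _ i] exI[of _ "AE k s"]) auto
    next
      case (DL X s)
      then obtain t i k where "v = DL (t, i, k) s" "(gr k, t, i) \<in> set ev" "k < NT" "s < L - 2" using v by (cases X) (auto simp: Kf_iff)
      then show ?thesis by (intro exI[of _ "gr k"] exI[of _ t] exI[of _ i] exI[of _ "DL k s"]) auto
    next
      case (DR X s)
      then obtain t i k where "v = DR (t, i, k) s" "(gr k, t, i) \<in> set ev" "k < NT" "s < L - 2" using v by (cases X) (auto simp: Kf_iff)
      then show ?thesis by (intro exI[of _ "gr k"] exI[of _ t] exI[of _ i] exI[of _ "DR k s"]) auto
    qed
    then show "v \<in> {loce t i e |g t i e. (g, t, i) \<in> set ev \<and> lev g e}" by blast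
  qed
  have "G.valid (loce t i v)" if "(g, t, i) \<in> set ev" "lev g v" for g t i v
    using that by (cases v) (auto simp: Rg_iff Kf_iff GM)
  then show "{loce t i e |g t i e. (g, t, i) \<in> set ev \<and> lev g e} \<subseteq> G.EI" by (auto simp: G.EI_def)
qed

lemma tn_shift: "shift t i (tn k j) = vname (G.node (t, i, k) j)"
proof -
  obtain g m a p r m' b where ty: "types ! k = (g, m, a, p, r, m', b)" by (metis prod_cases7)
  show ?thesis by (auto simp: shift_def tn_def G.node_def vname_def arm_at[OF ty] ty G.pos_def)
qed

lemma tends_shift:
  "shift t i (fst (tends e)) = vname (fst (G.ends (loce t i e)))"
  "shift t i (snd (tends e)) = vname (snd (G.ends (loce t i e)))"
proof -
  have "shift t i (fst (tends e)) = vname (fst (G.ends (loce t i e))) \<and>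
      shift t i (snd (tends e)) = vname (snd (G.ends (loce t i e)))"
  proof (cases e)
    case (RE m s)
    then show ?thesis by (simp add: GM shift_def vname_def)
  next
    case (AE k j)
    then show ?thesis by (simp add: tn_shift)
  next
    case (DL k j)
    then show ?thesis by (simp add: G.pl_def shift_def vname_def)
  next
    case (DR k j)
    then show ?thesis by (simp add: G.pr_def shift_def vname_def)
  qed
  then show "shift t i (fst (tends e)) = vname (fst (G.ends (loce t i e)))"
    "shift t i (snd (tends e)) = vname (snd (G.ends (loce t i e)))" by auto
qed

lemma col_loce: "G.col (loce t i e) = G.col (loce 0 0 e)"
  by (cases e) auto

lemma set_vertices: "set (vertices_of Vt ev) = vname ` G.V"
proof -
  have "set (vertices_of Vt ev) = {y. \<exists>g t i. (g, t, i) \<in> set ev \<and> y \<in> (\<lambda>v. vname (locv t i v)) ` {v. lvv g v}}"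
    unfolding vertices_of_def set_concat_events set_map Vt_def set_Vl image_image vname_locv ..
  then show ?thesis unfolding V_eq image_setcompr setcompr_image .
qed

lemma set_edges: "set (edges_of Et ev) = (\<lambda>e. (vname (fst (G.ends e)), vname (snd (G.ends e)), G.col e)) ` G.EI"
proof -
  let ?i = "\<lambda>e. (vname (fst (G.ends e)), vname (snd (G.ends e)), G.col e)"
  have eq: "(shift t i (fst (tends e)), shift t i (snd (tends e)), G.col (loce 0 0 e)) = ?i (loce t i e)" for t i e
    unfolding tends_shift col_loce[of t i e] ..
  have "set (edges_of Et ev) = {y. \<exists>g t i. (g, t, i) \<in> set ev \<and> y \<in> (\<lambda>e. ?i (loce t i e)) ` {e. lev g e}}"
    unfolding edges_of_def set_concat_events set_map Et_def set_El image_image prod.case eq ..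
  then show ?thesis unfolding EI_eq image_setcompr setcompr_image .
qed

lemma budget_eq: "budget_of kc ev = G.budget"
proof -
  have d: "distinct ev" by (simp add: ev_def distinct_events)
  have "budget_of kc ev = (\<Sum>e\<in>set ev. kc (fst e))"
    unfolding budget_of_def using d by (simp add: sum_list_distinct_conv_sum_set case_prod_beta')
  also have "\<dots> = (\<Sum>e\<in>set ev. card (if fst e = 0 then {..<\<delta>} else {})) * (M0 div L) + 3 * (\<Sum>e\<in>set ev. card {k. k < NT \<and> gr k = fst e})"
    unfolding sum_distrib_right sum_distrib_left sum.distrib[symmetric] by (intro sum.cong) (auto simp: kc_def)
  also have "(\<Sum>e\<in>set ev. card (if fst e = 0 then {..<\<delta>} else {})) = card Rg"
  proof -
    let ?S = "SIGMA e:set ev. (if fst e = 0 then {..<\<delta>} else {})"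
    have "(\<Sum>e\<in>set ev. card (if fst e = 0 then {..<\<delta>} else {})) = card ?S" by (subst card_SigmaI) auto
    also have "\<dots> = card ((\<lambda>((g, t, i), m). (t, i, m)) ` ?S)"
      by (rule card_image[symmetric]) (auto simp: inj_on_def split: if_splits)
    also have "(\<lambda>((g, t, i), m). (t, i, m)) ` ?S = Rg"
    proof
      show "Rg \<subseteq> (\<lambda>((g, t, i), m). (t, i, m)) ` ?S"
      proof
        fix X assume "X \<in> Rg"
        then obtain t i m where "X = (t, i, m)" "(0, t, i) \<in> set ev" "m < \<delta>" by (auto simp: Rg_def)
        then show "X \<in> (\<lambda>((g, t, i), m). (t, i, m)) ` ?S" by (intro image_eqI[of _ _ "((0, t, i), m)"]) auto
      qed
    qed (auto simp: Rg_def split: if_splits)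
    finally show ?thesis .
  qed
  also have "(\<Sum>e\<in>set ev. card {k. k < NT \<and> gr k = fst e}) = card Kf"
  proof -
    let ?S = "SIGMA e:set ev. {k. k < NT \<and> gr k = fst e}"
    have "(\<Sum>e\<in>set ev. card {k. k < NT \<and> gr k = fst e}) = card ?S" by (subst card_SigmaI) auto
    also have "\<dots> = card ((\<lambda>((g, t, i), m). (t, i, m)) ` ?S)"
      by (rule card_image[symmetric]) (auto simp: inj_on_def)
    also have "(\<lambda>((g, t, i), m). (t, i, m)) ` ?S = Kf"
    proof
      show "Kf \<subseteq> (\<lambda>((g, t, i), m). (t, i, m)) ` ?S"
      proof
        fix X assume "X \<in> Kf"
        then obtain t i m where "X = (t, i, m)" "(gr m, t, i) \<in> set ev" "m < NT" by (auto simp: Kf_def)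
        then show "X \<in> (\<lambda>((g, t, i), m). (t, i, m)) ` ?S" by (intro image_eqI[of _ _ "((gr m, t, i), m)"]) auto
      qed
    qed (auto simp: Kf_def)
    finally show ?thesis .
  qed
  finally show ?thesis by (simp add: G.budget_def G.N_def GM)
qed

definition solvable :: bool where
  "solvable \<longleftrightarrow> (\<exists>val. (\<forall>t i. (0, t, i) \<in> set ev \<longrightarrow> val t i < \<delta>) \<and>
     (\<forall>g t i m p r m'. (g, t, i) \<in> set ev \<longrightarrow> (m, p, r, m') \<in> set (forb g) \<longrightarrow>
        \<not> (val t i = m \<and> val (t + p) (i + r) = m')))"

lemma consistent_iff:
  "G.consistent ph \<longleftrightarrow> (\<forall>X\<in>Rg. ph X < L) \<and>
     (\<forall>t i g m a p r m' b. (g, t, i) \<in> set ev \<longrightarrow> (g, m, a, p, r, m', b) \<in> set types \<longrightarrow>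
        \<not> (ph (t, i, m) = a \<and> ph (t + p, i + r, m') = b))"
proof -
  have f: "(G.fires ph (lrf (t, i, k)) (lhf (t, i, k)) \<and> G.fires ph (rrf (t, i, k)) (rhf (t, i, k))) \<longleftrightarrow>
      (ph (t, i, m) = a \<and> ph (t + p, i + r, m') = b)"
    if "types ! k = (g, m, a, p, r, m', b)" "a < L" "b < L" for t i k g m a p r m' b
    using that section_phase[OF that(2), of k] section_phase[OF that(3), of "NT + k"]
    by (simp add: G.fires_def G.pos_def arm_at[OF that(1)] lsec_def rsec_def)
  have "(\<forall>k\<in>Kf. \<not> (G.fires ph (lrf k) (lhf k) \<and> G.fires ph (rrf k) (rhf k))) \<longleftrightarrow>
     (\<forall>t i g m a p r m' b. (g, t, i) \<in> set ev \<longrightarrow> (g, m, a, p, r, m', b) \<in> set types \<longrightarrow>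
        \<not> (ph (t, i, m) = a \<and> ph (t + p, i + r, m') = b))" (is "?l = ?r")
  proof
    assume l: ?l
    show ?r
    proof (intro allI impI)
      fix t i g m a p r m' b assume h: "(g, t, i) \<in> set ev" "(g, m, a, p, r, m', b) \<in> set types"
      obtain k where k: "k < NT" "types ! k = (g, m, a, p, r, m', b)" using h(2) by (metis NT_def in_set_conv_nth)
      have "(t, i, k) \<in> Kf" using k h(1) by (simp add: Kf_def gr_def)
      then have "\<not> (G.fires ph (lrf (t, i, k)) (lhf (t, i, k)) \<and> G.fires ph (rrf (t, i, k)) (rhf (t, i, k)))" using l by blast
      then show "\<not> (ph (t, i, m) = a \<and> ph (t + p, i + r, m') = b)"
        unfolding f[OF k(2) types_valid[OF h(2), THEN conjunct2, THEN conjunct2, THEN conjunct1]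
          types_valid[OF h(2), THEN conjunct2, THEN conjunct2, THEN conjunct2, THEN conjunct1]] .
    qed
  next
    assume r: ?r
    show ?l
    proof
      fix X assume "X \<in> Kf"
      then obtain t i k where X: "X = (t, i, k)" "k < NT" "(gr k, t, i) \<in> set ev" by (auto simp: Kf_def)
      obtain m a p r' m' b where ty: "types ! k = (gr k, m, a, p, r', m', b)" "(gr k, m, a, p, r', m', b) \<in> set types" "a < L" "b < L"
        using type_at[OF X(2)] by metis
      have "\<not> (ph (t, i, m) = a \<and> ph (t + p, i + r', m') = b)" using r X(3) ty(2) by blast
      then show "\<not> (G.fires ph (lrf X) (lhf X) \<and> G.fires ph (rrf X) (rhf X))"
        unfolding X(1) f[OF ty(1,3,4)] .
    qed
  qed
  then show ?thesis by (simp add: G.consistent_def)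
qed

text \<open>Along the rings of a cell, smaller is excluded at 0, larger at \<open>m\<close> excludes
  smaller at \<open>m + 1\<close>, and larger is excluded at \<open>\<delta> - 1\<close>. So some
  ring has phase 0. If several do, any of them can serve as the value, since the types from
  \<open>forb\<close> exclude every forbidden pair of rings in phase 0.\<close>

lemma consistent_solvable: "(\<exists>ph. G.consistent ph) \<longleftrightarrow> solvable"
proof
  assume "\<exists>ph. G.consistent ph"
  then obtain ph where ph: "\<And>X. X \<in> Rg \<Longrightarrow> ph X < L"
    and no: "\<And>t i g m a p r m' b. (g, t, i) \<in> set ev \<Longrightarrow> (g, m, a, p, r, m', b) \<in> set types \<Longrightarrow>
        \<not> (ph (t, i, m) = a \<and> ph (t + p, i + r, m') = b)"
    unfolding consistent_iff by blast
  have "\<exists>m<\<delta>. ph (t, i, m) = 0" if cell: "(0, t, i) \<in> set ev" for t i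
  proof (rule ccontr)
    assume n0: "\<not> (\<exists>m<\<delta>. ph (t, i, m) = 0)"
    have lt: "ph (t, i, m) < L" if "m < \<delta>" for m using that cell by (intro ph) (simp add: Rg_def)
    have "m < \<delta> \<Longrightarrow> ph (t, i, m) = 1" for m
    proof (induction m)
      case 0
      have "\<not> 2 \<le> ph (t, i, 0)"
      proof
        assume "2 \<le> ph (t, i, 0)"
        then have "(0, 0, ph (t, i, 0), 0, 0, 0, ph (t, i, 0)) \<in> set types" using lt[OF 0] by (auto simp: types_def)
        from no[OF cell this] show False by simp
      qed
      then show ?case using n0 0 by (metis One_nat_def less_2_cases not_le)
    next
      case (Suc m)
      then have IH: "ph (t, i, m) = 1" by simp
      have "\<not> 2 \<le> ph (t, i, Suc m)"
      proof
        assume "2 \<le> ph (t, i, Suc m)"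
        then have "ph (t, i, Suc m) \<in> {2..<L}" "m \<in> {0..<\<delta> - 1}" using lt[OF Suc.prems] Suc.prems by auto
        then have "(0, m, 1, 0, 0, Suc m, ph (t, i, Suc m)) \<in> (\<Union>m\<in>{0..<\<delta> - 1}. (\<lambda>b. (0, m, 1, 0, 0, Suc m, b)) ` {2..<L})"
          by blast
        then have "(0, m, 1, 0, 0, Suc m, ph (t, i, Suc m)) \<in> set types"
          by (simp only: types_def set_append set_concat set_map set_upt image_image Un_iff) blast
        from no[OF cell this] show False using IH by simp
      qed
      then show ?case using n0 Suc.prems by (metis One_nat_def less_2_cases not_le)
    qed
    then have "ph (t, i, \<delta> - 1) = 1" using \<delta> by simp
    moreover have "(0, \<delta> - 1, 1, 0, 0, \<delta> - 1, 1) \<in> set types" by (simp add: types_def)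
    ultimately show False using no[OF cell] by fastforce
  qed
  then obtain val where val: "\<And>t i. (0, t, i) \<in> set ev \<Longrightarrow> val t i < \<delta> \<and> ph (t, i, val t i) = 0" by metis
  have "\<not> (val t i = m \<and> val (t + p) (i + r) = m')" if "(g, t, i) \<in> set ev" "(m, p, r, m') \<in> set (forb g)" for g t i m p r m'
  proof
    assume v: "val t i = m \<and> val (t + p) (i + r) = m'"
    have "g < 9" using that(1) events_group by (simp add: ev_def)
    then have "(g, m, 0, p, r, m', 0) \<in> set types" using that(2) by (force simp: types_def)
    then have "\<not> (ph (t, i, m) = 0 \<and> ph (t + p, i + r, m') = 0)" using no that(1) by blast
    moreover have "(0, t, i) \<in> set ev" using that(1) by (rule ev_cell0)
    then have "ph (t, i, m) = 0" using val v by auto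
    moreover have "(0, t + p, i + r) \<in> set ev" using forb[OF that(2)] that(1) by (intro ev_cell) auto
    then have "ph (t + p, i + r, m') = 0" using val v by auto
    ultimately show False by blast
  qed
  then show solvable unfolding solvable_def using val by blast
next
  assume solvable
  then obtain val where val: "\<And>t i. (0, t, i) \<in> set ev \<Longrightarrow> val t i < \<delta>"
    and no: "\<And>g t i m p r m'. (g, t, i) \<in> set ev \<Longrightarrow> (m, p, r, m') \<in> set (forb g) \<Longrightarrow>
        \<not> (val t i = m \<and> val (t + p) (i + r) = m')" unfolding solvable_def by blast
  \<comment> \<open>Among the phases meaning smaller, 2 is chosen; it is below \<open>L\<close>
    because \<open>3 \<le> L\<close>.\<close>
  let ?ph = "\<lambda>(t, i, m). if m < val t i then 1 else if m = val t i then 0 else 2 :: nat"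
  have "G.consistent ?ph" unfolding consistent_iff
  proof (intro conjI allI impI)
    show "\<forall>X\<in>Rg. ?ph X < L" using L by auto
    fix t i g m a p r m' b assume h: "(g, t, i) \<in> set ev" "(g, m, a, p, r, m', b) \<in> set types"
    have v: "val t i < \<delta>" using val ev_cell0[OF h(1)] by blast
    from h(2) consider "m = 0 \<and> 2 \<le> a" | "a = 1 \<and> 2 \<le> b \<and> p = 0 \<and> r = 0 \<and> m' = Suc m" | "m = \<delta> - 1 \<and> a = 1"
      | "a = 0 \<and> b = 0 \<and> (m, p, r, m') \<in> set (forb g)" by (auto simp: types_def)
    then show "\<not> (?ph (t, i, m) = a \<and> ?ph (t + p, i + r, m') = b)"
    proof cases
      case 4
      then show ?thesis using no[OF h(1), of m p r m'] by (auto split: if_splits)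
    qed (use v in \<open>auto split: if_splits\<close>)
  qed
  then show "\<exists>ph. G.consistent ph" by blast
qed

definition instance_code :: "bool list" where
  "instance_code = input_code (vertices_of Vt ev) (edges_of Et ev) (budget_of kc ev)"

lemma encodes_instance:
  "encodes instance_code (vname ` G.V) ((`) vname ` G.E) (\<lambda>i. (`) vname ` G.C i) G.budget"
proof -
  have edge: "vname ` G.edge e = {vname (fst (G.ends e)), vname (snd (G.ends e))}" for e
    by (simp add: G.edge_def)
  have "(`) vname ` G.E = {{u, v} |u v i. (u, v, i) \<in> set (edges_of Et ev)}"
    unfolding set_edges G.E_def image_image edge by blast
  moreover have "(\<lambda>i. (`) vname ` G.C i) = (\<lambda>i. {{u, v} |u v. (u, v, i) \<in> set (edges_of Et ev)})"
    unfolding set_edges G.C_def image_image edge by (rule ext) blast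
  ultimately show ?thesis unfolding encodes_def instance_code_def
    using set_vertices budget_eq by metis
qed

lemma instance_in:
  assumes "r < real \<Lambda>"
  shows "instance_code \<in> max_degree_three_girth_inputs c r"
proof -
  have "enat \<Lambda> \<le> girth ((`) vname ` G.E)"
    by (rule girth_image[OF inj_vname, of _ G.V]) (use G.simple G.long_cycles in \<open>auto simp: simple_graph_def\<close>)
  then have "ereal_of_enat (enat \<Lambda>) \<le> ereal_of_enat (girth ((`) vname ` G.E))" by (simp only: ereal_of_enat_le_iff)
  moreover have "ereal r < ereal_of_enat (enat \<Lambda>)" using assms by simp
  ultimately have "ereal r < ereal_of_enat (girth ((`) vname ` G.E))" by (rule less_le_trans[rotated])
  then show ?thesis unfolding max_degree_three_girth_inputs_def
    using encodes_instance colored_graph_image[OF inj_vname G.colored] max_degree_image[OF inj_vname] G.max_degree by force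
qed

lemma instance_yes: "instance_code \<in> colored_path_deletion c (Suc L) \<longleftrightarrow> solvable"
proof -
  have "instance_code \<in> colored_path_deletion c (Suc L) \<longleftrightarrow>
      deletion_solvable c (Suc L) (vname ` G.V) ((`) vname ` G.E) (\<lambda>i. (`) vname ` G.C i) G.budget"
  proof
    assume "instance_code \<in> colored_path_deletion c (Suc L)"
    then obtain V E C k where k: "encodes instance_code V E C k" "deletion_solvable c (Suc L) V E C k"
      unfolding colored_path_deletion_def by blast
    then show "deletion_solvable c (Suc L) (vname ` G.V) ((`) vname ` G.E) (\<lambda>i. (`) vname ` G.C i) G.budget"
      using encodes_unique[OF k(1) encodes_instance] by simp
  next
    assume "deletion_solvable c (Suc L) (vname ` G.V) ((`) vname ` G.E) (\<lambda>i. (`) vname ` G.C i) G.budget"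
    then show "instance_code \<in> colored_path_deletion c (Suc L)"
      unfolding colored_path_deletion_def
      using encodes_instance colored_graph_image[OF inj_vname G.colored] by blast
  qed
  then show ?thesis by (simp only: deletion_image[OF inj_vname] G.deletion_iff consistent_solvable)
qed

end

end

section \<open>The tableau of a verifier\<close>

lemma pair_code_Cons: "pair_code (a # x) y = True # a # pair_code x y"
  by (simp add: pair_code_def)

lemma length_pair_code: "length (pair_code x y) = Suc (2 * length x + length y)"
  by (induction x) (auto simp: pair_code_Cons, simp add: pair_code_def)

lemma pair_code_nth:
  "j < length x \<Longrightarrow> pair_code x y ! (2 * j) = True"
  "j < length x \<Longrightarrow> pair_code x y ! Suc (2 * j) = x ! j"
  "pair_code x y ! (2 * length x) = False"
  "pair_code x y ! Suc (2 * length x + k) = y ! k"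
proof -
  show "pair_code x y ! (2 * j) = True" if "j < length x" using that
    by (induction x arbitrary: j) (auto simp: pair_code_Cons less_Suc_eq_0_disj)
  show "pair_code x y ! Suc (2 * j) = x ! j" if "j < length x" using that
    by (induction x arbitrary: j) (auto simp: pair_code_Cons less_Suc_eq_0_disj)
  show "pair_code x y ! (2 * length x) = False"
    by (induction x) (simp add: pair_code_def, simp add: pair_code_Cons)
  show "pair_code x y ! Suc (2 * length x + k) = y ! k"
    by (induction x) (simp add: pair_code_def, simp add: pair_code_Cons)
qed

lemma poly_mono_nat:
  fixes p :: "nat poly"
  shows "m \<le> n \<Longrightarrow> poly p m \<le> poly p n"
  by (induction p) (auto intro!: add_mono mult_mono)

type_synonym cell = "nat \<times> nat list \<times> nat list \<times> nat list"

text \<open>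
  A cell of the tableau holds the state, the symbols read by all heads, the symbols of all tapes at
  its position, and for every tape whether the head is here (0), to the right (1) or to the left (2).
\<close>

definition cells :: "tm \<Rightarrow> cell set" where
  "cells M = {(q, rd, sy, fl). q < states M \<and> length rd = tapes M \<and> set rd \<subseteq> {..<symbs M} \<and>
     length sy = tapes M \<and> set sy \<subseteq> {..<symbs M} \<and> length fl = tapes M \<and> set fl \<subseteq> {..<3} \<and>
     (\<forall>j<tapes M. fl ! j = 0 \<longrightarrow> rd ! j = sy ! j)}"

text \<open>Idling in the halting state lets every run fill all rows, however early it
  halts.\<close>

definition next_step :: "tm \<Rightarrow> nat \<Rightarrow> nat list \<Rightarrow> nat \<times> (nat \<times> int) list" where
  "next_step M q rd = (if q = 1 then (1, nop rd) else delta M q rd)"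

text \<open>The heads of different tapes stand in different columns, but a cell must determine its
  successor locally. Hence the state and all read symbols are spread along the row, and
  \<open>cells\<close> checks each read symbol where its head stands. The flags of a tape form
  \<open>1, ..., 1, 0, 2, ..., 2\<close>, or are all 1 or all 2; that the 0 exists comes from the
  start row and from \<open>ver\<close>.\<close>

definition hor :: "tm \<Rightarrow> cell \<Rightarrow> cell \<Rightarrow> bool" where
  "hor M = (\<lambda>(q, rd, sy, fl) (q', rd', sy', fl'). q = q' \<and> rd = rd' \<and>
     (\<forall>j<tapes M. (fl ! j = 1 \<longrightarrow> fl' ! j \<noteq> 2) \<and> (fl ! j \<noteq> 1 \<longrightarrow> fl' ! j = 2)))"

text \<open>A head moving to the right leaves flag 1 behind. Its right neighbor had flag 2 and may
  not get 1, and \<open>hor\<close> forbids 2 after 1, so it gets 0. The move to the left is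
  symmetric. Thus a head moves although this condition never looks at another column.\<close>

definition ver :: "tm \<Rightarrow> cell \<Rightarrow> cell \<Rightarrow> bool" where
  "ver M = (\<lambda>(q, rd, sy, fl) (q', rd', sy', fl'). q' = fst (next_step M q rd) \<and>
     (\<forall>j<tapes M. sy' ! j = (if fl ! j = 0 then fst (snd (next_step M q rd) ! j) else sy ! j) \<and>
       (fl ! j = 0 \<longrightarrow> fl' ! j = (if snd (snd (next_step M q rd) ! j) = 0 then 0
          else if snd (snd (next_step M q rd) ! j) = 1 then 1 else 2)) \<and>
       (fl ! j = 1 \<longrightarrow> fl' ! j \<noteq> 2) \<and> (fl ! j = 2 \<longrightarrow> fl' ! j \<noteq> 1)))"

definition start_cell :: "tm \<Rightarrow> cell \<Rightarrow> nat \<Rightarrow> bool" where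
  "start_cell M = (\<lambda>(q, rd, sy, fl) a. q = 0 \<and> sy ! 0 = a \<and> (\<forall>j<tapes M. 0 < j \<longrightarrow> sy ! j = 0))"

definition unary_ok :: "tm \<Rightarrow> nat \<Rightarrow> cell \<Rightarrow> bool" where
  "unary_ok M g c = (if g = 3 then start_cell M c 0 else if g = 4 then start_cell M c 2
     else if g = 5 then start_cell M c 1 else if g = 6 then (\<exists>a\<le>2. start_cell M c a)
     else if g = 7 then (\<forall>j<tapes M. snd (snd (snd c)) ! j = 0)
     else if g = 8 then fst (snd (snd c)) ! (tapes M - 1) = 2 else True)"

text \<open>All constraints are about pairs. A condition on one cell becomes one on the pair of the
  cell with itself, which is binding only if both entries agree. The pair condition of kind 6 says
  that a blank is followed by a blank.\<close>

definition allowed :: "tm \<Rightarrow> nat \<Rightarrow> nat \<Rightarrow> nat \<Rightarrow> cell \<Rightarrow> cell \<Rightarrow> bool" where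
  "allowed M g p r c c' = (if p = 1 then ver M c c'
     else if r = 1 then (if g = 1 then hor M c c' else fst (snd (snd c)) ! 0 = 0 \<longrightarrow> fst (snd (snd c')) ! 0 = 0)
     else c = c' \<longrightarrow> unary_ok M g c)"

lemma finite_cells: "finite (cells M)"
proof -
  have "cells M \<subseteq> {..<states M} \<times> {rd. set rd \<subseteq> {..<symbs M} \<and> length rd = tapes M} \<times>
      {rd. set rd \<subseteq> {..<symbs M} \<and> length rd = tapes M} \<times> {rd. set rd \<subseteq> {..<3} \<and> length rd = tapes M}"
    by (auto simp: cells_def)
  then show ?thesis by (rule finite_subset) (intro finite_cartesian_product finite_lists_length_eq finite_lessThan)
qed

section \<open>From runs to tableaux\<close>

definition cell_of :: "tm \<Rightarrow> nat \<Rightarrow> config \<Rightarrow> nat \<Rightarrow> cell" where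
  "cell_of M A s i = (case s of (q, h, tp) \<Rightarrow> (q, map (\<lambda>j. tp j (h j)) [0..<tapes M],
     map (\<lambda>j. tp j (int i - int A)) [0..<tapes M],
     map (\<lambda>j. if h j = int i - int A then 0 else if h j > int i - int A then 1 else 2) [0..<tapes M]))"

definition good :: "tm \<Rightarrow> nat \<Rightarrow> config \<Rightarrow> bool" where
  "good M t s = (case s of (q, h, tp) \<Rightarrow> q < states M \<and> (\<forall>j<tapes M. \<forall>i. tp j i < symbs M) \<and>
     (\<forall>j<tapes M. \<bar>h j\<bar> \<le> int t))"

lemma step_eq:
  "tm_step M (q, h, tp) = (fst (next_step M q (map (\<lambda>j. tp j (h j)) [0..<tapes M])),
     \<lambda>j. if j < tapes M then h j + snd (snd (next_step M q (map (\<lambda>j. tp j (h j)) [0..<tapes M])) ! j) else h j,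
     \<lambda>j. if j < tapes M then (tp j)(h j := fst (snd (next_step M q (map (\<lambda>j. tp j (h j)) [0..<tapes M])) ! j)) else tp j)"
  by (auto simp: next_step_def nop_nth fun_eq_iff case_prod_beta)

lemma next_step_wf:
  assumes "wf_tm M" "good M t (q, h, tp)" "j < tapes M"
  defines "ns \<equiv> next_step M q (map (\<lambda>j. tp j (h j)) [0..<tapes M])"
  shows "fst ns < states M" "fst (snd ns ! j) < symbs M" "snd (snd ns ! j) \<in> {-1, 0, 1}"
proof -
  let ?rs = "map (\<lambda>j. tp j (h j)) [0..<tapes M]"
  have rs: "length ?rs = tapes M" "set ?rs \<subseteq> {..<symbs M}" using assms(2) by (auto simp: good_def)
  have q: "q < states M" using assms(2) by (simp add: good_def)
  have "fst ns < states M \<and> snd ns ! j \<in> {..<symbs M} \<times> {-1, 0, 1}"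
  proof (cases "q = 1")
    case True
    have "tp j (h j) < symbs M" using assms(2,3) by (simp add: good_def)
    then show ?thesis using True q assms(3) by (simp add: ns_def next_step_def nop_nth)
  next
    case False
    have "case delta M q ?rs of (q', as) \<Rightarrow>
        q' < states M \<and> length as = tapes M \<and> set as \<subseteq> {..<symbs M} \<times> {-1, 0, 1}"
      using assms(1) rs q unfolding wf_tm_def by (elim conjE allE[of _ q] allE[of _ "?rs"]) simp
    then have d: "fst (delta M q ?rs) < states M" "length (snd (delta M q ?rs)) = tapes M"
      "set (snd (delta M q ?rs)) \<subseteq> {..<symbs M} \<times> {-1, 0, 1}" by (simp_all add: case_prod_beta)
    have "snd (delta M q ?rs) ! j \<in> set (snd (delta M q ?rs))" using d(2) assms(3) by simp
    then show ?thesis using d False by (auto simp: ns_def next_step_def)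
  qed
  then show "fst ns < states M" "fst (snd ns ! j) < symbs M" "snd (snd ns ! j) \<in> {-1, 0, 1}"
    by (auto simp: mem_Times_iff)
qed

lemma good_step:
  assumes "wf_tm M" "good M t s"
  shows "good M (Suc t) (tm_step M s)"
proof -
  obtain q h tp where s: "s = (q, h, tp)" by (metis prod_cases3)
  have K: "0 < tapes M" using assms(1) by (simp add: wf_tm_def)
  note nw = next_step_wf[OF assms(1) assms(2)[unfolded s]]
  have "\<bar>h j + snd (snd (next_step M q (map (\<lambda>j. tp j (h j)) [0..<tapes M])) ! j)\<bar> \<le> int (Suc t)" if "j < tapes M" for j
  proof -
    have "\<bar>h j\<bar> \<le> int t" using assms(2) that by (simp add: good_def s)
    then show ?thesis using nw(3)[OF that] by auto
  qed
  then show ?thesis using nw(1)[OF K] nw(2) assms(2) unfolding s step_eq by (simp add: good_def)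
qed

lemma good_init:
  assumes "wf_tm M"
  shows "good M 0 (tm_init w)"
proof -
  have "0 < states M" "2 < symbs M" using assms by (auto simp: wf_tm_def)
  then show ?thesis by (auto simp: good_def tm_init_def tape_of_def)
qed

lemma good_run: "wf_tm M \<Longrightarrow> good M t ((tm_step M ^^ t) (tm_init w))"
  by (induction t) (simp_all add: good_init good_step)

lemma cell_of_cells: "good M t s \<Longrightarrow> cell_of M A s i \<in> cells M"
  by (auto simp: cells_def cell_of_def good_def split: prod.splits)

lemma hor_cell_of: "hor M (cell_of M A s i) (cell_of M A s (Suc i))"
  by (auto simp: hor_def cell_of_def split: prod.splits)

lemma ver_cell_of:
  assumes "wf_tm M" "good M t s"
  shows "ver M (cell_of M A s i) (cell_of M A (tm_step M s) i)"
proof -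
  obtain q h tp where s: "s = (q, h, tp)" by (metis prod_cases3)
  note nw = next_step_wf(3)[OF assms(1) assms(2)[unfolded s]]
  show ?thesis unfolding s step_eq ver_def cell_of_def prod.case
  proof (intro conjI allI impI refl)
    fix j assume j: "j < tapes M"
    let ?ns = "next_step M q (map (\<lambda>j. tp j (h j)) [0..<tapes M])"
    let ?d = "snd (snd ?ns ! j)"
    have d: "?d = -1 \<or> ?d = 0 \<or> ?d = 1" using nw[OF j] by auto
    let ?x = "int i - int A"
    let ?f = "\<lambda>h. (if h = ?x then 0 else if h > ?x then 1 else 2) :: nat"
    have f: "map (\<lambda>j. if h j = ?x then 0 else if h j > ?x then 1 else 2) [0..<tapes M] ! j = ?f (h j)"
      "map (\<lambda>j. if (if j < tapes M then h j + snd (snd ?ns ! j) else h j) = ?x then 0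
          else if (if j < tapes M then h j + snd (snd ?ns ! j) else h j) > ?x then 1 else 2) [0..<tapes M] ! j = ?f (h j + ?d)"
      using j by simp_all
    show "map (\<lambda>j. (if j < tapes M then (tp j)(h j := fst (snd ?ns ! j)) else tp j) ?x) [0..<tapes M] ! j =
        (if map (\<lambda>j. if h j = ?x then 0 else if h j > ?x then 1 else 2) [0..<tapes M] ! j = (0 :: nat)
         then fst (snd ?ns ! j) else map (\<lambda>j. tp j ?x) [0..<tapes M] ! j)"
      unfolding f using j by auto
    show "map (\<lambda>j. if (if j < tapes M then h j + snd (snd ?ns ! j) else h j) = ?x then 0
          else if (if j < tapes M then h j + snd (snd ?ns ! j) else h j) > ?x then 1 else 2) [0..<tapes M] ! j =
        (if ?d = 0 then 0 else if ?d = 1 then 1 else (2 :: nat))"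
      if "map (\<lambda>j. if h j = ?x then 0 else if h j > ?x then 1 else 2) [0..<tapes M] ! j = (0 :: nat)"
      using that d unfolding f by (auto split: if_splits)
    show "map (\<lambda>j. if (if j < tapes M then h j + snd (snd ?ns ! j) else h j) = ?x then 0
          else if (if j < tapes M then h j + snd (snd ?ns ! j) else h j) > ?x then 1 else 2) [0..<tapes M] ! j \<noteq> (2 :: nat)"
      if "map (\<lambda>j. if h j = ?x then 0 else if h j > ?x then 1 else 2) [0..<tapes M] ! j = (1 :: nat)"
      using that d unfolding f by (auto split: if_splits)
    show "map (\<lambda>j. if (if j < tapes M then h j + snd (snd ?ns ! j) else h j) = ?x then 0
          else if (if j < tapes M then h j + snd (snd ?ns ! j) else h j) > ?x then 1 else 2) [0..<tapes M] ! j \<noteq> (1 :: nat)"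
      if "map (\<lambda>j. if h j = ?x then 0 else if h j > ?x then 1 else 2) [0..<tapes M] ! j = (2 :: nat)"
      using that d unfolding f by (auto split: if_splits)
  qed
qed

section \<open>From tableaux to runs\<close>

lemma flags_determined:
  fixes f :: "nat \<Rightarrow> nat"
  assumes step: "\<And>i. i < B \<Longrightarrow> (f i = 1 \<longrightarrow> f (Suc i) \<noteq> 2) \<and> (f i \<noteq> 1 \<longrightarrow> f (Suc i) = 2)"
    and P: "P \<le> B" "f P = 0" and i: "i \<le> B"
  shows "f i = (if i = P then 0 else if i < P then 1 else 2)"
proof -
  have up: "f (Suc P + k) = 2" if "Suc P + k \<le> B" for k
    using that
  proof (induction k)
    case 0
    then show ?case using step[of P] P by simp
  next
    case (Suc k)
    then show ?case using step[of "Suc P + k"] by simp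
  qed
  have down: "k \<le> P \<Longrightarrow> 0 < k \<Longrightarrow> f (P - k) = 1" for k
  proof (induction k)
    case (Suc k)
    have "f (Suc (P - Suc k)) \<noteq> 2"
    proof (cases "k = 0")
      case True
      then show ?thesis using P Suc.prems by simp
    next
      case False
      then have "f (P - k) = 1" using Suc by simp
      moreover have "Suc (P - Suc k) = P - k" using Suc.prems by simp
      ultimately show ?thesis by simp
    qed
    then show ?case using step[of "P - Suc k"] P Suc.prems by auto
  qed simp
  consider "i = P" | "i < P" | "P < i" by linarith
  then show ?thesis
  proof cases
    case 2
    then show ?thesis using down[of "P - i"] by simp
  next
    case 3
    then show ?thesis using up[of "i - Suc P"] i by simp
  qed (use P in simp)
qed

text \<open>One flag 0 per tape fixes all flags of the row, and the read symbols, constant along the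
  row, are correct because they are checked at the heads.\<close>

lemma row_determined:
  assumes cl: "\<And>i. i \<le> B \<Longrightarrow> c i \<in> cells M" and hr: "\<And>i. i < B \<Longrightarrow> hor M (c i) (c (Suc i))"
    and q: "\<And>i. i \<le> B \<Longrightarrow> fst (c i) = q"
    and sy: "\<And>i j. i \<le> B \<Longrightarrow> j < tapes M \<Longrightarrow> fst (snd (snd (c i))) ! j = tp j (int i - int A)"
    and hd: "\<And>j. j < tapes M \<Longrightarrow> 0 \<le> h j + int A \<and> nat (h j + int A) \<le> B \<and> snd (snd (snd (c (nat (h j + int A))))) ! j = 0"
    and i: "i \<le> B"
  shows "c i = cell_of M A (q, h, tp) i"
proof -
  have fl: "snd (snd (snd (c i))) ! j = (if h j = int i - int A then 0 else if h j > int i - int A then 1 else 2)"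
    if "i \<le> B" "j < tapes M" for i j
  proof -
    have "snd (snd (snd (c i))) ! j = (if i = nat (h j + int A) then 0 else if i < nat (h j + int A) then 1 else 2)"
    proof (rule flags_determined[of B "\<lambda>i. snd (snd (snd (c i))) ! j"])
      fix i assume "i < B"
      then show "(snd (snd (snd (c i))) ! j = 1 \<longrightarrow> snd (snd (snd (c (Suc i)))) ! j \<noteq> 2) \<and>
          (snd (snd (snd (c i))) ! j \<noteq> 1 \<longrightarrow> snd (snd (snd (c (Suc i)))) ! j = 2)"
        using hr[of i] that(2) by (simp add: hor_def case_prod_beta)
    qed (use hd[OF that(2)] that in auto)
    moreover have "0 \<le> h j + int A" using hd[OF that(2)] by blast
    ultimately show ?thesis by auto
  qed
  have rd0: "fst (snd (c i)) = fst (snd (c 0))" if "i \<le> B" for i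
    using that
  proof (induction i)
    case (Suc i)
    then have "hor M (c i) (c (Suc i))" by (intro hr) simp
    then show ?case using Suc by (simp add: hor_def case_prod_beta)
  qed simp
  have rd: "fst (snd (c i)) ! j = tp j (h j)" if "j < tapes M" for j
  proof -
    let ?P = "nat (h j + int A)"
    have P: "?P \<le> B" "int ?P - int A = h j" "snd (snd (snd (c ?P))) ! j = 0" using hd[OF that] by auto
    then have "fst (snd (c ?P)) ! j = fst (snd (snd (c ?P))) ! j"
      using cl[OF P(1)] that by (auto simp: cells_def)
    also have "\<dots> = tp j (h j)" using sy[OF P(1) that] P(2) by simp
    finally show ?thesis using rd0[OF i] rd0[OF P(1)] by simp
  qed
  have len: "length (fst (snd (c i))) = tapes M" "length (fst (snd (snd (c i)))) = tapes M" "length (snd (snd (snd (c i)))) = tapes M"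
    using cl[OF i] by (auto simp: cells_def)
  have 1: "fst (snd (c i)) = map (\<lambda>j. tp j (h j)) [0..<tapes M]"
    by (rule nth_equalityI) (use len rd in auto)
  have 2: "fst (snd (snd (c i))) = map (\<lambda>j. tp j (int i - int A)) [0..<tapes M]"
    by (rule nth_equalityI) (use len sy[OF i] in auto)
  have 3: "snd (snd (snd (c i))) = map (\<lambda>j. if h j = int i - int A then 0 else if h j > int i - int A then 1 else 2) [0..<tapes M]"
    by (rule nth_equalityI) (use len fl[OF i] in auto)
  have "c i = (fst (c i), fst (snd (c i)), fst (snd (snd (c i))), snd (snd (snd (c i))))" by simp
  then show ?thesis unfolding cell_of_def prod.case using 1 2 3 q[OF i] by metis
qed

text \<open>\<open>t < A\<close> and \<open>2 * A \<le> B\<close> keep every head strictly inside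
  the grid, so that both neighbors of its column exist.\<close>

lemma row_step:
  assumes wf: "wf_tm M" and gd: "good M t s" and t: "t < A" "2 * A \<le> B"
    and c: "\<And>i. i \<le> B \<Longrightarrow> c i = cell_of M A s i" and cl: "\<And>i. i \<le> B \<Longrightarrow> c' i \<in> cells M"
    and hr: "\<And>i. i < B \<Longrightarrow> hor M (c' i) (c' (Suc i))" and vr: "\<And>i. i \<le> B \<Longrightarrow> ver M (c i) (c' i)" and i: "i \<le> B"
  shows "c' i = cell_of M A (tm_step M s) i"
proof -
  obtain q h tp where s: "s = (q, h, tp)" by (metis prod_cases3)
  let ?rs = "map (\<lambda>j. tp j (h j)) [0..<tapes M]"
  let ?ns = "next_step M q ?rs"
  have v: "fst (c' i) = fst ?ns \<and> (\<forall>j<tapes M. fst (snd (snd (c' i))) ! j = (if h j = int i - int A then fst (snd ?ns ! j) else tp j (int i - int A)) \<and>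
      (h j = int i - int A \<longrightarrow> snd (snd (snd (c' i))) ! j = (if snd (snd ?ns ! j) = 0 then 0 else if snd (snd ?ns ! j) = 1 then 1 else 2)) \<and>
      (h j > int i - int A \<longrightarrow> snd (snd (snd (c' i))) ! j \<noteq> 2) \<and> (h j < int i - int A \<longrightarrow> snd (snd (snd (c' i))) ! j \<noteq> 1))" if "i \<le> B" for i
    using vr[OF that] unfolding c[OF that] s ver_def cell_of_def by (auto simp: case_prod_beta)
  have v1: "fst (c' i) = fst ?ns" if "i \<le> B" for i using v[OF that] by (rule conjunct1)
  have v2: "fst (snd (snd (c' i))) ! j = (if h j = int i - int A then fst (snd ?ns ! j) else tp j (int i - int A))"
    if "i \<le> B" "j < tapes M" for i j using v[OF that(1)] that(2) by simp
  have v3: "snd (snd (snd (c' i))) ! j = (if snd (snd ?ns ! j) = 0 then 0 else if snd (snd ?ns ! j) = 1 then 1 else 2)"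
    if "i \<le> B" "j < tapes M" "h j = int i - int A" for i j using v[OF that(1)] that(2,3) by simp
  have v4: "snd (snd (snd (c' i))) ! j \<noteq> 2" if "i \<le> B" "j < tapes M" "h j > int i - int A" for i j
    using v[OF that(1)] that(2,3) by simp
  have v5: "snd (snd (snd (c' i))) ! j \<noteq> 1" if "i \<le> B" "j < tapes M" "h j < int i - int A" for i j
    using v[OF that(1)] that(2,3) by simp
  show ?thesis unfolding s step_eq
  proof (rule row_determined[of B c'])
    show "i \<le> B" by (rule i)
    show "hor M (c' i) (c' (Suc i))" if "i < B" for i using hr[OF that] .
  next
    fix i assume i: "i \<le> B"
    show "c' i \<in> cells M" using cl[OF i] .
    show "fst (c' i) = fst ?ns" using v1[OF i] .
    fix j assume j: "j < tapes M"
    show "fst (snd (snd (c' i))) ! j = (if j < tapes M then (tp j)(h j := fst (snd ?ns ! j)) else tp j) (int i - int A)"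
      using v2[OF i j] j by simp
  next
    fix j assume j: "j < tapes M"
    let ?d = "snd (snd ?ns ! j)"
    let ?P = "nat (h j + int A)"
    let ?F = "\<lambda>i. snd (snd (snd (c' i))) ! j"
    have hj: "\<bar>h j\<bar> \<le> int t" using gd j by (simp add: good_def s)
    have h0: "0 < h j + int A" "h j < int A" using hj t(1) by linarith+
    then have iP: "int ?P = h j + int A" by simp
    have P: "int ?P - int A = h j" "Suc ?P \<le> B" "0 < ?P" using iP h0 t(2) by linarith+
    have d: "?d = -1 \<or> ?d = 0 \<or> ?d = 1" using next_step_wf(3)[OF wf gd[unfolded s] j] by auto
    have F: "?F i < 3" if "i \<le> B" for i
    proof -
      have "set (snd (snd (snd (c' i)))) \<subseteq> {..<3}" "length (snd (snd (snd (c' i)))) = tapes M"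
        using cl[OF that] by (auto simp: cells_def)
      then have "?F i \<in> {..<3}" using j by (metis nth_mem subsetD)
      then show ?thesis by simp
    qed
    have hrF: "(?F i = 1 \<longrightarrow> ?F (Suc i) \<noteq> 2) \<and> (?F i \<noteq> 1 \<longrightarrow> ?F (Suc i) = 2)" if "i < B" for i
      using hr[OF that] j by (simp add: hor_def case_prod_beta)
    have FP: "?F ?P = (if ?d = 0 then 0 else if ?d = 1 then 1 else 2)"
      by (rule v3[OF _ j]) (use P in linarith)+
    have "?F (nat (h j + ?d + int A)) = 0 \<and> 0 \<le> h j + ?d + int A \<and> nat (h j + ?d + int A) \<le> B"
    proof -
      consider "?d = 0" | "?d = 1" | "?d = -1" using d by blast
      then show ?thesis
      proof cases
        case 1
        then have n: "nat (h j + ?d + int A) = ?P" by simp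
        have "?F ?P = 0" using FP 1 by simp
        then show ?thesis unfolding n using 1 h0 P(2) by linarith
      next
        case 2
        have n: "nat (h j + ?d + int A) = Suc ?P" using 2 P by linarith
        have "?F ?P = 1" using FP 2 by simp
        then have "?F (Suc ?P) \<noteq> 2" using hrF[of ?P] P by simp
        moreover have "h j < int (Suc ?P) - int A" using P(1) by linarith
        then have "?F (Suc ?P) \<noteq> 1" using v5[OF P(2) j] by blast
        moreover have "?F (Suc ?P) < 3" by (rule F[OF P(2)])
        ultimately have "?F (Suc ?P) = 0" by linarith
        then show ?thesis unfolding n using 2 h0 P(2) by linarith
      next
        case 3
        have n: "nat (h j + ?d + int A) = ?P - 1" using 3 P by linarith
        have sp: "Suc (?P - 1) = ?P" "?P - 1 < B" using P by linarith+
        have "?F ?P = 2" using FP 3 by simp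
        then have "?F (?P - 1) \<noteq> 1" using hrF[OF sp(2)] sp(1) by simp
        moreover have "h j > int (?P - 1) - int A" using P by linarith
        then have "?F (?P - 1) \<noteq> 2" using v4[OF less_imp_le[OF sp(2)] j] by blast
        moreover have "?F (?P - 1) < 3" by (rule F[OF less_imp_le[OF sp(2)]])
        ultimately have "?F (?P - 1) = 0" by linarith
        then show ?thesis unfolding n using 3 h0 P(2) by linarith
      qed
    qed
    then show "0 \<le> (if j < tapes M then h j + ?d else h j) + int A \<and> nat ((if j < tapes M then h j + ?d else h j) + int A) \<le> B \<and>
        snd (snd (snd (c' (nat ((if j < tapes M then h j + ?d else h j) + int A))))) ! j = 0"
      using j by simp
  qed
qed

definition tableau :: "tm \<Rightarrow> nat \<Rightarrow> nat \<Rightarrow> bool list \<Rightarrow> (nat \<Rightarrow> nat \<Rightarrow> cell) \<Rightarrow> bool" where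
  "tableau M A q x cv \<longleftrightarrow> (\<forall>t i. (0, t, i) \<in> set (events A q x) \<longrightarrow> cv t i \<in> cells M) \<and>
     (\<forall>g t i p r. (g, t, i) \<in> set (events A q x) \<longrightarrow> (p, r) \<in> offsets g \<longrightarrow>
        allowed M g p r (cv t i) (cv (t + p) (i + r)))"

lemma start_symbol:
  assumes "length y \<le> q"
  shows "(3, 0, i) \<in> set (events A q x) \<Longrightarrow> tape_of (pair_code x y) (int i - int A) = 0"
    and "(4, 0, i) \<in> set (events A q x) \<Longrightarrow> tape_of (pair_code x y) (int i - int A) = 2"
    and "(5, 0, i) \<in> set (events A q x) \<Longrightarrow> tape_of (pair_code x y) (int i - int A) = 1"
proof -
  have at: "tape_of (pair_code x y) (int (A + k) - int A) = (if k < length (pair_code x y) then (if pair_code x y ! k then 2 else 1) else 0)" for k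
    by (simp add: tape_of_def)
  show "(3, 0, i) \<in> set (events A q x) \<Longrightarrow> tape_of (pair_code x y) (int i - int A) = 0"
    using assms unfolding events_iff Let_def by (auto simp: tape_of_def length_pair_code split: if_splits)
  show "tape_of (pair_code x y) (int i - int A) = 2" if e: "(4, 0, i) \<in> set (events A q x)"
  proof -
    obtain j where j: "j < length x" "i = A + 2 * j \<or> x ! j \<and> i = A + Suc (2 * j)"
      using e unfolding events_iff Let_def by (auto split: if_splits)
    then show ?thesis using at[of "2 * j"] at[of "Suc (2 * j)"] pair_code_nth(1,2)[of j x y]
      by (auto simp: length_pair_code)
  qed
  show "tape_of (pair_code x y) (int i - int A) = 1" if e: "(5, 0, i) \<in> set (events A q x)"
  proof -
    have "i = A + 2 * length x \<or> (\<exists>j<length x. \<not> x ! j \<and> i = A + Suc (2 * j))"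
      using e unfolding events_iff Let_def by (auto split: if_splits)
    then show ?thesis
    proof
      assume "i = A + 2 * length x"
      then show ?thesis using at[of "2 * length x"] pair_code_nth(3)[of x y] by (simp add: length_pair_code)
    next
      assume "\<exists>j<length x. \<not> x ! j \<and> i = A + Suc (2 * j)"
      then obtain j where "j < length x" "\<not> x ! j" "i = A + Suc (2 * j)" by blast
      then show ?thesis using at[of "Suc (2 * j)"] pair_code_nth(2)[of j x y] by (simp add: length_pair_code)
    qed
  qed
qed

lemma start_symbol_witness:
  "tape_of (pair_code x y) (int (Suc (A + 2 * length x + k)) - int A) = (if k < length y then (if y ! k then 2 else 1) else 0)"
proof -
  have e: "int (Suc (A + 2 * length x + k)) - int A = int (Suc (2 * length x + k))" by simp
  show ?thesis unfolding e tape_of_def nat_int using pair_code_nth(4)[of x y k]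
    by (simp add: length_pair_code del: of_nat_Suc of_nat_add of_nat_mult)
qed

lemma start_row_cases:
  assumes "i \<le> 2 * A + 2 * length x + q"
  shows "(3, 0, i) \<in> set (events A q x) \<or> (4, 0, i) \<in> set (events A q x) \<or> (5, 0, i) \<in> set (events A q x) \<or>
    (\<exists>k<q. i = Suc (A + 2 * length x + k) \<and> (6, 0, i) \<in> set (events A q x))"
proof -
  consider "i < A" | "A \<le> i \<and> i < A + 2 * length x" | "i = A + 2 * length x" | "A + 2 * length x < i \<and> i \<le> A + 2 * length x + q"
    | "A + 2 * length x + q < i" by linarith
  then show ?thesis
  proof cases
    case 1
    then show ?thesis unfolding events_iff Let_def by simp
  next
    case 2
    let ?j = "(i - A) div 2"
    have j: "?j < length x" "i = A + 2 * ?j \<or> i = Suc (A + 2 * ?j)" using 2 by presburger+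
    show ?thesis
    proof (cases "i = A + 2 * ?j")
      case True
      then have "(4, 0, i) \<in> set (events A q x)" unfolding events_iff Let_def using j(1) by blast
      then show ?thesis by blast
    next
      case False
      then have "i = Suc (A + 2 * ?j)" using j(2) by blast
      then have "(if x ! ?j then 4 else 5, 0, i) \<in> set (events A q x)" unfolding events_iff Let_def using j(1) by blast
      then show ?thesis by (auto split: if_splits)
    qed
  next
    case 3
    then show ?thesis unfolding events_iff Let_def by simp
  next
    case 4
    then have "i = Suc (A + 2 * length x + (i - Suc (A + 2 * length x)))" "i - Suc (A + 2 * length x) < q" by linarith+
    moreover have "(6, 0, i) \<in> set (events A q x)" using 4 unfolding events_iff Let_def by simp
    ultimately show ?thesis by blast
  next
    case 5
    then show ?thesis unfolding events_iff Let_def using assms by simp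
  qed
qed

lemma halted:
  assumes "tm_outputs_within M w [b] T" and "T \<le> A"
  shows "case (tm_step M ^^ A) (tm_init w) of (q, h, tp) \<Rightarrow> tp (tapes M - 1) 0 = 2 \<longleftrightarrow> b"
proof -
  obtain t h tp where t: "t \<le> T" "(tm_step M ^^ t) (tm_init w) = (1, h, tp)" "tp (tapes M - 1) = tape_of [b]"
    using assms(1) unfolding tm_outputs_within_def by (auto simp: case_prod_beta) (metis prod.collapse)
  have stay: "(tm_step M ^^ k) (1, h, tp) = (1, h, tp)" for k by (induction k) auto
  have "A = t + (A - t)" using t(1) assms(2) by simp
  then have "(tm_step M ^^ A) (tm_init w) = (tm_step M ^^ (A - t)) ((tm_step M ^^ t) (tm_init w))"
    using funpow_add_apply by metis
  then show ?thesis using t stay by (simp add: tape_of_def)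
qed

lemma tableau_complete:
  assumes wf: "wf_tm M" and y: "length y \<le> q"
    and acc: "case (tm_step M ^^ A) (tm_init (pair_code x y)) of (s, h, tp) \<Rightarrow> tp (tapes M - 1) 0 = 2"
  shows "tableau M A q x (\<lambda>t i. cell_of M A ((tm_step M ^^ t) (tm_init (pair_code x y))) i)"
proof -
  let ?w = "pair_code x y"
  let ?cfg = "\<lambda>t. (tm_step M ^^ t) (tm_init ?w)"
  have K: "0 < tapes M" using wf by (simp add: wf_tm_def)
  have st: "start_cell M (cell_of M A (tm_init ?w) i) (tape_of ?w (int i - int A))" for i
    using K by (simp add: start_cell_def cell_of_def tm_init_def)
  have sy0: "fst (snd (snd (cell_of M A (tm_init ?w) i))) ! 0 = tape_of ?w (int i - int A)" for i
    using K by (simp add: cell_of_def tm_init_def)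
  have un: "unary_ok M g (cell_of M A (?cfg t) i)" if e: "(g, t, i) \<in> set (events A q x)" for g t i
  proof -
    have t0: "g \<in> {3, 4, 5, 6, 7} \<Longrightarrow> t = 0" and t8: "g = 8 \<Longrightarrow> t = A \<and> i = A" and t7: "g = 7 \<Longrightarrow> i = A"
      using e unfolding events_iff Let_def by (auto split: if_splits)
    consider "g = 3" | "g = 4" | "g = 5" | "g = 6" | "g = 7" | "g = 8" | "g \<notin> {3, 4, 5, 6, 7, 8}" by blast
    then show ?thesis
    proof cases
      case 1
      then show ?thesis using e t0 start_symbol(1)[OF y, of i A x] st[of i] by (simp add: unary_ok_def)
    next
      case 2
      then show ?thesis using e t0 start_symbol(2)[OF y, of i A x] st[of i] by (simp add: unary_ok_def)
    next
      case 3
      then show ?thesis using e t0 start_symbol(3)[OF y, of i A x] st[of i] by (simp add: unary_ok_def)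
    next
      case 4
      moreover have "tape_of ?w (int i - int A) \<le> 2" by (simp add: tape_of_def)
      ultimately show ?thesis using t0 st[of i] by (auto simp: unary_ok_def)
    next
      case 5
      then show ?thesis using t0 t7 by (simp add: unary_ok_def cell_of_def tm_init_def)
    next
      case 6
      then show ?thesis using t8 acc K by (auto simp: unary_ok_def cell_of_def split: prod.splits)
    next
      case 7
      then show ?thesis by (simp add: unary_ok_def)
    qed
  qed
  have "allowed M g p r (cell_of M A (?cfg t) i) (cell_of M A (?cfg (t + p)) (i + r))"
    if e: "(g, t, i) \<in> set (events A q x)" "(p, r) \<in> offsets g" for g t i p r
  proof -
    consider "g = 2" "p = 1" "r = 0" | "g = 1" "p = 0" "r = 1" | "g = 6" "p = 0" "r = 1" | "p = 0" "r = 0"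
      using e(2) by (auto simp: offsets_def split: if_splits)
    then show ?thesis
    proof cases
      case 1
      then show ?thesis using ver_cell_of[OF wf good_run[OF wf], of A t ?w i] by (simp add: allowed_def)
    next
      case 2
      then show ?thesis using hor_cell_of[of M A "?cfg t" i] by (simp add: allowed_def)
    next
      case 3
      then have t: "t = 0" "A + 2 * length x < i" using e(1) unfolding events_iff Let_def by (auto split: if_splits)
      define k where "k = i - Suc (A + 2 * length x)"
      have i: "i = Suc (A + 2 * length x + k)" using t(2) by (simp add: k_def)
      have a: "tape_of ?w (int i - int A) = (if k < length y then (if y ! k then 2 else 1) else 0)"
        unfolding i by (rule start_symbol_witness)
      have "Suc i = Suc (A + 2 * length x + Suc k)" using i by simp
      then have b: "tape_of ?w (int (Suc i) - int A) = (if Suc k < length y then (if y ! Suc k then 2 else 1) else 0)"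
        using start_symbol_witness[of x y A "Suc k"] by simp
      have "tape_of ?w (int i - int A) = 0 \<longrightarrow> tape_of ?w (int (Suc i) - int A) = 0"
        unfolding a b by (simp split: if_splits)
      then show ?thesis using 3 t(1) sy0[of i] sy0[of "Suc i"] by (simp add: allowed_def)
    next
      case 4
      then show ?thesis using un[OF e(1)] by (simp add: allowed_def)
    qed
  qed
  then show ?thesis unfolding tableau_def using cell_of_cells[OF good_run[OF wf]] by blast
qed

lemma tableau_sound:
  assumes wf: "wf_tm M" and A: "1 \<le> A" and tb: "tableau M A q x cv"
  shows "\<exists>y. length y \<le> q \<and> (case (tm_step M ^^ A) (tm_init (pair_code x y)) of (s, h, tp) \<Rightarrow> tp (tapes M - 1) 0 = 2)"
proof -
  let ?EV = "set (events A q x)"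
  define B where "B = 2 * A + 2 * length x + q"
  have K: "0 < tapes M" using wf by (simp add: wf_tm_def)
  have cl: "cv t i \<in> cells M" if "t \<le> A" "i \<le> B" for t i
  proof -
    have "(0, t, i) \<in> ?EV" using that unfolding events_iff Let_def B_def by simp
    then show ?thesis using tb unfolding tableau_def by blast
  qed
  have al: "allowed M g p r (cv t i) (cv (t + p) (i + r))" if "(g, t, i) \<in> ?EV" "(p, r) \<in> offsets g" for g t i p r
    using tb that unfolding tableau_def by blast
  have hr: "hor M (cv t i) (cv t (Suc i))" if "t \<le> A" "i < B" for t i
  proof -
    have "(1, t, i) \<in> ?EV" using that unfolding events_iff Let_def B_def by simp
    from al[OF this, of 0 1] show ?thesis by (simp add: allowed_def offsets_def)
  qed
  have vr: "ver M (cv t i) (cv (Suc t) i)" if "t < A" "i \<le> B" for t i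
  proof -
    have "(2, t, i) \<in> ?EV" using that unfolding events_iff Let_def B_def by simp
    from al[OF this, of 1 0] show ?thesis by (simp add: allowed_def offsets_def)
  qed
  have un: "unary_ok M g (cv t i)" if "(g, t, i) \<in> ?EV" "g \<in> {3, 4, 5, 6, 7, 8}" for g t i
    using al[OF that(1), of 0 0] that(2) by (auto simp: allowed_def offsets_def)
  define a where "a k = fst (snd (snd (cv 0 (Suc (A + 2 * length x + k))))) ! 0" for k
  have ev6: "(6, 0, Suc (A + 2 * length x + k)) \<in> ?EV" if "k < q" for k
    using that unfolding events_iff Let_def by simp
  have a2: "a k \<le> 2" if "k < q" for k
    using un[OF ev6[OF that]] by (auto simp: unary_ok_def start_cell_def a_def case_prod_beta)
  have mono1: "a k = 0 \<Longrightarrow> a (Suc k) = 0" if "k < q" for k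
    using al[OF ev6[OF that], of 0 1] by (simp add: allowed_def offsets_def a_def)
  \<comment> \<open>The witness is the initial stretch of nonblank symbols in its area; since blanks
    persist to the right, nothing is lost behind \<open>n\<close>.\<close>
  define n where "n = (LEAST k. k = q \<or> a k = 0)"
  have n: "n = q \<or> a n = 0" unfolding n_def by (rule LeastI[of "\<lambda>k. k = q \<or> a k = 0" q]) simp
  have nq: "n \<le> q" unfolding n_def by (rule Least_le) simp
  have an: "a k \<noteq> 0" if "k < n" for k using not_less_Least[of k "\<lambda>k. k = q \<or> a k = 0"] that unfolding n_def by blast
  have az: "a (n + k) = 0" if "n + k < q" for k
    using that
  proof (induction k)
    case 0
    then show ?case using n by simp
  next
    case (Suc k)
    then show ?case using mono1[of "n + k"] by simp
  qed
  define y where "y = map (\<lambda>k. a k = 2) [0..<n]"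
  have y: "length y \<le> q" "length y = n" using nq by (simp_all add: y_def)
  let ?w = "pair_code x y"
  have st0: "start_cell M (cv 0 i) (tape_of ?w (int i - int A))" if iB: "i \<le> B" for i
  proof -
    consider "(3, 0, i) \<in> ?EV" | "(4, 0, i) \<in> ?EV" | "(5, 0, i) \<in> ?EV"
      | k where "k < q" "i = Suc (A + 2 * length x + k)" "(6, 0, i) \<in> ?EV"
      using start_row_cases[of i A x q] iB unfolding B_def by blast
    then show ?thesis
    proof cases
      case 1
      then show ?thesis using un[OF 1] start_symbol(1)[OF y(1) 1] by (simp add: unary_ok_def)
    next
      case 2
      then show ?thesis using un[OF 2] start_symbol(2)[OF y(1) 2] by (simp add: unary_ok_def)
    next
      case 3
      then show ?thesis using un[OF 3] start_symbol(3)[OF y(1) 3] by (simp add: unary_ok_def)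
    next
      case (4 k)
      have "\<exists>b. start_cell M (cv 0 i) b" using un[OF 4(3)] by (auto simp: unary_ok_def)
      then have sc: "start_cell M (cv 0 i) (a k)" by (auto simp: start_cell_def a_def 4(2) case_prod_beta)
      have "tape_of ?w (int i - int A) = (if k < n then (if y ! k then 2 else 1) else 0)"
        unfolding 4(2) start_symbol_witness y(2) ..
      also have "\<dots> = a k"
      proof (cases "k < n")
        case True
        have "a k \<noteq> 0" "a k \<le> 2" using an[OF True] a2[OF 4(1)] by auto
        then have "a k = 1 \<or> a k = 2" by linarith
        then show ?thesis using True by (auto simp: y_def)
      next
        case False
        then show ?thesis using az[of "k - n"] 4(1) by simp
      qed
      finally show ?thesis using sc by simp
    qed
  qed
  have rows: "t \<le> A \<Longrightarrow> i \<le> B \<Longrightarrow> cv t i = cell_of M A ((tm_step M ^^ t) (tm_init ?w)) i" for t i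
  proof (induction t arbitrary: i)
    case 0
    have "cv 0 i = cell_of M A (0, \<lambda>_. 0, \<lambda>j. if j = 0 then tape_of ?w else (\<lambda>_. 0)) i"
    proof (rule row_determined[of B "cv 0"])
      fix i assume i: "i \<le> B"
      show "cv 0 i \<in> cells M" using cl i by simp
      show "fst (cv 0 i) = 0" using st0[OF i] by (simp add: start_cell_def case_prod_beta)
      fix j assume "j < tapes M"
      then show "fst (snd (snd (cv 0 i))) ! j = (if j = 0 then tape_of ?w else (\<lambda>_. 0)) (int i - int A)"
        using st0[OF i] by (simp add: start_cell_def case_prod_beta)
    next
      fix i assume "i < B"
      then show "hor M (cv 0 i) (cv 0 (Suc i))" using hr by simp
    next
      fix j assume "j < tapes M"
      moreover have "(7, 0, A) \<in> ?EV" unfolding events_iff Let_def by simp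
      ultimately have "snd (snd (snd (cv 0 A))) ! j = 0" using un[of 7 0 A] by (simp add: unary_ok_def)
      then show "0 \<le> (0 :: int) + int A \<and> nat (0 + int A) \<le> B \<and> snd (snd (snd (cv 0 (nat (0 + int A))))) ! j = 0"
        by (simp add: B_def)
    qed (use 0 in simp)
    then show ?case by (simp add: tm_init_def)
  next
    case (Suc t)
    have "cv (Suc t) i = cell_of M A (tm_step M ((tm_step M ^^ t) (tm_init ?w))) i"
    proof (rule row_step[OF wf good_run[OF wf], of t A B "cv t" ?w "cv (Suc t)"])
      show "t < A" "2 * A \<le> B" "i \<le> B" using Suc.prems by (simp_all add: B_def)
      show "cv t i = cell_of M A ((tm_step M ^^ t) (tm_init ?w)) i" if "i \<le> B" for i
        using Suc.IH[of i] Suc.prems(1) that by simp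
      show "cv (Suc t) i \<in> cells M" if "i \<le> B" for i using cl Suc.prems(1) that by simp
      show "hor M (cv (Suc t) i) (cv (Suc t) (Suc i))" if "i < B" for i using hr Suc.prems(1) that by simp
      show "ver M (cv t i) (cv (Suc t) i)" if "i \<le> B" for i using vr Suc.prems(1) that by simp
    qed
    then show ?case by simp
  qed
  have ev8: "(8, A, A) \<in> ?EV" by (simp add: events_iff Let_def)
  have acc: "fst (snd (snd (cv A A))) ! (tapes M - 1) = 2" using un[OF ev8] by (simp add: unary_ok_def)
  obtain s h tp where cf: "(tm_step M ^^ A) (tm_init ?w) = (s, h, tp)" by (rule prod_cases3)
  have "cv A A = cell_of M A (s, h, tp) A" unfolding cf[symmetric] by (rule rows) (simp_all add: B_def)
  then have "map (\<lambda>j. tp j 0) [0..<tapes M] ! (tapes M - 1) = 2" using acc unfolding cell_of_def by simp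
  then have "case (tm_step M ^^ A) (tm_init ?w) of (s, h, tp) \<Rightarrow> tp (tapes M - 1) 0 = 2"
    unfolding cf prod.case using K by (subst (asm) nth_map) simp_all
  with y(1) have "length y \<le> q \<and> (case (tm_step M ^^ A) (tm_init ?w) of (s, h, tp) \<Rightarrow> tp (tapes M - 1) 0 = 2)" by (rule conjI)
  then show ?thesis by (rule exI)
qed

lemma tableau_csp:
  assumes wf: "wf_tm M"
  shows "\<exists>(\<delta> :: nat) forb. 1 \<le> \<delta> \<and>
    (\<forall>g m p r m'. (m, p, r, m') \<in> set (forb g) \<longrightarrow> m < \<delta> \<and> m' < \<delta> \<and> (p, r) \<in> offsets g) \<and>
    (\<forall>A q x. 1 \<le> A \<longrightarrow> (\<exists>val. (\<forall>t i. (0, t, i) \<in> set (events A q x) \<longrightarrow> val t i < \<delta>) \<and>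
      (\<forall>g t i m p r m'. (g, t, i) \<in> set (events A q x) \<longrightarrow> (m, p, r, m') \<in> set (forb g) \<longrightarrow>
        \<not> (val t i = m \<and> val (t + p) (i + r) = m'))) \<longleftrightarrow> (\<exists>cv. tableau M A q x cv))"
proof -
  define \<delta> where "\<delta> = card (cells M)"
  obtain en where en: "bij_betw en {0..<\<delta>} (cells M)"
    using ex_bij_betw_nat_finite[OF finite_cells] unfolding \<delta>_def by blast
  have en_in: "en m \<in> cells M" if "m < \<delta>" for m using bij_betwE[OF en] that by simp
  \<comment> \<open>Anything outside \<open>cells M\<close> gets the number \<open>\<delta>\<close>,
    which occurs in no entry of \<open>forb\<close>.\<close>
  define ix where "ix c = (if c \<in> cells M then inv_into {0..<\<delta>} en c else \<delta>)" for c
  have ix: "ix c < \<delta> \<and> en (ix c) = c" if "c \<in> cells M" for c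
    using bij_betw_inv_into_right[OF en that] bij_betwE[OF bij_betw_inv_into[OF en]] that by (auto simp: ix_def)
  have ixD: "en (ix c) = c" if "ix c < \<delta>" for c
    using ix that by (cases "c \<in> cells M") (auto simp: ix_def)
  have "cells M \<noteq> {}" using cell_of_cells[OF good_init[OF wf]] by blast
  then have \<delta>1: "1 \<le> \<delta>" using finite_cells[of M] by (simp add: \<delta>_def Suc_le_eq card_gt_0_iff)
  define S where "S g = {w. case w of (m, p, r, m') \<Rightarrow> m < \<delta> \<and> m' < \<delta> \<and> (p, r) \<in> offsets g \<and>
      \<not> allowed M g p r (en m) (en m')}" for g
  have "finite (S g)" for g
  proof (rule finite_subset)
    show "S g \<subseteq> {..<\<delta>} \<times> {..1} \<times> {..1} \<times> {..<\<delta>}" by (auto simp: S_def offsets_def split: if_splits)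
  qed simp
  then have "\<forall>g. \<exists>xs. set xs = S g" using finite_list by blast
  then have "\<exists>forb. \<forall>g. set (forb g) = S g" by (rule choice)
  then obtain forb where forb: "\<forall>g. set (forb g) = S g" by (rule exE)
  have forb_iff: "(m, p, r, m') \<in> set (forb g) \<longleftrightarrow> m < \<delta> \<and> m' < \<delta> \<and> (p, r) \<in> offsets g \<and>
      \<not> allowed M g p r (en m) (en m')" for g m p r m'
    by (simp add: forb S_def)
  show ?thesis
  proof (intro exI[of _ \<delta>] exI[of _ forb] conjI allI impI)
    show "1 \<le> \<delta>" by (rule \<delta>1)
    fix g m p r m' assume "(m, p, r, m') \<in> set (forb g)"
    then show "m < \<delta>" "m' < \<delta>" "(p, r) \<in> offsets g" by (simp_all add: forb_iff)
  next
    fix A q :: nat and x :: "bool list"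
    assume A: "1 \<le> A"
    let ?EV = "set (events A q x)"
    show "(\<exists>val. (\<forall>t i. (0, t, i) \<in> ?EV \<longrightarrow> val t i < \<delta>) \<and>
      (\<forall>g t i m p r m'. (g, t, i) \<in> ?EV \<longrightarrow> (m, p, r, m') \<in> set (forb g) \<longrightarrow>
        \<not> (val t i = m \<and> val (t + p) (i + r) = m'))) \<longleftrightarrow> (\<exists>cv. tableau M A q x cv)" (is "?l \<longleftrightarrow> ?r")
    proof
      assume ?l
      then obtain val where v: "\<And>t i. (0, t, i) \<in> ?EV \<Longrightarrow> val t i < \<delta>"
        and nf: "\<And>g t i m p r m'. (g, t, i) \<in> ?EV \<Longrightarrow> (m, p, r, m') \<in> set (forb g) \<Longrightarrow>
          \<not> (val t i = m \<and> val (t + p) (i + r) = m')"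
        by blast
      have cell0: "(0, t, i) \<in> ?EV" if "(g, t, i) \<in> ?EV" for g t i
        using that A unfolding events_iff Let_def by (auto split: if_splits)
      have "allowed M g p r (en (val t i)) (en (val (t + p) (i + r)))"
        if e: "(g, t, i) \<in> ?EV" and o: "(p, r) \<in> offsets g" for g t i p r
      proof (rule ccontr)
        assume "\<not> allowed M g p r (en (val t i)) (en (val (t + p) (i + r)))"
        then have "(val t i, p, r, val (t + p) (i + r)) \<in> set (forb g)"
          unfolding forb_iff using o v[OF cell0[OF e]] v[OF events_offset[OF A e o]] by simp
        from nf[OF e this] show False by simp
      qed
      then have "tableau M A q x (\<lambda>t i. en (val t i))" unfolding tableau_def using v en_in by blast
      then show ?r by (rule exI[of "tableau M A q x"])
    next
      assume ?r
      then obtain cv where cl: "\<And>t i. (0, t, i) \<in> ?EV \<Longrightarrow> cv t i \<in> cells M"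
        and al: "\<And>g t i p r. (g, t, i) \<in> ?EV \<Longrightarrow> (p, r) \<in> offsets g \<Longrightarrow> allowed M g p r (cv t i) (cv (t + p) (i + r))"
        unfolding tableau_def by blast
      have "\<not> (ix (cv t i) = m \<and> ix (cv (t + p) (i + r)) = m')"
        if e: "(g, t, i) \<in> ?EV" and f: "(m, p, r, m') \<in> set (forb g)" for g t i m p r m'
      proof
        assume m: "ix (cv t i) = m \<and> ix (cv (t + p) (i + r)) = m'"
        have f': "m < \<delta>" "m' < \<delta>" "(p, r) \<in> offsets g" "\<not> allowed M g p r (en m) (en m')"
          using f by (simp_all add: forb_iff)
        have "en m = cv t i" "en m' = cv (t + p) (i + r)" using m f'(1,2) ixD by metis+
        then show False using al[OF e f'(3)] f'(4) by simp
      qed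
      moreover have "ix (cv t i) < \<delta>" if "(0, t, i) \<in> ?EV" for t i using ix[OF cl[OF that]] by simp
      ultimately show ?l by (intro exI[of _ "\<lambda>t i. ix (cv t i)"] conjI allI impI)
    qed
  qed
qed

text \<open>\<open>Suc (2 * length x + q)\<close> is the length of the longest pair code, so by
  monotonicity \<open>A\<close> steps suffice for every witness.\<close>

lemma tableau_iff:
  fixes pM :: "nat poly"
  assumes wf: "wf_tm M" and out: "\<And>w. tm_outputs_within M w [w \<in> R] (poly pM (length w))"
    and A: "1 \<le> A" "poly pM (Suc (2 * length x + q)) \<le> A"
  shows "(\<exists>cv. tableau M A q x cv) \<longleftrightarrow> (\<exists>y. length y \<le> q \<and> pair_code x y \<in> R)"
proof -
  have acc: "(case (tm_step M ^^ A) (tm_init (pair_code x y)) of (s, h, tp) \<Rightarrow> tp (tapes M - 1) 0 = 2) \<longleftrightarrow> pair_code x y \<in> R"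
    if "length y \<le> q" for y
  proof -
    have "poly pM (length (pair_code x y)) \<le> poly pM (Suc (2 * length x + q))"
      by (rule poly_mono_nat) (simp add: length_pair_code that)
    then have "poly pM (length (pair_code x y)) \<le> A" using A(2) by (rule le_trans)
    from halted[OF out this] show ?thesis by (simp add: case_prod_beta)
  qed
  show ?thesis
  proof
    assume "\<exists>cv. tableau M A q x cv"
    then obtain cv where "tableau M A q x cv" by (rule exE)
    from tableau_sound[OF wf A(1) this] obtain y where y: "length y \<le> q"
      "case (tm_step M ^^ A) (tm_init (pair_code x y)) of (s, h, tp) \<Rightarrow> tp (tapes M - 1) 0 = 2" by (elim exE conjE)
    have "pair_code x y \<in> R" using y(2) unfolding acc[OF y(1)] .
    then show "\<exists>y. length y \<le> q \<and> pair_code x y \<in> R" using y(1) by (intro exI conjI)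
  next
    assume "\<exists>y. length y \<le> q \<and> pair_code x y \<in> R"
    then obtain y where y: "length y \<le> q" "pair_code x y \<in> R" by (elim exE conjE)
    have "case (tm_step M ^^ A) (tm_init (pair_code x y)) of (s, h, tp) \<Rightarrow> tp (tapes M - 1) 0 = 2"
      unfolding acc[OF y(1)] by (rule y(2))
    from tableau_complete[OF wf y(1) this] show "\<exists>cv. tableau M A q x cv" by (rule exI[of "tableau M A q x"])
  qed
qed

theorem theorem4:
  fixes l c :: nat and d :: real
  assumes "l \<ge> 4" and "c \<in> {2..l - 2}" and "d \<ge> 1"
  shows "NP_hard_restricted (colored_path_deletion c l)
           (max_degree_three_girth_inputs c (2 * d * real l))"
  unfolding NP_hard_restricted_def
proof
  fix X assume "X \<in> class_NP"
  then obtain R p where "R \<in> class_P" and p: "\<And>x. x \<in> X \<longleftrightarrow> (\<exists>y. length y \<le> poly p (length x) \<and> pair_code x y \<in> R)"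
    unfolding class_NP_def by blast
  then obtain M pM where M: "wf_tm M" "\<And>w. tm_outputs_within M w [w \<in> R] (poly pM (length w))"
    unfolding class_P_def polytime_def by blast
  obtain \<delta> :: nat and forb where csp: "1 \<le> \<delta>"
    "\<forall>g m p r m'. (m, p, r, m') \<in> set (forb g) \<longrightarrow> m < \<delta> \<and> m' < \<delta> \<and> (p, r) \<in> offsets g"
    "\<forall>A q x. 1 \<le> A \<longrightarrow> (\<exists>val. (\<forall>t i. (0, t, i) \<in> set (events A q x) \<longrightarrow> val t i < \<delta>) \<and>
      (\<forall>g t i m p r m'. (g, t, i) \<in> set (events A q x) \<longrightarrow> (m, p, r, m') \<in> set (forb g) \<longrightarrow>
        \<not> (val t i = m \<and> val (t + p) (i + r) = m'))) \<longleftrightarrow> (\<exists>cv. tableau M A q x cv)"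
    using tableau_csp[OF M(1)] by (elim exE conjE)
  \<comment> \<open>A path on \<open>l\<close> vertices has \<open>L\<close> edges.\<close>
  define L where "L = l - 1"
  have l: "Suc L = l" "3 \<le> L" "2 \<le> c" "c < L" using assms by (auto simp: L_def)
  define k where "k = nat \<lceil>2 * d * real l\<rceil>"
  \<comment> \<open>The summand \<open>L - 1\<close> gives the required residue, and
    \<open>k + 2\<close> copies of \<open>L\<close> lift \<open>\<Lambda>\<close> above both the
    girth bound and \<open>2 * L\<close>.\<close>
  define \<Lambda> where "\<Lambda> = L - 1 + (k + 2) * L"
  have "\<Lambda> mod L = (L - 1) mod L" unfolding \<Lambda>_def by (rule mod_mult_self1)
  then have \<Lambda>: "2 * L < \<Lambda>" "\<Lambda> mod L = L - 1" using l by (simp_all add: \<Lambda>_def)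
  have "2 * d * real l \<le> real k" using real_nat_ceiling_ge by (simp add: k_def)
  moreover have "k < \<Lambda>"
  proof -
    have "(k + 2) * 1 \<le> (k + 2) * L" using l(2) by (intro mult_le_mono2) simp
    then show ?thesis by (simp add: \<Lambda>_def)
  qed
  ultimately have girth: "2 * d * real l < real \<Lambda>" by simp
  interpret grid_csp L c \<Lambda> \<delta> forb
    by unfold_locales (fact l(2-4) \<Lambda> csp(1) | use csp(2) in auto)+
  \<comment> \<open>The inner polynomial is the length of the longest pair code, and the final
    summand ensures \<open>1 \<le> A\<close>.\<close>
  define A where "A = pcompose pM ([:1, 2:] + p) + [:1:]"
  have A: "poly A n = poly pM (Suc (2 * n + poly p n)) + 1" for n
    by (simp add: A_def poly_pcompose mult.commute)
  have A1: "1 \<le> poly A n" for n by (simp add: A)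
  let ?f = "\<lambda>x. instance_code (poly A (length x)) (poly p (length x)) x"
  have "polytime ?f"
    using polytime_grid_output[OF A1, of p Vt Et kc] unfolding Let_def instance_code_def[OF A1] ev_def[OF A1] .
  moreover have "?f x \<in> max_degree_three_girth_inputs c (2 * d * real l)" for x
    by (rule instance_in[OF A1 girth])
  moreover have "x \<in> X \<longleftrightarrow> ?f x \<in> colored_path_deletion c l" for x
  proof -
    have "?f x \<in> colored_path_deletion c l \<longleftrightarrow> (\<exists>cv. tableau M (poly A (length x)) (poly p (length x)) x cv)"
      unfolding l(1)[symmetric] instance_yes[OF A1] solvable_def[OF A1] ev_def[OF A1] by (rule csp(3)[rule_format, OF A1])
    also have "\<dots> \<longleftrightarrow> x \<in> X"
      unfolding p by (rule tableau_iff[OF M A1]) (simp add: A)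
    finally show ?thesis by (rule sym)
  qed
  ultimately show "\<exists>f. polytime f \<and> (\<forall>x. f x \<in> max_degree_three_girth_inputs c (2 * d * real l) \<and>
      (x \<in> X \<longleftrightarrow> f x \<in> colored_path_deletion c l))"
    by (intro exI[of _ ?f] conjI allI)
qed

end
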